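(* Let $d,n\ge1$ be integers, let $s=(s_1,\dots,s_n)\in\mathbb R^n$, and let $h=(h_{ij})_{i,j=1,\dots,n}$ be an $n\times n$ matrix-valued symbol with $h_{ij}:\mathbb R^d\to\mathbb C$. Consider the Cauchy problem $$i\partial_tu+h(D)u=0,\qquad u(0,x)=f(x),\qquad u=(u_1,\dots,u_n):\mathbb R^{1+d}\to\mathbb C^n. \qquad (\ast)$$ Assume that: (i) the problem $(\ast)$ is globally well-posed in $\dot H^s=\dot H^{s_1}\times\dots\times\dot H^{s_n}$, and its unique solution is given by the propagator $u(t,x)=e^{ith(D)}f(x)$; (ii) the flow $e^{ith(D)}$ is unitary onto $\dot H^s$, i.e. $\|e^{ith(D)}f\|_{\dot H^s}=\|f\|_{\dot H^s}$ for all $t\in\mathbb R$ and all $f\in\dot H^s$; (iii) there exist $j\in\{1,\dots,n\}$, exponents $2\le p<q\le\infty$ and a constant $C_j$ such that, whenever $u=(u_1,\dots,u_n)$ solves $(\ast)$ with datum $f\in\dot H^s$, $$\|u_j\|_{L^p_tL^q_x}\le C_j\|f\|_{\dot H^s};$$ (iv) if $u=(u_1,\dots,u_n)$ solves the equation $i\partial_tu+h(D)u=0$, then for every $\lambda>0$ so does $$u_\lambda(t,x)=\left(\lambda^{\frac d2-s_1}u_1(\lambda t,\lambda x),\dots,\lambda^{\frac d2-s_n}u_n(\lambda t,\lambda x)\right);$$ (v) $0<s_j<\frac d2$, where $j$ is the index in (iii). Set $r=\frac{2(1+d)}{d-2s_j}$, so that the estimate $\|u_j\|_{L^r_{t,x}}\le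 M\|f\|_{\dot H^s}$ holds for all $f\in\dot H^s$, where $u=(u_1,\dots,u_n)=e^{ith(D)}f$, with the (finite) best constant $$M:=\sup_{\|f\|_{\dot H^s}=1}\|u_j\|_{L^r_{t,x}},\qquad (u_1,\dots,u_n)=e^{ith(D)}f.$$ Then there exists $f_0\in\dot H^s$ such that $$\|f_0\|_{\dot H^s}=1,\qquad \|v_j\|_{L^r_{t,x}}=M,$$ where $(v_1,\dots,v_n)=e^{ith(D)}f_0$.
   Context: For $s=(s_1,\dots,s_n)\in\mathbb R^n$, $\dot H^s=\dot H^{s_1}\times\dots\times\dot H^{s_n}$ denotes the product of the scalar homogeneous Sobolev spaces on $\mathbb R^d$, with the Hilbert norm $\|f\|_{\dot H^s}^2=\sum_{i=1}^n\|f_i\|_{\dot H^{s_i}}^2$ for $f=(f_1,\dots,f_n)\in\dot H^s$, where $\|\cdot\|_{\dot H^{s_i}}$ is the standard scalar homogeneous Sobolev norm. The operator $h(D)$ is the Fourier multiplier $h(D)=\mathcal F^{-1}(h(\xi)\mathcal F)$, where $\mathcal F$ is the standard Fourier transform on $\mathbb R^d$ (acting componentwise), and $e^{ith(D)}$ is the associated propagator, i.e. $e^{ith(D)}=\mathcal F^{-1}(e^{ith(\xi)}\mathcal F)$. For scalar functions $F=F(t,x):\mathbb R^{1+d}\to\mathbb C$ and $1\le p,q\le\infty$, $$\|F\|_{L^p_tL^q_x}^p=\int_{\mathbb R}\Big(\int_{\mathbb R^d}|F(t,x)|^q\,dx\Big)^{p/q}dt,$$ with the usual modification when $p$ or $q$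 is $\infty$, and $L^r_{t,x}=L^r_tL^r_x$. *)

theory Defs
  imports "HOL-Analysis.Analysis" "HOL-Probability.Essential_Supremum"
begin

section \<open>Schwartz functions and the Fourier transform\<close>

definition directional_deriv ::
  "'a::euclidean_space \<Rightarrow> ('a \<Rightarrow> complex) \<Rightarrow> 'a \<Rightarrow> complex"
  where "directional_deriv b f = (\<lambda>x. frechet_derivative f (at x) b)"

definition schwartz :: "('a::euclidean_space \<Rightarrow> complex) set"
  where "schwartz = {\<phi>. \<forall>bs. set bs \<subseteq> Basis \<longrightarrow>
     (\<forall>x. foldr directional_deriv bs \<phi> differentiable (at x)) \<and>
     (\<forall>k::nat. bounded (range (\<lambda>x. (norm x ^ k) *\<^sub>R foldr directional_deriv bs \<phi> x)))}"

text \<open>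
  The unitary normalisation
  \<open>(F\<phi>)(\<xi>) = (2\<pi>)\<^sup>-\<^sup>d\<^sup>/\<^sup>2 \<integral> e\<^sup>-\<^sup>i\<^sup>x\<^sup>\<cdot>\<^sup>\<xi> \<phi>(x) dx\<close> is used. Only its inverse on
  Schwartz functions is needed explicitly; on distributions \<open>F\<close> and its inverse act by duality.
\<close>

definition inv_fourier :: "('a::euclidean_space \<Rightarrow> complex) \<Rightarrow> 'a \<Rightarrow> complex"
  where "inv_fourier \<phi> \<xi> =
     complex_of_real ((2 * pi) powr (- (real DIM('a) / 2))) *
     (\<integral>x. cis (x \<bullet> \<xi>) * \<phi> x \<partial>lborel)"

section \<open>Homogeneous Sobolev spaces\<close>

definition weighted_L2 :: "real \<Rightarrow> ('a::euclidean_space \<Rightarrow> complex) set"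
  where "weighted_L2 s = {g. g \<in> borel_measurable lebesgue \<and>
     (\<integral>\<^sup>+ \<xi>. ennreal (norm \<xi> powr (2 * s) * (cmod (g \<xi>))\<^sup>2) \<partial>lebesgue) < \<infinity>}"

text \<open>
  The elements of \<open>H\<^sup>s\<close> (homogeneous) are distributions, i.e. linear functionals on test functions,
  whose Fourier transform is a function \<open>g\<close> with \<open>|\<xi>|\<^sup>s g \<in> L\<^sup>2\<close>. The pairing
  \<open>\<langle>f, \<phi>\<rangle> = \<integral> g (F\<^sup>-\<^sup>1\<phi>)\<close> converges absolutely for all Schwartz \<open>\<phi>\<close> in homogeneous \<open>H\<^sup>-\<^sup>s\<close>.
  For \<open>s < d/2\<close> these are all Schwartz functions, so \<open>f\<close> is an ordinary tempered
  distribution. For \<open>s \<ge> d/2\<close> they are the Schwartz functions whose Fourier transform vanishes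
  at 0 to the appropriate order, so \<open>f\<close> is a tempered distribution modulo polynomials of degree
  at most \<open>s - d/2\<close>; this is what makes the space complete for every real \<open>s\<close>.
  By convention a functional is 0 off the test space, so that equality of distributions is
  equality of functions.
\<close>

type_synonym 'a distribution = "('a \<Rightarrow> complex) \<Rightarrow> complex"

definition test_space :: "real \<Rightarrow> ('a::euclidean_space \<Rightarrow> complex) set"
  where "test_space s = {\<phi> \<in> schwartz. inv_fourier \<phi> \<in> weighted_L2 (- s)}"

definition inv_fourier_dist :: "real \<Rightarrow> ('a::euclidean_space \<Rightarrow> complex) \<Rightarrow> 'a distribution"
  where "inv_fourier_dist s g = (\<lambda>\<phi>. if \<phi> \<in> test_space s
     then (\<integral>\<xi>. g \<xi> * inv_fourier \<phi> \<xi> \<partial>lebesgue) else 0)"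

definition hdot :: "real \<Rightarrow> 'a::euclidean_space distribution set"
  where "hdot s = inv_fourier_dist s ` weighted_L2 s"

text \<open>The Fourier transform of an element of the space; it is determined up to a null set.\<close>

definition fourier_dist :: "real \<Rightarrow> 'a::euclidean_space distribution \<Rightarrow> 'a \<Rightarrow> complex"
  where "fourier_dist s f = (SOME g. g \<in> weighted_L2 s \<and> inv_fourier_dist s g = f)"

definition hdot_norm :: "real \<Rightarrow> 'a::euclidean_space distribution \<Rightarrow> real"
  where "hdot_norm s f =
     sqrt (\<integral>\<xi>. norm \<xi> powr (2 * s) * (cmod (fourier_dist s f \<xi>))\<^sup>2 \<partial>lebesgue)"

definition hdot_prod :: "real^'n \<Rightarrow> (('a::euclidean_space distribution)^'n) set"
  where "hdot_prod s = {f. \<forall>i. f $ i \<in> hdot (s $ i)}"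

definition hdot_prod_norm :: "real^'n \<Rightarrow> ('a::euclidean_space distribution)^'n \<Rightarrow> real"
  where "hdot_prod_norm s f = sqrt (\<Sum>i\<in>UNIV. (hdot_norm (s $ i) (f $ i))\<^sup>2)"

section \<open>Matrix-valued Fourier multipliers and the propagator\<close>

definition fourier_vec ::
  "real^'n \<Rightarrow> ('a::euclidean_space distribution)^'n \<Rightarrow> 'a \<Rightarrow> complex^'n"
  where "fourier_vec s f \<xi> = (\<chi> i. fourier_dist (s $ i) (f $ i) \<xi>)"

definition multiplier_domain ::
  "real^'n \<Rightarrow> ('a::euclidean_space \<Rightarrow> complex^'n^'n) \<Rightarrow> (('a distribution)^'n) set"
  where "multiplier_domain s m = {f \<in> hdot_prod s.
     \<forall>i. (\<lambda>\<xi>. (m \<xi> *v fourier_vec s f \<xi>) $ i) \<in> weighted_L2 (s $ i)}"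

text \<open>\<open>m(D) f = F\<^sup>-\<^sup>1 (m F f)\<close>, meaningful for \<open>f\<close> in the domain above.\<close>

definition multiplier ::
  "real^'n \<Rightarrow> ('a::euclidean_space \<Rightarrow> complex^'n^'n) \<Rightarrow> ('a distribution)^'n \<Rightarrow> ('a distribution)^'n"
  where "multiplier s m f =
     (\<chi> i. inv_fourier_dist (s $ i) (\<lambda>\<xi>. (m \<xi> *v fourier_vec s f \<xi>) $ i))"

text \<open>The library's multiplication on the type of matrices is entrywise, hence so are
  \<open>power\<close> and \<open>exp\<close>; the exponential series has to be formed with the matrix product.\<close>

definition matrix_exp :: "complex^'n^'n \<Rightarrow> complex^'n^'n"
  where "matrix_exp A = (\<Sum>k. (1 / fact k) *\<^sub>R (((**) A) ^^ k) (mat 1))"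

definition propagator_symbol ::
  "('a \<Rightarrow> complex^'n^'n) \<Rightarrow> real \<Rightarrow> 'a \<Rightarrow> complex^'n^'n"
  where "propagator_symbol h t \<xi> = matrix_exp (\<chi> a b. \<i> * complex_of_real t * h \<xi> $ a $ b)"

definition propagator ::
  "real^'n \<Rightarrow> ('a::euclidean_space \<Rightarrow> complex^'n^'n) \<Rightarrow> real
     \<Rightarrow> ('a distribution)^'n \<Rightarrow> ('a distribution)^'n"
  where "propagator s h t f = multiplier s (propagator_symbol h t) f"

section \<open>The evolution equation\<close>

definition hdot_continuous ::
  "real^'n \<Rightarrow> (real \<Rightarrow> ('a::euclidean_space distribution)^'n) \<Rightarrow> bool"
  where "hdot_continuous s u \<longleftrightarrow> (\<forall>t. u t \<in> hdot_prod s) \<and>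
     (\<forall>t. ((\<lambda>\<tau>. hdot_prod_norm s (u \<tau> - u t)) \<longlongrightarrow> 0) (at t))"

definition time_integral ::
  "(real \<Rightarrow> ('a::euclidean_space distribution)^'n) \<Rightarrow> real \<Rightarrow> ('a distribution)^'n"
  where "time_integral u t = (\<chi> i. (\<lambda>\<phi>. LBINT \<tau>=0..t. (u \<tau> $ i) \<phi>))"

text \<open>
  Since \<open>h(D)\<close> is in general unbounded, \<open>i \<partial>\<^sub>t u + h(D) u = 0\<close> is understood in the usual
  (mild) sense for \<open>u \<in> C(\<real>; H\<^sup>s)\<close>: for all \<open>t\<close> the integral of \<open>u\<close> over \<open>[0,t]\<close> lies in the
  domain of \<open>h(D)\<close> and \<open>i (u(t) - u(0)) + h(D) \<integral>\<^sub>0\<^sup>t u = 0\<close>.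
\<close>

definition solves_equation ::
  "real^'n \<Rightarrow> ('a::euclidean_space \<Rightarrow> complex^'n^'n) \<Rightarrow> (real \<Rightarrow> ('a distribution)^'n) \<Rightarrow> bool"
  where "solves_equation s h u \<longleftrightarrow> hdot_continuous s u \<and>
     (\<forall>t. time_integral u t \<in> multiplier_domain s h \<and>
        (\<forall>i \<phi>. \<i> * ((u t $ i) \<phi> - (u 0 $ i) \<phi>)
                 + (multiplier s h (time_integral u t) $ i) \<phi> = 0))"

definition solves_cauchy ::
  "real^'n \<Rightarrow> ('a::euclidean_space \<Rightarrow> complex^'n^'n) \<Rightarrow> ('a distribution)^'n
     \<Rightarrow> (real \<Rightarrow> ('a distribution)^'n) \<Rightarrow> bool"
  where "solves_cauchy s h f u \<longleftrightarrow> solves_equation s h u \<and> u 0 = f"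

text \<open>Global well-posedness in the sense of Hadamard, with continuous dependence locally
  uniformly in time.\<close>

definition globally_well_posed ::
  "real^'n \<Rightarrow> ('a::euclidean_space \<Rightarrow> complex^'n^'n) \<Rightarrow> bool"
  where "globally_well_posed s h \<longleftrightarrow>
     (\<forall>f\<in>hdot_prod s. \<exists>!u. solves_cauchy s h f u) \<and>
     (\<forall>f\<in>hdot_prod s. \<forall>T>0. \<forall>\<epsilon>>0. \<exists>\<delta>>0. \<forall>g\<in>hdot_prod s.
        hdot_prod_norm s (g - f) < \<delta> \<longrightarrow>
        (\<forall>u v. solves_cauchy s h f u \<longrightarrow> solves_cauchy s h g v \<longrightarrow>
           (\<forall>t. \<bar>t\<bar> \<le> T \<longrightarrow> hdot_prod_norm s (v t - u t) < \<epsilon>)))"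

text \<open>\<open>x \<mapsto> f(\<rho>x)\<close> as a distribution.\<close>

definition dilate :: "real \<Rightarrow> 'a::euclidean_space distribution \<Rightarrow> 'a distribution"
  where "dilate \<rho> f = (\<lambda>\<phi>. f (\<lambda>x. \<phi> (x /\<^sub>R \<rho>)) / complex_of_real (\<rho> ^ DIM('a)))"

definition rescale ::
  "real^'n \<Rightarrow> real \<Rightarrow> (real \<Rightarrow> ('a::euclidean_space distribution)^'n)
     \<Rightarrow> real \<Rightarrow> ('a distribution)^'n"
  where "rescale s \<rho> u = (\<lambda>t. \<chi> i. (\<lambda>\<phi>.
     complex_of_real (\<rho> powr (real DIM('a) / 2 - s $ i)) * dilate \<rho> (u (\<rho> * t) $ i) \<phi>))"

section \<open>Mixed space-time norms\<close>

text \<open>\<open>x\<^sup>a\<close> for \<open>a > 0\<close>.\<close>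

definition ennreal_powr :: "ennreal \<Rightarrow> real \<Rightarrow> ennreal"
  where "ennreal_powr x a = (if x = \<infinity> then \<infinity> else ennreal (enn2real x powr a))"

definition Lp_norm :: "ennreal \<Rightarrow> 'b measure \<Rightarrow> ('b \<Rightarrow> ennreal) \<Rightarrow> ennreal"
  where "Lp_norm p M F = (if p = \<infinity> then esssup M F
     else ennreal_powr (\<integral>\<^sup>+x. ennreal_powr (F x) (enn2real p) \<partial>M) (1 / enn2real p))"

definition mixed_norm ::
  "ennreal \<Rightarrow> ennreal \<Rightarrow> (real \<times> 'a::euclidean_space \<Rightarrow> complex) \<Rightarrow> ennreal"
  where "mixed_norm p q U =
     Lp_norm p lborel (\<lambda>t. Lp_norm q lborel (\<lambda>x. ennreal (cmod (U (t, x)))))"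

text \<open>The time-dependent distribution \<open>w\<close> is given by the measurable function \<open>U\<close>
  on space-time.\<close>

definition represents ::
  "(real \<times> 'a::euclidean_space \<Rightarrow> complex) \<Rightarrow> (real \<Rightarrow> 'a distribution) \<Rightarrow> bool"
  where "represents U w \<longleftrightarrow> U \<in> borel_measurable borel \<and>
     (AE t in lborel. \<forall>\<phi>\<in>schwartz.
        integrable lborel (\<lambda>x. U (t, x) * \<phi> x) \<and> w t \<phi> = (\<integral>x. U (t, x) * \<phi> x \<partial>lborel))"

text \<open>The representing function is unique up to a null set, so the infimum is over at most one
  value; it is \<open>\<infinity>\<close> if \<open>w\<close> is not given by a function.\<close>

definition spacetime_norm ::
  "ennreal \<Rightarrow> ennreal \<Rightarrow> (real \<Rightarrow> 'a::euclidean_space distribution) \<Rightarrow> ennreal"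
  where "spacetime_norm p q w = (INF U\<in>{U. represents U w}. mixed_norm p q U)"

end

theory Submission
  imports Defs "HOL-Probability.Characteristic_Functions" "HOL-Probability.Sinc_Integral"
    "HOL-Library.Diagonal_Subsequence"
begin

text \<open>
  On the Fourier side the data form an \<open>L\<^sup>2\<close> space on which the flow acts by unitary multipliers, and
  the problem is invariant under translations in space and time and under \<open>L\<^sup>2\<close> dilations.
  A Chemin--Xu type refinement of the Sobolev inequality, with sharp frequency cut-offs, bounds a
  Lebesgue norm at fixed time by the supremum over \<open>N\<close> and \<open>x\<close> of the normalised low-pass parts.
  Interpolated with the Strichartz estimate, it shows that the low-pass parts of a maximising
  sequence do not vanish. After renormalisation by the symmetries the low-pass part at frequency one,
  evaluated at the space-time origin, stays bounded below, so a weak limit \<open>G\<close> is nonzero.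
  The solutions converge almost everywhere along a subsequence, hence the Brezis--Lieb lemma splits
  \<open>M\<^sup>r\<close> between \<open>G\<close> and the remainder. With \<open>a = \<parallel>G\<parallel>\<^sup>2\<close> this gives
  \<open>1 \<le> a powr (r/2) + (1 - a) powr (r/2)\<close>, which forces \<open>a = 1\<close> as \<open>r > 2\<close>.
\<close>

text \<open>The flow is accessible only through the hypotheses: the group law and the dilation law
  of \<open>evol\<close> come from uniqueness for the Cauchy problem, and its adjoint from norm
  preservation together with the group law. The condition p < q enters as positivity of \<theta> = 1
  - p/q (with p/q = 0 for infinite q). The supremum of the low-pass parts appears in the final bound
  with the power (\<open>sobolev_exp\<close> - 2) times \<theta>, and only a positive power turns a
  lower bound for the space-time norm into a lower bound for some low-pass part. Almost everywhere
  convergence replaces a compact embedding. A low-pass value at a fixed space-time point is a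
  bounded functional of the datum and so converges under weak limits, while the high-pass remainder
  is O(N powr (- \<sigma>)) in spatial L2, uniformly in time and along the sequence; a Gaussian
  weight makes the space-time measure finite, so that both estimates combine. If (p, q) violates the
  scaling relation, the Strichartz estimate forces the supremum to be 0, and every unit datum is a
  maximiser.\<close>

lemma cis_measurable [measurable]: "cis \<in> borel_measurable borel"
  by (intro borel_measurable_continuous_onI continuous_on_cis continuous_on_id)

section \<open>Affine substitutions and product formulas for Lebesgue measure\<close>

lemma nn_integral_lborel_affine:
  fixes f :: "'a::euclidean_space \<Rightarrow> ennreal"
  assumes [measurable]: "f \<in> borel_measurable borel" and c: "c \<noteq> 0"
  shows "(\<integral>\<^sup>+x. f x \<partial>lborel) = ennreal (\<bar>c\<bar> ^ DIM('a)) * (\<integral>\<^sup>+x. f (t + c *\<^sub>R x) \<partial>lborel)"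
  by (subst lborel_affine[OF c, of t])
     (simp add: nn_integral_density nn_integral_distr nn_integral_cmult)

lemma integrable_lborel_affine:
  fixes f :: "'a::euclidean_space \<Rightarrow> 'b::{banach, second_countable_topology}"
  assumes f: "integrable lborel f" and c: "c \<noteq> 0"
  shows "integrable lborel (\<lambda>x. f (t + c *\<^sub>R x))"
proof -
  have [measurable]: "f \<in> borel_measurable borel" using f by auto
  have "(\<integral>\<^sup>+x. ennreal (norm (f x)) \<partial>lborel) < \<infinity>"
    using f by (simp add: integrable_iff_bounded)
  then have "ennreal (\<bar>c\<bar> ^ DIM('a)) * (\<integral>\<^sup>+x. ennreal (norm (f (t + c *\<^sub>R x))) \<partial>lborel) < \<infinity>"
    by (subst (asm) nn_integral_lborel_affine[OF _ c, of _ t]) auto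
  then have "(\<integral>\<^sup>+x. ennreal (norm (f (t + c *\<^sub>R x))) \<partial>lborel) < \<infinity>"
    using c by (auto simp: ennreal_mult_less_top less_top[symmetric])
  then show ?thesis by (simp add: integrable_iff_bounded)
qed

lemma integral_lborel_affine:
  fixes f :: "'a::euclidean_space \<Rightarrow> 'b::{banach, second_countable_topology}"
  assumes [measurable]: "f \<in> borel_measurable borel" and c: "c \<noteq> 0"
  shows "(\<integral>x. f x \<partial>lborel) = (\<bar>c\<bar> ^ DIM('a)) *\<^sub>R (\<integral>x. f (t + c *\<^sub>R x) \<partial>lborel)"
  by (subst lborel_affine[OF c, of t]) (simp add: integral_density integral_distr)

lemma AE_lborel_affine:
  fixes P :: "'a::euclidean_space \<Rightarrow> bool"
  assumes P: "AE x in lborel. P x" and c: "c \<noteq> 0"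
  shows "AE x in lborel. P (t + c *\<^sub>R x)"
proof -
  obtain N where N: "{x. \<not> P x} \<subseteq> N" "emeasure lborel N = 0" and [measurable]: "N \<in> sets borel"
    using P by (auto elim!: AE_E)
  have "ennreal (\<bar>c\<bar> ^ DIM('a)) * (\<integral>\<^sup>+x. indicator N (t + c *\<^sub>R x) \<partial>lborel) = 0"
    using nn_integral_lborel_affine[OF _ c, of "indicator N" t] N by simp
  then have "(\<integral>\<^sup>+x. indicator N (t + c *\<^sub>R x) \<partial>(lborel::'a measure)) = (0::ennreal)"
    using c by simp
  then have "AE x in lborel. indicator N (t + c *\<^sub>R x) = (0::ennreal)"
    by (subst (asm) nn_integral_0_iff_AE) auto
  then show ?thesis
    by eventually_elim (use N in \<open>auto simp: indicator_def split: if_splits\<close>)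
qed

text \<open>Lebesgue measure is the image of the product measure over \<open>Basis\<close>, so
  tensor products integrate factor by factor. This reduces Gaussians, the decay of Schwartz
  functions and negative powers of the norm to one-dimensional integrals.\<close>

lemma lborel_prod_integrable:
  fixes f :: "'a::euclidean_space \<Rightarrow> real \<Rightarrow> 'b::{real_normed_field,banach,second_countable_topology}"
  assumes f: "\<And>b. b \<in> Basis \<Longrightarrow> integrable lborel (f b)"
  shows "integrable lborel (\<lambda>x::'a. \<Prod>b\<in>Basis. f b (x \<bullet> b))"
    and "(\<integral>x. (\<Prod>b\<in>Basis. f b (x \<bullet> b)) \<partial>(lborel::'a measure)) = (\<Prod>b\<in>Basis. \<integral>x. f b x \<partial>lborel)"
proof -
  interpret P: product_sigma_finite "\<lambda>b::'a. lborel :: real measure" ..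
  let ?T = "\<lambda>g::'a \<Rightarrow> real. \<Sum>b\<in>Basis. g b *\<^sub>R b"
  have [measurable]: "f b \<in> borel_measurable borel" if "b \<in> Basis" for b
    using f[OF that] by auto
  have T: "?T \<in> measurable (Pi\<^sub>M Basis (\<lambda>b. lborel)) borel" by simp
  have eq: "(\<Prod>b\<in>Basis. f b (?T g \<bullet> b)) = (\<Prod>b\<in>Basis. f b (g b))" for g :: "'a \<Rightarrow> real"
    by (intro prod.cong refl) (simp add: inner_sum_left_Basis)
  have L: "(lborel :: 'a measure) = distr (Pi\<^sub>M Basis (\<lambda>b. lborel)) borel ?T"
    by (subst lborel_def) (simp add: lborel_eq_real)
  have m: "(\<lambda>x::'a. \<Prod>b\<in>Basis. f b (x \<bullet> b)) \<in> borel_measurable borel"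
    by (rule borel_measurable_prod) simp
  show "integrable lborel (\<lambda>x::'a. \<Prod>b\<in>Basis. f b (x \<bullet> b))"
    by (subst L, subst integrable_distr_eq[OF T m])
       (auto simp: eq intro!: P.product_integrable_prod f)
  show "(\<integral>x. (\<Prod>b\<in>Basis. f b (x \<bullet> b)) \<partial>(lborel::'a measure)) = (\<Prod>b\<in>Basis. \<integral>x. f b x \<partial>lborel)"
    by (subst L, subst integral_distr[OF T m])
       (auto simp: eq intro!: P.product_integral_prod f)
qed

text \<open>The first part supplies the integrable majorant in the Fubini arguments below: each
  integrand there is a product in separate variables up to a bounded factor.\<close>

lemma integral_pair_mult:
  fixes f :: "'a \<Rightarrow> 'b::{real_normed_field,banach,second_countable_topology}"
  assumes "sigma_finite_measure M1" "sigma_finite_measure M2"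
    and f: "integrable M1 f" and g: "integrable M2 g"
  shows "integrable (M1 \<Otimes>\<^sub>M M2) (\<lambda>z. f (fst z) * g (snd z))"
    and "(\<integral>z. f (fst z) * g (snd z) \<partial>(M1 \<Otimes>\<^sub>M M2)) = (\<integral>x. f x \<partial>M1) * (\<integral>y. g y \<partial>M2)"
proof -
  interpret pair_sigma_finite M1 M2
    using assms by (simp add: pair_sigma_finite_def)
  have [measurable]: "f \<in> borel_measurable M1" "g \<in> borel_measurable M2"
    using f g by auto
  show *: "integrable (M1 \<Otimes>\<^sub>M M2) (\<lambda>z. f (fst z) * g (snd z))"
    by (rule Fubini_integrable) (use f g in \<open>auto simp: norm_mult\<close>)
  show "(\<integral>z. f (fst z) * g (snd z) \<partial>(M1 \<Otimes>\<^sub>M M2)) = (\<integral>x. f x \<partial>M1) * (\<integral>y. g y \<partial>M2)"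
    using integral_fst'[OF *] by simp
qed

section \<open>Gaussians and their Fourier integrals\<close>

text \<open>The parameter is an inverse width, so the Fourier integral exchanges \<tau> and 1 /
  \<tau>.\<close>

definition gauss :: "real \<Rightarrow> 'a::euclidean_space \<Rightarrow> real"
  where "gauss \<tau> x = exp (- (\<tau>\<^sup>2 * (norm x)\<^sup>2) / 2)"

lemma gauss_pos [simp]: "0 < gauss \<tau> x" "0 \<le> gauss \<tau> x" "\<bar>gauss \<tau> x\<bar> = gauss \<tau> x"
  by (auto simp: gauss_def)

lemma gauss_le_1 [simp]: "gauss \<tau> x \<le> 1"
  by (auto simp: gauss_def)

lemma gauss_measurable [measurable]: "gauss \<tau> \<in> borel_measurable borel"
  unfolding gauss_def by measurable

lemma gauss_prod: "gauss \<tau> x = (\<Prod>b\<in>Basis. exp (- (\<tau>\<^sup>2 * (x \<bullet> b)\<^sup>2) / 2))"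
proof -
  have "(norm x)\<^sup>2 = (\<Sum>b\<in>Basis. (x \<bullet> b)\<^sup>2)"
    unfolding power2_norm_eq_inner by (subst euclidean_inner) (simp add: power2_eq_square)
  then show ?thesis
    by (simp add: gauss_def exp_sum[symmetric] sum_distrib_left sum_negf sum_divide_distrib)
qed

text \<open>The characteristic function of the standard normal law, rescaled by \<tau>.\<close>

lemma gauss_char_real:
  assumes "\<tau> > 0"
  shows "integrable lborel (\<lambda>x::real. cis (x * \<xi>) * complex_of_real (exp (- (\<tau>\<^sup>2 * x\<^sup>2) / 2)))"
    and "(\<integral>x. cis (x * \<xi>) * complex_of_real (exp (- (\<tau>\<^sup>2 * x\<^sup>2) / 2)) \<partial>lborel) =
      complex_of_real (sqrt (2 * pi) / \<tau> * exp (- (\<xi>\<^sup>2 / (2 * \<tau>\<^sup>2))))"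
proof -
  let ?f = "\<lambda>x::real. cis (x * (\<xi> / \<tau>)) * complex_of_real (exp (- x\<^sup>2 / 2))"
  have int0: "integrable lborel std_normal_density"
    using integrable_std_normal_moment[of 0] by simp
  have g: "integrable lborel (\<lambda>x::real. exp (- x\<^sup>2 / 2))"
    using integrable_mult_right[OF int0, of "sqrt (2 * pi)"] by (simp add: std_normal_density_def)
  have i: "integrable lborel ?f"
    by (rule Bochner_Integration.integrable_bound[OF g]) (auto simp: norm_mult)
  have "(\<integral>x. cis (x * (\<xi> / \<tau>)) \<partial>std_normal_distribution) = complex_of_real (exp (- ((\<xi> / \<tau>)\<^sup>2) / 2))"
    using fun_cong[OF char_std_normal_distribution, of "\<xi> / \<tau>"]
    by (simp add: char_def cis_conv_exp mult_ac)
  also have "(\<integral>x. cis (x * (\<xi> / \<tau>)) \<partial>std_normal_distribution) =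
      (\<integral>x. std_normal_density x *\<^sub>R cis (x * (\<xi> / \<tau>)) \<partial>lborel)"
    by (subst integral_density) (auto simp: normal_density_nonneg)
  also have "\<dots> = (\<integral>x. complex_of_real (1 / sqrt (2 * pi)) * ?f x \<partial>lborel)"
    by (intro Bochner_Integration.integral_cong refl)
       (simp add: std_normal_density_def scaleR_conv_of_real mult_ac)
  also have "\<dots> = complex_of_real (1 / sqrt (2 * pi)) * (\<integral>x. ?f x \<partial>lborel)"
    by simp
  finally have f: "(\<integral>x. ?f x \<partial>lborel) = complex_of_real (sqrt (2 * pi) * exp (- ((\<xi> / \<tau>)\<^sup>2) / 2))"
    by (simp add: field_simps)
  have eq: "?f (0 + \<tau> *\<^sub>R x) = cis (x * \<xi>) * complex_of_real (exp (- (\<tau>\<^sup>2 * x\<^sup>2) / 2))" for x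
    using assms by (simp add: power_mult_distrib)
  show "integrable lborel (\<lambda>x::real. cis (x * \<xi>) * complex_of_real (exp (- (\<tau>\<^sup>2 * x\<^sup>2) / 2)))"
    using integrable_lborel_affine[OF i, of \<tau> 0] assms unfolding eq by simp
  have "(\<integral>x. ?f x \<partial>lborel) = \<tau> *\<^sub>R (\<integral>x. cis (x * \<xi>) * complex_of_real (exp (- (\<tau>\<^sup>2 * x\<^sup>2) / 2))
    \<partial>lborel)"
    using integral_lborel_affine[of ?f \<tau> 0] i assms unfolding eq by simp
  then have "complex_of_real \<tau> * (\<integral>x. cis (x * \<xi>) * complex_of_real (exp (- (\<tau>\<^sup>2 * x\<^sup>2) / 2)) \<partial>lborel)
      = complex_of_real (sqrt (2 * pi) * exp (- ((\<xi> / \<tau>)\<^sup>2) / 2))"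
    using f by (simp add: scaleR_conv_of_real)
  then have "(\<integral>x. cis (x * \<xi>) * complex_of_real (exp (- (\<tau>\<^sup>2 * x\<^sup>2) / 2)) \<partial>lborel)
      = complex_of_real (sqrt (2 * pi) * exp (- ((\<xi> / \<tau>)\<^sup>2) / 2)) / complex_of_real \<tau>"
    using assms by (simp add: nonzero_eq_divide_eq mult.commute)
  also have "\<dots> = complex_of_real (sqrt (2 * pi) / \<tau> * exp (- (\<xi>\<^sup>2 / (2 * \<tau>\<^sup>2))))"
    by (simp add: power_divide field_simps)
  finally show "(\<integral>x. cis (x * \<xi>) * complex_of_real (exp (- (\<tau>\<^sup>2 * x\<^sup>2) / 2)) \<partial>lborel) =
      complex_of_real (sqrt (2 * pi) / \<tau> * exp (- (\<xi>\<^sup>2 / (2 * \<tau>\<^sup>2))))" .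
qed

lemma gauss_char:
  fixes \<xi> :: "'a::euclidean_space"
  assumes "\<tau> > 0"
  shows "integrable lborel (\<lambda>x. cis (x \<bullet> \<xi>) * complex_of_real (gauss \<tau> x))"
    and "(\<integral>x. cis (x \<bullet> \<xi>) * complex_of_real (gauss \<tau> x) \<partial>lborel) =
      complex_of_real ((sqrt (2 * pi) / \<tau>) ^ DIM('a) * gauss (1 / \<tau>) \<xi>)"
proof -
  let ?f = "\<lambda>b x::real. cis (x * (\<xi> \<bullet> b)) * complex_of_real (exp (- (\<tau>\<^sup>2 * x\<^sup>2) / 2))"
  have c: "cis (\<Sum>b\<in>A. h b) = (\<Prod>b\<in>A. cis (h b))" if "finite A" for h and A :: "'a set"
    using that by induction (auto simp: cis_mult[symmetric])
  have eq: "cis (x \<bullet> \<xi>) * complex_of_real (gauss \<tau> x) = (\<Prod>b\<in>Basis. ?f b (x \<bullet> b))" for x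
    by (subst euclidean_inner) (simp add: c gauss_prod prod.distrib)
  note * = lborel_prod_integrable[of ?f, OF gauss_char_real(1)[OF assms]]
  show "integrable lborel (\<lambda>x. cis (x \<bullet> \<xi>) * complex_of_real (gauss \<tau> x))"
    unfolding eq by (rule *)
  show "(\<integral>x. cis (x \<bullet> \<xi>) * complex_of_real (gauss \<tau> x) \<partial>lborel) =
      complex_of_real ((sqrt (2 * pi) / \<tau>) ^ DIM('a) * gauss (1 / \<tau>) \<xi>)"
    unfolding eq *(2) gauss_char_real(2)[OF assms]
    by (simp add: gauss_prod prod.distrib power_divide prod_dividef divide_simps mult.commute[of 2]
      flip: of_real_mult of_real_prod)
qed

lemma integrable_gauss:
  assumes "\<tau> > 0"
  shows "integrable lborel (gauss \<tau> :: 'a::euclidean_space \<Rightarrow> real)"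
    and "(\<integral>x. gauss \<tau> (x::'a) \<partial>lborel) = (sqrt (2 * pi) / \<tau>) ^ DIM('a)"
proof -
  show "integrable lborel (gauss \<tau> :: 'a \<Rightarrow> real)"
    using integrable_norm[OF gauss_char(1)[OF assms, of 0]] by simp
  show "(\<integral>x. gauss \<tau> (x::'a) \<partial>lborel) = (sqrt (2 * pi) / \<tau>) ^ DIM('a)"
    using gauss_char(2)[OF assms, of "0::'a"]
      by (simp add: gauss_def flip: of_real_power of_real_divide)
qed

section \<open>The Fourier integral and Bessel's inequality\<close>

lemma cnj_measurable [measurable]: "cnj \<in> borel_measurable borel"
  by (intro borel_measurable_continuous_onI continuous_on_cnj continuous_on_id)

text \<open>Positive phase and no constant in front: \<open>inv_fourier\<close> is this integral
  times \<open>fourier_const\<close>.\<close>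

definition FT :: "('a::euclidean_space \<Rightarrow> complex) \<Rightarrow> 'a \<Rightarrow> complex"
  where "FT k x = (\<integral>\<xi>. cis (x \<bullet> \<xi>) * k \<xi> \<partial>lborel)"

lemma integrable_cis_mult:
  assumes "integrable lborel k"
  shows "integrable lborel (\<lambda>\<xi>. cis (x \<bullet> \<xi>) * k \<xi>)"
proof -
  have [measurable]: "k \<in> borel_measurable borel" using assms by auto
  show ?thesis
    by (rule Bochner_Integration.integrable_bound[OF assms]) (auto simp: norm_mult)
qed

lemma FT_bound:
  assumes "integrable lborel k"
  shows "cmod (FT k x) \<le> (\<integral>\<xi>. cmod (k \<xi>) \<partial>lborel)"
  using integral_norm_bound[of lborel "\<lambda>\<xi>. cis (x \<bullet> \<xi>) * k \<xi>"] by (simp add: FT_def norm_mult)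

lemma continuous_FT:
  fixes k :: "'a::euclidean_space \<Rightarrow> complex"
  assumes "integrable lborel k"
  shows "continuous_on UNIV (FT k)"
proof -
  have [measurable]: "k \<in> borel_measurable borel" using assms by auto
  have "isCont (FT k) x" for x
  proof (unfold continuous_at_sequentially, safe)
    fix X :: "nat \<Rightarrow> 'a" assume X: "X \<longlonglongrightarrow> x"
    show "(FT k \<circ> X) \<longlonglongrightarrow> FT k x"
      unfolding o_def FT_def
    proof (rule integral_dominated_convergence[where w="\<lambda>\<xi>. cmod (k \<xi>)"])
      show "AE \<xi> in lborel. (\<lambda>i. cis (X i \<bullet> \<xi>) * k \<xi>) \<longlonglongrightarrow> cis (x \<bullet> \<xi>) * k \<xi>"
        by (intro AE_I2 tendsto_intros continuous_on_tendsto_compose[OF continuous_on_cis[OF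
          continuous_on_id]] X)
    qed (use assms in \<open>auto simp: norm_mult\<close>)
  qed
  then show ?thesis by (auto intro: continuous_at_imp_continuous_on)
qed

lemma FT_measurable:
  fixes k :: "'a::euclidean_space \<Rightarrow> complex"
  assumes "integrable lborel k"
  shows "FT k \<in> borel_measurable borel"
  by (simp add: borel_measurable_continuous_onI continuous_FT assms)

lemma nn_integral_gauss:
  assumes "\<tau> > 0"
  shows "(\<integral>\<^sup>+x. ennreal (gauss \<tau> (x::'a::euclidean_space)) \<partial>lborel)
    = ennreal ((sqrt (2 * pi) / \<tau>) ^ DIM('a))"
  using integrable_gauss[OF assms, where 'a='a] by (simp add: nn_integral_eq_integral)

text \<open>The Gaussian weight makes the triple integral behind |FT k|^2 absolutely convergent.
  Fubini then replaces the weight by its transform, a positive convolution kernel, and Schur's test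
  bounds the resulting quadratic form by the mass of the kernel.\<close>

lemma bessel_gauss:
  fixes k :: "'a::euclidean_space \<Rightarrow> complex"
  assumes k: "integrable lborel k" and k2: "integrable lborel (\<lambda>x. (cmod (k x))\<^sup>2)" and \<tau>: "\<tau> > 0"
  shows "(\<integral>x. gauss \<tau> x * (cmod (FT k x))\<^sup>2 \<partial>lborel) \<le> (2 * pi) ^ DIM('a)
    * (\<integral>x. (cmod (k x))\<^sup>2 \<partial>lborel)"
proof -
  let ?L = "lborel :: 'a measure"
  \<comment> \<open>The transform of the weight. Its total mass is (2 pi)^d whatever \<tau> is,
    which allows \<tau> to tend to 0 afterwards.\<close>
  define G where "G z = (sqrt (2 * pi) / \<tau>) ^ DIM('a) * gauss (1 / \<tau>) z" for z :: 'a
  have [measurable]: "G \<in> borel_measurable borel" unfolding G_def by measurable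
  have G0: "0 \<le> G z" for z using \<tau> by (simp add: G_def)
  have [measurable]: "k \<in> borel_measurable borel" using k by auto
  define H where "H x p = complex_of_real (gauss \<tau> x) * (cis (x \<bullet> fst p) * k (fst p)
    * cnj (cis (x \<bullet> snd p) * k (snd p)))"
    for x :: 'a and p :: "'a \<times> 'a"
  have sf: "sigma_finite_measure ?L" "sigma_finite_measure (?L \<Otimes>\<^sub>M ?L)"
    by (auto intro: sigma_finite_lborel simp: lborel_prod)
  interpret P: pair_sigma_finite "?L" "?L \<Otimes>\<^sub>M ?L"
    using sf by (simp add: pair_sigma_finite_def)
  have kc: "integrable lborel (\<lambda>x. cnj (k x))" using k by simp
  note kk = integral_pair_mult(1)[OF sf(1) sf(1) k kc]
  have g: "integrable ?L (\<lambda>x. complex_of_real (gauss \<tau> x))"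
    using integrable_gauss(1)[OF \<tau>] by (rule integrable_of_real)
  have Hi: "integrable (?L \<Otimes>\<^sub>M (?L \<Otimes>\<^sub>M ?L)) (\<lambda>(x, p). H x p)"
    by (rule Bochner_Integration.integrable_bound[OF integral_pair_mult(1)[OF sf(1) sf(2) g kk]])
       (auto simp: H_def norm_mult)
  have 1: "(\<integral>p. H x p \<partial>(?L \<Otimes>\<^sub>M ?L)) = complex_of_real (gauss \<tau> x * (cmod (FT k x))\<^sup>2)" for x
  proof -
    note a = integrable_cis_mult[OF k, of x]
    have b: "integrable lborel (\<lambda>\<eta>. cnj (cis (x \<bullet> \<eta>) * k \<eta>))" using a
      by (simp del: complex_cnj_mult)
    show ?thesis
      unfolding H_def
      using integral_pair_mult(2)[OF sf(1) sf(1) a b]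
      by (simp add: FT_def[symmetric] complex_norm_square[symmetric] del: complex_cnj_mult)
  qed
  have 2: "(\<integral>x. H x p \<partial>?L) = k (fst p) * cnj (k (snd p)) * complex_of_real (G (fst p - snd p))"
    for p
  proof -
    have "H x p = k (fst p) * cnj (k (snd p)) * (cis (x \<bullet> (fst p - snd p))
      * complex_of_real (gauss \<tau> x))" for x
    proof -
      have "cis (x \<bullet> (fst p - snd p)) = cis (x \<bullet> fst p) * cis (- (x \<bullet> snd p))"
        by (simp add: cis_mult inner_diff_right)
      then show ?thesis by (simp add: H_def cis_cnj mult_ac)
    qed
    then show ?thesis by (simp add: gauss_char(2)[OF \<tau>] G_def)
  qed
  have "complex_of_real (\<integral>x. gauss \<tau> x * (cmod (FT k x))\<^sup>2 \<partial>lborel)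
    = (\<integral>x. (\<integral>p. H x p \<partial>(?L \<Otimes>\<^sub>M ?L)) \<partial>?L)"
    unfolding 1 by (rule integral_complex_of_real[symmetric])
  also have "\<dots> = (\<integral>p. (\<integral>x. H x p \<partial>?L) \<partial>(?L \<Otimes>\<^sub>M ?L))"
    by (rule P.Fubini_integral[OF Hi, symmetric])
  also have "\<dots> = (\<integral>p. k (fst p) * cnj (k (snd p)) * complex_of_real (G (fst p - snd p))
    \<partial>(?L \<Otimes>\<^sub>M ?L))"
    unfolding 2 ..
  finally have eq: "complex_of_real (\<integral>x. gauss \<tau> x * (cmod (FT k x))\<^sup>2 \<partial>lborel) = \<dots>" .
  have GI: "(\<integral>\<^sup>+z. ennreal (G z) \<partial>lborel) = ennreal ((2 * pi) ^ DIM('a))"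
  proof -
    have "(\<integral>\<^sup>+z. ennreal (G z) \<partial>lborel) = ennreal ((sqrt (2 * pi) / \<tau>) ^ DIM('a))
      * (\<integral>\<^sup>+z. ennreal (gauss (1/\<tau>) z) \<partial>?L)"
      using \<tau> by (simp add: G_def ennreal_mult nn_integral_cmult)
    also have "\<dots> = ennreal ((sqrt (2 * pi) / \<tau>) ^ DIM('a) * (sqrt (2 * pi) / (1 / \<tau>)) ^ DIM('a))"
      using \<tau> by (subst nn_integral_gauss) (auto intro!: ennreal_mult[symmetric])
    also have "(sqrt (2 * pi) / \<tau>) ^ DIM('a) * (sqrt (2 * pi) / (1 / \<tau>)) ^ DIM('a)
      = (2 * pi) ^ DIM('a)"
      unfolding power_mult_distrib[symmetric] using \<tau> by simp
    finally show ?thesis .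
  qed
  have sh: "(\<integral>\<^sup>+z. ennreal (G (y - z)) \<partial>lborel) = ennreal ((2 * pi) ^ DIM('a))"
    "(\<integral>\<^sup>+z. ennreal (G (z - y)) \<partial>lborel) = ennreal ((2 * pi) ^ DIM('a))" for y
    using trans[OF nn_integral_lborel_affine[symmetric] GI, of "-1" y]
      trans[OF nn_integral_lborel_affine[symmetric] GI, of "1" "-y"] by simp_all
  have c: "(\<integral>\<^sup>+y. ennreal ((cmod z)\<^sup>2 * G (f y) / 2) \<partial>lborel) = ennreal ((cmod z)\<^sup>2 / 2)
    * (\<integral>\<^sup>+y. ennreal (G (f y)) \<partial>lborel)"
    if [measurable]: "f \<in> borel_measurable borel" for z and f :: "'a \<Rightarrow> 'a"
    by (subst nn_integral_cmult[symmetric]) (auto intro!: nn_integral_cong simp: G0 simp flip: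
      ennreal_mult)
  have "ennreal (\<integral>x. gauss \<tau> x * (cmod (FT k x))\<^sup>2 \<partial>lborel)
      \<le> ennreal (cmod (complex_of_real (\<integral>x. gauss \<tau> x * (cmod (FT k x))\<^sup>2 \<partial>lborel)))"
    by (rule ennreal_leI) (simp only: norm_of_real abs_ge_self)
  also have "\<dots>
    \<le> (\<integral>\<^sup>+p. ennreal (cmod (k (fst p) * cnj (k (snd p)) * complex_of_real (G (fst p - snd p))))
    \<partial>(?L \<Otimes>\<^sub>M ?L))"
    unfolding eq
      by (rule integral_norm_bound_ennreal) (use P.integrable_snd[OF Hi] in \<open>simp add: 2\<close>)
  also have "\<dots> \<le> (\<integral>\<^sup>+p. ennreal ((cmod (k (fst p)))\<^sup>2 * G (fst p - snd p) / 2)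
    + ennreal ((cmod (k (snd p)))\<^sup>2 * G (fst p - snd p) / 2) \<partial>(?L \<Otimes>\<^sub>M ?L))"
  proof (rule nn_integral_mono)
    fix p
    \<comment> \<open>Schur's test for a symmetric kernel: after this splitting each half contains
      only one of the two values of k, and the other variable is integrated out of the
      kernel.\<close>
    have "cmod (k (fst p)) * cmod (k (snd p)) \<le> ((cmod (k (fst p)))\<^sup>2 + (cmod (k (snd p)))\<^sup>2) / 2"
      using sum_squares_bound[of "cmod (k (fst p))" "cmod (k (snd p))"] by simp
    from mult_right_mono[OF this G0[of "fst p - snd p"]]
    have "cmod (k (fst p) * cnj (k (snd p)) * complex_of_real (G (fst p - snd p)))
      \<le> (cmod (k (fst p)))\<^sup>2 * G (fst p - snd p) / 2 + (cmod (k (snd p)))\<^sup>2 * G (fst p - snd p) / 2"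
      using G0[of "fst p - snd p"] by (simp add: norm_mult algebra_simps)
    then show "ennreal (cmod (k (fst p) * cnj (k (snd p)) * complex_of_real (G (fst p - snd p))))
      \<le> ennreal ((cmod (k (fst p)))\<^sup>2 * G (fst p - snd p) / 2) + ennreal
        ((cmod (k (snd p)))\<^sup>2 * G (fst p - snd p) / 2)"
      using G0[of "fst p - snd p"] by (simp add: ennreal_leI flip: ennreal_plus)
  qed
  also have "\<dots> = (\<integral>\<^sup>+p. ennreal ((cmod (k (fst p)))\<^sup>2 * G (fst p - snd p) / 2) \<partial>(?L \<Otimes>\<^sub>M ?L))
     + (\<integral>\<^sup>+p. ennreal ((cmod (k (snd p)))\<^sup>2 * G (fst p - snd p) / 2) \<partial>(?L \<Otimes>\<^sub>M ?L))"
    by (rule nn_integral_add) auto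
  also have "(\<integral>\<^sup>+p. ennreal ((cmod (k (fst p)))\<^sup>2 * G (fst p - snd p) / 2) \<partial>(?L \<Otimes>\<^sub>M ?L))
     = (\<integral>\<^sup>+x. ennreal ((cmod (k x))\<^sup>2 / 2) * (\<integral>\<^sup>+y. ennreal (G (x - y)) \<partial>?L) \<partial>?L)"
    by (subst lborel.nn_integral_fst[symmetric]) (auto simp: c)
  also have "(\<integral>\<^sup>+p. ennreal ((cmod (k (snd p)))\<^sup>2 * G (fst p - snd p) / 2) \<partial>(?L \<Otimes>\<^sub>M ?L))
     = (\<integral>\<^sup>+y. ennreal ((cmod (k y))\<^sup>2 / 2) * (\<integral>\<^sup>+x. ennreal (G (x - y)) \<partial>?L) \<partial>?L)"
    by (subst lborel_pair.nn_integral_snd[symmetric]) (auto simp: c)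
  also have "(\<integral>\<^sup>+x. ennreal ((cmod (k x))\<^sup>2 / 2) * (\<integral>\<^sup>+y. ennreal (G (x - y)) \<partial>?L) \<partial>?L)
    + (\<integral>\<^sup>+y. ennreal ((cmod (k y))\<^sup>2 / 2) * (\<integral>\<^sup>+x. ennreal (G (x - y)) \<partial>?L) \<partial>?L)
    = ennreal ((2 * pi) ^ DIM('a) * (\<integral>x. (cmod (k x))\<^sup>2 \<partial>lborel))"
  proof -
    have "(\<integral>\<^sup>+x. ennreal ((cmod (k x))\<^sup>2 / 2) * ennreal ((2 * pi) ^ DIM('a)) \<partial>?L)
      = ennreal ((\<integral>x. (cmod (k x))\<^sup>2 \<partial>lborel) / 2 * (2 * pi) ^ DIM('a))"
      by (subst nn_integral_multc, simp, subst nn_integral_eq_integral)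
        (use k2 in \<open>auto simp flip: ennreal_mult\<close>)
    then show ?thesis unfolding sh
      by (simp flip: ennreal_plus)
  qed
  finally show ?thesis
    by (subst (asm) ennreal_le_iff) auto
qed

text \<open>With \<tau> = 1 / (n + 1) the weight increases to 1 and the bound does not depend on n,
  so Fatou's lemma removes the weight.\<close>

lemma bessel:
  fixes k :: "'a::euclidean_space \<Rightarrow> complex"
  assumes k: "integrable lborel k" and k2: "integrable lborel (\<lambda>x. (cmod (k x))\<^sup>2)"
  shows "(\<integral>\<^sup>+x. ennreal ((cmod (FT k x))\<^sup>2) \<partial>lborel)
    \<le> ennreal ((2 * pi) ^ DIM('a) * (\<integral>x. (cmod (k x))\<^sup>2 \<partial>lborel))"
proof -
  have [measurable]: "k \<in> borel_measurable borel" using k by auto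
  note [measurable] = FT_measurable[OF k]
  let ?t = "\<lambda>n. 1 / real (Suc n)"
  let ?u = "\<lambda>n x. ennreal (gauss (?t n) x * (cmod (FT k x))\<^sup>2)"
  let ?R = "ennreal ((2 * pi) ^ DIM('a) * (\<integral>x. (cmod (k x))\<^sup>2 \<partial>lborel))"
  have lim: "(\<lambda>n. ?u n x) \<longlonglongrightarrow> ennreal ((cmod (FT k x))\<^sup>2)" for x
  proof -
    have "(\<lambda>n. exp (- ((?t n)\<^sup>2 * (norm x)\<^sup>2) / 2) * (cmod (FT k x))\<^sup>2) \<longlonglongrightarrow> exp (- (0\<^sup>2 * (norm x)\<^sup>2) / 2)
      * (cmod (FT k x))\<^sup>2"
      by (intro tendsto_intros LIMSEQ_inverse_real_of_nat[unfolded inverse_eq_divide]) auto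
    then show ?thesis by (intro tendsto_ennrealI) (simp add: gauss_def)
  qed
  have le: "(\<integral>\<^sup>+x. ?u n x \<partial>lborel) \<le> ?R" for n
  proof -
    have "integrable lborel (\<lambda>x. gauss (?t n) x * (cmod (FT k x))\<^sup>2)"
    proof (rule Bochner_Integration.integrable_bound)
      show "integrable lborel (\<lambda>x::'a. gauss (?t n) x * (\<integral>\<xi>. cmod (k \<xi>) \<partial>lborel)\<^sup>2)"
        by (intro integrable_mult_left integrable_gauss) simp
      show "AE x in lborel. norm (gauss (?t n) x * (cmod (FT k x))\<^sup>2)
        \<le> norm (gauss (?t n) x * (\<integral>\<xi>. cmod (k \<xi>) \<partial>lborel)\<^sup>2)"
        using FT_bound[OF k]
          by (intro AE_I2) (auto simp: abs_mult intro!: mult_left_mono power_mono)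
    qed simp
    then show ?thesis
      by (subst nn_integral_eq_integral) (use bessel_gauss[OF k k2, of "?t n"] in
        \<open>auto intro!: ennreal_leI simp: power_mult_distrib\<close>)
  qed
  have "(\<integral>\<^sup>+x. ennreal ((cmod (FT k x))\<^sup>2) \<partial>lborel) = (\<integral>\<^sup>+x. liminf (\<lambda>n. ?u n x) \<partial>lborel)"
    by (intro nn_integral_cong lim_imp_Liminf[OF sequentially_bot lim, symmetric])
  also have "\<dots> \<le> liminf (\<lambda>n. \<integral>\<^sup>+x. ?u n x \<partial>lborel)"
    by (rule nn_integral_liminf) simp
  also have "\<dots> \<le> ?R"
    by (rule Liminf_le) (use le in \<open>auto\<close>)
  finally show ?thesis .
qed

section \<open>Functions determined by their integrals against Gaussians\<close>

text \<open>Boxes are an intersection-stable generator of the Borel sets, so vanishing integrals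
  spread to all Borel sets by Dynkin induction. The complement case uses the integral over the whole
  space, which is a limit over growing boxes.\<close>

lemma AE_zero_if_box_integrals_zero:
  fixes F :: "'a::euclidean_space \<Rightarrow> 'b::{banach, second_countable_topology}"
  assumes F: "integrable lborel F"
    and box: "\<And>l u. (LINT x:box l u|lborel. F x) = 0"
  shows "AE x in lborel. F x = 0"
proof (rule sigma_finite_measure.density_zero[OF sigma_finite_lborel F])
  have [measurable]: "F \<in> borel_measurable borel" using F by auto
  have set: "set_integrable lborel A F" if "A \<in> sets borel" for A
    unfolding set_integrable_def using integrable_mult_indicator[OF _ F, of A] that by simp
  have total: "(\<integral>x. F x \<partial>lborel) = 0"
  proof -
    let ?A = "\<lambda>n::nat. box (- (real n *\<^sub>R One)) (real n *\<^sub>R One) :: 'a set"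
    have "(\<lambda>n. \<integral>x. indicator (?A n) x *\<^sub>R F x \<partial>lborel) \<longlonglongrightarrow> (\<integral>x. F x \<partial>lborel)"
    proof (rule integral_dominated_convergence[where w="\<lambda>x. norm (F x)"])
      show "AE x in lborel. (\<lambda>n. indicator (?A n) x *\<^sub>R F x) \<longlonglongrightarrow> F x"
      proof (rule AE_I2)
        fix x
        obtain m where m: "x \<in> ?A m" using UN_box_eq_UNIV[where 'a='a] by blast
        have "x \<in> ?A n" if "m \<le> n" for n
          using m that by (auto simp: box_def)
        then have "eventually (\<lambda>n. indicator (?A n) x *\<^sub>R F x = F x) sequentially"
          by (auto simp: eventually_sequentially simp del: scaleR_eq_0_iff intro!: exI[of _ m])
        then show "(\<lambda>n. indicator (?A n) x *\<^sub>R F x) \<longlonglongrightarrow> F x"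
          by (rule tendsto_eventually)
      qed
    qed (use F in \<open>auto simp: indicator_def\<close>)
    then show ?thesis using box by (simp add: set_lebesgue_integral_def LIMSEQ_const_iff)
  qed
  let ?E = "range (\<lambda>(a, b). box a b::'a set)"
  have sE: "sigma_sets UNIV ?E = sets borel"
    by (simp add: borel_eq_box)
  fix A :: "'a set" assume "A \<in> sets lborel"
  then have A: "A \<in> sigma_sets UNIV ?E" by (simp add: borel_eq_box)
  have E: "Int_stable ?E" "?E \<subseteq> Pow UNIV"
    by (auto simp: Int_stable_def box_Int_box)
  from E A show "(LINT x:A|lborel. F x) = 0"
  proof (induction rule: sigma_sets_induct_disjoint)
    case (basic A)
    then show ?case using box by auto
  next
    case empty
    then show ?case by (simp add: set_lebesgue_integral_def)
  next
    case (compl A)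
    then have [measurable]: "A \<in> sets borel" unfolding sE by simp
    have "(LINT x:UNIV - A|lborel. F x) = (\<integral>x. F x - indicator A x *\<^sub>R F x \<partial>lborel)"
      unfolding set_lebesgue_integral_def
        by (intro Bochner_Integration.integral_cong) (auto simp: indicator_def)
    also have "\<dots> = 0"
      using F set[of A] compl total by (simp add: set_integrable_def set_lebesgue_integral_def)
    finally show ?case .
  next
    case (union A)
    then have [measurable]: "A i \<in> sets borel" for i unfolding sE by auto
    show ?case
      using union
      by (subst lebesgue_integral_countable_add) (auto simp: disjoint_family_on_def intro!: set)
  qed
qed

text \<open>Integrating narrow Gaussians over all centres in a box gives, up to the mass
  \<open>K\<close>, a mollified indicator of the box; in the limit the integral of F over the box
  vanishes.\<close>

lemma AE_zero_if_gauss_L1: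
  fixes F :: "'a::euclidean_space \<Rightarrow> complex"
  assumes F: "integrable lborel F"
    and G: "\<And>c \<tau>. \<tau> > 0 \<Longrightarrow> (\<integral>x. F x * complex_of_real (gauss \<tau> (x - c)) \<partial>lborel) = 0"
  shows "AE x in lborel. F x = 0"
proof (rule AE_zero_if_box_integrals_zero[OF F])
  fix l u :: 'a
  let ?A = "box l u" and ?L = "lborel :: 'a measure"
  have [measurable]: "F \<in> borel_measurable borel" using F by auto
  define K where "K = (\<integral>x. gauss 1 (x::'a) \<partial>lborel)"
  have K: "K > 0" using integrable_gauss(2)[of 1, where 'a='a] by (simp add: K_def)
  \<comment> \<open>The indicator mollified at scale 1 / (n + 1), written in the rescaled variable
    so that the kernel \<open>gauss 1\<close> is a fixed integrable majorant. The limit is correct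
    off the boundary of the box, which is a null set.\<close>
  define R where "R n y = (\<integral>z. indicator ?A (y + (1 / real (Suc n)) *\<^sub>R z) * gauss 1 z \<partial>?L)" for n
    and y :: 'a
  have bnd: "\<bar>indicator ?A y * gauss \<tau> z :: real\<bar> \<le> gauss \<tau> z" for y z :: 'a and \<tau>
    by (auto simp: indicator_def)
  have Rb: "\<bar>R n y\<bar> \<le> K" for n y
  proof -
    have "norm (R n y) \<le> (\<integral>z. norm (indicator ?A (y + (1 / real (Suc n)) *\<^sub>R z) * gauss 1 z) \<partial>?L)"
      unfolding R_def by (rule integral_norm_bound)
    also have "\<dots> \<le> K"
      unfolding K_def
      by (intro integral_mono Bochner_Integration.integrable_bound[OF integrable_gauss(1)[of 1]]
        integrable_gauss)
         (auto intro!: AE_I2 simp: indicator_def)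
    finally show ?thesis by simp
  qed
  have Rlim: "(\<lambda>n. R n y) \<longlonglongrightarrow> indicator ?A y * K" if y: "y \<notin> cbox l u - box l u" for y
  proof -
    have "(\<lambda>n. R n y) \<longlonglongrightarrow> (\<integral>z. indicator ?A y * gauss 1 z \<partial>?L)"
      unfolding R_def
    proof (rule integral_dominated_convergence[where w="gauss 1"])
      show "AE z in lborel. (\<lambda>n. indicator ?A (y + (1 / real (Suc n)) *\<^sub>R z) * gauss 1 z) \<longlonglongrightarrow> indicator
        ?A y * gauss 1 z"
      proof (rule AE_I2)
        fix z :: 'a
        have lim: "(\<lambda>n. y + (1 / real (Suc n)) *\<^sub>R z) \<longlonglongrightarrow> y + 0 *\<^sub>R z"
          by (intro tendsto_intros LIMSEQ_inverse_real_of_nat[unfolded inverse_eq_divide])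
        have "eventually (\<lambda>n. indicator ?A (y + (1 / real (Suc n)) *\<^sub>R z) = (indicator ?A y::real))
          sequentially"
        proof (cases "y \<in> ?A")
          case True
          have "eventually (\<lambda>n. y + (1 / real (Suc n)) *\<^sub>R z \<in> ?A) sequentially"
            by (rule topological_tendstoD[OF lim]) (use True in auto)
          then show ?thesis by eventually_elim (use True in auto)
        next
          case False
          have "eventually (\<lambda>n. y + (1 / real (Suc n)) *\<^sub>R z \<in> - cbox l u) sequentially"
            by (rule topological_tendstoD[OF lim]) (use False y in auto)
          then show ?thesis
            by eventually_elim (use False box_subset_cbox[of l u] in \<open>auto simp: indicator_def\<close>)
        qed
        then have "eventually (\<lambda>n. indicator ?A (y + (1 / real (Suc n)) *\<^sub>R z) * gauss 1 z
          = indicator ?A y * gauss 1 z) sequentially"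
          by eventually_elim simp
        then show "(\<lambda>n. indicator ?A (y + (1 / real (Suc n)) *\<^sub>R z) * gauss 1 z) \<longlonglongrightarrow> indicator ?A y
          * gauss 1 z"
          by (rule tendsto_eventually)
      qed
      show "AE z in lborel. norm (indicator ?A (y + (1 / real (Suc n)) *\<^sub>R z) * gauss 1 z)
        \<le> gauss 1 z" for n
        using bnd by (intro AE_I2) auto
    qed (auto intro: integrable_gauss)
    then show ?thesis by (simp add: K_def)
  qed
  \<comment> \<open>Substituting c = y + z / (n + 1) rewrites \<open>R n y\<close> as an integral
    over centres c in the box; after Fubini the assumption \<open>G\<close> applies to each
    centre.\<close>
  have R0: "(\<integral>y. F y * complex_of_real (R n y) \<partial>lborel) = 0" for n
  proof -
    let ?t = "real (Suc n)"
    define H where "H y c = F y * complex_of_real (indicator ?A c * gauss ?t (y - c))" for y c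
    have R: "R n y = ?t ^ DIM('a) * (\<integral>c. indicator ?A c * gauss ?t (y - c) \<partial>?L)" for y
    proof -
      have *: "gauss ?t ((1 / ?t) *\<^sub>R x) = gauss 1 x" for x :: 'a
        by (simp add: gauss_def power_divide)
      have "(\<integral>c. indicator ?A c * gauss ?t (y - c) \<partial>?L) = (1 / ?t) ^ DIM('a) * R n y"
        by (subst integral_lborel_affine[where t=y and c="1 / ?t"])
           (auto simp: R_def gauss_def power_divide simp del: of_nat_Suc)
      then show ?thesis by (simp add: power_divide del: of_nat_Suc)
    qed
    have sf: "sigma_finite_measure ?L" by (rule sigma_finite_lborel)
    have iA: "integrable ?L (\<lambda>c. complex_of_real (indicator ?A c))"
      by (rule integrable_of_real) (auto intro!: integrable_real_indicator
        emeasure_lborel_box_finite)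
    have Hi: "integrable (?L \<Otimes>\<^sub>M ?L) (\<lambda>(y, c). H y c)"
      by (rule Bochner_Integration.integrable_bound[OF integral_pair_mult(1)[OF sf sf F iA]])
         (auto simp: H_def norm_mult mult_left_le indicator_def)
    have "(\<integral>y. F y * complex_of_real (R n y) \<partial>lborel) = complex_of_real (?t ^ DIM('a))
      * (\<integral>y. (\<integral>c. H y c \<partial>?L) \<partial>?L)"
      unfolding R H_def
        by (simp add: mult_ac flip: integral_mult_right_zero integral_complex_of_real)
    also have "(\<integral>y. (\<integral>c. H y c \<partial>?L) \<partial>?L) = (\<integral>c. (\<integral>y. H y c \<partial>?L) \<partial>?L)"
      by (rule lborel_pair.Fubini_integral[OF Hi, symmetric])
    also have "\<dots> = (\<integral>c. complex_of_real (indicator ?A c)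
      * (\<integral>y. F y * complex_of_real (gauss ?t (y - c)) \<partial>?L) \<partial>?L)"
      unfolding H_def
        by (intro Bochner_Integration.integral_cong refl)
        (simp add: mult_ac flip: integral_mult_right_zero)
    also have "\<dots> = 0" using G[of ?t] by simp
    finally show ?thesis by simp
  qed
  have [measurable]: "R n \<in> borel_measurable borel" for n
    unfolding R_def by measurable
  have fr: "AE y in lborel. y \<notin> cbox l u - box l u"
  proof -
    have "cbox l u - box l u \<in> null_sets lborel"
      using negligible_frontier_interval[of l u]
      by (simp add: negligible_iff_null_sets null_sets_completion_iff)
    then show ?thesis by (rule AE_not_in)
  qed
  have "(\<lambda>n. \<integral>y. F y * complex_of_real (R n y) \<partial>lborel) \<longlonglongrightarrow> (\<integral>y. F y * complex_of_real (indicator ?A y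
    * K) \<partial>lborel)"
  proof (rule integral_dominated_convergence[where w="\<lambda>y. cmod (F y) * K"])
    show "AE y in lborel. (\<lambda>n. F y * complex_of_real (R n y)) \<longlonglongrightarrow> F y
      * complex_of_real (indicator ?A y * K)"
      using fr by eventually_elim (intro tendsto_intros Rlim)
    show "AE y in lborel. norm (F y * complex_of_real (R n y)) \<le> cmod (F y) * K" for n
      using Rb by (auto simp: norm_mult intro!: mult_left_mono)
  qed (use F in auto)
  then have "(\<integral>y. F y * complex_of_real (indicator ?A y * K) \<partial>lborel) = 0"
    unfolding R0 by (simp add: LIMSEQ_const_iff)
  moreover have "(\<integral>y. F y * complex_of_real (indicator ?A y * K) \<partial>lborel)
    = (\<integral>y. indicator ?A y *\<^sub>R F y \<partial>lborel) * complex_of_real K"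
    by (simp add: scaleR_conv_of_real mult_ac flip: integral_mult_right_zero)
  ultimately show "(LINT y:?A|lborel. F y) = 0"
    using K by (simp add: set_lebesgue_integral_def)
qed

text \<open>Completing the square: squared inverse widths add, and the new centre is the mean of the
  old ones weighted by them.\<close>

lemma gauss_mult_gauss:
  fixes c :: "'a::euclidean_space"
  shows "gauss 1 x * gauss \<tau> (x - c) = gauss (sqrt (1 + \<tau>\<^sup>2)) (x - (\<tau>\<^sup>2 / (1 + \<tau>\<^sup>2)) *\<^sub>R c)
    * exp (- (\<tau>\<^sup>2 * (norm c)\<^sup>2 / (1 + \<tau>\<^sup>2)) / 2)"
proof -
  have p: "1 + \<tau>\<^sup>2 > 0" by (simp add: add_pos_nonneg)
  have "(norm x)\<^sup>2 + \<tau>\<^sup>2 * (norm (x - c))\<^sup>2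
     = (1 + \<tau>\<^sup>2) * (norm (x - (\<tau>\<^sup>2 / (1 + \<tau>\<^sup>2)) *\<^sub>R c))\<^sup>2 + \<tau>\<^sup>2 * (norm c)\<^sup>2 / (1 + \<tau>\<^sup>2)"
    using p unfolding power2_norm_eq_inner
    by (simp add: inner_diff_left inner_diff_right inner_commute[of c x] divide_simps)
       (simp add: algebra_simps power2_eq_square)
  then have eq: "1\<^sup>2 * (norm x)\<^sup>2 + \<tau>\<^sup>2 * (norm (x - c))\<^sup>2
     = (sqrt (1 + \<tau>\<^sup>2))\<^sup>2 * (norm (x - (\<tau>\<^sup>2 / (1 + \<tau>\<^sup>2)) *\<^sub>R c))\<^sup>2 + \<tau>\<^sup>2 * (norm c)\<^sup>2 / (1 + \<tau>\<^sup>2)"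
    using p by simp
  have half: "- a / 2 + - b / 2 = - u / 2 + - v / 2" if "a + b = u + v" for a b u v :: real
    using that by simp
  show ?thesis
    unfolding gauss_def exp_add[symmetric] by (intro arg_cong[where f=exp] half eq)
qed

text \<open>W itself may fail to be integrable. Multiplication by \<open>gauss 1\<close> makes it
  so, and the vanishing hypothesis survives because a product of two Gaussians is a multiple of a
  Gaussian.\<close>

lemma AE_zero_if_gauss:
  fixes W :: "'a::euclidean_space \<Rightarrow> complex"
  assumes I: "\<And>c \<tau>. \<tau> > 0 \<Longrightarrow> integrable lborel (\<lambda>x. W x * complex_of_real (gauss \<tau> (x - c)))"
    and G: "\<And>c \<tau>. \<tau> > 0 \<Longrightarrow> (\<integral>x. W x * complex_of_real (gauss \<tau> (x - c)) \<partial>lborel) = 0"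
  shows "AE x in lborel. W x = 0"
proof -
  have "AE x in lborel. W x * complex_of_real (gauss 1 x) = 0"
  proof (rule AE_zero_if_gauss_L1)
    show "integrable lborel (\<lambda>x. W x * complex_of_real (gauss 1 x))"
      using I[of 1 0] by simp
    fix c :: 'a and \<tau> :: real assume \<tau>: "\<tau> > 0"
    have "W x * complex_of_real (gauss 1 x) * complex_of_real (gauss \<tau> (x - c)) =
      W x * complex_of_real (gauss (sqrt (1 + \<tau>\<^sup>2)) (x - (\<tau>\<^sup>2 / (1 + \<tau>\<^sup>2)) *\<^sub>R c)) * complex_of_real
        (exp (- (\<tau>\<^sup>2 * (norm c)\<^sup>2 / (1 + \<tau>\<^sup>2)) / 2))" for x
      unfolding mult.assoc of_real_mult[symmetric] gauss_mult_gauss ..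
    note eq = this
    show "(\<integral>x. W x * complex_of_real (gauss 1 x) * complex_of_real (gauss \<tau> (x - c)) \<partial>lborel) = 0"
      unfolding eq integral_mult_left_zero using G[of "sqrt (1 + \<tau>\<^sup>2)"] by (simp add: add_pos_nonneg)
  qed
  then show ?thesis
    by eventually_elim (metis gauss_pos(1) less_irrefl mult_eq_0_iff of_real_eq_0_iff)
qed

section \<open>Schwartz functions: Gaussians, stability and decay\<close>

lemma power_le_fact_exp:
  fixes x :: real
  assumes "0 \<le> x"
  shows "x ^ n \<le> fact n * exp x"
proof -
  have "(\<Sum>k\<in>{n}. inverse (fact k) *\<^sub>R x ^ k) \<le> (\<Sum>k. inverse (fact k) *\<^sub>R x ^ k)"
    using assms summable_exp[of x] by (intro sum_le_suminf) auto
  then have "inverse (fact n) * x ^ n \<le> exp x" by (simp add: exp_def divide_inverse_commute)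
  then show ?thesis by (simp add: field_simps)
qed

lemma poly_gauss_bounded:
  assumes "\<tau> > 0"
  shows "\<exists>B. \<forall>x::'a::euclidean_space. (1 + norm x) ^ m * gauss \<tau> x \<le> B"
proof -
  define a where "a = \<tau>\<^sup>2 / 2"
  have a: "a > 0" using assms by (simp add: a_def)
  have "(1 + norm x) ^ m * gauss \<tau> x \<le> fact m * exp (1 + 1 / (4 * a))" for x :: 'a
  proof -
    have "norm x - a * (norm x)\<^sup>2 \<le> 1 / (4 * a)"
    proof -
      have "0 \<le> (2 * a * norm x - 1)\<^sup>2 / (4 * a)" using a by simp
      also have "\<dots> = a * (norm x)\<^sup>2 - norm x + 1 / (4 * a)"
        using a by (simp add: power2_eq_square field_simps)
      finally show ?thesis by simp
    qed
    then have e: "exp (1 + norm x) * gauss \<tau> x \<le> exp (1 + 1 / (4 * a))"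
      by (simp add: gauss_def a_def flip: exp_add)
    have "(1 + norm x) ^ m * gauss \<tau> x \<le> (fact m * exp (1 + norm x)) * gauss \<tau> x"
      by (intro mult_right_mono power_le_fact_exp) auto
    also have "\<dots> \<le> fact m * exp (1 + 1 / (4 * a))"
      using e by (simp add: mult.assoc mult_left_mono)
    finally show ?thesis .
  qed
  then show ?thesis by blast
qed

text \<open>Polynomial multiples of a modulated Gaussian, given by closure rules that make the class
  stable under directional derivatives. Membership in \<open>schwartz\<close> concerns iterated
  derivatives, so stability together with a growth bound for the whole class settles it.\<close>

inductive poly_gauss :: "'a::euclidean_space \<Rightarrow> real \<Rightarrow> ('a \<Rightarrow> complex) \<Rightarrow> bool" for c \<tau> where
  base: "poly_gauss c \<tau> (\<lambda>x. cis (c \<bullet> x) * complex_of_real (gauss \<tau> x))"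
| add: "poly_gauss c \<tau> f \<Longrightarrow> poly_gauss c \<tau> g \<Longrightarrow> poly_gauss c \<tau> (\<lambda>x. f x + g x)"
| scale: "poly_gauss c \<tau> f \<Longrightarrow> poly_gauss c \<tau> (\<lambda>x. z * f x)"
| coord: "poly_gauss c \<tau> f \<Longrightarrow> poly_gauss c \<tau> (\<lambda>x. complex_of_real (x \<bullet> b) * f x)"

lemma poly_gauss_has_derivative:
  assumes "poly_gauss c \<tau> f"
  shows "\<exists>D. (\<forall>x. (f has_derivative D x) (at x)) \<and> (\<forall>b. poly_gauss c \<tau> (\<lambda>x. D x b))"
  using assms
proof induction
  case base
  let ?g = "\<lambda>x. cis (c \<bullet> x) * complex_of_real (gauss \<tau> x)"
  define D where "D x b = \<i> * complex_of_real (c \<bullet> b) * ?g x + (- complex_of_real (\<tau>\<^sup>2))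
    * (complex_of_real (x \<bullet> b) * ?g x)"
    for x b
  have "(?g has_derivative D x) (at x)" for x
  proof -
    let ?e = "\<lambda>x. \<i> * complex_of_real (c \<bullet> x) + complex_of_real (- (\<tau>\<^sup>2 * (x \<bullet> x)) / 2)"
    let ?e' = "\<lambda>b. \<i> * complex_of_real (c \<bullet> b) + complex_of_real (- (\<tau>\<^sup>2 * (x \<bullet> b + b \<bullet> x)) / 2)"
    have e: "(?e has_derivative ?e') (at x)"
      by (auto intro!: derivative_eq_intros)
    have *: "((\<lambda>x. exp (?e x)) has_derivative (\<lambda>b. exp (?e x) * ?e' b)) (at x)"
      using has_derivative_compose[OF e, of exp "(*) (exp (?e x))"] DERIV_exp[of "?e x"]
      by (simp add: has_field_derivative_def)
    have "exp (?e x) = ?g x" for x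
      by (simp only: exp_add cis_conv_exp exp_of_real gauss_def power2_norm_eq_inner)
    moreover have "?g x * ?e' b = D x b" for b
      by (simp add: D_def inner_commute[of b x] algebra_simps)
    ultimately have "(\<lambda>x. exp (?e x)) = ?g" "(\<lambda>b. exp (?e x) * ?e' b) = D x"
      by (simp_all only: fun_eq_iff simp_thms)
    with * show ?thesis by simp
  qed
  moreover have "poly_gauss c \<tau> (\<lambda>x. D x b)" for b
    unfolding D_def by (intro poly_gauss.intros)
  ultimately show ?case by blast
next
  case (add f g)
  then obtain D E where "\<forall>x. (f has_derivative D x) (at x)" "\<forall>b. poly_gauss c \<tau> (\<lambda>x. D x b)"
    "\<forall>x. (g has_derivative E x) (at x)" "\<forall>b. poly_gauss c \<tau> (\<lambda>x. E x b)" by blast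
  then show ?case
    by (intro exI[of _ "\<lambda>x b. D x b + E x b"]) (auto intro!: poly_gauss.add has_derivative_add)
next
  case (scale f z)
  then obtain D where "\<forall>x. (f has_derivative D x) (at x)" "\<forall>b. poly_gauss c \<tau> (\<lambda>x. D x b)" by blast
  then show ?case
    by (intro exI[of _ "\<lambda>x b. z * D x b"]) (auto intro!: poly_gauss.scale has_derivative_mult_right)
next
  case (coord f v)
  then obtain D where D: "\<forall>x. (f has_derivative D x) (at x)" "\<forall>b. poly_gauss c \<tau> (\<lambda>x. D x b)"
    by blast
  have "((\<lambda>x. complex_of_real (x \<bullet> v) * f x) has_derivative (\<lambda>b. complex_of_real (x \<bullet> v) * D x b
    + complex_of_real (b \<bullet> v) * f x)) (at x)" for x
    by (rule has_derivative_mult) (use D in \<open>auto intro!: derivative_eq_intros\<close>)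
  then show ?case
    using D(2) coord
    by (intro exI[of _ "\<lambda>x b. complex_of_real (x \<bullet> v) * D x b + complex_of_real (b \<bullet> v) * f x"])
       (auto intro!: poly_gauss.add poly_gauss.scale poly_gauss.coord)
qed

lemma poly_gauss_bound:
  assumes "poly_gauss c \<tau> f"
  shows "\<exists>C m. \<forall>x. cmod (f x) \<le> C * ((1 + norm x) ^ m * gauss \<tau> x)"
  using assms
proof induction
  case base
  show ?case by (rule exI[of _ 1], rule exI[of _ 0]) (auto simp: norm_mult)
next
  case (add f g)
  then obtain C m C' m' where *: "\<And>x. cmod (f x) \<le> C * ((1 + norm x) ^ m * gauss \<tau> x)"
    "\<And>x. cmod (g x) \<le> C' * ((1 + norm x) ^ m' * gauss \<tau> x)" by blast
  have "cmod (f x + g x) \<le> (\<bar>C\<bar> + \<bar>C'\<bar>) * ((1 + norm x) ^ (m + m') * gauss \<tau> x)" for x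
  proof -
    have p: "(1 + norm x) ^ m \<le> (1 + norm x) ^ (m + m')" "(1 + norm x) ^ m'
      \<le> (1 + norm x) ^ (m + m')"
      by (auto intro: power_increasing)
    have "cmod (f x) \<le> \<bar>C\<bar> * ((1 + norm x) ^ (m + m') * gauss \<tau> x)"
      by (rule order_trans[OF *(1)]) (intro mult_mono mult_right_mono p, auto)
    moreover have "cmod (g x) \<le> \<bar>C'\<bar> * ((1 + norm x) ^ (m + m') * gauss \<tau> x)"
      by (rule order_trans[OF *(2)]) (intro mult_mono mult_right_mono p, auto)
    ultimately show ?thesis
      using norm_triangle_ineq[of "f x" "g x"] by (simp add: algebra_simps)
  qed
  then show ?case by blast
next
  case (scale f z)
  then obtain C m where *: "\<And>x. cmod (f x) \<le> C * ((1 + norm x) ^ m * gauss \<tau> x)" by blast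
  have "cmod (z * f x) \<le> (cmod z * C) * ((1 + norm x) ^ m * gauss \<tau> x)" for x
    using mult_left_mono[OF *, of "cmod z" x] by (simp add: norm_mult mult_ac)
  then show ?case by blast
next
  case (coord f v)
  then obtain C m where *: "\<And>x. cmod (f x) \<le> C * ((1 + norm x) ^ m * gauss \<tau> x)" by blast
  have "cmod (complex_of_real (x \<bullet> v) * f x) \<le> (norm v * C) * ((1 + norm x) ^ Suc m * gauss \<tau> x)"
    for x
  proof -
    have "\<bar>x \<bullet> v\<bar> \<le> norm x * norm v" by (rule Cauchy_Schwarz_ineq2)
    also have "\<dots> \<le> (1 + norm x) * norm v" by (intro mult_right_mono) auto
    finally have "\<bar>x \<bullet> v\<bar> * cmod (f x) \<le> ((1 + norm x) * norm v)
      * (C * ((1 + norm x) ^ m * gauss \<tau> x))"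
      using * by (intro mult_mono) auto
    then show ?thesis by (simp add: norm_mult mult_ac)
  qed
  then show ?case by blast
qed

lemma foldr_directional_deriv_Cons:
  "foldr directional_deriv (b # bs) f
    = (\<lambda>x. frechet_derivative (foldr directional_deriv bs f) (at x) b)"
  by (simp add: directional_deriv_def[of b "foldr directional_deriv bs f"])

lemma foldr_poly_gauss:
  assumes "poly_gauss c \<tau> f"
  shows "poly_gauss c \<tau> (foldr directional_deriv bs f)"
proof (induction bs)
  case Nil
  then show ?case using assms by simp
next
  case (Cons b bs)
  obtain D where D: "\<And>x. (foldr directional_deriv bs f has_derivative D x) (at x)"
    "poly_gauss c \<tau> (\<lambda>x. D x b)"
    using poly_gauss_has_derivative[OF Cons] by blast
  have "frechet_derivative (foldr directional_deriv bs f) (at x) = D x" for x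
    using frechet_derivative_at[OF D(1)] by simp
  then show ?case using D(2) unfolding foldr_directional_deriv_Cons by simp
qed

lemma schwartz_poly_gauss:
  assumes "poly_gauss c \<tau> f" "\<tau> > 0"
  shows "f \<in> schwartz"
  unfolding schwartz_def
proof (intro CollectI allI impI conjI)
  fix bs :: "'a list" and x :: 'a and k :: nat
  let ?f = "foldr directional_deriv bs f"
  have pg: "poly_gauss c \<tau> ?f" by (rule foldr_poly_gauss[OF assms(1)])
  show "?f differentiable at x"
    using poly_gauss_has_derivative[OF pg] by (auto simp: differentiable_def)
  obtain C m where C: "\<And>x. cmod (?f x) \<le> C * ((1 + norm x) ^ m * gauss \<tau> x)"
    using poly_gauss_bound[OF pg] by blast
  obtain B where B: "\<And>x::'a. (1 + norm x) ^ (k + m) * gauss \<tau> x \<le> B"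
    using poly_gauss_bounded[OF assms(2)] by blast
  have "norm (norm x ^ k *\<^sub>R ?f x) \<le> \<bar>C\<bar> * B" for x
  proof -
    have "norm x ^ k * cmod (?f x) \<le> (1 + norm x) ^ k * (\<bar>C\<bar> * ((1 + norm x) ^ m * gauss \<tau> x))"
      by (intro mult_mono power_mono order_trans[OF C] mult_right_mono) auto
    also have "\<dots> = \<bar>C\<bar> * ((1 + norm x) ^ (k + m) * gauss \<tau> x)" by (simp add: power_add mult_ac)
    also have "\<dots> \<le> \<bar>C\<bar> * B" using B by (intro mult_left_mono) auto
    finally show ?thesis by simp
  qed
  then show "bounded (range (\<lambda>x. norm x ^ k *\<^sub>R ?f x))"
    by (auto intro!: boundedI)
qed

lemma schwartz_differentiable:
  "\<phi> \<in> schwartz \<Longrightarrow> set bs \<subseteq> Basis \<Longrightarrow> foldr directional_deriv bs \<phi> differentiable (at x)"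
  by (simp add: schwartz_def)

lemma schwartz_bounded:
  "\<phi> \<in> schwartz \<Longrightarrow> set bs \<subseteq> Basis
    \<Longrightarrow> bounded (range (\<lambda>x. (norm x ^ k) *\<^sub>R foldr directional_deriv bs \<phi> x))"
  by (simp add: schwartz_def)

lemma schwartz_diff:
  assumes "\<phi> \<in> schwartz" "\<psi> \<in> schwartz"
  shows "(\<lambda>x. \<phi> x - \<psi> x) \<in> schwartz"
proof -
  have eq: "foldr directional_deriv bs (\<lambda>x. \<phi> x - \<psi> x)
    = (\<lambda>x. foldr directional_deriv bs \<phi> x - foldr directional_deriv bs \<psi> x)"
    if "set bs \<subseteq> Basis" for bs
    using that
  proof (induction bs)
    case (Cons b bs)
    then have d: "foldr directional_deriv bs \<phi> differentiable (at x)" "foldr directional_deriv bs \<psi>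
      differentiable (at x)" for x
      using assms by (auto intro: schwartz_differentiable)
    have "frechet_derivative (\<lambda>x. foldr directional_deriv bs \<phi> x - foldr directional_deriv bs \<psi> x)
      (at x)
      = (\<lambda>v. frechet_derivative (foldr directional_deriv bs \<phi>) (at x) v - frechet_derivative
        (foldr directional_deriv bs \<psi>) (at x) v)" for x
      by (intro frechet_derivative_at[symmetric] has_derivative_diff)
        (use d in \<open>simp_all flip: frechet_derivative_works\<close>)
    then show ?case using Cons unfolding foldr_directional_deriv_Cons by simp
  qed simp
  show ?thesis
    unfolding schwartz_def
  proof (intro CollectI allI impI conjI)
    fix bs :: "'a list" and x :: 'a and k :: nat assume bs: "set bs \<subseteq> Basis"
    show "foldr directional_deriv bs (\<lambda>x. \<phi> x - \<psi> x) differentiable at x"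
      unfolding eq[OF bs] using assms bs
        by (auto intro!: differentiable_diff schwartz_differentiable)
    show "bounded (range (\<lambda>x. norm x ^ k *\<^sub>R foldr directional_deriv bs (\<lambda>x. \<phi> x - \<psi> x) x))"
      unfolding eq[OF bs] scaleR_diff_right
      using assms bs by (intro bounded_minus_comp schwartz_bounded)
  qed
qed

lemma schwartz_affine:
  fixes \<phi> :: "'a::euclidean_space \<Rightarrow> complex"
  assumes \<phi>: "\<phi> \<in> schwartz" and c: "c \<noteq> 0"
  shows "(\<lambda>x. \<phi> (t + c *\<^sub>R x)) \<in> schwartz"
proof -
  have eq: "foldr directional_deriv bs (\<lambda>x. \<phi> (t + c *\<^sub>R x))
    = (\<lambda>x. c ^ length bs *\<^sub>R foldr directional_deriv bs \<phi> (t + c *\<^sub>R x))"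
    if "set bs \<subseteq> Basis" for bs
    using that
  proof (induction bs)
    case (Cons b bs)
    let ?F = "foldr directional_deriv bs \<phi>"
    have d: "?F differentiable (at x)" for x
      using assms Cons by (auto intro: schwartz_differentiable)
    have "((\<lambda>x. c ^ length bs *\<^sub>R ?F (t + c *\<^sub>R x)) has_derivative
      (\<lambda>v. c ^ length bs *\<^sub>R frechet_derivative ?F (at (t + c *\<^sub>R x)) (c *\<^sub>R v))) (at x)" for x
      by (intro has_derivative_scaleR_right has_derivative_compose[of "\<lambda>x. t + c *\<^sub>R x" "\<lambda>v. c *\<^sub>R v"
        x UNIV ?F])
         (use d in \<open>auto intro!: derivative_eq_intros simp flip: frechet_derivative_works\<close>)
    from frechet_derivative_at[OF this]
    have "frechet_derivative (\<lambda>x. c ^ length bs *\<^sub>R ?F (t + c *\<^sub>R x)) (at x) b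
       = c ^ length bs *\<^sub>R (c *\<^sub>R frechet_derivative ?F (at (t + c *\<^sub>R x)) b)" for x
      using linear_scale[OF linear_frechet_derivative[OF d]] by metis
    then show ?case using Cons unfolding foldr_directional_deriv_Cons by (simp add: mult.commute)
  qed simp
  show ?thesis
    unfolding schwartz_def
  proof (intro CollectI allI impI conjI)
    fix bs :: "'a list" and x :: 'a and k :: nat assume bs: "set bs \<subseteq> Basis"
    let ?F = "foldr directional_deriv bs \<phi>"
    have d: "?F differentiable (at x)" for x
      using \<phi> bs by (auto intro: schwartz_differentiable)
    show "foldr directional_deriv bs (\<lambda>x. \<phi> (t + c *\<^sub>R x)) differentiable at x"
      unfolding eq[OF bs]
      by (intro differentiable_scaleR differentiable_const differentiable_compose[of ?F "\<lambda>x. t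
        + c *\<^sub>R x"] d)
         (auto intro!: derivative_intros)
    obtain B where B: "\<And>y. norm (norm y ^ k *\<^sub>R ?F y) \<le> B"
      using schwartz_bounded[OF \<phi> bs, of k] by (auto simp: bounded_iff)
    obtain B0 where B0: "\<And>y. norm (norm y ^ 0 *\<^sub>R ?F y) \<le> B0"
      using schwartz_bounded[OF \<phi> bs, of 0] unfolding bounded_iff by auto
    have "norm (norm x ^ k *\<^sub>R c ^ length bs *\<^sub>R ?F (t + c *\<^sub>R x))
       \<le> \<bar>c\<bar> ^ length bs * ((2 / \<bar>c\<bar>) ^ k * (B + norm t ^ k * B0))" for x
    proof -
      let ?y = "t + c *\<^sub>R x"
      have "\<bar>c\<bar> * norm x = norm (?y - t)" by simp
      also have "\<dots> \<le> norm ?y + norm t" by (rule norm_triangle_ineq4)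
      also have "\<dots> \<le> 2 * max (norm ?y) (norm t)" by simp
      finally have "norm x \<le> 2 / \<bar>c\<bar> * max (norm ?y) (norm t)"
        using c by (simp add: field_simps)
      then have "norm x ^ k \<le> (2 / \<bar>c\<bar>) ^ k * max (norm ?y) (norm t) ^ k"
        by (subst power_mult_distrib[symmetric], intro power_mono) auto
      also have "\<dots> \<le> (2 / \<bar>c\<bar>) ^ k * (norm ?y ^ k + norm t ^ k)"
        by (intro mult_left_mono) (auto simp: max_def)
      finally have "norm x ^ k * norm (?F ?y) \<le> (2 / \<bar>c\<bar>) ^ k * (norm ?y ^ k + norm t ^ k)
        * norm (?F ?y)"
        by (rule mult_right_mono) simp
      also have "\<dots> = (2 / \<bar>c\<bar>) ^ k * (norm (norm ?y ^ k *\<^sub>R ?F ?y) + norm t ^ k * norm (?F ?y))"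
        by (simp add: algebra_simps)
      also have "\<dots> \<le> (2 / \<bar>c\<bar>) ^ k * (B + norm t ^ k * B0)"
        using B0[of ?y] by (intro mult_left_mono add_mono B) auto
      finally have "\<bar>c\<bar> ^ length bs * (norm x ^ k * norm (?F ?y))
        \<le> \<bar>c\<bar> ^ length bs * ((2 / \<bar>c\<bar>) ^ k * (B + norm t ^ k * B0))"
        by (intro mult_left_mono) auto
      then show ?thesis by (simp add: power_abs abs_mult mult_ac)
    qed
    then show "bounded (range (\<lambda>x. norm x ^ k *\<^sub>R foldr directional_deriv bs (\<lambda>x. \<phi> (t + c *\<^sub>R x))
      x))"
      unfolding eq[OF bs] by (auto intro!: boundedI)
  qed
qed

lemma schwartz_gauss:
  assumes "\<tau> > 0"
  shows "(\<lambda>x. cis (c \<bullet> x) * complex_of_real (gauss \<tau> x)) \<in> schwartz"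
  by (rule schwartz_poly_gauss[OF poly_gauss.base assms])

lemma schwartz_gauss_shift:
  assumes "\<tau> > 0"
  shows "(\<lambda>x. complex_of_real (gauss \<tau> (x - c))) \<in> schwartz"
  using schwartz_affine[OF schwartz_gauss[OF assms, of 0], of 1 "- c"] by simp

lemma schwartz_measurable:
  assumes "\<phi> \<in> schwartz"
  shows "\<phi> \<in> borel_measurable borel"
proof (rule borel_measurable_continuous_onI)
  show "continuous_on UNIV \<phi>"
    using schwartz_differentiable[OF assms, of "[]"]
    by (auto intro!: continuous_at_imp_continuous_on differentiable_imp_continuous_within)
qed

lemma integrable_inverse_1_plus_square_real:
  "integrable lborel (\<lambda>x::real. inverse (1 + x\<^sup>2))"
  using integrable_inverse_1_plus_square by (simp add: set_integrable_def)

text \<open>The majorant is a tensor product, hence integrable by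
  \<open>lborel_prod_integrable\<close>. Each of its d denominators is at most 2 max(1, |x|^2), so
  decay of order 2d suffices.\<close>

lemma schwartz_dominated:
  fixes \<phi> :: "'a::euclidean_space \<Rightarrow> complex"
  assumes \<phi>: "\<phi> \<in> schwartz"
  shows "\<exists>C. \<forall>x. cmod (\<phi> x) \<le> C * (\<Prod>b\<in>Basis. inverse (1 + (x \<bullet> b)\<^sup>2))"
proof -
  let ?d = "DIM('a)"
  obtain B where B: "\<And>y. norm (norm y ^ (2 * ?d) *\<^sub>R \<phi> y) \<le> B"
    using schwartz_bounded[OF \<phi>, of "[]" "2 * ?d"] by (auto simp: bounded_iff)
  obtain B0 where B0: "\<And>y. norm (norm y ^ 0 *\<^sub>R \<phi> y) \<le> B0"
    using schwartz_bounded[OF \<phi>, of "[]" 0] unfolding bounded_iff by auto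
  have "cmod (\<phi> x) \<le> 2 ^ ?d * (B0 + B) * (\<Prod>b\<in>Basis. inverse (1 + (x \<bullet> b)\<^sup>2))" for x
  proof -
    let ?P = "\<Prod>b\<in>Basis. (1 + (x \<bullet> b)\<^sup>2)"
    have P: "?P > 0" by (intro prod_pos) (simp add: add_pos_nonneg)
    have "?P \<le> (\<Prod>b\<in>(Basis::'a set). 2 * max 1 ((norm x)\<^sup>2))"
    proof (intro prod_mono conjI)
      fix b :: 'a assume "b \<in> Basis"
      then have "(x \<bullet> b)\<^sup>2 \<le> (norm x)\<^sup>2"
        using Basis_le_norm[of b x] by (metis abs_le_square_iff abs_norm_cancel)
      then show "1 + (x \<bullet> b)\<^sup>2 \<le> 2 * max 1 ((norm x)\<^sup>2)" by simp
    qed simp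
    also have "\<dots> = 2 ^ ?d * max 1 ((norm x)\<^sup>2) ^ ?d" by (simp add: power_mult_distrib)
    also have "\<dots> \<le> 2 ^ ?d * (1 + norm x ^ (2 * ?d))"
      by (intro mult_left_mono) (auto simp: max_def power_mult)
    finally have "?P * cmod (\<phi> x) \<le> 2 ^ ?d * (1 + norm x ^ (2 * ?d)) * cmod (\<phi> x)"
      by (rule mult_right_mono) simp
    also have "\<dots> = 2 ^ ?d * (cmod (\<phi> x) + norm (norm x ^ (2 * ?d) *\<^sub>R \<phi> x))"
      by (simp add: algebra_simps)
    also have "\<dots> \<le> 2 ^ ?d * (B0 + B)"
      using B0[of x] by (intro mult_left_mono add_mono B) auto
    finally have "cmod (\<phi> x) \<le> 2 ^ ?d * (B0 + B) / ?P"
      using P by (simp add: field_simps)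
    then show ?thesis by (simp add: prod_inversef[symmetric] divide_inverse o_def)
  qed
  then show ?thesis by blast
qed

lemma schwartz_integrable:
  fixes \<phi> :: "'a::euclidean_space \<Rightarrow> complex"
  assumes \<phi>: "\<phi> \<in> schwartz"
  shows "integrable lborel \<phi>" "integrable lborel (\<lambda>x. (cmod (\<phi> x))\<^sup>2)"
proof -
  note [measurable] = schwartz_measurable[OF \<phi>]
  obtain C where C: "\<And>x. cmod (\<phi> x) \<le> C * (\<Prod>b\<in>Basis. inverse (1 + (x \<bullet> b)\<^sup>2))"
    using schwartz_dominated[OF \<phi>] by blast
  have i: "integrable lborel (\<lambda>x::'a. C * (\<Prod>b\<in>Basis. inverse (1 + (x \<bullet> b)\<^sup>2)))"
    by (intro integrable_mult_right lborel_prod_integrable(1)[of "\<lambda>b x. inverse (1 + x\<^sup>2)"]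
      integrable_inverse_1_plus_square_real)
  show int: "integrable lborel \<phi>"
    by (rule Bochner_Integration.integrable_bound[OF i])
      (auto intro!: AE_I2 order_trans[OF C abs_ge_self])
  obtain B where B: "\<And>y. norm (norm y ^ 0 *\<^sub>R \<phi> y) \<le> B"
    using schwartz_bounded[OF \<phi>, of "[]" 0] unfolding bounded_iff by auto
  have Bi: "integrable lborel (\<lambda>x. B * cmod (\<phi> x))" using int by simp
  show "integrable lborel (\<lambda>x. (cmod (\<phi> x))\<^sup>2)"
  proof (rule Bochner_Integration.integrable_bound[OF Bi])
    show "AE x in lborel. norm ((cmod (\<phi> x))\<^sup>2) \<le> norm (B * cmod (\<phi> x))"
    proof (rule AE_I2)
      fix x
      have "cmod (\<phi> x) \<le> B" using B[of x] by simp
      then have "cmod (\<phi> x) * cmod (\<phi> x) \<le> B * cmod (\<phi> x)" by (rule mult_right_mono) simp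
      then show "norm ((cmod (\<phi> x))\<^sup>2) \<le> norm (B * cmod (\<phi> x))"
        by (simp add: power2_eq_square)
    qed
  qed simp
qed

section \<open>Square integrable functions\<close>

text \<open>A predicate on functions instead of a quotient space: identities hold almost everywhere.
  Values lie in a Euclidean space, so the pairing \<open>f x \<bullet> g x\<close> is the real inner
  product even for complex values, and weak convergence below refers to it.\<close>

definition sqint :: "'a measure \<Rightarrow> ('a \<Rightarrow> 'b::euclidean_space) \<Rightarrow> bool"
  where "sqint M f \<longleftrightarrow> f \<in> borel_measurable M \<and> integrable M (\<lambda>x. (norm (f x))\<^sup>2)"

definition l2norm :: "'a measure \<Rightarrow> ('a \<Rightarrow> 'b::euclidean_space) \<Rightarrow> real"
  where "l2norm M f = sqrt (\<integral>x. (norm (f x))\<^sup>2 \<partial>M)"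

lemma sqint_measurable [measurable_dest]: "sqint M f \<Longrightarrow> f \<in> borel_measurable M"
  by (simp add: sqint_def)

lemma sqint_integrable: "sqint M f \<Longrightarrow> integrable M (\<lambda>x. (norm (f x))\<^sup>2)"
  by (simp add: sqint_def)

lemma l2norm_nonneg [simp]: "0 \<le> l2norm M f"
  by (simp add: l2norm_def)

lemma l2norm_power2: "(l2norm M f)\<^sup>2 = (\<integral>x. (norm (f x))\<^sup>2 \<partial>M)"
  by (simp add: l2norm_def)

lemma nn_integral_l2norm:
  assumes "sqint M f"
  shows "(\<integral>\<^sup>+x. ennreal ((norm (f x))\<^sup>2) \<partial>M) = ennreal ((l2norm M f)\<^sup>2)"
  using assms by (simp add: l2norm_power2 nn_integral_eq_integral sqint_def)

lemma sqint_of_nn_integral: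
  assumes [measurable]: "f \<in> borel_measurable M"
    and B: "(\<integral>\<^sup>+x. ennreal ((norm (f x))\<^sup>2) \<partial>M) \<le> ennreal (B\<^sup>2)" "0 \<le> B"
  shows "sqint M f" "l2norm M f \<le> B"
proof -
  show s: "sqint M f"
    using le_less_trans[OF B(1)] by (simp add: sqint_def integrable_iff_bounded)
  show "l2norm M f \<le> B"
  proof (rule power2_le_imp_le)
    show "(l2norm M f)\<^sup>2 \<le> B\<^sup>2"
      using B(1) unfolding nn_integral_l2norm[OF s] by (subst (asm) ennreal_le_iff) auto
  qed (rule B(2))
qed

lemma sqint_cong_AE:
  assumes "sqint M f" "g \<in> borel_measurable M" "AE x in M. f x = g x"
  shows "sqint M g" "l2norm M g = l2norm M f"
proof -
  have [measurable]: "f \<in> borel_measurable M" using assms by (simp add: sqint_def)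
  have *: "AE x in M. (norm (f x))\<^sup>2 = (norm (g x))\<^sup>2" using assms(3) by eventually_elim simp
  show "sqint M g"
    using assms integrable_cong_AE[OF _ _ *] by (simp add: sqint_def)
  show "l2norm M g = l2norm M f"
    unfolding l2norm_def using assms(2)
      by (intro arg_cong[where f=sqrt] integral_cong_AE[symmetric] *) simp_all
qed

lemma sqint_bound:
  assumes "sqint M g" "f \<in> borel_measurable M" "\<And>x. norm (f x) \<le> norm (g x)"
  shows "sqint M f" "l2norm M f \<le> l2norm M g"
proof -
  have *: "(norm (f x))\<^sup>2 \<le> (norm (g x))\<^sup>2" for x using assms(3) by (simp add: power_mono)
  show s: "sqint M f"
    unfolding sqint_def
    by (intro conjI assms Bochner_Integration.integrable_bound[OF sqint_integrable[OF assms(1)]])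
       (use assms(2) * in auto)
  show "l2norm M f \<le> l2norm M g"
    unfolding l2norm_def using assms s *
      by (intro real_sqrt_le_mono integral_mono) (auto simp: sqint_def)
qed

lemma sqint_norm_mult:
  assumes "sqint M f" "sqint M g"
  shows "integrable M (\<lambda>x. norm (f x) * norm (g x))"
    and "(\<integral>x. norm (f x) * norm (g x) \<partial>M) \<le> l2norm M f * l2norm M g"
proof -
  note [measurable] = sqint_measurable[OF assms(1)] sqint_measurable[OF assms(2)]
  have b: "norm (f x) * norm (g x) \<le> ((norm (f x))\<^sup>2 + (norm (g x))\<^sup>2) / 2" for x
    using sum_squares_bound[of "norm (f x)" "norm (g x)"] by simp
  have bi: "integrable M (\<lambda>x. ((norm (f x))\<^sup>2 + (norm (g x))\<^sup>2) / 2)"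
    using assms by (auto simp: sqint_def)
  show i: "integrable M (\<lambda>x. norm (f x) * norm (g x))"
    by (rule Bochner_Integration.integrable_bound[OF bi]) (use b in auto)
  have "(ennreal (\<integral>x. norm (f x) * norm (g x) \<partial>M))\<^sup>2
    = (\<integral>\<^sup>+x. ennreal (norm (f x)) * ennreal (norm (g x)) \<partial>M)\<^sup>2"
    using i by (simp add: nn_integral_eq_integral flip: ennreal_mult)
  also have "\<dots> \<le> (\<integral>\<^sup>+x. ennreal (norm (f x)) ^ 2 \<partial>M) * (\<integral>\<^sup>+x. ennreal (norm (g x)) ^ 2 \<partial>M)"
    by (rule Cauchy_Schwarz_nn_integral) auto
  also have "\<dots> = ennreal ((l2norm M f * l2norm M g)\<^sup>2)"
    using assms by (simp add: ennreal_power nn_integral_l2norm power_mult_distrib ennreal_mult)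
  finally have "(\<integral>x. norm (f x) * norm (g x) \<partial>M)\<^sup>2 \<le> (l2norm M f * l2norm M g)\<^sup>2"
    by (simp add: ennreal_power integral_nonneg_AE)
  then show "(\<integral>x. norm (f x) * norm (g x) \<partial>M) \<le> l2norm M f * l2norm M g"
    by (rule power2_le_imp_le) simp
qed

lemma sqint_inner:
  assumes "sqint M f" "sqint M g"
  shows "integrable M (\<lambda>x. f x \<bullet> g x)" and "\<bar>\<integral>x. f x \<bullet> g x \<partial>M\<bar> \<le> l2norm M f * l2norm M g"
proof -
  note [measurable] = sqint_measurable[OF assms(1)] sqint_measurable[OF assms(2)]
  show i: "integrable M (\<lambda>x. f x \<bullet> g x)"
    by (rule Bochner_Integration.integrable_bound[OF sqint_norm_mult(1)[OF assms]])
       (auto simp: Cauchy_Schwarz_ineq2)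
  have "\<bar>\<integral>x. f x \<bullet> g x \<partial>M\<bar> \<le> (\<integral>x. \<bar>f x \<bullet> g x\<bar> \<partial>M)"
    using integral_norm_bound[of M "\<lambda>x. f x \<bullet> g x"] by simp
  also have "\<dots> \<le> (\<integral>x. norm (f x) * norm (g x) \<partial>M)"
    using i by (intro integral_mono sqint_norm_mult[OF assms]) (auto simp: Cauchy_Schwarz_ineq2)
  also have "\<dots> \<le> l2norm M f * l2norm M g" by (rule sqint_norm_mult[OF assms])
  finally show "\<bar>\<integral>x. f x \<bullet> g x \<partial>M\<bar> \<le> l2norm M f * l2norm M g" .
qed

lemma sqint_cmult:
  fixes f g :: "'a \<Rightarrow> complex"
  assumes "sqint M f" "sqint M g"
  shows "integrable M (\<lambda>x. f x * g x)" and "cmod (\<integral>x. f x * g x \<partial>M) \<le> l2norm M f * l2norm M g"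
proof -
  note [measurable] = sqint_measurable[OF assms(1)] sqint_measurable[OF assms(2)]
  show i: "integrable M (\<lambda>x. f x * g x)"
    by (rule Bochner_Integration.integrable_bound[OF sqint_norm_mult(1)[OF assms]])
      (auto simp: norm_mult)
  have "cmod (\<integral>x. f x * g x \<partial>M) \<le> (\<integral>x. norm (f x) * norm (g x) \<partial>M)"
    using integral_norm_bound[of M "\<lambda>x. f x * g x"] by (simp add: norm_mult)
  also have "\<dots> \<le> l2norm M f * l2norm M g" by (rule sqint_norm_mult[OF assms])
  finally show "cmod (\<integral>x. f x * g x \<partial>M) \<le> l2norm M f * l2norm M g" .
qed

lemma sqint_scaleR:
  assumes "sqint M f"
  shows "sqint M (\<lambda>x. c *\<^sub>R f x)" "l2norm M (\<lambda>x. c *\<^sub>R f x) = \<bar>c\<bar> * l2norm M f"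
  using assms by (auto simp: sqint_def l2norm_def power_mult_distrib real_sqrt_mult)

lemma sqint_add:
  assumes "sqint M f" "sqint M g"
  shows "sqint M (\<lambda>x. f x + g x)" "l2norm M (\<lambda>x. f x + g x) \<le> l2norm M f + l2norm M g"
    "(l2norm M (\<lambda>x. f x + g x))\<^sup>2 = (l2norm M f)\<^sup>2 + 2 * (\<integral>x. f x \<bullet> g x \<partial>M) + (l2norm M g)\<^sup>2"
proof -
  note [measurable] = sqint_measurable[OF assms(1)] sqint_measurable[OF assms(2)]
  have eq: "(norm (f x + g x))\<^sup>2 = (norm (f x))\<^sup>2 + 2 * (f x \<bullet> g x) + (norm (g x))\<^sup>2" for x
    unfolding power2_norm_eq_inner by (simp add: inner_add_left inner_add_right inner_commute)
  show "sqint M (\<lambda>x. f x + g x)"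
    using assms sqint_inner(1)[OF assms] by (simp add: sqint_def eq)
  show *: "(l2norm M (\<lambda>x. f x + g x))\<^sup>2 = (l2norm M f)\<^sup>2 + 2 * (\<integral>x. f x \<bullet> g x \<partial>M) + (l2norm M g)\<^sup>2"
    using assms sqint_inner(1)[OF assms] by (simp add: l2norm_power2 eq sqint_def)
  have "(l2norm M (\<lambda>x. f x + g x))\<^sup>2 \<le> (l2norm M f + l2norm M g)\<^sup>2"
    unfolding * using sqint_inner(2)[OF assms] by (simp add: power2_sum)
  then show "l2norm M (\<lambda>x. f x + g x) \<le> l2norm M f + l2norm M g"
    by (rule power2_le_imp_le) simp
qed

lemma sqint_diff:
  assumes "sqint M f" "sqint M g"
  shows "sqint M (\<lambda>x. f x - g x)" "l2norm M (\<lambda>x. f x - g x) \<le> l2norm M f + l2norm M g"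
    "(l2norm M (\<lambda>x. f x - g x))\<^sup>2 = (l2norm M f)\<^sup>2 - 2 * (\<integral>x. f x \<bullet> g x \<partial>M) + (l2norm M g)\<^sup>2"
proof -
  note m = sqint_scaleR[OF assms(2), of "-1"]
  show "sqint M (\<lambda>x. f x - g x)" "l2norm M (\<lambda>x. f x - g x) \<le> l2norm M f + l2norm M g"
    using sqint_add(1,2)[OF assms(1) m(1)] m(2) by auto
  show "(l2norm M (\<lambda>x. f x - g x))\<^sup>2 = (l2norm M f)\<^sup>2 - 2 * (\<integral>x. f x \<bullet> g x \<partial>M) + (l2norm M g)\<^sup>2"
    using sqint_add(3)[OF assms(1) m(1)] m(2) by simp
qed

lemma l2norm_minus_commute: "l2norm M (\<lambda>x. f x - g x) = l2norm M (\<lambda>x. g x - f x)"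
  by (simp add: l2norm_def norm_minus_commute)

lemma sqint_nth:
  assumes "sqint M (K :: 'a \<Rightarrow> complex^'n)"
  shows "sqint M (\<lambda>x. K x $ i)" "l2norm M (\<lambda>x. K x $ i) \<le> l2norm M K"
proof -
  have [measurable]: "K \<in> borel_measurable M" using assms by (simp add: sqint_def)
  have m: "(\<lambda>x. K x $ i) \<in> borel_measurable M"
    by (rule borel_measurable_continuous_on[of "\<lambda>y. y $ i" K]) (auto intro: continuous_intros)
  have "cmod (K x $ i) \<le> norm (K x)" for x by (rule Finite_Cartesian_Product.norm_nth_le)
  from sqint_bound[of M K "\<lambda>x. K x $ i", OF assms m this]
  show "sqint M (\<lambda>x. K x $ i)" "l2norm M (\<lambda>x. K x $ i) \<le> l2norm M K" .
qed

section \<open>Completeness and weak sequential compactness of L2\<close>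

lemma ennreal_finite_ex: "x \<noteq> \<infinity> \<Longrightarrow> \<exists>S\<ge>0. x = ennreal S"
  by (cases x) auto

text \<open>Riesz--Fischer: along a subsequence with geometrically small increments the functions
  converge almost everywhere, and Fatou's lemma shows that the pointwise limit is also the norm
  limit.\<close>

theorem l2_complete:
  fixes f :: "nat \<Rightarrow> 'a \<Rightarrow> 'b::euclidean_space"
  assumes f: "\<And>n. sqint M (f n)"
    and Cauchy: "\<And>e. e > 0 \<Longrightarrow> \<exists>N. \<forall>m\<ge>N. \<forall>n\<ge>N. l2norm M (\<lambda>x. f m x - f n x) < e"
  shows "\<exists>g r. sqint M g \<and> (\<lambda>n. l2norm M (\<lambda>x. f n x - g x)) \<longlonglongrightarrow> 0 \<and> strict_mono (r::nat \<Rightarrow> nat) \<and>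
    (AE x in M. (\<lambda>n. f (r n) x) \<longlonglongrightarrow> g x)"
proof -
  have [measurable]: "f n \<in> borel_measurable M" for n using f by (simp add: sqint_def)
  \<comment> \<open>Squared increments are at most 8^-k, so they stay summable after multiplication
    by 4^k. Where the weighted sum is a finite S, the k-th increment is at most sqrt S times 2^-k,
    which is summable.\<close>
  have "\<exists>N. \<forall>m\<ge>N. \<forall>n\<ge>N. l2norm M (\<lambda>x. f m x - f n x) < sqrt ((1/8) ^ k)" for k
    by (rule Cauchy) simp
  then obtain N where N: "\<And>k m n. m \<ge> N k \<Longrightarrow> n \<ge> N k \<Longrightarrow> l2norm M (\<lambda>x. f m x - f n x)
    < sqrt ((1/8) ^ k)"
    by metis
  \<comment> \<open>The partial sums of N make \<open>r k \<ge> N k\<close>, and the summand k makes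
    r strictly increasing.\<close>
  define r where "r k = (\<Sum>i\<le>k. N i) + k" for k
  have r: "strict_mono r" by (simp add: strict_mono_Suc_iff r_def)
  have rN: "r k \<ge> N k" for k by (simp add: r_def lessThan_Suc_atMost[symmetric])
  define a where "a k x = norm (f (r (Suc k)) x - f (r k) x)" for k x
  have [measurable]: "a k \<in> borel_measurable M" for k unfolding a_def by measurable
  have ak: "(\<integral>\<^sup>+x. ennreal ((a k x)\<^sup>2) \<partial>M) \<le> ennreal ((1/8) ^ k)" for k
  proof -
    have "r (Suc k) \<ge> N k" using rN[of k] strict_monoD[OF r, of k "Suc k"] by simp
    then have "l2norm M (\<lambda>x. f (r (Suc k)) x - f (r k) x) \<le> sqrt ((1/8) ^ k)"
      using N[OF _ rN] by (simp add: less_imp_le)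
    then have "(l2norm M (\<lambda>x. f (r (Suc k)) x - f (r k) x))\<^sup>2 \<le> (1/8) ^ k"
      using power_mono[of "l2norm M (\<lambda>x. f (r (Suc k)) x - f (r k) x)" "sqrt ((1/8) ^ k)" 2] by simp
    then show ?thesis
      unfolding a_def nn_integral_l2norm[OF sqint_diff(1)[OF f f]] by (rule ennreal_leI)
  qed
  have "(\<integral>\<^sup>+x. (\<Sum>k. ennreal (4 ^ k * (a k x)\<^sup>2)) \<partial>M) = (\<Sum>k. (\<integral>\<^sup>+x. ennreal (4 ^ k * (a k x)\<^sup>2) \<partial>M))"
    by (rule nn_integral_suminf) simp
  also have "\<dots> \<le> (\<Sum>k. ennreal ((1/2) ^ k))"
  proof (rule suminf_le)
    fix k
    have "(\<integral>\<^sup>+x. ennreal (4 ^ k * (a k x)\<^sup>2) \<partial>M) = ennreal (4 ^ k) * (\<integral>\<^sup>+x. ennreal ((a k x)\<^sup>2) \<partial>M)"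
      by (subst nn_integral_cmult[symmetric]) (auto simp: ennreal_mult)
    also have "\<dots> \<le> ennreal (4 ^ k) * ennreal ((1/8) ^ k)" by (intro mult_left_mono ak) simp
    also have "\<dots> = ennreal ((1/2) ^ k)" by (simp flip: ennreal_mult power_mult_distrib)
    finally show "(\<integral>\<^sup>+x. ennreal (4 ^ k * (a k x)\<^sup>2) \<partial>M) \<le> ennreal ((1/2) ^ k)" .
  qed auto
  also have "\<dots> = ennreal (\<Sum>k. (1/2) ^ k)"
    by (rule suminf_ennreal2) (auto intro: summable_geometric)
  finally have fin: "(\<integral>\<^sup>+x. (\<Sum>k. ennreal (4 ^ k * (a k x)\<^sup>2)) \<partial>M) < \<infinity>"
    by (simp add: le_less_trans)
  have "AE x in M. (\<Sum>k. ennreal (4 ^ k * (a k x)\<^sup>2)) \<noteq> \<infinity>"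
    by (rule nn_integral_PInf_AE) (use fin in auto)
  then have conv: "AE x in M. convergent (\<lambda>k. f (r k) x)"
  proof eventually_elim
    fix x assume "(\<Sum>k. ennreal (4 ^ k * (a k x)\<^sup>2)) \<noteq> \<infinity>"
    then obtain S where S: "(\<Sum>k. ennreal (4 ^ k * (a k x)\<^sup>2)) = ennreal S" "S \<ge> 0"
      using ennreal_finite_ex by blast
    have le: "a k x \<le> sqrt S * (1/2) ^ k" for k
    proof -
      have "ennreal (4 ^ k * (a k x)\<^sup>2) \<le> ennreal S"
      proof -
        have "ennreal (4 ^ k * (a k x)\<^sup>2) = (\<Sum>k\<in>{k}. ennreal (4 ^ k * (a k x)\<^sup>2))" by simp
        also have "\<dots> \<le> (\<Sum>k. ennreal (4 ^ k * (a k x)\<^sup>2))" by (rule sum_le_suminf) auto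
        finally show ?thesis unfolding S(1) .
      qed
      then have "(a k x)\<^sup>2 \<le> S / 4 ^ k" using S by (simp add: field_simps)
      then have "a k x \<le> sqrt (S / 4 ^ k)" by (rule real_le_rsqrt)
      also have "sqrt (S / 4 ^ k) = sqrt S * (1/2) ^ k"
      proof -
        have "sqrt (4 ^ k) = (2::real) ^ k" by (simp add: real_sqrt_power)
        then show ?thesis by (simp add: real_sqrt_divide power_divide)
      qed
      finally show ?thesis .
    qed
    have "summable (\<lambda>k. a k x)"
      by (rule summable_comparison_test'[of "\<lambda>k. sqrt S * (1/2) ^ k"])
         (use le in \<open>auto intro!: summable_mult summable_geometric simp: a_def\<close>)
    then have "summable (\<lambda>k. f (r (Suc k)) x - f (r k) x)"
      unfolding a_def by (rule summable_norm_cancel)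
    then have "convergent (\<lambda>n. \<Sum>k<n. f (r (Suc k)) x - f (r k) x)"
      by (simp add: summable_iff_convergent)
    then have "convergent (\<lambda>n. f (r n) x - f (r 0) x)"
      by (simp add: sum_lessThan_telescope[of "\<lambda>k. f (r k) x"])
    then have "convergent (\<lambda>n. (f (r n) x - f (r 0) x) + f (r 0) x)"
      by (intro convergent_add convergent_const)
    then show "convergent (\<lambda>k. f (r k) x)" by simp
  qed
  define g where "g x = lim (\<lambda>k. f (r k) x)" for x
  have [measurable]: "g \<in> borel_measurable M" unfolding g_def
    by (rule borel_measurable_lim_metric) simp
  have lim: "AE x in M. (\<lambda>k. f (r k) x) \<longlonglongrightarrow> g x"
    using conv by eventually_elim (simp add: g_def convergent_LIMSEQ_iff)
  \<comment> \<open>Fatou's lemma in the second index of the Cauchy condition.\<close>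
  have est: "sqint M (\<lambda>x. f m x - g x) \<and> l2norm M (\<lambda>x. f m x - g x) \<le> e"
    if m: "\<forall>m\<ge>N. \<forall>n\<ge>N. l2norm M (\<lambda>x. f m x - f n x) < e" "m \<ge> N" "e > 0" for m N e
  proof -
    have "(\<integral>\<^sup>+x. ennreal ((norm (f m x - g x))\<^sup>2) \<partial>M)
      = (\<integral>\<^sup>+x. liminf (\<lambda>k. ennreal ((norm (f m x - f (r k) x))\<^sup>2)) \<partial>M)"
    proof (rule nn_integral_cong_AE)
      show "AE x in M. ennreal ((norm (f m x - g x))\<^sup>2)
        = liminf (\<lambda>k. ennreal ((norm (f m x - f (r k) x))\<^sup>2))"
        using lim
      proof eventually_elim
        fix x assume l: "(\<lambda>k. f (r k) x) \<longlonglongrightarrow> g x"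
        have "(\<lambda>k. ennreal ((norm (f m x - f (r k) x))\<^sup>2)) \<longlonglongrightarrow> ennreal ((norm (f m x - g x))\<^sup>2)"
          by (intro tendsto_ennrealI tendsto_intros l)
        then show "ennreal ((norm (f m x - g x))\<^sup>2)
          = liminf (\<lambda>k. ennreal ((norm (f m x - f (r k) x))\<^sup>2))"
          by (rule lim_imp_Liminf[OF sequentially_bot, symmetric])
      qed
    qed
    also have "\<dots> \<le> liminf (\<lambda>k. \<integral>\<^sup>+x. ennreal ((norm (f m x - f (r k) x))\<^sup>2) \<partial>M)"
      by (rule nn_integral_liminf) simp
    also have "\<dots> \<le> limsup (\<lambda>k. \<integral>\<^sup>+x. ennreal ((norm (f m x - f (r k) x))\<^sup>2) \<partial>M)"
      by (rule Liminf_le_Limsup) simp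
    also have "\<dots> \<le> ennreal (e\<^sup>2)"
    proof (rule Limsup_bounded)
      show "\<forall>\<^sub>F k in sequentially. (\<integral>\<^sup>+x. ennreal ((norm (f m x - f (r k) x))\<^sup>2) \<partial>M) \<le> ennreal (e\<^sup>2)"
        unfolding nn_integral_l2norm[OF sqint_diff(1)[OF f f]]
      proof (rule eventually_sequentiallyI[of N])
        fix k assume "N \<le> k"
        then have "r k \<ge> N" using strict_mono_imp_increasing[OF r, of k] by simp
        then have "l2norm M (\<lambda>x. f m x - f (r k) x) \<le> e" using m by (simp add: less_imp_le)
        then show "ennreal ((l2norm M (\<lambda>x. f m x - f (r k) x))\<^sup>2) \<le> ennreal (e\<^sup>2)"
          by (intro ennreal_leI power_mono) auto
      qed
    qed
    finally show ?thesis
      using m(3) by (intro conjI sqint_of_nn_integral) auto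
  qed
  have "sqint M g"
  proof -
    obtain N0 where "\<forall>m\<ge>N0. \<forall>n\<ge>N0. l2norm M (\<lambda>x. f m x - f n x) < 1" using Cauchy[of 1] by auto
    then have "sqint M (\<lambda>x. f N0 x - g x)" using est[of N0 1 N0] by simp
    from sqint_diff(1)[OF f this, of N0] show ?thesis by simp
  qed
  moreover have "(\<lambda>n. l2norm M (\<lambda>x. f n x - g x)) \<longlonglongrightarrow> 0"
  proof (rule LIMSEQ_I)
    fix e :: real assume "e > 0"
    then obtain N0 where "\<forall>m\<ge>N0. \<forall>n\<ge>N0. l2norm M (\<lambda>x. f m x - f n x) < e/2" using Cauchy[of "e/2"]
      by auto
    then have "\<forall>n\<ge>N0. l2norm M (\<lambda>x. f n x - g x) \<le> e/2" using est[of N0 "e/2"] \<open>e > 0\<close> by simp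
    then show "\<exists>N0. \<forall>n\<ge>N0. norm (l2norm M (\<lambda>x. f n x - g x) - 0) < e"
      using \<open>e > 0\<close> by (intro exI[of _ N0]) force
  qed
  ultimately show ?thesis using r lim by blast
qed

text \<open>
  Weak limits are obtained without a representation theorem: by the parallelogram law, elements of
  nearly minimal norm in the midpoint hulls of the tails form a Cauchy sequence.
\<close>

inductive midhull :: "(nat \<Rightarrow> 'a \<Rightarrow> 'b::real_vector) \<Rightarrow> nat \<Rightarrow> ('a \<Rightarrow> 'b) \<Rightarrow> bool" for f m where
  base: "m \<le> n \<Longrightarrow> midhull f m (f n)"
| mid: "midhull f m u \<Longrightarrow> midhull f m v \<Longrightarrow> midhull f m (\<lambda>x. (1/2) *\<^sub>R (u x + v x))"

lemma midhull_mono: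
  assumes "midhull f n u" "m \<le> n"
  shows "midhull f m u"
  using assms(1) by induction (use assms(2) in \<open>auto intro: midhull.intros\<close>)

lemma midhull_l2norm:
  assumes "midhull f m u" "\<And>n. sqint M (f n)" "\<And>n. l2norm M (f n) \<le> B"
  shows "sqint M u \<and> l2norm M u \<le> B"
  using assms(1)
proof induction
  case (mid u v)
  then have s: "sqint M (\<lambda>x. u x + v x)" "l2norm M (\<lambda>x. u x + v x) \<le> 2 * B"
    using sqint_add[of M u v] by auto
  then show ?case using sqint_scaleR[OF s(1), of "1/2"] by auto
qed (use assms in auto)

lemma midhull_inner:
  assumes "midhull f m u" "\<And>n. sqint M (f n)" "sqint M g"
    and "\<And>n. n \<ge> m \<Longrightarrow> \<bar>(\<integral>x. f n x \<bullet> g x \<partial>M) - L\<bar> \<le> e"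
  shows "\<bar>(\<integral>x. u x \<bullet> g x \<partial>M) - L\<bar> \<le> e \<and> sqint M u"
  using assms(1)
proof induction
  case (mid u v)
  then have i: "integrable M (\<lambda>x. u x \<bullet> g x)" "integrable M (\<lambda>x. v x \<bullet> g x)"
    and s: "sqint M (\<lambda>x. u x + v x)"
    using sqint_inner(1) assms(3) sqint_add(1) by blast+
  have "(\<integral>x. ((1/2) *\<^sub>R (u x + v x)) \<bullet> g x \<partial>M) = (1/2) * ((\<integral>x. u x \<bullet> g x \<partial>M) + (\<integral>x. v x \<bullet> g x \<partial>M))"
    using i by (simp add: inner_add_left)
  then have "\<bar>(\<integral>x. ((1/2) *\<^sub>R (u x + v x)) \<bullet> g x \<partial>M) - L\<bar> \<le> e"
    using mid.IH by (auto simp: abs_le_iff field_simps)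
  then show ?case using sqint_scaleR(1)[OF s] by blast
qed (use assms in auto)

text \<open>A diagonal subsequence reaches only countably many test functions, here the \<phi> k and
  the f k. Testing with the limit g is possible as well, because g is a norm limit of midpoints of
  the sequence; \<open>l2_weak_compact\<close> relies on that last clause.\<close>

theorem l2_weak_limit:
  fixes f \<phi> :: "nat \<Rightarrow> 'a \<Rightarrow> 'b::euclidean_space"
  assumes f: "\<And>n. sqint M (f n)" and B: "\<And>n. l2norm M (f n) \<le> B" and \<phi>: "\<And>k. sqint M (\<phi> k)"
  shows "\<exists>r g. strict_mono (r::nat \<Rightarrow> nat) \<and> sqint M g \<and>
    (\<forall>k. (\<lambda>n. \<integral>x. f (r n) x \<bullet> \<phi> k x \<partial>M) \<longlonglongrightarrow> (\<integral>x. g x \<bullet> \<phi> k x \<partial>M)) \<and>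
    (\<lambda>n. \<integral>x. f (r n) x \<bullet> g x \<partial>M) \<longlonglongrightarrow> (\<integral>x. g x \<bullet> g x \<partial>M)"
proof -
  \<comment> \<open>Even indices carry \<phi> and odd ones f, so that the pairings also converge
    against every element of the midpoint hulls.\<close>
  define \<psi> where "\<psi> k = (if even k then \<phi> (k div 2) else f (k div 2))" for k
  have \<psi>: "sqint M (\<psi> k)" for k using f \<phi> by (simp add: \<psi>_def)
  have B0: "B \<ge> 0" using order_trans[OF l2norm_nonneg B] .
  interpret S: subseqs "\<lambda>k s. convergent (\<lambda>n. \<integral>x. f (s n) x \<bullet> \<psi> k x \<partial>M)"
  proof
    fix k and s :: "nat \<Rightarrow> nat" assume "strict_mono s"
    have "bounded (range (\<lambda>n. \<integral>x. f (s n) x \<bullet> \<psi> k x \<partial>M))"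
    proof (rule boundedI[of _ "B * l2norm M (\<psi> k)"])
      fix y assume "y \<in> range (\<lambda>n. \<integral>x. f (s n) x \<bullet> \<psi> k x \<partial>M)"
      then obtain n where y: "y = (\<integral>x. f (s n) x \<bullet> \<psi> k x \<partial>M)" by blast
      have "\<bar>y\<bar> \<le> l2norm M (f (s n)) * l2norm M (\<psi> k)" unfolding y by (rule sqint_inner(2)[OF f \<psi>])
      also have "\<dots> \<le> B * l2norm M (\<psi> k)" by (intro mult_right_mono B) simp
      finally show "norm y \<le> B * l2norm M (\<psi> k)" by simp
    qed
    from bounded_imp_convergent_subsequence[OF this]
    show "\<exists>r'. strict_mono r' \<and> convergent (\<lambda>n. \<integral>x. f ((s \<circ> r') n) x \<bullet> \<psi> k x \<partial>M)"
      by (auto simp: convergent_def o_def)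
  qed
  define r where "r = S.diagseq"
  have r: "strict_mono r" unfolding r_def by (rule S.subseq_diagseq)
  have "convergent (\<lambda>n. \<integral>x. f (r n) x \<bullet> \<psi> k x \<partial>M)" for k
  proof -
    have "convergent (\<lambda>n. \<integral>x. f ((S.diagseq \<circ> ((+) (Suc k))) n) x \<bullet> \<psi> k x \<partial>M)"
    proof (rule S.diagseq_holds)
      fix s r :: "nat \<Rightarrow> nat" and n :: nat
      assume "strict_mono r" "convergent (\<lambda>i. \<integral>x. f (s i) x \<bullet> \<psi> n x \<partial>M)"
      then show "convergent (\<lambda>i. \<integral>x. f ((s \<circ> r) i) x \<bullet> \<psi> n x \<partial>M)"
        using convergent_subseq_convergent[of "\<lambda>i. \<integral>x. f (s i) x \<bullet> \<psi> n x \<partial>M" r] by (simp add: o_def)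
    qed
    then have "convergent (\<lambda>n. \<integral>x. f (r (n + Suc k)) x \<bullet> \<psi> k x \<partial>M)"
      by (simp add: o_def r_def add.commute)
    then show ?thesis
      by (subst (asm) convergent_ignore_initial_segment)
  qed
  then obtain L where L: "\<And>k. (\<lambda>n. \<integral>x. f (r n) x \<bullet> \<psi> k x \<partial>M) \<longlonglongrightarrow> L k"
    unfolding convergent_def by metis
  let ?F = "\<lambda>n. f (r n)"
  have hull: "sqint M u \<and> l2norm M u \<le> B" if "midhull ?F m u" for m u
    by (rule midhull_l2norm[OF that]) (use f B in auto)
  \<comment> \<open>Least squared norm in the midpoint hull of the m-th tail. The hulls shrink with
    m, so I increases, and it is bounded by the square of B.\<close>
  define I where "I m = Inf {(l2norm M u)\<^sup>2 | u. midhull ?F m u}" for m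
  have bdd: "bdd_below {(l2norm M u)\<^sup>2 | u. midhull ?F m u}" for m
    by (rule bdd_belowI[of _ 0]) auto
  have ne: "{(l2norm M u)\<^sup>2 | u. midhull ?F m u} \<noteq> {}" for m using midhull.base[of m m ?F] by auto
  have I_le: "I m \<le> (l2norm M u)\<^sup>2" if "midhull ?F m u" for m u
    unfolding I_def by (rule cInf_lower[OF _ bdd]) (use that in auto)
  have I_mono: "incseq I"
  proof (rule incseq_SucI)
    fix m
    show "I m \<le> I (Suc m)"
      unfolding I_def
    proof (rule cInf_superset_mono[OF ne bdd], rule subsetI)
      fix y assume "y \<in> {(l2norm M u)\<^sup>2 | u. midhull ?F (Suc m) u}"
      then obtain u where u: "y = (l2norm M u)\<^sup>2" "midhull ?F (Suc m) u" by blast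
      then show "y \<in> {(l2norm M u)\<^sup>2 | u. midhull ?F m u}" using midhull_mono[OF u(2), of m] by auto
    qed
  qed
  have I_bdd: "I m \<le> B\<^sup>2" for m
    using I_le[OF midhull.base[of m m ?F]] power_mono[OF B l2norm_nonneg, of "r m" 2] by simp
  have "\<exists>I0. I \<longlonglongrightarrow> I0" using incseq_convergent[OF I_mono, of "B\<^sup>2"] I_bdd by blast
  then obtain I0 where I0: "I \<longlonglongrightarrow> I0" by blast
  have "\<exists>v. midhull ?F m v \<and> (l2norm M v)\<^sup>2 < I m + 1 / real (Suc m)" for m
  proof -
    have "\<exists>y\<in>{(l2norm M u)\<^sup>2 | u. midhull ?F m u}. y < I m + 1 / real (Suc m)"
      unfolding I_def by (rule cInf_lessD[OF ne]) simp
    then show ?thesis by blast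
  qed
  then obtain v where v: "\<And>m. midhull ?F m (v m)" "\<And>m. (l2norm M (v m))\<^sup>2 < I m + 1 / real (Suc m)"
    by metis
  have vs: "sqint M (v m)" for m using hull[OF v(1)] by blast
  \<comment> \<open>The midpoint of \<open>v m\<close> and \<open>v n\<close> lies in the hull of
    the m-th tail, so its squared norm is at least \<open>I m\<close>; the parallelogram law turns
    this into a bound for the difference.\<close>
  have par: "(l2norm M (\<lambda>x. v m x - v n x))\<^sup>2 \<le> 2 * (I n - I m) + 4 * (1 / real (Suc m))"
    if mn: "m \<le> n" for m n
  proof -
    have "midhull ?F m (\<lambda>x. (1/2) *\<^sub>R (v m x + v n x))"
      by (intro midhull.mid v(1) midhull_mono[OF v(1) mn])
    from I_le[OF this] have "4 * I m \<le> (l2norm M (\<lambda>x. v m x + v n x))\<^sup>2"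
      using sqint_scaleR(2)[OF sqint_add(1)[OF vs vs], of "1/2" m n] by (simp add: power_divide)
    moreover have "(l2norm M (\<lambda>x. v m x - v n x))\<^sup>2 + (l2norm M (\<lambda>x. v m x + v n x))\<^sup>2
      = 2 * (l2norm M (v m))\<^sup>2 + 2 * (l2norm M (v n))\<^sup>2"
      by (simp add: sqint_add(3)[OF vs vs] sqint_diff(3)[OF vs vs])
    moreover have "1 / real (Suc n) \<le> 1 / real (Suc m)" using mn by (simp add: frac_le)
    moreover have "A \<le> 2 * (b - a) + 4 * \<epsilon>"
      if "4 * a \<le> S" "A + S = 2 * p + 2 * q" "\<epsilon>' \<le> \<epsilon>" "p < a + \<epsilon>" "q < b + \<epsilon>'"
        for A S a b p q \<epsilon> \<epsilon>' :: real
      using that by argo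
    ultimately show ?thesis using v(2)[of m] v(2)[of n] by blast
  qed
  have "\<exists>N. \<forall>m\<ge>N. \<forall>n\<ge>N. l2norm M (\<lambda>x. v m x - v n x) < e" if e: "e > 0" for e
  proof -
    have "(\<lambda>m. 2 * (I0 - I m) + 4 * (1 / real (Suc m))) \<longlonglongrightarrow> 2 * (I0 - I0) + 4 * 0"
      by (intro tendsto_intros I0 LIMSEQ_Suc[OF lim_const_over_n])
    then have "\<forall>\<^sub>F m in sequentially. 2 * (I0 - I m) + 4 * (1 / real (Suc m)) < e\<^sup>2"
      by (rule order_tendstoD) (use e in auto)
    then obtain N where N: "\<And>m. m \<ge> N \<Longrightarrow> 2 * (I0 - I m) + 4 * (1 / real (Suc m)) < e\<^sup>2"
      by (auto simp: eventually_sequentially)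
    have *: "l2norm M (\<lambda>x. v m x - v n x) < e" if "m \<ge> N" "m \<le> n" for m n
    proof -
      have "I n \<le> I0" by (rule incseq_le[OF I_mono I0])
      then have "(l2norm M (\<lambda>x. v m x - v n x))\<^sup>2 < e\<^sup>2" using par[OF that(2)] N[OF that(1)] by argo
      then show ?thesis using e by (simp add: power2_less_imp_less)
    qed
    have "l2norm M (\<lambda>x. v m x - v n x) < e" if "m \<ge> N" "n \<ge> N" for m n
      using *[of m n] *[of n m] that l2norm_minus_commute[of M "v m" "v n"] by (cases "m \<le> n") auto
    then show ?thesis by blast
  qed
  from l2_complete[OF vs this] obtain g where g: "sqint M g"
    and vg: "(\<lambda>n. l2norm M (\<lambda>x. v n x - g x)) \<longlonglongrightarrow> 0"
    by blast
  have lim_inner: "(\<lambda>m. \<integral>x. v m x \<bullet> h x \<partial>M) \<longlonglongrightarrow> (\<integral>x. g x \<bullet> h x \<partial>M)" if h: "sqint M h" for h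
  proof (rule Lim_null[THEN iffD2], rule Lim_null_comparison)
    have "norm ((\<integral>x. v m x \<bullet> h x \<partial>M) - (\<integral>x. g x \<bullet> h x \<partial>M)) \<le> l2norm M (\<lambda>x. v m x - g x)
      * l2norm M h" for m
      using sqint_inner(2)[OF sqint_diff(1)[OF vs g] h, of m] sqint_inner(1)[OF vs h]
        sqint_inner(1)[OF g h]
      by (simp add: inner_diff_left)
    then show "\<forall>\<^sub>F m in sequentially. norm ((\<integral>x. v m x \<bullet> h x \<partial>M) - (\<integral>x. g x \<bullet> h x \<partial>M))
      \<le> l2norm M (\<lambda>x. v m x - g x) * l2norm M h"
      by simp
    show "(\<lambda>m. l2norm M (\<lambda>x. v m x - g x) * l2norm M h) \<longlonglongrightarrow> 0"
      using tendsto_mult_left_zero[OF vg] .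
  qed
  \<comment> \<open>Pairings within e of \<open>L k\<close> form a condition stable under midpoints,
    so it passes from a tail of the sequence to \<open>v m\<close> and then to the norm limit
    g.\<close>
  have Lg: "L k = (\<integral>x. g x \<bullet> \<psi> k x \<partial>M)" for k
  proof (rule LIMSEQ_unique[OF _ lim_inner[OF \<psi>]])
    show "(\<lambda>m. \<integral>x. v m x \<bullet> \<psi> k x \<partial>M) \<longlonglongrightarrow> L k"
    proof (rule LIMSEQ_I)
      fix e :: real assume e: "e > 0"
      obtain N where N: "\<And>n. n \<ge> N \<Longrightarrow> \<bar>(\<integral>x. f (r n) x \<bullet> \<psi> k x \<partial>M) - L k\<bar> < e/2"
        using LIMSEQ_D[OF L, of "e/2" k] e by auto
      have "\<bar>(\<integral>x. v m x \<bullet> \<psi> k x \<partial>M) - L k\<bar> \<le> e/2" if "m \<ge> N" for m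
      proof -
        have "\<bar>(\<integral>x. f (r n) x \<bullet> \<psi> k x \<partial>M) - L k\<bar> \<le> e/2" if "n \<ge> m" for n
          using N[of n] \<open>m \<ge> N\<close> that by simp
        from midhull_inner[OF v(1)[of m] f \<psi> this] show ?thesis by blast
      qed
      then show "\<exists>N. \<forall>m\<ge>N. norm ((\<integral>x. v m x \<bullet> \<psi> k x \<partial>M) - L k) < e"
        using e by (intro exI[of _ N]) force
    qed
  qed
  have weak: "(\<lambda>n. \<integral>x. f (r n) x \<bullet> \<psi> k x \<partial>M) \<longlonglongrightarrow> (\<integral>x. g x \<bullet> \<psi> k x \<partial>M)" for k
    using L[of k] unfolding Lg .
  have weak_hull: "(\<lambda>n. \<integral>x. f (r n) x \<bullet> u x \<partial>M) \<longlonglongrightarrow> (\<integral>x. g x \<bullet> u x \<partial>M)" if "midhull ?F 0 u" for u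
    using that
  proof induction
    case (base n)
    then show ?case using weak[of "2 * r n + 1"] by (simp add: \<psi>_def)
  next
    case (mid u w)
    then have s: "sqint M u" "sqint M w" using hull by blast+
    have i: "(\<integral>x. h x \<bullet> ((1/2) *\<^sub>R (u x + w x)) \<partial>M)
      = (1/2) * ((\<integral>x. h x \<bullet> u x \<partial>M) + (\<integral>x. h x \<bullet> w x \<partial>M))"
      if "sqint M h" for h
      using sqint_inner(1)[OF that s(1)] sqint_inner(1)[OF that s(2)] by (simp add: inner_add_right)
    show ?case unfolding i[OF f] i[OF g] by (intro tendsto_intros mid.IH)
  qed
  have "(\<lambda>n. \<integral>x. f (r n) x \<bullet> g x \<partial>M) \<longlonglongrightarrow> (\<integral>x. g x \<bullet> g x \<partial>M)"
  proof (rule LIMSEQ_I)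
    fix e :: real assume e: "e > 0"
    \<comment> \<open>A common bound for the norms of \<open>f (r n)\<close> and of g; the summand 1
      makes it positive, as it is divided by.\<close>
    define K where "K = B + l2norm M g + 1"
    have K: "K > 0" using B0 by (simp add: K_def add_nonneg_pos)
    obtain m where m: "l2norm M (\<lambda>x. v m x - g x) < e / (3 * K)"
      using LIMSEQ_D[OF vg, of "e / (3 * K)"] e K by auto
    have near: "\<bar>(\<integral>x. h x \<bullet> g x \<partial>M) - (\<integral>x. h x \<bullet> v m x \<partial>M)\<bar> \<le> e/3"
      if h: "sqint M h" "l2norm M h \<le> K" for h
    proof -
      have "\<bar>(\<integral>x. h x \<bullet> g x \<partial>M) - (\<integral>x. h x \<bullet> v m x \<partial>M)\<bar> \<le> l2norm M h * l2norm M (\<lambda>x. g x - v m x)"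
        using sqint_inner(2)[OF h(1) sqint_diff(1)[OF g vs], of m] sqint_inner(1)[OF h(1) vs]
          sqint_inner(1)[OF h(1) g]
        by (simp add: inner_diff_right)
      also have "\<dots> \<le> K * (e / (3 * K))"
        using m h(2) K by (intro mult_mono) (auto simp: l2norm_minus_commute[of M g])
      finally show ?thesis using K by simp
    qed
    have "midhull ?F 0 (v m)" by (rule midhull_mono[OF v(1)]) simp
    from LIMSEQ_D[OF weak_hull[OF this], of "e/3"] e
    obtain N where N: "\<And>n. n \<ge> N \<Longrightarrow> \<bar>(\<integral>x. f (r n) x \<bullet> v m x \<partial>M) - (\<integral>x. g x \<bullet> v m x \<partial>M)\<bar> < e/3"
      by auto
    have "norm ((\<integral>x. f (r n) x \<bullet> g x \<partial>M) - (\<integral>x. g x \<bullet> g x \<partial>M)) < e" if "n \<ge> N" for n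
    proof -
      have "l2norm M (f (r n)) \<le> K" "l2norm M g \<le> K" using B[of "r n"] B0
        by (auto simp: K_def add_increasing add_increasing2)
      then show ?thesis
        using near[OF f, of "r n"] near[OF g] N[OF that] unfolding real_norm_def by linarith
    qed
    then show "\<exists>N. \<forall>n\<ge>N. norm ((\<integral>x. f (r n) x \<bullet> g x \<partial>M) - (\<integral>x. g x \<bullet> g x \<partial>M)) < e" by blast
  qed
  moreover have "(\<lambda>n. \<integral>x. f (r n) x \<bullet> \<phi> k x \<partial>M) \<longlonglongrightarrow> (\<integral>x. g x \<bullet> \<phi> k x \<partial>M)" for k
    using weak[of "2 * k"] by (simp add: \<psi>_def)
  ultimately show ?thesis using r g by blast
qed

section \<open>Local integrability of negative powers of the norm\<close>

lemma integrable_powr_Icc: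
  assumes "\<alpha> < 1" "0 \<le> N"
  shows "integrable lborel (\<lambda>x::real. indicator {-N..N} x * \<bar>x\<bar> powr (- \<alpha>))"
proof -
  let ?f = "\<lambda>x::real. indicator {0..N} x *\<^sub>R (x powr (- \<alpha>))"
  have "(\<lambda>x::real. x powr (- \<alpha>)) absolutely_integrable_on {0..N}"
    using assms by (intro nonnegative_absolutely_integrable_1 integrable_on_powr_from_0) auto
  then have f: "integrable lborel ?f"
    by (simp add: set_integrable_def integrable_completion)
  have "integrable lborel (\<lambda>x. ?f (0 + (-1) *\<^sub>R x))"
    by (rule integrable_lborel_affine[OF f]) simp
  from Bochner_Integration.integrable_add[OF f this]
  show ?thesis
    by (rule Bochner_Integration.integrable_cong[THEN iffD1, rotated -1])
      (auto simp: indicator_def abs_if)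
qed

lemma AE_hyperplane:
  fixes a :: "'a::euclidean_space"
  assumes "a \<noteq> 0"
  shows "AE x in lborel. a \<bullet> x \<noteq> b"
proof -
  have "closed {x. a \<bullet> x = b}" by (rule closed_hyperplane)
  then have "{x. a \<bullet> x = b} \<in> null_sets lborel"
    using negligible_hyperplane[of a b] assms
    by (simp add: negligible_iff_null_sets null_sets_completion_iff borel_closed)
  from AE_not_in[OF this] show ?thesis by simp
qed

lemma AE_nonzero: "AE x in lborel. (x::'a::euclidean_space) \<noteq> 0"
proof -
  have "AE x in lborel. (SOME b. b \<in> Basis) \<bullet> (x::'a) \<noteq> 0"
    by (rule AE_hyperplane) (metis SOME_Basis nonzero_Basis)
  then show ?thesis by eventually_elim auto
qed

text \<open>Instead of polar coordinates: the norm dominates every coordinate, so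
  |\<xi>|^(-\<alpha>) is at most the product of the d factors |\<xi> \<bullet> b|^(-\<alpha>/d), and
  each exponent \<alpha>/d is below 1. The ball lies in the corresponding cube.\<close>

lemma integrable_norm_powr_ball:
  assumes \<alpha>: "0 \<le> \<alpha>" "\<alpha> < real DIM('a)" and N: "0 \<le> N"
  shows "integrable lborel (\<lambda>\<xi>::'a::euclidean_space. indicator (ball 0 N) \<xi> * norm \<xi> powr (- \<alpha>))"
proof -
  let ?d = "real DIM('a)"
  let ?P = "\<lambda>\<xi>::'a. \<Prod>b\<in>Basis. indicator {-N..N} (\<xi> \<bullet> b) * \<bar>\<xi> \<bullet> b\<bar> powr (- (\<alpha> / ?d))"
  have i: "integrable lborel ?P"
    by (rule lborel_prod_integrable(1)[of "\<lambda>b x. indicator {-N..N} x * \<bar>x\<bar> powr (- (\<alpha> / ?d))"], rule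
      integrable_powr_Icc)
       (use \<alpha> N in \<open>auto simp: divide_less_eq\<close>)
  have "AE \<xi> in lborel. \<forall>b\<in>Basis. b \<bullet> (\<xi>::'a) \<noteq> 0"
    by (subst AE_finite_all) (auto intro!: AE_hyperplane)
  then have ae: "AE \<xi> in lborel. norm (indicator (ball 0 N) \<xi> * norm \<xi> powr (- \<alpha>)) \<le> norm (?P \<xi>)"
  proof eventually_elim
    fix \<xi> :: 'a assume nz: "\<forall>b\<in>Basis. b \<bullet> \<xi> \<noteq> 0"
    have P0: "?P \<xi> \<ge> 0" by (intro prod_nonneg) auto
    show "norm (indicator (ball 0 N) \<xi> * norm \<xi> powr (- \<alpha>)) \<le> norm (?P \<xi>)"
    proof (cases "\<xi> \<in> ball 0 N")
      case True
      have "\<xi> \<noteq> 0" using nz SOME_Basis by force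
      then have "norm \<xi> powr (- \<alpha>) = (norm \<xi> powr (- (\<alpha> / ?d))) ^ DIM('a)"
        by (simp add: powr_realpow[symmetric] powr_powr)
      also have "\<dots> = (\<Prod>b\<in>(Basis::'a set). norm \<xi> powr (- (\<alpha> / ?d)))" by simp
      also have "\<dots> \<le> ?P \<xi>"
      proof (rule prod_mono, intro conjI)
        fix b :: 'a assume b: "b \<in> Basis"
        have n: "\<bar>\<xi> \<bullet> b\<bar> \<le> norm \<xi>" using Basis_le_norm[OF b] .
        have "norm \<xi> powr (- (\<alpha> / ?d)) \<le> \<bar>\<xi> \<bullet> b\<bar> powr (- (\<alpha> / ?d))"
          using nz b n \<alpha> by (intro powr_mono2') (auto simp: inner_commute)
        moreover have "\<xi> \<bullet> b \<in> {-N..N}" using n True by auto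
        ultimately show "norm \<xi> powr (- (\<alpha> / ?d)) \<le> indicator {-N..N} (\<xi> \<bullet> b)
          * \<bar>\<xi> \<bullet> b\<bar> powr (- (\<alpha> / ?d))" by simp
      qed simp
      finally show ?thesis using True P0 by simp
    qed (use P0 in simp)
  qed
  have [measurable]: "ball (0::'a) N \<in> sets borel" by simp
  show ?thesis
    by (rule Bochner_Integration.integrable_bound[OF i _ ae]) measurable
qed

lemma sqrt_powr: "(x powr s)\<^sup>2 = (x::real) powr (2 * s)"
  by (simp add: power2_eq_square flip: powr_add)

text \<open>At the origin \<open>powr\<close> returns 0 for every exponent, including 0, so opposite
  weights cancel only for \<xi> \<noteq> 0, that is, almost everywhere.\<close>

definition weight :: "real \<Rightarrow> 'a::euclidean_space \<Rightarrow> complex"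
  where "weight s \<xi> = complex_of_real (norm \<xi> powr s)"

lemma weight_measurable [measurable]: "weight s \<in> borel_measurable borel"
  unfolding weight_def by measurable

lemma norm_weight [simp]: "cmod (weight s \<xi>) = norm \<xi> powr s"
  by (simp add: weight_def)

lemma weight_mult: "weight s \<xi> * weight t \<xi> = weight (s + t) \<xi>"
  by (simp add: weight_def powr_add)

lemma weight_0: "\<xi> \<noteq> 0 \<Longrightarrow> weight 0 \<xi> = 1"
  by (simp add: weight_def)

lemma weight_cancel: "\<xi> \<noteq> 0 \<Longrightarrow> weight (- s) \<xi> * (weight s \<xi> * z) = z"
  by (simp add: mult.assoc[symmetric] weight_mult weight_0)

section \<open>Fourier transforms of Schwartz functions\<close>

definition fourier_const :: "'a::euclidean_space itself \<Rightarrow> real"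
  where "fourier_const _ = (2 * pi) powr (- (real DIM('a) / 2))"

lemma fourier_const_pos: "fourier_const TYPE('a::euclidean_space) > 0"
    by (simp add: fourier_const_def)

lemma fourier_const_power2: "(fourier_const TYPE('a::euclidean_space))\<^sup>2 * (2 * pi) ^ DIM('a) = 1"
proof -
  have "(fourier_const TYPE('a))\<^sup>2 = (2 * pi) powr (- real DIM('a))"
    by (simp add: fourier_const_def sqrt_powr)
  moreover have "(2 * pi) ^ DIM('a) = (2 * pi) powr (real DIM('a))" by (simp add: powr_realpow)
  ultimately show ?thesis by (simp flip: powr_add)
qed

lemma inv_fourier_FT: "inv_fourier \<phi> \<xi> = complex_of_real (fourier_const TYPE('a))
    * FT \<phi> (\<xi>::'a::euclidean_space)"
  by (simp add: inv_fourier_def FT_def fourier_const_def inner_commute)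

lemma inv_fourier_measurable:
  "\<phi> \<in> schwartz \<Longrightarrow> inv_fourier \<phi> \<in> borel_measurable borel"
  unfolding inv_fourier_FT[abs_def] using FT_measurable[OF schwartz_integrable(1)[of \<phi>]] by simp

lemma inv_fourier_bound:
  fixes \<phi> :: "'a::euclidean_space \<Rightarrow> complex"
  assumes "\<phi> \<in> schwartz"
  shows "\<exists>B. \<forall>\<xi>. cmod (inv_fourier \<phi> \<xi>) \<le> B"
  using mult_left_mono[OF FT_bound[OF schwartz_integrable(1)[OF assms]], of
    "\<bar>fourier_const TYPE('a)\<bar>"]
  by (auto simp: inv_fourier_FT norm_mult)

text \<open>In the unitary normalisation the constant of \<open>bessel\<close> becomes 1.\<close>

lemma sqint_scaled_FT:
  fixes k :: "'a::euclidean_space \<Rightarrow> complex"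
  assumes k: "integrable lborel k" "sqint lborel k"
  shows "sqint lborel (\<lambda>x. complex_of_real (fourier_const TYPE('a)) * FT k x)"
    and "l2norm lborel (\<lambda>x. complex_of_real (fourier_const TYPE('a)) * FT k x) \<le> l2norm lborel k"
proof -
  let ?c = "fourier_const TYPE('a)"
  have [measurable]: "FT k \<in> borel_measurable borel" by (rule FT_measurable[OF k(1)])
  have "(\<integral>\<^sup>+x. ennreal ((cmod (complex_of_real ?c * FT k x))\<^sup>2) \<partial>lborel)
    = ennreal (?c\<^sup>2) * (\<integral>\<^sup>+x. ennreal ((cmod (FT k x))\<^sup>2) \<partial>lborel)"
    by (subst nn_integral_cmult[symmetric]) (auto simp: norm_mult power_mult_distrib ennreal_mult)
  also have "\<dots> \<le> ennreal (?c\<^sup>2) * ennreal ((2 * pi) ^ DIM('a) * (\<integral>x. (cmod (k x))\<^sup>2 \<partial>lborel))"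
    by (intro mult_left_mono bessel k sqint_integrable) simp
  also have "\<dots> = ennreal ((?c\<^sup>2 * (2 * pi) ^ DIM('a)) * (l2norm lborel k)\<^sup>2)"
    by (subst ennreal_mult[symmetric]) (auto simp: l2norm_power2 mult.assoc)
  finally have "(\<integral>\<^sup>+x. ennreal ((cmod (complex_of_real ?c * FT k x))\<^sup>2) \<partial>lborel)
    \<le> ennreal ((l2norm lborel k)\<^sup>2)"
    unfolding fourier_const_power2 by simp
  from sqint_of_nn_integral[OF _ this]
  show "sqint lborel (\<lambda>x. complex_of_real ?c * FT k x)"
    "l2norm lborel (\<lambda>x. complex_of_real ?c * FT k x) \<le> l2norm lborel k" by simp_all
qed

lemma schwartz_sqint: "\<phi> \<in> schwartz \<Longrightarrow> sqint lborel \<phi>"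
  using schwartz_integrable[of \<phi>] schwartz_measurable[of \<phi>] by (simp add: sqint_def)

lemma inv_fourier_sqint:
  assumes "\<phi> \<in> schwartz"
  shows "sqint lborel (inv_fourier \<phi>)"
  using sqint_scaled_FT(1)[OF schwartz_integrable(1)[OF assms] schwartz_sqint[OF assms]]
  by (simp add: inv_fourier_FT[abs_def])

lemma inv_fourier_diff:
  assumes "\<phi> \<in> schwartz" "\<psi> \<in> schwartz"
  shows "inv_fourier (\<lambda>x. \<phi> x - \<psi> x) \<xi> = inv_fourier \<phi> \<xi> - inv_fourier \<psi> \<xi>"
  using integrable_cis_mult[OF schwartz_integrable(1)[OF assms(1)], of \<xi>]
    integrable_cis_mult[OF schwartz_integrable(1)[OF assms(2)], of \<xi>]
  by (simp add: inv_fourier_FT FT_def right_diff_distrib)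

lemma FT_affine:
  fixes \<phi> :: "'a::euclidean_space \<Rightarrow> complex"
  assumes [measurable]: "\<phi> \<in> borel_measurable borel" and c: "c \<noteq> 0"
  shows "FT (\<lambda>x. \<phi> (x /\<^sub>R c - t)) \<xi> = complex_of_real (\<bar>c\<bar> ^ DIM('a)) * cis (c * (t \<bullet> \<xi>))
    * FT \<phi> (c *\<^sub>R \<xi>)"
proof -
  have "FT (\<lambda>x. \<phi> (x /\<^sub>R c - t)) \<xi> = (\<bar>c\<bar> ^ DIM('a)) *\<^sub>R (\<integral>x. cis (\<xi> \<bullet> (c *\<^sub>R t + c *\<^sub>R x))
    * \<phi> ((c *\<^sub>R t + c *\<^sub>R x) /\<^sub>R c - t) \<partial>lborel)"
    unfolding FT_def by (rule integral_lborel_affine[OF _ c]) measurable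
  also have "(\<lambda>x. cis (\<xi> \<bullet> (c *\<^sub>R t + c *\<^sub>R x)) * \<phi> ((c *\<^sub>R t + c *\<^sub>R x) /\<^sub>R c - t))
    = (\<lambda>x. cis (c * (t \<bullet> \<xi>)) * (cis ((c *\<^sub>R \<xi>) \<bullet> x) * \<phi> x))"
    using c by (auto simp: fun_eq_iff inner_add_right scaleR_add_right inner_commute
      cis_mult[symmetric] mult.assoc)
  finally show ?thesis by (simp add: FT_def scaleR_conv_of_real)
qed

lemma inv_fourier_shift:
  assumes "\<phi> \<in> schwartz"
  shows "inv_fourier (\<lambda>x. \<phi> (x - t)) \<xi> = cis (t \<bullet> \<xi>) * inv_fourier \<phi> \<xi>"
  using FT_affine[OF schwartz_measurable[OF assms], of 1 t \<xi>] by (simp add: inv_fourier_FT)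

lemma inv_fourier_dilate:
  fixes \<phi> :: "'a::euclidean_space \<Rightarrow> complex"
  assumes "\<phi> \<in> schwartz" "\<rho> > 0"
  shows "inv_fourier (\<lambda>x. \<phi> (x /\<^sub>R \<rho>)) \<xi> = complex_of_real (\<rho> ^ DIM('a)) * inv_fourier \<phi> (\<rho> *\<^sub>R \<xi>)"
  using FT_affine[OF schwartz_measurable[OF assms(1)], of \<rho> 0 \<xi>] assms(2)
    by (simp add: inv_fourier_FT)

text \<open>Modulation by - c moves the transform to the centre c, so every Gaussian in frequency is
  a multiple of the transform of a Schwartz function.\<close>

lemma inv_fourier_gauss:
  fixes c :: "'a::euclidean_space"
  assumes "\<tau> > 0"
  shows "inv_fourier (\<lambda>x. cis ((- c) \<bullet> x) * complex_of_real (gauss \<tau> x)) \<xi> =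
    complex_of_real (fourier_const TYPE('a) * (sqrt (2 * pi) / \<tau>) ^ DIM('a)) * complex_of_real
      (gauss (1 / \<tau>) (\<xi> - c))"
proof -
  have "FT (\<lambda>x. cis ((- c) \<bullet> x) * complex_of_real (gauss \<tau> x)) \<xi>
    = (\<integral>x. cis (x \<bullet> (\<xi> - c)) * complex_of_real (gauss \<tau> x) \<partial>lborel)"
    unfolding FT_def
    by (intro Bochner_Integration.integral_cong refl)
       (simp add: mult.assoc[symmetric] cis_mult inner_diff_right inner_commute)
  then show ?thesis using gauss_char(2)[OF assms, of "\<xi> - c"] by (simp add: inv_fourier_FT)
qed

lemma borel_imp_lebesgue: "f \<in> borel_measurable borel \<Longrightarrow> f \<in> borel_measurable lebesgue"
  by (rule measurable_completion) simp

section \<open>Homogeneous Sobolev spaces as weighted square integrable functions\<close>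

lemma weighted_L2_iff:
  assumes [measurable]: "g \<in> borel_measurable borel"
  shows "g \<in> weighted_L2 s \<longleftrightarrow> sqint lborel (\<lambda>\<xi>. weight s \<xi> * g \<xi>)"
proof -
  have "g \<in> borel_measurable lebesgue" using assms by (rule borel_imp_lebesgue)
  then have "g \<in> weighted_L2 s \<longleftrightarrow> (\<integral>\<^sup>+ \<xi>. ennreal (norm \<xi> powr (2 * s) * (cmod (g \<xi>))\<^sup>2) \<partial>lborel) < \<infinity>"
    by (simp add: weighted_L2_def nn_integral_completion)
  also have "(\<lambda>\<xi>. norm \<xi> powr (2 * s) * (cmod (g \<xi>))\<^sup>2) = (\<lambda>\<xi>. (cmod (weight s \<xi> * g \<xi>))\<^sup>2)"
    by (simp add: norm_mult power_mult_distrib sqrt_powr)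
  also have "(\<integral>\<^sup>+ \<xi>. ennreal ((cmod (weight s \<xi> * g \<xi>))\<^sup>2) \<partial>lborel) < \<infinity>
    \<longleftrightarrow> sqint lborel (\<lambda>\<xi>. weight s \<xi> * g \<xi>)"
    by (simp add: sqint_def integrable_iff_bounded)
  finally show ?thesis .
qed

lemma lebesgue_borel_ex:
  fixes g :: "'a::euclidean_space \<Rightarrow> complex"
  assumes "g \<in> borel_measurable lebesgue"
  shows "\<exists>g'\<in>borel_measurable borel. AE x in lborel. g x = g' x"
proof -
  have "(\<lambda>x. Re (g x)) \<in> borel_measurable lebesgue" "(\<lambda>x. Im (g x)) \<in> borel_measurable lebesgue"
    using assms by auto
  from this[THEN completion_ex_borel_measurable_real]
  obtain u v where [measurable]: "u \<in> borel_measurable lborel" "v \<in> borel_measurable lborel"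
    and uv: "AE x in lborel. Re (g x) = u x" "AE x in lborel. Im (g x) = v x" by blast
  show ?thesis
  proof
    show "(\<lambda>x. Complex (u x) (v x)) \<in> borel_measurable borel"
      unfolding Complex_eq by measurable
    show "AE x in lborel. g x = Complex (u x) (v x)"
      using uv by eventually_elim (simp add: complex_eq_iff)
  qed
qed

lemma inv_fourier_dist_cong_AE:
  assumes "g \<in> borel_measurable lebesgue" "g' \<in> borel_measurable lebesgue" "AE \<xi> in lborel. g \<xi>
    = g' \<xi>"
  shows "inv_fourier_dist s g = inv_fourier_dist s g'"
proof
  fix \<phi>
  have "(\<integral>\<xi>. g \<xi> * inv_fourier \<phi> \<xi> \<partial>lebesgue) = (\<integral>\<xi>. g' \<xi> * inv_fourier \<phi> \<xi> \<partial>lebesgue)"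
    if "\<phi> \<in> test_space s"
  proof (rule integral_cong_AE)
    have "inv_fourier \<phi> \<in> borel_measurable borel"
      using that inv_fourier_measurable by (auto simp: test_space_def)
    then have "inv_fourier \<phi> \<in> borel_measurable lebesgue" by (rule borel_imp_lebesgue)
    then show "(\<lambda>\<xi>. g \<xi> * inv_fourier \<phi> \<xi>) \<in> borel_measurable lebesgue"
      "(\<lambda>\<xi>. g' \<xi> * inv_fourier \<phi> \<xi>) \<in> borel_measurable lebesgue"
      using assms by auto
    show "AE \<xi> in lebesgue. g \<xi> * inv_fourier \<phi> \<xi> = g' \<xi> * inv_fourier \<phi> \<xi>"
      using AE_completion[OF assms(3)] by eventually_elim simp
  qed
  then show "inv_fourier_dist s g \<phi> = inv_fourier_dist s g' \<phi>" by (simp add: inv_fourier_dist_def)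
qed

text \<open>An isometric parametrisation of the homogeneous space by L2: k is |\<xi>|^s times the
  Fourier transform. Everything that follows is carried out on k.\<close>

definition hdot_of :: "real \<Rightarrow> ('a::euclidean_space \<Rightarrow> complex) \<Rightarrow> 'a distribution"
  where "hdot_of s k = inv_fourier_dist s (\<lambda>\<xi>. weight (- s) \<xi> * k \<xi>)"

lemma weight_weighted_L2:
  assumes "sqint lborel k"
  shows "(\<lambda>\<xi>. weight (- s) \<xi> * k \<xi>) \<in> weighted_L2 s"
proof -
  have [measurable]: "k \<in> borel_measurable borel" using assms by (simp add: sqint_def)
  have "sqint lborel (\<lambda>\<xi>. weight s \<xi> * (weight (- s) \<xi> * k \<xi>))"
    by (rule sqint_bound[OF assms])
       (auto simp: norm_mult mult.assoc[symmetric] powr_add[symmetric])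
  then show ?thesis by (subst weighted_L2_iff) auto
qed

lemma test_space_sqint:
  assumes "\<phi> \<in> test_space s"
  shows "sqint lborel (\<lambda>\<xi>. weight (- s) \<xi> * inv_fourier \<phi> \<xi>)"
  using assms weighted_L2_iff[OF inv_fourier_measurable, of \<phi> "- s"] by (simp add: test_space_def)

lemma hdot_of_apply:
  assumes k: "sqint lborel k" and \<phi>: "\<phi> \<in> test_space s"
  shows "hdot_of s k \<phi> = (\<integral>\<xi>. k \<xi> * (weight (- s) \<xi> * inv_fourier \<phi> \<xi>) \<partial>lborel)"
    and "integrable lborel (\<lambda>\<xi>. k \<xi> * (weight (- s) \<xi> * inv_fourier \<phi> \<xi>))"
    and "cmod (hdot_of s k \<phi>) \<le> l2norm lborel k * l2norm lborel (\<lambda>\<xi>. weight (- s) \<xi>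
      * inv_fourier \<phi> \<xi>)"
proof -
  have [measurable]: "k \<in> borel_measurable borel" using k by (simp add: sqint_def)
  have [measurable]: "inv_fourier \<phi> \<in> borel_measurable borel"
    using \<phi> inv_fourier_measurable by (auto simp: test_space_def)
  show i: "integrable lborel (\<lambda>\<xi>. k \<xi> * (weight (- s) \<xi> * inv_fourier \<phi> \<xi>))"
    by (rule sqint_cmult(1)[OF k test_space_sqint[OF \<phi>]])
  have "hdot_of s k \<phi> = (\<integral>\<xi>. weight (- s) \<xi> * k \<xi> * inv_fourier \<phi> \<xi> \<partial>lebesgue)"
    using \<phi> by (simp add: hdot_of_def inv_fourier_dist_def)
  also have "\<dots> = (\<integral>\<xi>. weight (- s) \<xi> * k \<xi> * inv_fourier \<phi> \<xi> \<partial>lborel)"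
    by (rule integral_completion) measurable
  finally show *: "hdot_of s k \<phi> = (\<integral>\<xi>. k \<xi> * (weight (- s) \<xi> * inv_fourier \<phi> \<xi>) \<partial>lborel)"
    by (simp add: mult_ac)
  show "cmod (hdot_of s k \<phi>) \<le> l2norm lborel k * l2norm lborel (\<lambda>\<xi>. weight (- s) \<xi>
    * inv_fourier \<phi> \<xi>)"
    unfolding * by (rule sqint_cmult(2)[OF k test_space_sqint[OF \<phi>]])
qed

lemma hdot_of_not_test: "\<phi> \<notin> test_space s \<Longrightarrow> hdot_of s k \<phi> = 0"
  by (simp add: hdot_of_def inv_fourier_dist_def)

lemma hdot_of_in_hdot: "sqint lborel k \<Longrightarrow> hdot_of s k \<in> hdot s"
  unfolding hdot_of_def hdot_def by (intro imageI weight_weighted_L2)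

lemma hdot_of_cong_AE:
  assumes "sqint lborel k" "sqint lborel k'" "AE \<xi> in lborel. k \<xi> = k' \<xi>"
  shows "hdot_of s k = hdot_of s k'"
  unfolding hdot_of_def
proof (rule inv_fourier_dist_cong_AE)
  show "AE \<xi> in lborel. weight (- s) \<xi> * k \<xi> = weight (- s) \<xi> * k' \<xi>"
    using assms(3) by eventually_elim simp
qed (use weight_weighted_L2[OF assms(1)] weight_weighted_L2[OF assms(2)] in
  \<open>auto simp: weighted_L2_def\<close>)

text \<open>Fourier transforms are only Lebesgue measurable by definition; passing to a Borel
  representative allows the later integrals to be taken over \<open>lborel\<close>.\<close>

lemma weighted_L2_rep:
  assumes "g \<in> weighted_L2 s"
  shows "\<exists>k. sqint lborel k \<and> (AE \<xi> in lborel. g \<xi> = weight (- s) \<xi> * k \<xi>) \<and> inv_fourier_dist s g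
    = hdot_of s k"
proof -
  have g: "g \<in> borel_measurable lebesgue" using assms by (simp add: weighted_L2_def)
  from lebesgue_borel_ex[OF this] obtain g' where [measurable]: "g' \<in> borel_measurable borel"
    and ae: "AE \<xi> in lborel. g \<xi> = g' \<xi>" by blast
  have g': "g' \<in> borel_measurable lebesgue" by (rule borel_imp_lebesgue) simp
  have "(\<integral>\<^sup>+ \<xi>. ennreal (norm \<xi> powr (2 * s) * (cmod (g' \<xi>))\<^sup>2) \<partial>lebesgue)
    = (\<integral>\<^sup>+ \<xi>. ennreal (norm \<xi> powr (2 * s) * (cmod (g \<xi>))\<^sup>2) \<partial>lebesgue)"
    by (intro nn_integral_cong_AE) (use AE_completion[OF ae] in \<open>eventually_elim, simp\<close>)
  then have "g' \<in> weighted_L2 s" using assms g' by (simp add: weighted_L2_def)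
  then have s: "sqint lborel (\<lambda>\<xi>. weight s \<xi> * g' \<xi>)" by (simp add: weighted_L2_iff)
  have ae2: "AE \<xi> in lborel. g \<xi> = weight (- s) \<xi> * (weight s \<xi> * g' \<xi>)"
    using ae AE_nonzero by eventually_elim (simp add: weight_cancel)
  have "inv_fourier_dist s g = hdot_of s (\<lambda>\<xi>. weight s \<xi> * g' \<xi>)"
    unfolding hdot_of_def using weight_weighted_L2[OF s, of s]
    by (intro inv_fourier_dist_cong_AE g ae2) (simp add: weighted_L2_def)
  then show ?thesis using s ae2 by blast
qed

lemma hdot_rep: "f \<in> hdot s \<Longrightarrow> \<exists>k. sqint lborel k \<and> f = hdot_of s k"
  unfolding hdot_def using weighted_L2_rep by blast

lemma cis_minus_1_bound: "cmod (cis \<theta> - 1) \<le> \<bar>\<theta>\<bar>"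
proof -
  have "(cmod (cis \<theta> - 1))\<^sup>2 = 2 - 2 * cos \<theta>"
    unfolding cmod_power2 using sin_cos_squared_add[of \<theta>]
      by (simp add: power2_eq_square algebra_simps)
  also have "\<dots> = (2 * sin (\<theta> / 2))\<^sup>2"
    using cos_double_sin[of "\<theta>/2"] by (simp add: power2_eq_square)
  also have "\<dots> \<le> \<theta>\<^sup>2"
    using abs_sin_x_le_abs_x[of "\<theta>/2"] by (intro abs_le_square_iff[THEN iffD1]) (simp add: abs_mult)
  finally show ?thesis by (simp add: abs_le_square_iff flip: abs_le_square_iff)
qed

text \<open>The exceptional set is a countable union of hyperplanes.\<close>

lemma AE_cis_neq_1:
  fixes e :: "'a::euclidean_space"
  assumes "e \<noteq> 0"
  shows "AE \<xi> in lborel. cis (e \<bullet> \<xi>) \<noteq> 1"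
proof -
  have "AE \<xi> in lborel. \<forall>n::int. e \<bullet> \<xi> \<noteq> of_int n * 2 * pi"
    unfolding AE_all_countable using AE_hyperplane[OF assms] by blast
  then show ?thesis
  proof eventually_elim
    fix \<xi> assume n: "\<forall>n::int. e \<bullet> \<xi> \<noteq> of_int n * 2 * pi"
    show "cis (e \<bullet> \<xi>) \<noteq> 1"
    proof
      assume "cis (e \<bullet> \<xi>) = 1"
      then have "cos (e \<bullet> \<xi>) = 1" by (simp add: complex_eq_iff)
      then show False using n by (simp add: cos_one_2pi_int)
    qed
  qed
qed

text \<open>
  An \<open>n\<close>-fold difference multiplies the Fourier transform by a factor vanishing to order \<open>n\<close> at 0,
  so that differences of Gaussians are test functions for every \<open>s\<close>.
\<close>

definition diff_op :: "'a::euclidean_space \<Rightarrow> ('a \<Rightarrow> complex) \<Rightarrow> 'a \<Rightarrow> complex"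
  where "diff_op e \<phi> = (\<lambda>x. \<phi> (x - e) - \<phi> x)"

lemma inv_fourier_diff_op:
  assumes "\<phi> \<in> schwartz"
  shows "diff_op e \<phi> \<in> schwartz" "inv_fourier (diff_op e \<phi>) \<xi> = (cis (e \<bullet> \<xi>) - 1) * inv_fourier \<phi> \<xi>"
proof -
  have sh: "(\<lambda>x. \<phi> (x - e)) \<in> schwartz" using schwartz_affine[OF assms, of 1 "- e"] by simp
  show "diff_op e \<phi> \<in> schwartz" unfolding diff_op_def by (rule schwartz_diff[OF sh assms])
  show "inv_fourier (diff_op e \<phi>) \<xi> = (cis (e \<bullet> \<xi>) - 1) * inv_fourier \<phi> \<xi>"
    unfolding diff_op_def inv_fourier_diff[OF sh assms] inv_fourier_shift[OF assms]
      by (simp add: algebra_simps)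
qed

lemma diff_op_power:
  assumes "\<phi> \<in> schwartz"
  shows "(diff_op e ^^ n) \<phi> \<in> schwartz \<and> inv_fourier ((diff_op e ^^ n) \<phi>) \<xi> = (cis (e \<bullet> \<xi>) - 1) ^ n
    * inv_fourier \<phi> \<xi>"
proof (induction n)
  case (Suc n)
  then show ?case using inv_fourier_diff_op[of "(diff_op e ^^ n) \<phi>" e] by simp
qed (use assms in simp)

text \<open>Near 0 the n-th order zero of the difference factor absorbs the singularity
  |\<xi>|^(-s), since n \<ge> s; at infinity the Gaussian absorbs the remaining polynomial
  growth.\<close>

lemma gauss_test_function:
  fixes c :: "'a::euclidean_space"
  assumes \<tau>: "\<tau> > 0" and e: "norm e = 1" and n: "real n \<ge> s"
  shows "(diff_op e ^^ n) (\<lambda>x. cis ((- c) \<bullet> x) * complex_of_real (gauss \<tau> x)) \<in> test_space s"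
proof -
  let ?\<phi> = "\<lambda>x. cis ((- c) \<bullet> x) * complex_of_real (gauss \<tau> x)"
  have \<phi>: "?\<phi> \<in> schwartz" by (rule schwartz_gauss[OF \<tau>])
  let ?\<psi> = "(diff_op e ^^ n) ?\<phi>"
  let ?A = "fourier_const TYPE('a) * (sqrt (2 * pi) / \<tau>) ^ DIM('a)"
  have \<psi>: "?\<psi> \<in> schwartz" and F: "inv_fourier ?\<psi> \<xi> = (cis (e \<bullet> \<xi>) - 1) ^ n * inv_fourier ?\<phi> \<xi>" for \<xi>
    using diff_op_power[OF \<phi>] by blast+
  \<comment> \<open>An integer exponent dominating the growth |\<xi>|^(n - s), so that
    \<open>poly_gauss_bounded\<close> applies.\<close>
  define m where "m = nat \<lceil>real n - s\<rceil>"
  have m: "real m \<ge> real n - s" by (simp add: m_def of_nat_ceiling)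
  obtain B where B: "\<And>x::'a. (1 + norm x) ^ (2 * m) * gauss (1 / \<tau>) x \<le> B"
    using poly_gauss_bounded[of "1 / \<tau>" "2 * m"] \<tau> by auto
  have bd: "norm \<xi> powr (- s) * cmod (cis (e \<bullet> \<xi>) - 1) ^ n
    \<le> ((1 + norm c) * (1 + norm (\<xi> - c))) ^ m" for \<xi>
  proof (cases "\<xi> = 0")
    case False
    have "cmod (cis (e \<bullet> \<xi>) - 1) \<le> norm \<xi>"
      using cis_minus_1_bound[of "e \<bullet> \<xi>"] Cauchy_Schwarz_ineq2[of e \<xi>] e by simp
    then have "norm \<xi> powr (- s) * cmod (cis (e \<bullet> \<xi>) - 1) ^ n \<le> norm \<xi> powr (- s) * norm \<xi> ^ n"
      by (intro mult_left_mono power_mono) auto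
    also have "\<dots> = norm \<xi> powr (real n - s)"
      using False by (simp add: powr_realpow[symmetric] powr_add[symmetric])
    also have "\<dots> \<le> (1 + norm \<xi>) powr (real n - s)"
      using n by (intro powr_mono2) auto
    also have "\<dots> \<le> (1 + norm \<xi>) powr (real m)"
      using m by (intro powr_mono) auto
    also have "\<dots> = (1 + norm \<xi>) ^ m" by (rule powr_realpow) (simp add: add_pos_nonneg)
    also have "\<dots> \<le> ((1 + norm c) * (1 + norm (\<xi> - c))) ^ m"
    proof (rule power_mono)
      have *: "norm \<xi> \<le> norm c + norm (\<xi> - c)" using norm_triangle_ineq[of c "\<xi> - c"] by simp
      have e2: "(1 + norm c) * (1 + norm (\<xi> - c)) = 1 + norm c + norm (\<xi> - c) + norm c
        * norm (\<xi> - c)"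
        by (simp add: algebra_simps)
      show "1 + norm \<xi> \<le> (1 + norm c) * (1 + norm (\<xi> - c))"
        using mult_nonneg_nonneg[OF norm_ge_zero[of c] norm_ge_zero[of "\<xi> - c"]] *
        unfolding e2 by linarith
    qed simp
    finally show ?thesis .
  qed simp
  have "sqint lborel (\<lambda>\<xi>. weight (- s) \<xi> * inv_fourier ?\<psi> \<xi>)"
    unfolding sqint_def
  proof (intro conjI)
    note [measurable] = inv_fourier_measurable[OF \<psi>]
    show "(\<lambda>\<xi>. weight (- s) \<xi> * inv_fourier ?\<psi> \<xi>) \<in> borel_measurable lborel" by measurable
    let ?C = "?A\<^sup>2 * (1 + norm c) ^ (2 * m) * B"
    have i: "integrable lborel (\<lambda>\<xi>. ?C * gauss (1 / \<tau>) (\<xi> - c))"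
      using integrable_lborel_affine[OF integrable_gauss(1)[of "1 / \<tau>"], of 1 "- c"] \<tau> by simp
    show "integrable lborel (\<lambda>\<xi>. (cmod (weight (- s) \<xi> * inv_fourier ?\<psi> \<xi>))\<^sup>2)"
    proof (rule Bochner_Integration.integrable_bound[OF i])
      show "AE \<xi> in lborel. norm ((cmod (weight (- s) \<xi> * inv_fourier ?\<psi> \<xi>))\<^sup>2)
        \<le> norm (?C * gauss (1 / \<tau>) (\<xi> - c))"
      proof (rule AE_I2)
        fix \<xi> :: 'a
        let ?g = "gauss (1 / \<tau>) (\<xi> - c)"
        have A: "?A \<ge> 0" using \<tau> fourier_const_pos[where 'a='a] by simp
        have sq: "P ^ (2 * m) = (P ^ m)\<^sup>2" for P :: real by (simp add: mult.commute flip: power_mult)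
        have AA: "cmod (complex_of_real ?A * complex_of_real ?g) = ?A * ?g"
          by (simp only: norm_mult norm_of_real abs_of_nonneg[OF A] gauss_pos)
        have "cmod (weight (- s) \<xi> * inv_fourier ?\<psi> \<xi>)
          = (norm \<xi> powr (- s) * cmod (cis (e \<bullet> \<xi>) - 1) ^ n) * (?A * ?g)"
          unfolding F inv_fourier_gauss[OF \<tau>] norm_mult[of "weight (- s) \<xi>"]
            norm_mult[of "(cis (e \<bullet> \<xi>) - 1) ^ n"]
            AA norm_power norm_weight by (simp only: mult.assoc)
        also have "\<dots> \<le> ((1 + norm c) * (1 + norm (\<xi> - c))) ^ m * (?A * ?g)"
          by (rule mult_right_mono[OF bd]) (use A in simp)
        finally have "(cmod (weight (- s) \<xi> * inv_fourier ?\<psi> \<xi>))\<^sup>2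
          \<le> (((1 + norm c) * (1 + norm (\<xi> - c))) ^ m * (?A * ?g))\<^sup>2"
          by (rule power_mono) simp
        also have "\<dots> = (?A\<^sup>2 * (1 + norm c) ^ (2 * m)) * ((1 + norm (\<xi> - c)) ^ (2 * m) * ?g) * ?g"
          unfolding sq by (simp only: power_mult_distrib power2_eq_square mult_ac)
        \<comment> \<open>Of the two Gaussian factors one pays for the polynomial through
          \<open>B\<close>; the other remains as the integrable majorant.\<close>
        also have "\<dots> \<le> (?A\<^sup>2 * (1 + norm c) ^ (2 * m)) * B * ?g"
          by (intro mult_right_mono mult_left_mono B) auto
        finally show "norm ((cmod (weight (- s) \<xi> * inv_fourier ?\<psi> \<xi>))\<^sup>2) \<le> norm (?C * ?g)"
          by simp
      qed
    qed measurable
  qed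
  then show ?thesis
    using \<psi> weighted_L2_iff[OF inv_fourier_measurable[OF \<psi>], of "- s"] by (simp add: test_space_def)
qed

lemma integral_zero_cancel:
  fixes f :: "'a \<Rightarrow> complex"
  assumes "integrable M (\<lambda>x. A * f x)" "(\<integral>x. A * f x \<partial>M) = 0" "A \<noteq> 0"
  shows "integrable M f \<and> (\<integral>x. f x \<partial>M) = 0"
  using assms integrable_mult_right[OF assms(1), of "inverse A"] by (simp flip: mult.assoc)

text \<open>Differences of modulated Gaussians are test functions for every s. Testing with them
  shows that \<open>k\<close> times the weight and the difference factor is orthogonal to all
  Gaussians in frequency; weight and difference factor vanish only on null sets, so k does
  too.\<close>

lemma hdot_of_zero:
  fixes k :: "'a::euclidean_space \<Rightarrow> complex"
  assumes k: "sqint lborel k" and z: "\<And>\<phi>. \<phi> \<in> test_space s \<Longrightarrow> hdot_of s k \<phi> = 0"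
  shows "AE \<xi> in lborel. k \<xi> = 0"
proof -
  define e :: 'a where "e = (SOME b. b \<in> Basis)"
  have e: "norm e = 1" "e \<noteq> 0" unfolding e_def using SOME_Basis[where 'a='a]
    by (auto simp: nonzero_Basis)
  \<comment> \<open>For s \<le> 0 the conversion to \<open>nat\<close> gives n = 0, for which n
    \<ge> s still holds.\<close>
  define n where "n = nat \<lceil>s\<rceil>"
  have n: "real n \<ge> s" by (simp add: n_def of_nat_ceiling)
  let ?W = "\<lambda>\<xi>. k \<xi> * weight (- s) \<xi> * (cis (e \<bullet> \<xi>) - 1) ^ n"
  have *: "integrable lborel (\<lambda>\<xi>. ?W \<xi> * complex_of_real (gauss \<tau> (\<xi> - c))) \<and>
      (\<integral>\<xi>. ?W \<xi> * complex_of_real (gauss \<tau> (\<xi> - c)) \<partial>lborel) = 0" if \<tau>: "\<tau> > 0" for c \<tau>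
  proof -
    let ?\<phi> = "\<lambda>x. cis ((- c) \<bullet> x) * complex_of_real (gauss (1 / \<tau>) x)"
    let ?\<psi> = "(diff_op e ^^ n) ?\<phi>"
    let ?A = "complex_of_real (fourier_const TYPE('a) * (sqrt (2 * pi) / (1 / \<tau>)) ^ DIM('a))"
    have t: "1 / \<tau> > 0" using \<tau> by simp
    have A: "?A \<noteq> 0" using \<tau> fourier_const_pos[where 'a='a]
      by (simp del: of_real_mult of_real_power)
    have \<psi>: "?\<psi> \<in> test_space s" by (rule gauss_test_function[OF t e(1) n])
    have "inv_fourier ?\<psi> \<xi> = (cis (e \<bullet> \<xi>) - 1) ^ n * inv_fourier ?\<phi> \<xi>" for \<xi>
      using diff_op_power[OF schwartz_gauss[OF t]] by blast
    then have F: "inv_fourier ?\<psi> \<xi> = (cis (e \<bullet> \<xi>) - 1) ^ n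
      * (?A * complex_of_real (gauss \<tau> (\<xi> - c)))" for \<xi>
      unfolding inv_fourier_gauss[OF t] by simp
    have eq: "k \<xi> * (weight (- s) \<xi> * inv_fourier ?\<psi> \<xi>)
      = ?A * (?W \<xi> * complex_of_real (gauss \<tau> (\<xi> - c)))" for \<xi>
      unfolding F by (simp only: mult_ac)
    have i1: "(\<integral>\<xi>. ?A * (?W \<xi> * complex_of_real (gauss \<tau> (\<xi> - c))) \<partial>lborel) = 0"
      using z[OF \<psi>] unfolding hdot_of_apply(1)[OF k \<psi>] eq .
    have i2: "integrable lborel (\<lambda>\<xi>. ?A * (?W \<xi> * complex_of_real (gauss \<tau> (\<xi> - c))))"
      using hdot_of_apply(2)[OF k \<psi>] unfolding eq .
    show ?thesis by (rule integral_zero_cancel[OF i2 i1 A])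
  qed
  have "AE \<xi> in lborel. ?W \<xi> = 0"
  proof (rule AE_zero_if_gauss)
    fix c :: 'a and \<tau> :: real assume "\<tau> > 0"
    from *[OF this, of c]
    show "integrable lborel (\<lambda>\<xi>. ?W \<xi> * complex_of_real (gauss \<tau> (\<xi> - c)))"
      "(\<integral>\<xi>. ?W \<xi> * complex_of_real (gauss \<tau> (\<xi> - c)) \<partial>lborel) = 0"
        by (rule conjunct1, rule conjunct2)
  qed
  then show ?thesis
    using AE_cis_neq_1[OF e(2)] AE_nonzero by eventually_elim (auto simp: weight_def)
qed

lemma hdot_of_linear:
  assumes k: "sqint lborel k" "sqint lborel k'"
  shows "hdot_of s (\<lambda>\<xi>. k \<xi> - k' \<xi>) = (\<lambda>\<phi>. hdot_of s k \<phi> - hdot_of s k' \<phi>)"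
proof
  fix \<phi>
  show "hdot_of s (\<lambda>\<xi>. k \<xi> - k' \<xi>) \<phi> = hdot_of s k \<phi> - hdot_of s k' \<phi>"
  proof (cases "\<phi> \<in> test_space s")
    case True
    show ?thesis
      using hdot_of_apply(2)[OF k(1) True] hdot_of_apply(2)[OF k(2) True]
      by (simp add: hdot_of_apply(1)[OF sqint_diff(1)[OF k] True] hdot_of_apply(1)[OF k(1) True]
        hdot_of_apply(1)[OF k(2) True] left_diff_distrib)
  qed (simp add: hdot_of_not_test)
qed

lemma hdot_of_inj:
  assumes k: "sqint lborel k" "sqint lborel k'" and eq: "hdot_of s k = hdot_of s k'"
  shows "AE \<xi> in lborel. k \<xi> = k' \<xi>"
proof -
  have "AE \<xi> in lborel. k \<xi> - k' \<xi> = 0"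
    by (rule hdot_of_zero[OF sqint_diff(1)[OF k], of s]) (simp add: hdot_of_linear[OF k] eq)
  then show ?thesis by eventually_elim simp
qed

text \<open>\<open>fourier_dist\<close> selects an arbitrary admissible transform; by injectivity of
  the parametrisation all of them agree almost everywhere.\<close>

lemma fourier_dist_hdot_of:
  assumes k: "sqint lborel k"
  shows "AE \<xi> in lborel. fourier_dist s (hdot_of s k) \<xi> = weight (- s) \<xi> * k \<xi>"
    and "fourier_dist s (hdot_of s k) \<in> borel_measurable lebesgue"
proof -
  have *: "fourier_dist s (hdot_of s k) \<in> weighted_L2 s
    \<and> inv_fourier_dist s (fourier_dist s (hdot_of s k)) = hdot_of s k"
    unfolding fourier_dist_def
    by (rule someI[of _ "\<lambda>\<xi>. weight (- s) \<xi> * k \<xi>"]) (simp add: weight_weighted_L2[OF k]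
      hdot_of_def)
  then show "fourier_dist s (hdot_of s k) \<in> borel_measurable lebesgue"
    by (simp add: weighted_L2_def)
  obtain k' where k': "sqint lborel k'" "AE \<xi> in lborel. fourier_dist s (hdot_of s k) \<xi>
    = weight (- s) \<xi> * k' \<xi>"
    "hdot_of s k = hdot_of s k'"
    using weighted_L2_rep * by metis
  have "AE \<xi> in lborel. k \<xi> = k' \<xi>" by (rule hdot_of_inj[OF k k'(1,3)])
  with k'(2) show "AE \<xi> in lborel. fourier_dist s (hdot_of s k) \<xi> = weight (- s) \<xi> * k \<xi>"
    by eventually_elim simp
qed

lemma hdot_norm_hdot_of:
  assumes k: "sqint lborel k"
  shows "hdot_norm s (hdot_of s k) = l2norm lborel k"
proof -
  have [measurable]: "k \<in> borel_measurable borel" using k by (simp add: sqint_def)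
  have km: "(\<lambda>\<xi>. (cmod (k \<xi>))\<^sup>2) \<in> borel_measurable lborel" by simp
  have "(\<integral>\<xi>. norm \<xi> powr (2 * s) * (cmod (fourier_dist s (hdot_of s k) \<xi>))\<^sup>2 \<partial>lebesgue)
    = (\<integral>\<xi>. (cmod (k \<xi>))\<^sup>2 \<partial>lebesgue)"
  proof (rule integral_cong_AE)
    have "(\<lambda>\<xi>::'a. norm \<xi> powr (2 * s)) \<in> borel_measurable lborel" by simp
    from measurable_completion[OF this] fourier_dist_hdot_of(2)[OF k, of s]
    show "(\<lambda>\<xi>. norm \<xi> powr (2 * s) * (cmod (fourier_dist s (hdot_of s k) \<xi>))\<^sup>2)
      \<in> borel_measurable lebesgue" by simp
    show "(\<lambda>\<xi>. (cmod (k \<xi>))\<^sup>2) \<in> borel_measurable lebesgue" by (rule measurable_completion[OF km])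
    have "AE \<xi> in lborel. norm \<xi> powr (2 * s) * (cmod (fourier_dist s (hdot_of s k) \<xi>))\<^sup>2
      = (cmod (k \<xi>))\<^sup>2"
      using fourier_dist_hdot_of(1)[OF k] AE_nonzero
    proof eventually_elim
      fix \<xi> :: 'a assume h: "fourier_dist s (hdot_of s k) \<xi> = weight (- s) \<xi> * k \<xi>" and nz: "\<xi> \<noteq> 0"
      have "norm \<xi> powr (2 * s) * (norm \<xi> powr (- s))\<^sup>2 = 1"
        using nz by (simp add: sqrt_powr flip: powr_add)
      then show "norm \<xi> powr (2 * s) * (cmod (fourier_dist s (hdot_of s k) \<xi>))\<^sup>2 = (cmod (k \<xi>))\<^sup>2"
        by (simp add: h norm_mult power_mult_distrib flip: mult.assoc)
    qed
    then show "AE \<xi> in lebesgue. norm \<xi> powr (2 * s) * (cmod (fourier_dist s (hdot_of s k) \<xi>))\<^sup>2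
      = (cmod (k \<xi>))\<^sup>2"
      by (rule AE_completion)
  qed
  then show ?thesis by (simp add: hdot_norm_def l2norm_def integral_completion[OF km])
qed

text \<open>The multiplication formula, by Fubini. It identifies the pairing of a low-pass part, as
  a function, with the pairing on the Fourier side.\<close>

lemma integral_FT_mult:
  fixes k \<phi> :: "'a::euclidean_space \<Rightarrow> complex"
  assumes k: "integrable lborel k" and \<phi>: "integrable lborel \<phi>"
  shows "(\<integral>x. FT k x * \<phi> x \<partial>lborel) = (\<integral>\<xi>. k \<xi> * FT \<phi> \<xi> \<partial>lborel)"
proof -
  let ?L = "lborel :: 'a measure"
  have sf: "sigma_finite_measure ?L" by (rule sigma_finite_lborel)
  have [measurable]: "k \<in> borel_measurable borel" "\<phi> \<in> borel_measurable borel" using assms by auto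
  have i: "integrable (?L \<Otimes>\<^sub>M ?L) (\<lambda>(x, \<xi>). cis (x \<bullet> \<xi>) * k \<xi> * \<phi> x)"
    by (rule Bochner_Integration.integrable_bound[OF integral_pair_mult(1)[OF sf sf \<phi> k]])
       (auto simp: norm_mult)
  have "(\<integral>x. FT k x * \<phi> x \<partial>lborel) = (\<integral>x. (\<integral>\<xi>. cis (x \<bullet> \<xi>) * k \<xi> * \<phi> x \<partial>?L) \<partial>?L)"
    by (simp add: FT_def)
  also have "\<dots> = (\<integral>\<xi>. (\<integral>x. cis (x \<bullet> \<xi>) * k \<xi> * \<phi> x \<partial>?L) \<partial>?L)"
    by (rule lborel_pair.Fubini_integral[OF i, symmetric])
  also have "\<dots> = (\<integral>\<xi>. k \<xi> * FT \<phi> \<xi> \<partial>lborel)"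
    unfolding FT_def
    by (intro Bochner_Integration.integral_cong refl) (simp add: inner_commute mult_ac flip:
      integral_mult_right_zero)
  finally show ?thesis .
qed

lemma nn_integral_powr_Ioo:
  assumes "p > 0" "y \<ge> 0"
  shows "(\<integral>\<^sup>+l. ennreal (indicator {0<..<y} l * (p * l powr (p - 1))) \<partial>lborel) = ennreal (y powr p)"
proof -
  have "((\<lambda>x. p * x powr (p - 1)) has_integral p * (y powr (p - 1 + 1) / (p - 1 + 1))) {0..y}"
    using assms by (intro has_integral_mult_right has_integral_powr_from_0) auto
  then have "((\<lambda>x. p * x powr (p - 1)) has_integral y powr p) {0..y}"
    using assms by simp
  then have "((\<lambda>x. p * x powr (p - 1)) has_integral y powr p) {0<..<y}"
    by (simp only: has_integral_Icc_iff_Ioo)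
  then have "((\<lambda>x. indicator {0<..<y} x * (p * x powr (p - 1))) has_integral y powr p) UNIV"
    by (subst (asm) has_integral_restrict_UNIV[symmetric])
       (auto elim!: has_integral_eq[rotated] simp: indicator_def)
  then show ?thesis
    using assms by (intro nn_integral_has_integral_lborel) (auto simp: indicator_def)
qed

section \<open>Low-pass and high-pass parts\<close>

text \<open>2\<sigma> < d makes |\<xi>|^(-2\<sigma>) integrable near 0, so low-pass parts are
  bounded functions; \<sigma> > 0 makes the weight decay, so high-pass parts are small in L2. The
  argument \<open>dummy\<close> only fixes the type of the space.\<close>

locale sobolev_index =
  fixes \<sigma> :: real and dummy :: "'a::euclidean_space itself"
  assumes \<sigma>: "0 < \<sigma>" "2 * \<sigma> < real DIM('a)"
begin

lemma sqint_low_weight: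
  assumes "N \<ge> 0"
  shows "sqint lborel (\<lambda>\<xi>::'a. indicator (ball 0 N) \<xi> * weight (- \<sigma>) \<xi>)"
proof -
  have [measurable]: "ball (0::'a) N \<in> sets borel" by simp
  have "integrable lborel (\<lambda>\<xi>::'a. indicator (ball 0 N) \<xi> * norm \<xi> powr (- (2 * \<sigma>)))"
    by (rule integrable_norm_powr_ball) (use \<sigma> assms in auto)
  moreover have "(\<lambda>\<xi>::'a. (cmod (indicator (ball 0 N) \<xi> * weight (- \<sigma>) \<xi>))\<^sup>2)
    = (\<lambda>\<xi>. indicator (ball 0 N) \<xi> * norm \<xi> powr (- (2 * \<sigma>)))"
    by (auto simp: fun_eq_iff norm_mult power_mult_distrib sqrt_powr indicator_def)
  ultimately show ?thesis unfolding sqint_def by auto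
qed

text \<open>On the unit ball the weight is square integrable and the transform bounded; outside it
  the weight is at most 1 and the transform square integrable.\<close>

lemma schwartz_test_space:
  fixes \<phi> :: "'a \<Rightarrow> complex"
  shows "\<phi> \<in> test_space \<sigma> \<longleftrightarrow> \<phi> \<in> schwartz"
proof
  assume \<phi>: "\<phi> \<in> schwartz"
  note [measurable] = inv_fourier_measurable[OF \<phi>]
  have [measurable]: "ball (0::'a) 1 \<in> sets borel" by simp
  obtain B where B: "\<And>\<xi>. cmod (inv_fourier \<phi> \<xi>) \<le> B" using inv_fourier_bound[OF \<phi>] by blast
  have B0: "B \<ge> 0" using order_trans[OF norm_ge_zero B] .
  let ?g = "\<lambda>\<xi>::'a. B *\<^sub>R (indicator (ball 0 1) \<xi> * weight (- \<sigma>) \<xi>)"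
  have g: "sqint lborel ?g" by (intro sqint_scaleR sqint_low_weight) simp
  have "sqint lborel (\<lambda>\<xi>. indicator (ball 0 1) \<xi> * (weight (- \<sigma>) \<xi> * inv_fourier \<phi> \<xi>))"
  proof (rule sqint_bound[OF g])
    fix \<xi> :: 'a
    show "norm (indicator (ball 0 1) \<xi> * (weight (- \<sigma>) \<xi> * inv_fourier \<phi> \<xi>))
      \<le> norm (B *\<^sub>R (indicator (ball 0 1) \<xi> * weight (- \<sigma>) \<xi>))"
      using mult_left_mono[OF B[of \<xi>], of "norm \<xi> powr (- \<sigma>)"] B0
        by (auto simp: norm_mult indicator_def mult.commute)
  qed measurable
  moreover have "sqint lborel (\<lambda>\<xi>. indicator (- ball 0 1) \<xi> * (weight (- \<sigma>) \<xi> * inv_fourier \<phi> \<xi>))"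
  proof (rule sqint_bound[OF inv_fourier_sqint[OF \<phi>]])
    fix \<xi> :: 'a
    show "norm (indicator (- ball 0 1) \<xi> * (weight (- \<sigma>) \<xi> * inv_fourier \<phi> \<xi>))
      \<le> norm (inv_fourier \<phi> \<xi>)"
    proof (cases "\<xi> \<in> ball 0 1")
      case False
      then have "norm \<xi> powr (- \<sigma>) \<le> 1 powr (- \<sigma>)" using \<sigma> by (intro powr_mono2') auto
      then show ?thesis using False by (simp add: norm_mult mult_left_le_one_le)
    qed simp
  qed measurable
  ultimately have "sqint lborel (\<lambda>\<xi>. indicator (ball 0 1) \<xi> * (weight (- \<sigma>) \<xi> * inv_fourier \<phi> \<xi>)
    + indicator (- ball 0 1) \<xi> * (weight (- \<sigma>) \<xi> * inv_fourier \<phi> \<xi>))"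
    by (rule sqint_add(1))
  also have "(\<lambda>\<xi>. indicator (ball 0 1) \<xi> * (weight (- \<sigma>) \<xi> * inv_fourier \<phi> \<xi>)
    + indicator (- ball 0 1) \<xi> * (weight (- \<sigma>) \<xi> * inv_fourier \<phi> \<xi>)) = (\<lambda>\<xi>. weight (- \<sigma>) \<xi> *
    inv_fourier \<phi> \<xi>)"
    by (auto simp: indicator_def)
  finally have "inv_fourier \<phi> \<in> weighted_L2 (- \<sigma>)" by (subst weighted_L2_iff) auto
  then show "\<phi> \<in> test_space \<sigma>" using \<phi> by (simp add: test_space_def)
qed (simp add: test_space_def)

definition lowp :: "real \<Rightarrow> ('a \<Rightarrow> complex) \<Rightarrow> 'a \<Rightarrow> complex"
  where "lowp N k \<xi> = indicator (ball 0 N) \<xi> * weight (- \<sigma>) \<xi> * k \<xi>"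

definition highp :: "real \<Rightarrow> ('a \<Rightarrow> complex) \<Rightarrow> 'a \<Rightarrow> complex"
  where "highp N k \<xi> = indicator (- ball 0 N) \<xi> * weight (- \<sigma>) \<xi> * k \<xi>"

text \<open>The low-pass part of \<open>hdot_of \<sigma> k\<close> at frequency N, as an absolutely
  convergent integral, hence a continuous function with a value at every point.\<close>

definition LP :: "real \<Rightarrow> ('a \<Rightarrow> complex) \<Rightarrow> 'a \<Rightarrow> complex"
  where "LP N k x = complex_of_real (fourier_const TYPE('a)) * FT (lowp N k) x"

lemma lowp_measurable [measurable]: "k \<in> borel_measurable borel \<Longrightarrow> lowp N k \<in> borel_measurable borel"
  and highp_measurable [measurable]: "k \<in> borel_measurable borel \<Longrightarrow> highp N k
    \<in> borel_measurable borel"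
proof -
  have [measurable]: "ball (0::'a) N \<in> sets borel" by simp
  show "k \<in> borel_measurable borel \<Longrightarrow> lowp N k \<in> borel_measurable borel"
    unfolding lowp_def[abs_def] by measurable
  show "k \<in> borel_measurable borel \<Longrightarrow> highp N k \<in> borel_measurable borel"
    unfolding highp_def[abs_def] by measurable
qed

lemma lowp_integrable:
  assumes "sqint lborel k" "N \<ge> 0"
  shows "integrable lborel (lowp N k)"
  unfolding lowp_def[abs_def] by (rule sqint_cmult(1)[OF sqint_low_weight[OF assms(2)] assms(1)])

lemma LP_bound:
  assumes "sqint lborel k" "N \<ge> 0"
  shows "cmod (LP N k x) \<le> fourier_const TYPE('a) * l2norm lborel (\<lambda>\<xi>::'a. indicator (ball 0 N) \<xi>
    * weight (- \<sigma>) \<xi>) * l2norm lborel k"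
proof -
  have "cmod (FT (lowp N k) x) \<le> (\<integral>\<xi>. cmod (lowp N k \<xi>) \<partial>lborel)"
    by (rule FT_bound[OF lowp_integrable[OF assms]])
  also have "\<dots> \<le> l2norm lborel (\<lambda>\<xi>::'a. indicator (ball 0 N) \<xi> * weight (- \<sigma>) \<xi>) * l2norm lborel k"
    using sqint_norm_mult(2)[OF sqint_low_weight[OF assms(2)] assms(1)]
      by (simp add: lowp_def[abs_def] norm_mult)
  finally show ?thesis
    using fourier_const_pos[where 'a='a] by (simp add: LP_def norm_mult mult.assoc)
qed

lemma LP_diff:
  assumes "sqint lborel k" "sqint lborel k'" "N \<ge> 0"
  shows "LP N (\<lambda>\<xi>. k \<xi> - k' \<xi>) x = LP N k x - LP N k' x"
  using integrable_cis_mult[OF lowp_integrable[OF assms(1,3)], of x]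
    integrable_cis_mult[OF lowp_integrable[OF assms(2,3)], of x]
  by (simp add: LP_def FT_def lowp_def right_diff_distrib)

lemma continuous_LP: "sqint lborel k \<Longrightarrow> N \<ge> 0 \<Longrightarrow> continuous_on UNIV (LP N k)"
  unfolding LP_def[abs_def] by (intro continuous_intros continuous_FT lowp_integrable)

lemma LP_measurable: "sqint lborel k \<Longrightarrow> N \<ge> 0 \<Longrightarrow> LP N k \<in> borel_measurable borel"
  by (intro borel_measurable_continuous_onI continuous_LP)

lemma highp_sqint:
  assumes "sqint lborel k" "N > 0"
  shows "sqint lborel (highp N k)" "l2norm lborel (highp N k) \<le> N powr (- \<sigma>) * l2norm lborel k"
proof -
  have [measurable]: "k \<in> borel_measurable borel" using assms by (simp add: sqint_def)
  have k: "sqint lborel (\<lambda>\<xi>. (N powr (- \<sigma>)) *\<^sub>R k \<xi>)" by (rule sqint_scaleR(1)[OF assms(1)])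
  have b: "norm (highp N k \<xi>) \<le> norm ((N powr (- \<sigma>)) *\<^sub>R k \<xi>)" for \<xi>
  proof (cases "\<xi> \<in> ball 0 N")
    case False
    then have "norm \<xi> powr (- \<sigma>) \<le> N powr (- \<sigma>)" using \<sigma> assms(2) by (intro powr_mono2') auto
    then show ?thesis using False by (simp add: highp_def norm_mult mult_right_mono)
  qed (simp add: highp_def)
  have m: "highp N k \<in> borel_measurable lborel" by simp
  show "sqint lborel (highp N k)" by (rule sqint_bound(1)[OF k m b])
  show "l2norm lborel (highp N k) \<le> N powr (- \<sigma>) * l2norm lborel k"
    using sqint_bound(2)[OF k m b] sqint_scaleR(2)[OF assms(1), of "N powr (- \<sigma>)"] by simp
qed

lemma LP_diff_sqint:
  assumes k: "sqint lborel k" and MN: "0 < M" "M \<le> N"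
  shows "sqint lborel (\<lambda>x. LP N k x - LP M k x)"
    and "l2norm lborel (\<lambda>x. LP N k x - LP M k x) \<le> l2norm lborel (highp M k)"
proof -
  have [measurable]: "k \<in> borel_measurable borel" using k by (simp add: sqint_def)
  let ?b = "\<lambda>\<xi>. lowp N k \<xi> - lowp M k \<xi>"
  have iN: "integrable lborel (lowp N k)" and iM: "integrable lborel (lowp M k)"
    using MN by (auto intro: lowp_integrable[OF k])
  have bb: "norm (?b \<xi>) \<le> norm (highp M k \<xi>)" for \<xi>
    using MN by (auto simp: lowp_def highp_def indicator_def)
  have m: "?b \<in> borel_measurable lborel" by simp
  have s: "sqint lborel ?b" "l2norm lborel ?b \<le> l2norm lborel (highp M k)"
    by (rule sqint_bound[OF highp_sqint(1)[OF k MN(1)] m bb])+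
  have eq: "LP N k x - LP M k x = complex_of_real (fourier_const TYPE('a)) * FT ?b x" for x
    using integrable_cis_mult[OF iN, of x] integrable_cis_mult[OF iM, of x]
    by (simp add: LP_def FT_def right_diff_distrib)
  show "sqint lborel (\<lambda>x. LP N k x - LP M k x)"
    unfolding eq by (rule sqint_scaled_FT(1)) (use iN iM s in auto)
  have "l2norm lborel (\<lambda>x. LP N k x - LP M k x) \<le> l2norm lborel ?b"
    unfolding eq by (rule sqint_scaled_FT(2)) (use iN iM s in auto)
  with s(2) show "l2norm lborel (\<lambda>x. LP N k x - LP M k x) \<le> l2norm lborel (highp M k)" by simp
qed

text \<open>The condition that \<open>represents\<close> imposes at almost every single
  time.\<close>

definition has_density :: "('a \<Rightarrow> complex) \<Rightarrow> 'a distribution \<Rightarrow> bool"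
  where "has_density v w \<longleftrightarrow> (\<forall>\<phi>\<in>schwartz. integrable lborel (\<lambda>x. v x * \<phi> x) \<and> w \<phi>
    = (\<integral>x. v x * \<phi> x \<partial>lborel))"

lemma has_density_unique:
  assumes "has_density v w" "has_density v' w"
  shows "AE x in lborel. v x = v' x"
proof -
  have "AE x in lborel. v x - v' x = 0"
  proof (rule AE_zero_if_gauss)
    fix c :: 'a and \<tau> :: real assume "\<tau> > 0"
    note s = schwartz_gauss_shift[OF this, of c]
    show "integrable lborel (\<lambda>x. (v x - v' x) * complex_of_real (gauss \<tau> (x - c)))"
      "(\<integral>x. (v x - v' x) * complex_of_real (gauss \<tau> (x - c)) \<partial>lborel) = 0"
      using assms s unfolding has_density_def by (auto simp: left_diff_distrib)
  qed
  then show ?thesis by eventually_elim simp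
qed

text \<open>Low-pass parts with growing cut-off, minus \<open>LP N k\<close>, are Cauchy in L2
  because the high-pass tails vanish. Adding their limit w to \<open>LP N k\<close> gives a density
  of the same distribution, and uniqueness of densities identifies it with v.\<close>

lemma has_density_highp:
  assumes k: "sqint lborel k" and v: "has_density v (hdot_of \<sigma> k)"
    and vm [measurable]: "v \<in> borel_measurable borel"
    and N: "N > 0"
  shows "sqint lborel (\<lambda>x. v x - LP N k x)" "l2norm lborel (\<lambda>x. v x - LP N k x)
    \<le> l2norm lborel (highp N k)"
proof -
  have [measurable]: "k \<in> borel_measurable borel" using k by (simp add: sqint_def)
  define u where "u m = LP (N + real m) k" for m
  have um [measurable]: "u m \<in> borel_measurable borel" for m
    unfolding u_def using N by (intro LP_measurable k) auto
  have u0: "u 0 = LP N k" by (simp add: u_def)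
  have ud: "sqint lborel (\<lambda>x. u m x - u l x)" "l2norm lborel (\<lambda>x. u m x - u l x)
    \<le> l2norm lborel (highp (N + real l) k)" if "l \<le> m" for m l
    unfolding u_def using N that by (auto intro!: LP_diff_sqint k)
  define f where "f m x = u m x - u 0 x" for m x
  have f: "sqint lborel (f m)" for m unfolding f_def by (rule ud) simp
  have tail: "(\<lambda>l. l2norm lborel (highp (N + real l) k)) \<longlonglongrightarrow> 0"
  proof (rule Lim_null_comparison)
    show "\<forall>\<^sub>F l in sequentially. norm (l2norm lborel (highp (N + real l) k))
      \<le> (N + real l) powr (- \<sigma>) * l2norm lborel k"
      using N by (auto intro!: always_eventually highp_sqint(2)[OF k])
    have "filterlim (\<lambda>l. N + real l) at_top sequentially"
      by (rule filterlim_tendsto_add_at_top[OF tendsto_const filterlim_real_sequentially])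
    from tendsto_neg_powr[OF _ this, of "- \<sigma>"] \<sigma> show "(\<lambda>l. (N + real l) powr (- \<sigma>)
      * l2norm lborel k) \<longlonglongrightarrow> 0"
      by (intro tendsto_mult_left_zero) auto
  qed
  have "\<exists>L. \<forall>m\<ge>L. \<forall>n\<ge>L. l2norm lborel (\<lambda>x. f m x - f n x) < e" if e: "e > 0" for e
  proof -
    obtain L where L: "\<And>l. l \<ge> L \<Longrightarrow> l2norm lborel (highp (N + real l) k) < e"
      using LIMSEQ_D[OF tail e] by auto
    have *: "l2norm lborel (\<lambda>x. f m x - f n x) < e" if "n \<ge> L" "n \<le> m" for m n
      using le_less_trans[OF ud(2)[OF that(2)] L[OF that(1)]] by (simp add: f_def)
    have "l2norm lborel (\<lambda>x. f m x - f n x) < e" if "n \<ge> L" "m \<ge> L" for m n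
      using *[of n m] *[of m n] that l2norm_minus_commute[of lborel "f m" "f n"]
        by (cases "n \<le> m") auto
    then show ?thesis by blast
  qed
  from l2_complete[OF f this] obtain w where w: "sqint lborel w"
    and lim: "(\<lambda>n. l2norm lborel (\<lambda>x. f n x - w x)) \<longlonglongrightarrow> 0"
    by blast
  have [measurable]: "w \<in> borel_measurable borel" using w by (simp add: sqint_def)
  have wn: "l2norm lborel w \<le> l2norm lborel (highp N k)"
  proof (rule field_le_epsilon)
    fix e :: real assume "e > 0"
    from LIMSEQ_D[OF lim this] obtain n where "l2norm lborel (\<lambda>x. f n x - w x) < e" by auto
    moreover have "l2norm lborel w \<le> l2norm lborel (f n) + l2norm lborel (\<lambda>x. f n x - w x)"
      using sqint_diff(2)[OF f sqint_diff(1)[OF f w], of n n] by simp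
    moreover have "l2norm lborel (f n) \<le> l2norm lborel (highp N k)" using ud(2)[of 0 n]
      by (simp add: f_def[abs_def])
    ultimately show "l2norm lborel w \<le> l2norm lborel (highp N k) + e" by simp
  qed
  \<comment> \<open>The pairings of \<open>f m\<close> with a Schwartz function are computed in the
    limit in two ways, by dominated convergence in frequency and by L2 convergence in space.\<close>
  have "has_density (\<lambda>x. u 0 x + w x) (hdot_of \<sigma> k)"
    unfolding has_density_def
  proof (intro ballI conjI)
    fix \<phi> :: "'a \<Rightarrow> complex" assume \<phi>: "\<phi> \<in> schwartz"
    note \<phi>i = schwartz_integrable(1)[OF \<phi>] and \<phi>s = schwartz_sqint[OF \<phi>]
    note [measurable] = schwartz_measurable[OF \<phi>] inv_fourier_measurable[OF \<phi>]
    have t: "\<phi> \<in> test_space \<sigma>" using schwartz_test_space \<phi> by blast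
    have ui: "integrable lborel (\<lambda>x. u m x * \<phi> x)" for m
    proof (rule Bochner_Integration.integrable_bound)
      let ?C = "fourier_const TYPE('a) * l2norm lborel (\<lambda>\<xi>::'a. indicator (ball 0 (N + real m)) \<xi>
        * weight (- \<sigma>) \<xi>) * l2norm lborel k"
      show "integrable lborel (\<lambda>x. ?C * cmod (\<phi> x))" using \<phi>i by simp
      show "AE x in lborel. norm (u m x * \<phi> x) \<le> norm (?C * cmod (\<phi> x))"
      proof (rule AE_I2)
        fix x
        have b: "cmod (u m x) \<le> ?C" unfolding u_def by (rule LP_bound) (use k N in auto)
        have "?C \<ge> 0" by (rule order_trans[OF norm_ge_zero b])
        then show "norm (u m x * \<phi> x) \<le> norm (?C * cmod (\<phi> x))"
          using mult_right_mono[OF b, of "cmod (\<phi> x)"] by (simp add: norm_mult)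
      qed
    qed simp
    note wi = sqint_cmult(1)[OF w \<phi>s]
    show "integrable lborel (\<lambda>x. (u 0 x + w x) * \<phi> x)" using ui[of 0] wi
      by (simp add: distrib_right)
    have uF: "(\<integral>x. u m x * \<phi> x \<partial>lborel) = (\<integral>\<xi>. indicator (ball 0 (N + real m)) \<xi>
      * (k \<xi> * (weight (- \<sigma>) \<xi> * inv_fourier \<phi> \<xi>)) \<partial>lborel)" for m
    proof -
      have il: "integrable lborel (lowp (N + real m) k)" by (rule lowp_integrable) (use k N in auto)
      have "(\<integral>x. u m x * \<phi> x \<partial>lborel) = complex_of_real (fourier_const TYPE('a))
        * (\<integral>x. FT (lowp (N + real m) k) x * \<phi> x \<partial>lborel)"
        unfolding u_def LP_def mult.assoc by simp
      also have "\<dots> = (\<integral>\<xi>. complex_of_real (fourier_const TYPE('a)) * (lowp (N + real m) k \<xi>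
        * FT \<phi> \<xi>) \<partial>lborel)"
        unfolding integral_FT_mult[OF il \<phi>i] by simp
      finally show ?thesis by (simp add: inv_fourier_FT lowp_def mult_ac)
    qed
    have lim1: "(\<lambda>m. \<integral>x. u m x * \<phi> x \<partial>lborel) \<longlonglongrightarrow> hdot_of \<sigma> k \<phi>"
      unfolding uF hdot_of_apply(1)[OF k t]
    proof (rule integral_dominated_convergence[where w="\<lambda>\<xi>. cmod (k \<xi> * (weight (- \<sigma>) \<xi>
      * inv_fourier \<phi> \<xi>))"])
      show "AE \<xi> in lborel. (\<lambda>m. indicator (ball 0 (N + real m)) \<xi>
        * (k \<xi> * (weight (- \<sigma>) \<xi> * inv_fourier \<phi> \<xi>)))
         \<longlonglongrightarrow> k \<xi> * (weight (- \<sigma>) \<xi> * inv_fourier \<phi> \<xi>)"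
      proof (intro AE_I2 tendsto_eventually)
        fix \<xi> :: 'a
        obtain m0 where m0: "norm \<xi> < real m0" using reals_Archimedean2 by blast
        show "\<forall>\<^sub>F m in sequentially. indicator (ball 0 (N + real m)) \<xi>
          * (k \<xi> * (weight (- \<sigma>) \<xi> * inv_fourier \<phi> \<xi>)) = k \<xi> * (weight (- \<sigma>) \<xi> * inv_fourier \<phi> \<xi>)"
          by (rule eventually_sequentiallyI[of m0]) (use m0 N in \<open>auto simp: indicator_def\<close>)
      qed
      have [measurable]: "ball (0::'a) R \<in> sets borel" for R by simp
      show "(\<lambda>\<xi>. indicator (ball 0 (N + real m)) \<xi> * (k \<xi> * (weight (- \<sigma>) \<xi> * inv_fourier \<phi> \<xi>)))
        \<in> borel_measurable lborel" for m
        by measurable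
      show "AE \<xi> in lborel. norm (indicator (ball 0 (N + real m)) \<xi>
        * (k \<xi> * (weight (- \<sigma>) \<xi> * inv_fourier \<phi> \<xi>))) \<le> cmod (k \<xi> * (weight (- \<sigma>) \<xi> * inv_fourier \<phi>
        \<xi>))" for m
        by (intro AE_I2) (auto simp: indicator_def)
    qed (use hdot_of_apply(2)[OF k t] in auto)
    have lim2: "(\<lambda>m. \<integral>x. f m x * \<phi> x \<partial>lborel) \<longlonglongrightarrow> (\<integral>x. w x * \<phi> x \<partial>lborel)"
    proof (rule Lim_null[THEN iffD2], rule Lim_null_comparison)
      have "norm ((\<integral>x. f m x * \<phi> x \<partial>lborel) - (\<integral>x. w x * \<phi> x \<partial>lborel))
        \<le> l2norm lborel (\<lambda>x. f m x - w x) * l2norm lborel \<phi>" for m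
        using sqint_cmult(2)[OF sqint_diff(1)[OF f w] \<phi>s, of m] sqint_cmult(1)[OF f \<phi>s, of m] wi
        by (simp add: left_diff_distrib)
      then show "\<forall>\<^sub>F m in sequentially. norm ((\<integral>x. f m x * \<phi> x \<partial>lborel) - (\<integral>x. w x * \<phi> x \<partial>lborel))
        \<le> l2norm lborel (\<lambda>x. f m x - w x) * l2norm lborel \<phi>"
        by simp
      show "(\<lambda>m. l2norm lborel (\<lambda>x. f m x - w x) * l2norm lborel \<phi>) \<longlonglongrightarrow> 0"
        by (rule tendsto_mult_left_zero[OF lim])
    qed
    have "(\<integral>x. f m x * \<phi> x \<partial>lborel) = (\<integral>x. u m x * \<phi> x \<partial>lborel) - (\<integral>x. u 0 x * \<phi> x \<partial>lborel)" for m
      using ui[of m] ui[of 0] by (simp add: f_def left_diff_distrib)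
    then have "(\<lambda>m. \<integral>x. f m x * \<phi> x \<partial>lborel) \<longlonglongrightarrow> hdot_of \<sigma> k \<phi> - (\<integral>x. u 0 x * \<phi> x \<partial>lborel)"
      using tendsto_diff[OF lim1 tendsto_const] by simp
    from LIMSEQ_unique[OF this lim2] have "hdot_of \<sigma> k \<phi> = (\<integral>x. u 0 x * \<phi> x \<partial>lborel)
      + (\<integral>x. w x * \<phi> x \<partial>lborel)"
      by (simp add: algebra_simps)
    then show "hdot_of \<sigma> k \<phi> = (\<integral>x. (u 0 x + w x) * \<phi> x \<partial>lborel)"
      using ui[of 0] wi by (simp add: distrib_right)
  qed
  from has_density_unique[OF v this] have ae: "AE x in lborel. w x = v x - LP N k x"
    by eventually_elim (simp add: u0)
  have m: "(\<lambda>x. v x - LP N k x) \<in> borel_measurable lborel" using um[of 0] unfolding u0 by simp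
  show "sqint lborel (\<lambda>x. v x - LP N k x)" by (rule sqint_cong_AE(1)[OF w m ae])
  show "l2norm lborel (\<lambda>x. v x - LP N k x) \<le> l2norm lborel (highp N k)"
    using sqint_cong_AE(2)[OF w m ae] wn by simp
qed

end

section \<open>Powers of extended nonnegative reals and mixed norms\<close>

lemma ennreal_powr_ennreal: "0 \<le> x \<Longrightarrow> ennreal_powr (ennreal x) a = ennreal (x powr a)"
  by (simp add: ennreal_powr_def)

lemma ennreal_powr_top [simp]: "ennreal_powr \<infinity> a = \<infinity>" "ennreal_powr top a = top"
  by (simp_all add: ennreal_powr_def)

lemma ennreal_powr_0 [simp]: "ennreal_powr 0 a = 0"
  by (simp add: ennreal_powr_def)

lemma ennreal_powr_powr: "ennreal_powr (ennreal_powr x a) b = ennreal_powr x (a * b)"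
  by (simp add: ennreal_powr_def powr_powr)

lemma ennreal_powr_1 [simp]: "ennreal_powr x 1 = x"
  by (simp add: ennreal_powr_def less_top)

lemma ennreal_powr_inverse: "a \<noteq> 0 \<Longrightarrow> ennreal_powr (ennreal_powr x (1 / a)) a = x"
  "a \<noteq> 0 \<Longrightarrow> ennreal_powr (ennreal_powr x a) (1 / a) = x"
  by (simp_all add: ennreal_powr_powr)

lemma ennreal_powr_mono: "x \<le> y \<Longrightarrow> 0 \<le> a \<Longrightarrow> ennreal_powr x a \<le> ennreal_powr y a"
  by (auto simp: ennreal_powr_def top_unique less_top intro!: ennreal_leI powr_mono2 enn2real_mono)

lemma ennreal_powr_eq_0_iff: "ennreal_powr x a = 0 \<longleftrightarrow> x = 0"
  by (cases x) (auto simp: ennreal_powr_def)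

lemma ennreal_powr_mult:
  assumes "c > 0"
  shows "ennreal_powr (ennreal c * x) a = ennreal (c powr a) * ennreal_powr x a"
proof (cases x)
  case (real y)
  then show ?thesis using assms
    by (simp add: ennreal_powr_ennreal powr_mult flip: ennreal_mult)
next
  case top
  then show ?thesis using assms by (simp add: ennreal_mult_top)
qed

lemma ennreal_powr_measurable [measurable]: "(\<lambda>x. ennreal_powr x a) \<in> borel_measurable borel"
  unfolding ennreal_powr_def by measurable

lemma esssup_le_iff:
  assumes f: "f \<in> borel_measurable M"
  shows "esssup M f \<le> c \<longleftrightarrow> (AE x in M. f x \<le> (c::ennreal))"
proof
  assume c: "esssup M f \<le> c"
  show "AE x in M. f x \<le> c"
    using esssup_AE[of f M] by eventually_elim (rule order_trans[OF _ c])
qed (rule esssup_I[OF f])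

text \<open>For infinite q measurability in t is read off sublevel sets: the essential supremum is
  at most c exactly when the section of the set where the modulus exceeds c has measure 0, and the
  measure of a section depends measurably on t.\<close>

lemma Lp_norm_section_measurable:
  fixes U :: "real \<times> 'a::euclidean_space \<Rightarrow> complex"
  assumes [measurable]: "U \<in> borel_measurable borel"
  shows "(\<lambda>t. Lp_norm q lborel (\<lambda>x. ennreal (cmod (U (t, x))))) \<in> borel_measurable borel"
proof (cases "q = \<infinity>")
  case False
  have "(\<lambda>t. \<integral>\<^sup>+x. ennreal_powr (ennreal (cmod (U (t, x)))) (enn2real q) \<partial>lborel)
    \<in> borel_measurable borel"
    by (rule lborel.borel_measurable_nn_integral) (simp add: borel_prod[symmetric])
  then show ?thesis using False unfolding Lp_norm_def by simp
next
  case True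
  have [measurable]: "(\<lambda>x. ennreal (cmod (U (t, x)))) \<in> borel_measurable lborel" for t by simp
  show ?thesis
  proof (rule borel_measurableI_le)
    fix c :: ennreal
    have "{t \<in> space borel. Lp_norm q lborel (\<lambda>x. ennreal (cmod (U (t, x)))) \<le> c} =
      {t. (\<integral>\<^sup>+x. indicator {z. \<not> ennreal (cmod (U z)) \<le> c} (t, x) \<partial>lborel) = 0}"
      using True
      by (subst nn_integral_0_iff_AE)
         (auto simp: Lp_norm_def esssup_le_iff indicator_def elim!: eventually_mono split:
           if_splits)
    also have "\<dots> \<in> sets borel"
    proof -
      have "(\<lambda>t. \<integral>\<^sup>+x. indicator {z. \<not> ennreal (cmod (U z)) \<le> c} (t, x) \<partial>lborel)
        \<in> borel_measurable borel"
      proof (rule lborel.borel_measurable_nn_integral)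
        have "{z. \<not> ennreal (cmod (U z)) \<le> c} \<in> sets borel" by measurable
        moreover have "sets (borel \<Otimes>\<^sub>M (lborel :: 'a measure)) = sets (borel :: (real \<times> 'a) measure)"
          by (simp add: borel_prod[symmetric] cong: sets_pair_measure_cong)
        ultimately have "indicator {z. \<not> ennreal (cmod (U z)) \<le> c}
          \<in> borel_measurable (borel \<Otimes>\<^sub>M (lborel :: 'a measure))"
          by (intro borel_measurable_indicator) simp
        then show "(\<lambda>(t, x). indicator {z. \<not> ennreal (cmod (U z)) \<le> c} (t, x) :: ennreal)
          \<in> borel_measurable (borel \<Otimes>\<^sub>M (lborel :: 'a measure))"
          by simp
      qed
      then show ?thesis by simp
    qed
    finally show "{t \<in> space borel. Lp_norm q lborel (\<lambda>x. ennreal (cmod (U (t, x)))) \<le> c}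
      \<in> sets borel" .
  qed
qed

lemma mixed_norm_diag:
  assumes "r > 0"
  shows "mixed_norm (ennreal r) (ennreal r) U =
    ennreal_powr (\<integral>\<^sup>+t. (\<integral>\<^sup>+x. ennreal (cmod (U (t, x)) powr r) \<partial>lborel) \<partial>lborel) (1 / r)"
  using assms by (simp add: mixed_norm_def Lp_norm_def ennreal_powr_inverse ennreal_powr_ennreal)

text \<open>Hoelder's inequality with exponents 1/\<alpha> and 1/(1 - \<alpha>), derived from
  Young's inequality for the two factors normalised by \<open>F0\<close> and \<open>G0\<close>. An
  integral that is 0 or infinite cannot be normalised and is treated apart.\<close>

lemma holder_interpolation:
  fixes v :: "'a \<Rightarrow> complex"
  assumes [measurable]: "v \<in> borel_measurable M"
    and G: "(\<integral>\<^sup>+x. ennreal (cmod (v x) powr Q) \<partial>M) \<le> ennreal G0" "G0 > 0"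
    and \<alpha>: "0 < \<alpha>" "\<alpha> < 1" and q: "q > 0"
  shows "(\<integral>\<^sup>+x. ennreal (cmod (v x) powr (\<alpha> * q + (1 - \<alpha>) * Q)) \<partial>M)
    \<le> ennreal_powr (\<integral>\<^sup>+x. ennreal (cmod (v x) powr q) \<partial>M) \<alpha> * ennreal (G0 powr (1 - \<alpha>))"
proof (cases "\<integral>\<^sup>+x. ennreal (cmod (v x) powr q) \<partial>M")
  case top
  then show ?thesis using G(2) by (simp add: ennreal_top_mult)
next
  case (real F0)
  show ?thesis
  proof (cases "F0 = 0")
    case True
    then have "AE x in M. ennreal (cmod (v x) powr q) = 0"
      using real by (subst nn_integral_0_iff_AE[symmetric]) auto
    then have "AE x in M. ennreal (cmod (v x) powr (\<alpha> * q + (1 - \<alpha>) * Q)) = 0"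
      by eventually_elim (auto simp: ennreal_eq_0_iff)
    then have "(\<integral>\<^sup>+x. ennreal (cmod (v x) powr (\<alpha> * q + (1 - \<alpha>) * Q)) \<partial>M) = 0"
      by (subst nn_integral_0_iff_AE) auto
    then show ?thesis by simp
  next
    case False
    with real have F0: "F0 > 0" by simp
    let ?K = "F0 powr \<alpha> * G0 powr (1 - \<alpha>)"
    have pw: "cmod (v x) powr (\<alpha> * q + (1 - \<alpha>) * Q) \<le> ?K * (\<alpha> / F0) * cmod (v x) powr q + ?K
      * ((1 - \<alpha>) / G0) * cmod (v x) powr Q" for x
    proof (cases "v x = 0")
      case False
      let ?c = "cmod (v x)"
      have "(?c powr q / F0) powr \<alpha> * (?c powr Q / G0) powr (1 - \<alpha>) \<le> \<alpha> * (?c powr q / F0) + (1 - \<alpha>)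
        * (?c powr Q / G0)"
        by (rule Youngs_inequality_0) (use \<alpha> F0 G(2) False in auto)
      moreover have "(?c powr q / F0) powr \<alpha> * (?c powr Q / G0) powr (1 - \<alpha>)
        = ?c powr (\<alpha> * q + (1 - \<alpha>) * Q) / ?K"
        using F0 G(2) by (simp add: powr_divide powr_powr powr_add mult.commute)
      ultimately have "?c powr (\<alpha> * q + (1 - \<alpha>) * Q) / ?K \<le> \<alpha> * (?c powr q / F0) + (1 - \<alpha>)
        * (?c powr Q / G0)" by simp
      moreover have "?K > 0" using F0 G(2) by simp
      ultimately have "?c powr (\<alpha> * q + (1 - \<alpha>) * Q)
        \<le> (\<alpha> * (?c powr q / F0) + (1 - \<alpha>) * (?c powr Q / G0)) * ?K"
        by (simp only: pos_divide_le_eq)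
      then show ?thesis by (simp add: algebra_simps)
    qed simp
    have "(\<integral>\<^sup>+x. ennreal (cmod (v x) powr (\<alpha> * q + (1 - \<alpha>) * Q)) \<partial>M)
      \<le> (\<integral>\<^sup>+x. ennreal (?K * (\<alpha> / F0)) * ennreal (cmod (v x) powr q) + ennreal (?K * ((1 - \<alpha>) / G0))
        * ennreal (cmod (v x) powr Q) \<partial>M)"
      using pw \<alpha> F0 G(2)
        by (intro nn_integral_mono) (simp flip: ennreal_mult ennreal_plus add: ennreal_leI)
    also have "\<dots> = ennreal (?K * (\<alpha> / F0)) * ennreal F0 + ennreal (?K * ((1 - \<alpha>) / G0))
      * (\<integral>\<^sup>+x. ennreal (cmod (v x) powr Q) \<partial>M)"
      using real by (simp add: nn_integral_add nn_integral_cmult)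
    also have "\<dots> \<le> ennreal (?K * (\<alpha> / F0)) * ennreal F0 + ennreal (?K * ((1 - \<alpha>) / G0))
      * ennreal G0"
      by (intro add_left_mono mult_left_mono G) simp
    also have "\<dots> = ennreal (?K * (\<alpha> / F0) * F0 + ?K * ((1 - \<alpha>) / G0) * G0)"
      using \<alpha> F0 G(2) by (simp flip: ennreal_mult ennreal_plus)
    also have "?K * (\<alpha> / F0) * F0 + ?K * ((1 - \<alpha>) / G0) * G0 = ?K"
    proof -
      have "?K * (\<alpha> / F0) * F0 = ?K * \<alpha>" "?K * ((1 - \<alpha>) / G0) * G0 = ?K * (1 - \<alpha>)" using F0 G(2)
        by simp_all
      then show ?thesis by (simp only: distrib_left[symmetric]) simp
    qed
    also have "ennreal ?K = ennreal_powr (ennreal F0) \<alpha> * ennreal (G0 powr (1 - \<alpha>))"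
      using F0 by (simp add: ennreal_powr_ennreal ennreal_mult)
    finally show ?thesis unfolding real .
  qed
qed

text \<open>The exponent is the one for which the Lq norm occurs exactly to the power p. After
  integration in time this becomes the p-th power of the Strichartz norm.\<close>

lemma Lp_interpolation:
  fixes v :: "'a \<Rightarrow> complex" and p q :: ennreal
  assumes v [measurable]: "v \<in> borel_measurable M"
    and G: "(\<integral>\<^sup>+x. ennreal (cmod (v x) powr Q) \<partial>M) \<le> ennreal G0" "G0 > 0"
    and pq: "0 < p" "p < q"
    and \<theta>: "\<theta> = (if q = \<infinity> then 1 else 1 - enn2real p / enn2real q)"
  shows "(\<integral>\<^sup>+x. ennreal (cmod (v x) powr (enn2real p + \<theta> * Q)) \<partial>M)
    \<le> ennreal_powr (Lp_norm q M (\<lambda>x. ennreal (cmod (v x)))) (enn2real p) * ennreal (G0 powr \<theta>)"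
proof -
  have pf: "p \<noteq> \<infinity>" using less_le_trans[OF pq(2) top_greatest] by auto
  define P where "P = enn2real p"
  have P: "p = ennreal P" "P > 0"
    using pf pq by (auto simp: P_def enn2real_positive_iff less_top)
  show ?thesis
  proof (cases "q = \<infinity>")
    case False
    define q' where "q' = enn2real q"
    have q': "q = ennreal q'" using False by (simp add: q'_def less_top)
    have Pq: "P < q'" using pq(2) P unfolding q' by (simp add: ennreal_less_iff)
    have \<theta>': "\<theta> = 1 - P / q'" unfolding \<theta> P_def q'_def using False by simp
    have e: "P / q' * q' + (1 - P / q') * Q = P + \<theta> * Q"
      using Pq P(2) by (simp add: \<theta>')
    have N: "ennreal_powr (Lp_norm q M (\<lambda>x. ennreal (cmod (v x)))) P
      = ennreal_powr (\<integral>\<^sup>+x. ennreal (cmod (v x) powr q') \<partial>M) (P / q')"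
      using False by (simp add: Lp_norm_def ennreal_powr_powr ennreal_powr_ennreal q'_def)
    show ?thesis
      using holder_interpolation[OF v G, of "P / q'" q'] P(2) Pq
      unfolding e P_def[symmetric] N \<theta>' by simp
  next
    case True
    let ?S = "esssup M (\<lambda>x. ennreal (cmod (v x)))"
    have N: "Lp_norm q M (\<lambda>x. ennreal (cmod (v x))) = ?S" using True by (simp add: Lp_norm_def)
    have \<theta>1: "\<theta> = 1" using True \<theta> by simp
    have "AE x in M. ennreal (cmod (v x)) \<le> ?S" by (rule esssup_AE)
    then have "AE x in M. ennreal (cmod (v x) powr (P + 1 * Q)) \<le> ennreal_powr ?S P
      * ennreal (cmod (v x) powr Q)"
    proof eventually_elim
      fix x assume "ennreal (cmod (v x)) \<le> ?S"
      then have "ennreal_powr (ennreal (cmod (v x))) P \<le> ennreal_powr ?S P" using P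
        by (intro ennreal_powr_mono) auto
      then have "ennreal (cmod (v x) powr P) * ennreal (cmod (v x) powr Q)
        \<le> ennreal_powr ?S P * ennreal (cmod (v x) powr Q)"
        by (intro mult_right_mono) (auto simp: ennreal_powr_ennreal)
      then show "ennreal (cmod (v x) powr (P + 1 * Q)) \<le> ennreal_powr ?S P
        * ennreal (cmod (v x) powr Q)"
        by (simp add: powr_add ennreal_mult)
    qed
    then have "(\<integral>\<^sup>+x. ennreal (cmod (v x) powr (P + 1 * Q)) \<partial>M)
      \<le> (\<integral>\<^sup>+x. ennreal_powr ?S P * ennreal (cmod (v x) powr Q) \<partial>M)"
      by (rule nn_integral_mono_AE)
    also have "\<dots> = ennreal_powr ?S P * (\<integral>\<^sup>+x. ennreal (cmod (v x) powr Q) \<partial>M)"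
      by (simp add: nn_integral_cmult)
    also have "\<dots> \<le> ennreal_powr ?S P * ennreal G0" by (intro mult_left_mono G) simp
    finally show ?thesis using G(2) unfolding N \<theta>1 P_def[symmetric] by simp
  qed
qed

section \<open>The refined Sobolev inequality\<close>

context sobolev_index
begin

text \<open>By Bernstein's inequality the supremum norm of a low-pass part grows like N to this
  power. The exponent defined next is 2d/(d - 2\<sigma>), that of the Sobolev embedding.\<close>

definition bernstein_exp :: real where "bernstein_exp = real DIM('a) / 2 - \<sigma>"
definition sobolev_exp :: real where "sobolev_exp = real DIM('a) / bernstein_exp"
text \<open>The first 4 is from Chebyshev's inequality at height l/2, the quotient from the two
  integrations of powers of l, and the power of 4 from the range of heights that meet a given
  frequency.\<close>

definition sobolev_const :: real
    where "sobolev_const = 4 * sobolev_exp / (sobolev_exp - 2) * 4 powr (sobolev_exp - 2)"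

lemma bernstein_exp_pos: "bernstein_exp > 0" using \<sigma> by (simp add: bernstein_exp_def)

text \<open>This identity makes the powers of |\<xi>| cancel in
  \<open>refined_sobolev\<close>.\<close>

lemma bernstein_exp_sobolev_exp: "bernstein_exp * (sobolev_exp - 2) = 2 * \<sigma>"
  using bernstein_exp_pos
    by (simp add: sobolev_exp_def right_diff_distrib) (simp add: bernstein_exp_def)

lemma sobolev_exp_gt_2: "sobolev_exp > 2"
proof -
  have "0 < bernstein_exp * (sobolev_exp - 2)" using \<sigma> bernstein_exp_sobolev_exp by simp
  then show ?thesis using bernstein_exp_pos by (simp add: zero_less_mult_iff)
qed

lemma sobolev_const_pos: "sobolev_const > 0" using sobolev_exp_gt_2 by (simp add: sobolev_const_def)

lemma nn_integral_level_sets: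
  fixes v :: "'a \<Rightarrow> complex"
  assumes [measurable]: "v \<in> borel_measurable borel" and Q: "Q > 0"
  shows "(\<integral>\<^sup>+x. ennreal (cmod (v x) powr Q) \<partial>lborel) =
    (\<integral>\<^sup>+l. ennreal (indicator {0<..} l * (Q * l powr (Q - 1))) * emeasure lborel {x. l < cmod (v x)}
      \<partial>lborel)"
proof -
  have "(\<integral>\<^sup>+x. ennreal (cmod (v x) powr Q) \<partial>lborel) =
    (\<integral>\<^sup>+x. (\<integral>\<^sup>+l. ennreal (indicator {0<..<cmod (v x)} l * (Q * l powr (Q - 1))) \<partial>lborel) \<partial>lborel)"
    using Q by (intro nn_integral_cong) (simp add: nn_integral_powr_Ioo)
  also have "\<dots> = (\<integral>\<^sup>+x. (\<integral>\<^sup>+l. ennreal (indicator {0<..} l * (Q * l powr (Q - 1)))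
    * indicator {z. fst z < cmod (v (snd z))} (l, x) \<partial>lborel) \<partial>lborel)"
    by (intro nn_integral_cong) (auto simp: indicator_def)
  also have "\<dots> = (\<integral>\<^sup>+l. (\<integral>\<^sup>+x. ennreal (indicator {0<..} l * (Q * l powr (Q - 1)))
    * indicator {z. fst z < cmod (v (snd z))} (l, x) \<partial>lborel) \<partial>lborel)"
    by (rule lborel_pair.Fubini') measurable
  also have "\<dots> = (\<integral>\<^sup>+l. ennreal (indicator {0<..} l * (Q * l powr (Q - 1))) * emeasure lborel {x. l
    < cmod (v x)} \<partial>lborel)"
  proof (rule nn_integral_cong)
    fix l :: real
    have "(\<integral>\<^sup>+x. indicator {z. fst z < cmod (v (snd z))} (l, x) \<partial>(lborel :: 'a measure))
      = (\<integral>\<^sup>+x. indicator {x. l < cmod (v x)} x \<partial>lborel)"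
      by (intro nn_integral_cong) (auto simp: indicator_def)
    also have "\<dots> = emeasure lborel {x. l < cmod (v x)}" by (rule nn_integral_indicator) measurable
    finally have "(\<integral>\<^sup>+x. indicator {z. fst z < cmod (v (snd z))} (l, x) \<partial>(lborel :: 'a measure))
      = emeasure lborel {x. l < cmod (v x)}" .
    then show "(\<integral>\<^sup>+x. ennreal (indicator {0<..} l * (Q * l powr (Q - 1))) * indicator {z. fst z
      < cmod (v (snd z))} (l, x) \<partial>(lborel :: 'a measure)) =
       ennreal (indicator {0<..} l * (Q * l powr (Q - 1))) * emeasure lborel {x. l < cmod (v x)}"
      by (subst nn_integral_cmult) auto
  qed
  finally show ?thesis .
qed

text \<open>Layer-cake formula with a cut-off depending on the height. Chebyshev's inequality bounds
  each level set by the high-pass energy; after exchanging height and frequency, a frequency \<xi>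
  meets only heights up to a multiple of B |\<xi>|^\<open>bernstein_exp\<close>. Integrating over
  those heights gives B^(\<open>sobolev_exp\<close> - 2) |\<xi>|^(2\<sigma>), and the last factor
  cancels the weight.\<close>

lemma refined_sobolev:
  assumes k: "sqint lborel k" and v: "has_density v (hdot_of \<sigma> k)"
    and vm [measurable]: "v \<in> borel_measurable borel"
    and B: "B > 0" "\<And>N x. N > 0 \<Longrightarrow> cmod (LP N k x) \<le> B * N powr bernstein_exp"
  shows "(\<integral>\<^sup>+x. ennreal (cmod (v x) powr sobolev_exp) \<partial>lborel)
    \<le> ennreal (sobolev_const * B powr (sobolev_exp - 2) * (l2norm lborel k)\<^sup>2)"
proof -
  have [measurable]: "k \<in> borel_measurable borel" using k by (simp add: sqint_def)
  \<comment> \<open>At this cut-off the low-pass part is at most \<open>l/2\<close>, so only the high-pass part contributes to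
    the level set at height \<open>l\<close>.\<close>
  define N where "N l = (l / (2 * B)) powr (1 / bernstein_exp)" for l
  have Npos: "N l > 0" if "l > 0" for l using that B by (simp add: N_def)
  have Nsa: "N l powr bernstein_exp = l / (2 * B)" if "l > 0" for l using that B bernstein_exp_pos
    by (simp add: N_def powr_powr)
  have [measurable]: "N \<in> borel_measurable borel" unfolding N_def by measurable
  \<comment> \<open>The squared modulus of \<open>highp (N l) k\<close>, written out so that joint
    measurability in l and \<xi> is visible for Tonelli's theorem.\<close>
  define h where "h l \<xi> = (if N l \<le> norm \<xi> then (norm \<xi> powr (- \<sigma>) * cmod (k \<xi>))\<^sup>2 else 0)" for l
    and \<xi> :: 'a
  have hm [measurable]: "(\<lambda>z. h (fst z) (snd z)) \<in> borel_measurable (borel \<Otimes>\<^sub>M borel)"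
    unfolding h_def by measurable
  have level: "emeasure lborel {x. l < cmod (v x)} \<le> ennreal (4 / l\<^sup>2)
    * (\<integral>\<^sup>+\<xi>. ennreal (h l \<xi>) \<partial>lborel)" if l: "l > 0" for l
  proof -
    note W = has_density_highp[OF k v vm Npos[OF l]]
    have "emeasure lborel {x. l < cmod (v x)} = (\<integral>\<^sup>+x. indicator {x. l < cmod (v x)} x \<partial>lborel)"
      by simp
    also have "\<dots> \<le> (\<integral>\<^sup>+x. ennreal (4 / l\<^sup>2) * ennreal ((norm (v x - LP (N l) k x))\<^sup>2) \<partial>lborel)"
    proof (rule nn_integral_mono)
      fix x
      show "indicator {x. l < cmod (v x)} x \<le> ennreal (4 / l\<^sup>2)
        * ennreal ((norm (v x - LP (N l) k x))\<^sup>2)"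
      proof (cases "l < cmod (v x)")
        case True
        have "cmod (LP (N l) k x) \<le> l / 2" using B(2)[OF Npos[OF l], of x] Nsa[OF l] B(1) by simp
        then have "l / 2 \<le> norm (v x - LP (N l) k x)"
          using True norm_triangle_ineq2[of "v x" "LP (N l) k x"] by linarith
        then have "(l / 2)\<^sup>2 \<le> (norm (v x - LP (N l) k x))\<^sup>2" using l by (intro power_mono) auto
        then have "1 \<le> 4 / l\<^sup>2 * (norm (v x - LP (N l) k x))\<^sup>2" using l
          by (simp add: power_divide field_simps)
        then have "ennreal 1 \<le> ennreal (4 / l\<^sup>2 * (norm (v x - LP (N l) k x))\<^sup>2)"
          by (rule ennreal_leI)
        also have "\<dots> = ennreal (4 / l\<^sup>2) * ennreal ((norm (v x - LP (N l) k x))\<^sup>2)"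
          by (rule ennreal_mult) auto
        finally show ?thesis using True by simp
      qed simp
    qed
    also have "\<dots> = ennreal (4 / l\<^sup>2) * ennreal ((l2norm lborel (\<lambda>x. v x - LP (N l) k x))\<^sup>2)"
      using sqint_measurable[OF W(1)] by (simp add: nn_integral_cmult nn_integral_l2norm[OF W(1)])
    also have "\<dots> \<le> ennreal (4 / l\<^sup>2) * ennreal ((l2norm lborel (highp (N l) k))\<^sup>2)"
      by (intro mult_left_mono ennreal_leI power_mono W) auto
    also have "ennreal ((l2norm lborel (highp (N l) k))\<^sup>2) = (\<integral>\<^sup>+\<xi>. ennreal (h l \<xi>) \<partial>lborel)"
      unfolding nn_integral_l2norm[OF highp_sqint(1)[OF k Npos[OF l]], symmetric]
      by (intro nn_integral_cong) (auto simp: highp_def h_def norm_mult indicator_def)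
    finally show ?thesis .
  qed
  have Q0: "sobolev_exp > 0" using sobolev_exp_gt_2 by simp
  have hz: "(\<integral>\<^sup>+l. ennreal (indicator {0<..} l * (4 * sobolev_exp * l powr (sobolev_exp - 3))
    * h l \<xi>) \<partial>lborel) \<le> ennreal (sobolev_const * B powr (sobolev_exp - 2) * (cmod (k \<xi>))\<^sup>2)"
    if \<xi>: "\<xi> \<noteq> 0" for \<xi> :: 'a
  proof -
    \<comment> \<open>The condition N l \<le> |\<xi>| means l \<le> 2 B
      |\<xi>|^\<open>bernstein_exp\<close>; the factor 4 makes the inequality strict, so that l lies
      in an open interval.\<close>
    let ?y = "4 * B * norm \<xi> powr bernstein_exp"
    let ?c = "4 * sobolev_exp / (sobolev_exp - 2) * (norm \<xi> powr (- \<sigma>) * cmod (k \<xi>))\<^sup>2"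
    have c0: "?c \<ge> 0" using sobolev_exp_gt_2 by simp
    have y0: "?y > 0" using \<xi> B by simp
    have "(\<integral>\<^sup>+l. ennreal (indicator {0<..} l * (4 * sobolev_exp * l powr (sobolev_exp - 3)) * h l \<xi>)
      \<partial>lborel)
      \<le> (\<integral>\<^sup>+l. ennreal ?c * ennreal (indicator {0<..<?y} l * ((sobolev_exp - 2) * l powr
        (sobolev_exp - 2 - 1))) \<partial>lborel)"
    proof (rule nn_integral_mono)
      fix l :: real
      show "ennreal (indicator {0<..} l * (4 * sobolev_exp * l powr (sobolev_exp - 3)) * h l \<xi>)
        \<le> ennreal ?c * ennreal (indicator {0<..<?y} l * ((sobolev_exp - 2) * l powr
        (sobolev_exp - 2 - 1)))"
      proof (cases "l > 0 \<and> N l \<le> norm \<xi>")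
        case True
        then have "N l powr bernstein_exp \<le> norm \<xi> powr bernstein_exp"
          using bernstein_exp_pos Npos[of l] by (intro powr_mono2) auto
        then have "l \<le> 2 * B * norm \<xi> powr bernstein_exp" using Nsa[of l] True B(1)
          by (simp add: field_simps)
        also have "\<dots> < ?y" using B \<xi> by simp
        finally have ly: "l < ?y" .
        have "indicator {0<..} l * (4 * sobolev_exp * l powr (sobolev_exp - 3)) * h l \<xi>
          = ?c * (indicator {0<..<?y} l * ((sobolev_exp - 2) * l powr (sobolev_exp - 2 - 1)))"
          using True ly sobolev_exp_gt_2 by (simp add: h_def)
        then have "ennreal (indicator {0<..} l * (4 * sobolev_exp * l powr (sobolev_exp - 3))
          * h l \<xi>) = ennreal (?c * (indicator {0<..<?y} l * ((sobolev_exp - 2) * l powr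
          (sobolev_exp - 2 - 1))))"
          by simp
        also have "\<dots> = ennreal ?c * ennreal (indicator {0<..<?y} l
          * ((sobolev_exp - 2) * l powr (sobolev_exp - 2 - 1)))"
          using sobolev_exp_gt_2 by (intro ennreal_mult c0) auto
        finally show ?thesis by simp
      qed (auto simp: h_def)
    qed
    also have "\<dots> = ennreal ?c * ennreal (?y powr (sobolev_exp - 2))"
      by (subst nn_integral_cmult, measurable, subst nn_integral_powr_Ioo)
        (use sobolev_exp_gt_2 y0 in auto)
    also have "\<dots> = ennreal (?c * ?y powr (sobolev_exp - 2))"
      by (rule ennreal_mult[symmetric, OF c0]) simp
    also have "?c * ?y powr (sobolev_exp - 2) = sobolev_const * B powr (sobolev_exp - 2)
      * (cmod (k \<xi>))\<^sup>2"
    proof -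
      have y: "?y powr (sobolev_exp - 2) = 4 powr (sobolev_exp - 2) * B powr (sobolev_exp - 2)
        * norm \<xi> powr (2 * \<sigma>)"
        using B bernstein_exp_sobolev_exp by (simp add: powr_mult powr_powr)
      have uw: "(norm \<xi> powr (- \<sigma>))\<^sup>2 * norm \<xi> powr (2 * \<sigma>) = 1"
        using \<xi> by (simp add: sqrt_powr flip: powr_add)
      have alg: "c * (u * K) * (f * b * w) = (c * f) * b * K" if "u * w = 1" for c u K f b w :: real
      proof -
        have "c * (u * K) * (f * b * w) = (c * f) * b * K * (u * w)" by (simp only: mult_ac)
        then show ?thesis using that by simp
      qed
      show ?thesis unfolding y power_mult_distrib sobolev_const_def by (rule alg[OF uw])
    qed
    finally show ?thesis .
  qed
  have "(\<integral>\<^sup>+x. ennreal (cmod (v x) powr sobolev_exp) \<partial>lborel) =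
    (\<integral>\<^sup>+l. ennreal (indicator {0<..} l * (sobolev_exp * l powr (sobolev_exp - 1))) * emeasure lborel
      {x. l < cmod (v x)} \<partial>lborel)"
    by (rule nn_integral_level_sets[OF vm Q0])
  also have "\<dots>
    \<le> (\<integral>\<^sup>+l. (\<integral>\<^sup>+\<xi>. ennreal (indicator {0<..} l * (4 * sobolev_exp * l powr (sobolev_exp - 3)) * h l
    \<xi>) \<partial>lborel) \<partial>lborel)"
  proof (rule nn_integral_mono)
    fix l :: real
    show "ennreal (indicator {0<..} l * (sobolev_exp * l powr (sobolev_exp - 1)))
      * emeasure lborel {x. l < cmod (v x)}
      \<le> (\<integral>\<^sup>+\<xi>. ennreal (indicator {0<..} l * (4 * sobolev_exp * l powr (sobolev_exp - 3)) * h l \<xi>)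
        \<partial>lborel)"
    proof (cases "l > 0")
      case True
      have e: "l powr (sobolev_exp - 1) * (4 / l\<^sup>2) = 4 * l powr (sobolev_exp - 3)"
      proof -
        have "l powr (sobolev_exp - 1) = l powr (sobolev_exp - 3) * l powr 2"
          by (simp flip: powr_add)
        then show ?thesis using True by (simp add: powr_realpow[of l 2, simplified])
      qed
      have "ennreal (sobolev_exp * l powr (sobolev_exp - 1)) * emeasure lborel {x. l < cmod (v x)}
        \<le> ennreal (sobolev_exp * l powr (sobolev_exp - 1)) *
          (ennreal (4 / l\<^sup>2) * (\<integral>\<^sup>+\<xi>. ennreal (h l \<xi>) \<partial>lborel))"
        by (intro mult_left_mono level True) simp
      also have "\<dots> = ennreal (4 * sobolev_exp * l powr (sobolev_exp - 3))
        * (\<integral>\<^sup>+\<xi>. ennreal (h l \<xi>) \<partial>lborel)"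
      proof -
        have e2: "sobolev_exp * l powr (sobolev_exp - 1) * (4 / l\<^sup>2)
          = 4 * sobolev_exp * l powr (sobolev_exp - 3)"
          unfolding mult.assoc e by (simp only: mult.left_commute)
        have "ennreal (sobolev_exp * l powr (sobolev_exp - 1)) * ennreal (4 / l\<^sup>2)
          = ennreal (4 * sobolev_exp * l powr (sobolev_exp - 3))"
          unfolding e2[symmetric] using Q0 by (intro ennreal_mult[symmetric]) auto
        then show ?thesis by (simp only: mult.assoc[symmetric])
      qed
      also have "\<dots> = (\<integral>\<^sup>+\<xi>. ennreal (4 * sobolev_exp * l powr (sobolev_exp - 3) * h l \<xi>) \<partial>lborel)"
      proof -
        have [measurable]: "h l \<in> borel_measurable borel" unfolding h_def by measurable
        have h0: "0 \<le> h l \<xi>" for \<xi> by (simp add: h_def)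
        show ?thesis using Q0 h0 by (subst nn_integral_cmult[symmetric]) (auto simp: ennreal_mult)
      qed
      finally show ?thesis using True by simp
    qed simp
  qed
  also have "\<dots>
    = (\<integral>\<^sup>+\<xi>. (\<integral>\<^sup>+l. ennreal (indicator {0<..} l * (4 * sobolev_exp * l powr (sobolev_exp - 3)) * h l
    \<xi>) \<partial>lborel) \<partial>lborel)"
    using hm by (intro lborel_pair.Fubini'[symmetric]) (auto simp: split_beta' cong:
      measurable_cong_sets)
  also have "\<dots> \<le> (\<integral>\<^sup>+\<xi>. ennreal (sobolev_const * B powr (sobolev_exp - 2) * (cmod (k \<xi>))\<^sup>2) \<partial>lborel)"
    by (rule nn_integral_mono_AE) (use AE_nonzero hz in \<open>auto elim: eventually_mono\<close>)
  also have "\<dots> = ennreal (sobolev_const * B powr (sobolev_exp - 2)) * ennreal ((l2norm lborel k)\<^sup>2)"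
    unfolding nn_integral_l2norm[OF k, symmetric] using sobolev_const_pos
    by (subst nn_integral_cmult[symmetric]) (auto simp: ennreal_mult)
  also have "\<dots> = ennreal (sobolev_const * B powr (sobolev_exp - 2) * (l2norm lborel k)\<^sup>2)"
    using sobolev_const_pos by (intro ennreal_mult[symmetric]) auto
  finally show ?thesis .
qed

end

section \<open>Vector valued data and Fourier multipliers\<close>

lemma norm_vec_power2: "(norm (x :: complex^'n))\<^sup>2 = (\<Sum>i\<in>UNIV. (cmod (x $ i))\<^sup>2)"
  by (simp add: norm_vec_def L2_set_def sum_nonneg)

lemma vec_nth_measurable [measurable]: "(\<lambda>x :: complex^'n. x $ i) \<in> borel_measurable borel"
  by (intro borel_measurable_continuous_onI continuous_intros)

lemma vec_measurableI:
  fixes K :: "'a \<Rightarrow> complex^'n"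
  assumes "\<And>i. (\<lambda>x. K x $ i) \<in> borel_measurable M"
  shows "K \<in> borel_measurable M"
proof (subst borel_measurable_euclidean_space, intro ballI)
  fix b :: "complex^'n" assume "b \<in> Basis"
  then obtain i c where b: "b = axis i c" by (auto simp: Basis_vec_def)
  show "(\<lambda>x. K x \<bullet> b) \<in> borel_measurable M"
    unfolding b inner_axis using assms by simp
qed

lemma sqint_vec:
  fixes K :: "'a \<Rightarrow> complex^'n"
  assumes "\<And>i. sqint M (\<lambda>x. K x $ i)"
  shows "sqint M K" "(l2norm M K)\<^sup>2 = (\<Sum>i\<in>UNIV. (l2norm M (\<lambda>x. K x $ i))\<^sup>2)"
proof -
  show "sqint M K"
    unfolding sqint_def norm_vec_power2
    using assms by (auto simp: sqint_def intro!: vec_measurableI)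
  show "(l2norm M K)\<^sup>2 = (\<Sum>i\<in>UNIV. (l2norm M (\<lambda>x. K x $ i))\<^sup>2)"
    unfolding l2norm_power2 norm_vec_power2
    using assms by (intro Bochner_Integration.integral_sum) (simp add: sqint_def)
qed

text \<open>\<open>hdot_of\<close> applied componentwise, so that the product space is parametrised
  by vector-valued L2 functions.\<close>

definition datum :: "real^'n \<Rightarrow> ('a::euclidean_space \<Rightarrow> complex^'n) \<Rightarrow> ('a distribution)^'n"
  where "datum s K = (\<chi> i. hdot_of (s $ i) (\<lambda>\<xi>. K \<xi> $ i))"

lemma datum_nth: "datum s K $ i = hdot_of (s $ i) (\<lambda>\<xi>. K \<xi> $ i)"
  by (simp add: datum_def)

lemma datum_in: "sqint lborel K \<Longrightarrow> datum s K \<in> hdot_prod s"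
  by (simp add: hdot_prod_def datum_nth hdot_of_in_hdot sqint_nth)

lemma datum_surj:
  assumes "f \<in> hdot_prod s"
  shows "\<exists>K. sqint lborel K \<and> f = datum s K"
proof -
  have "\<forall>i. \<exists>k. sqint lborel k \<and> f $ i = hdot_of (s $ i) k"
    using assms hdot_rep by (auto simp: hdot_prod_def)
  then obtain k where k: "\<And>i. sqint lborel (k i)" "\<And>i. f $ i = hdot_of (s $ i) (k i)" by metis
  have "sqint lborel (\<lambda>\<xi>. \<chi> i. k i \<xi>)" by (rule sqint_vec(1)) (simp add: k)
  moreover have "f = datum s (\<lambda>\<xi>. \<chi> i. k i \<xi>)" by (simp add: vec_eq_iff datum_nth k)
  ultimately show ?thesis by blast
qed

lemma datum_inj:
  assumes "sqint lborel K" "sqint lborel K'" "datum s K = datum s K'"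
  shows "AE \<xi> in lborel. K \<xi> = K' \<xi>"
proof -
  have "AE \<xi> in lborel. K \<xi> $ i = K' \<xi> $ i" for i
    using assms by (intro hdot_of_inj[of _ _ "s $ i"] sqint_nth) (auto simp: vec_eq_iff datum_nth)
  then have "AE \<xi> in lborel. \<forall>i\<in>UNIV. K \<xi> $ i = K' \<xi> $ i" by (subst AE_finite_all) auto
  then show ?thesis by eventually_elim (simp add: vec_eq_iff)
qed

lemma datum_cong_AE:
  assumes "sqint lborel K" "sqint lborel K'" "AE \<xi> in lborel. K \<xi> = K' \<xi>"
  shows "datum s K = datum s K'"
proof (subst vec_eq_iff, rule allI)
  fix i
  have "AE \<xi> in lborel. K \<xi> $ i = K' \<xi> $ i" using assms(3) by eventually_elim simp
  then show "datum s K $ i = datum s K' $ i"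
    unfolding datum_nth using assms by (intro hdot_of_cong_AE sqint_nth)
qed

lemma datum_norm:
  assumes "sqint lborel K"
  shows "hdot_prod_norm s (datum s K) = l2norm lborel K"
proof -
  have "(\<Sum>i\<in>UNIV. (hdot_norm (s $ i) (datum s K $ i))\<^sup>2) = (l2norm lborel K)\<^sup>2"
    unfolding sqint_vec(2)[of lborel K, OF sqint_nth(1)[OF assms]] datum_nth
    by (simp add: hdot_norm_hdot_of[OF sqint_nth(1)[OF assms]])
  then show ?thesis by (simp add: hdot_prod_norm_def)
qed

lemma datum_diff:
  assumes "sqint lborel K" "sqint lborel K'"
  shows "datum s (\<lambda>\<xi>. K \<xi> - K' \<xi>) = datum s K - datum s K'"
  by (simp add: vec_eq_iff datum_nth hdot_of_linear[OF sqint_nth(1)[OF assms(1)]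
    sqint_nth(1)[OF assms(2)]] fun_eq_iff)

text \<open>Completeness of Lebesgue measure. The symbol is an arbitrary function, so measurability
  of its product with a transform is inherited from an almost everywhere equal function.\<close>

lemma sqint_AE_lebesgue:
  fixes g g' :: "'a::euclidean_space \<Rightarrow> complex"
  assumes "g' \<in> borel_measurable lebesgue" "AE \<xi> in lborel. g \<xi> = g' \<xi>"
  shows "g \<in> borel_measurable lebesgue"
proof (rule measurableI)
  fix A :: "complex set" assume A: "A \<in> sets borel"
  show "g -` A \<inter> space lebesgue \<in> sets lebesgue"
  proof (rule completion.in_sets_AE)
    show "AE x in lebesgue. (x \<in> g' -` A \<inter> space lebesgue) = (x \<in> g -` A \<inter> space lebesgue)"
      using AE_completion[OF assms(2)] by eventually_elim auto
    show "g' -` A \<inter> space lebesgue \<in> sets lebesgue" using assms(1) A by (rule measurable_sets)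
  qed simp
qed simp

definition weight_vec :: "real^'n \<Rightarrow> 'a::euclidean_space \<Rightarrow> complex^'n \<Rightarrow> complex^'n"
  where "weight_vec s \<xi> x = (\<chi> i. weight (- (s $ i)) \<xi> * x $ i)"

lemma weight_vec_inj: "\<xi> \<noteq> 0 \<Longrightarrow> weight_vec s \<xi> x = weight_vec s \<xi> y \<Longrightarrow> x = y"
  by (auto simp: weight_vec_def vec_eq_iff weight_def)

lemma weight_vec_diff: "weight_vec s \<xi> (x - y) = weight_vec s \<xi> x - weight_vec s \<xi> y"
  by (simp add: weight_vec_def vec_eq_iff right_diff_distrib)

lemma weight_vec_cmult: "weight_vec s \<xi> (c *s x) = c *s weight_vec s \<xi> x"
  by (simp add: weight_vec_def vec_eq_iff)

text \<open>\<open>K'\<close> is the image of \<open>K\<close> under the symbol \<open>m\<close>, conjugated with the Sobolev weights.\<close>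

definition multiplier_rel :: "real^'n \<Rightarrow> ('a::euclidean_space \<Rightarrow> complex^'n^'n) \<Rightarrow> ('a \<Rightarrow> complex^'n) \<Rightarrow>
    ('a \<Rightarrow> complex^'n) \<Rightarrow> bool"
  where "multiplier_rel s m K K' \<longleftrightarrow> sqint lborel K \<and> sqint lborel K'
    \<and> (AE \<xi> in lborel. weight_vec s \<xi> (K' \<xi>) = m \<xi> *v weight_vec s \<xi> (K \<xi>))"

lemma fourier_vec_datum:
  assumes "sqint lborel K"
  shows "AE \<xi> in lborel. fourier_vec s (datum s K) \<xi> = weight_vec s \<xi> (K \<xi>)"
proof -
  have "AE \<xi> in lborel. \<forall>i\<in>UNIV. fourier_dist (s $ i) (datum s K $ i) \<xi> = weight (- (s $ i)) \<xi>
    * K \<xi> $ i"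
    unfolding datum_nth
      by (subst AE_finite_all) (auto intro!: fourier_dist_hdot_of(1) sqint_nth assms)
  then show ?thesis
    by eventually_elim (simp add: vec_eq_iff fourier_vec_def weight_vec_def)
qed

text \<open>Together with the converse that follows, this turns multipliers on distributions into a
  relation between L2 functions holding pointwise in frequency, where linearity, phases and
  uniqueness are evident.\<close>

lemma multiplier_rel_of_domain:
  assumes K: "sqint lborel K" and dom: "datum s K \<in> multiplier_domain s m"
  shows "\<exists>K'. multiplier_rel s m K K' \<and> multiplier s m (datum s K) = datum s K'"
proof -
  let ?g = "\<lambda>i \<xi>. (m \<xi> *v fourier_vec s (datum s K) \<xi>) $ i"
  have "\<forall>i. \<exists>k. sqint lborel k \<and> (AE \<xi> in lborel. ?g i \<xi> = weight (- (s $ i)) \<xi> * k \<xi>)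
    \<and> inv_fourier_dist (s $ i) (?g i) = hdot_of (s $ i) k"
    using dom by (intro allI weighted_L2_rep) (simp add: multiplier_domain_def)
  from choice[OF this] obtain k
    where kk: "\<forall>i. sqint lborel (k i) \<and> (AE \<xi> in lborel. ?g i \<xi> = weight (- (s $ i)) \<xi> * k i \<xi>)
    \<and> inv_fourier_dist (s $ i) (?g i) = hdot_of (s $ i) (k i)"
    by (elim exE)
  have k: "sqint lborel (k i)" "AE \<xi> in lborel. ?g i \<xi> = weight (- (s $ i)) \<xi> * k i \<xi>"
    "inv_fourier_dist (s $ i) (?g i) = hdot_of (s $ i) (k i)" for i
    using spec[OF kk, of i] by (simp_all only: simp_thms)
  let ?K' = "\<lambda>\<xi>. \<chi> i. k i \<xi>"
  have s': "sqint lborel ?K'" by (rule sqint_vec(1)) (simp add: k)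
  have "AE \<xi> in lborel. \<forall>i\<in>UNIV. ?g i \<xi> = weight (- (s $ i)) \<xi> * k i \<xi>" using k(2)
    by (subst AE_finite_all) auto
  then have "AE \<xi> in lborel. weight_vec s \<xi> (?K' \<xi>) = m \<xi> *v weight_vec s \<xi> (K \<xi>)"
    using fourier_vec_datum[OF K, of s]
  proof eventually_elim
    fix \<xi> assume g: "\<forall>i\<in>UNIV. ?g i \<xi> = weight (- (s $ i)) \<xi> * k i \<xi>"
      and f: "fourier_vec s (datum s K) \<xi> = weight_vec s \<xi> (K \<xi>)"
    show "weight_vec s \<xi> (?K' \<xi>) = m \<xi> *v weight_vec s \<xi> (K \<xi>)"
      unfolding f[symmetric] vec_eq_iff weight_vec_def[of s \<xi> "?K' \<xi>"] using g by simp
  qed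
  moreover have "multiplier s m (datum s K) = datum s ?K'"
    unfolding multiplier_def vec_eq_iff datum_nth by (simp only: vec_lambda_beta k(3)) simp
  ultimately show ?thesis using K s' unfolding multiplier_rel_def by blast
qed

lemma domain_of_multiplier_rel:
  assumes r: "multiplier_rel s m K K'"
  shows "datum s K \<in> multiplier_domain s m" "multiplier s m (datum s K) = datum s K'"
proof -
  have K: "sqint lborel K" "sqint lborel K'" using r by (auto simp: multiplier_rel_def)
  have ae: "AE \<xi> in lborel. (m \<xi> *v fourier_vec s (datum s K) \<xi>) $ i = weight (- (s $ i)) \<xi>
    * K' \<xi> $ i" for i
  proof -
    have "AE \<xi> in lborel. weight_vec s \<xi> (K' \<xi>) = m \<xi> *v weight_vec s \<xi> (K \<xi>)" using r
      by (simp add: multiplier_rel_def)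
    then show ?thesis
      using fourier_vec_datum[OF K(1), of s]
    proof eventually_elim
      fix \<xi> assume w: "weight_vec s \<xi> (K' \<xi>) = m \<xi> *v weight_vec s \<xi> (K \<xi>)"
        and f: "fourier_vec s (datum s K) \<xi> = weight_vec s \<xi> (K \<xi>)"
      show "(m \<xi> *v fourier_vec s (datum s K) \<xi>) $ i = weight (- (s $ i)) \<xi> * K' \<xi> $ i"
        unfolding f w[symmetric] by (simp add: weight_vec_def)
    qed
  qed
  let ?g = "\<lambda>i \<xi>. (m \<xi> *v fourier_vec s (datum s K) \<xi>) $ i"
  let ?g' = "\<lambda>i \<xi>. weight (- (s $ i)) \<xi> * K' \<xi> $ i"
  have g': "?g' i \<in> weighted_L2 (s $ i)" for i
    by (rule weight_weighted_L2[OF sqint_nth(1)[OF K(2)]])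
  then have g'm: "?g' i \<in> borel_measurable lebesgue" for i by (simp add: weighted_L2_def)
  have gm: "?g i \<in> borel_measurable lebesgue" for i by (rule sqint_AE_lebesgue[OF g'm ae])
  have "?g i \<in> weighted_L2 (s $ i)" for i
  proof -
    have "(\<integral>\<^sup>+ \<xi>. ennreal (norm \<xi> powr (2 * (s $ i)) * (cmod (?g i \<xi>))\<^sup>2) \<partial>lebesgue)
      = (\<integral>\<^sup>+ \<xi>. ennreal (norm \<xi> powr (2 * (s $ i)) * (cmod (?g' i \<xi>))\<^sup>2) \<partial>lebesgue)"
      by (intro nn_integral_cong_AE) (use AE_completion[OF ae[of i]] in \<open>eventually_elim, simp\<close>)
    then show ?thesis using g'[of i] gm[of i] by (simp add: weighted_L2_def)
  qed
  then show "datum s K \<in> multiplier_domain s m" using datum_in[OF K(1)]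
    by (simp add: multiplier_domain_def)
  have "inv_fourier_dist (s $ i) (?g i) = hdot_of (s $ i) (\<lambda>\<xi>. K' \<xi> $ i)" for i
    unfolding hdot_of_def by (rule inv_fourier_dist_cong_AE[OF gm g'm ae])
  then show "multiplier s m (datum s K) = datum s K'"
    by (simp add: multiplier_def vec_eq_iff datum_nth)
qed

lemma multiplier_rel_diff:
  assumes "multiplier_rel s m K K'" "multiplier_rel s m L L'"
  shows "multiplier_rel s m (\<lambda>\<xi>. K \<xi> - L \<xi>) (\<lambda>\<xi>. K' \<xi> - L' \<xi>)"
proof -
  have "AE \<xi> in lborel. weight_vec s \<xi> (K' \<xi>) = m \<xi> *v weight_vec s \<xi> (K \<xi>)"
    "AE \<xi> in lborel. weight_vec s \<xi> (L' \<xi>) = m \<xi> *v weight_vec s \<xi> (L \<xi>)"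
    using assms by (auto simp: multiplier_rel_def)
  then have "AE \<xi> in lborel. weight_vec s \<xi> (K' \<xi> - L' \<xi>) = m \<xi> *v weight_vec s \<xi> (K \<xi> - L \<xi>)"
    by eventually_elim (simp add: weight_vec_diff matrix_vector_mult_diff_distrib)
  then show ?thesis using assms by (auto simp: multiplier_rel_def intro: sqint_diff(1))
qed

lemma multiplier_rel_unique:
  assumes "multiplier_rel s m K K'" "multiplier_rel s m K K''"
  shows "AE \<xi> in lborel. K' \<xi> = K'' \<xi>"
proof -
  have "AE \<xi> in lborel. weight_vec s \<xi> (K' \<xi>) = m \<xi> *v weight_vec s \<xi> (K \<xi>)"
    "AE \<xi> in lborel. weight_vec s \<xi> (K'' \<xi>) = m \<xi> *v weight_vec s \<xi> (K \<xi>)"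
    using assms by (auto simp: multiplier_rel_def)
  then show ?thesis using AE_nonzero by eventually_elim (metis weight_vec_inj)
qed

lemma sqint_cis_mult:
  fixes K :: "'a::euclidean_space \<Rightarrow> complex^'n"
  assumes "sqint lborel K"
  shows "sqint lborel (\<lambda>\<xi>. cis (x \<bullet> \<xi>) *s K \<xi>)" "l2norm lborel (\<lambda>\<xi>. cis (x \<bullet> \<xi>) *s K \<xi>)
    = l2norm lborel K"
proof -
  have [measurable]: "K \<in> borel_measurable borel" using assms by (simp add: sqint_def)
  have n: "norm (cis t *s y) = norm y" for t and y :: "complex^'n"
    by (rule power2_eq_imp_eq) (simp_all add: norm_vec_power2 norm_mult)
  have "(\<lambda>\<xi>. cis (x \<bullet> \<xi>) *s K \<xi>) \<in> borel_measurable lborel"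
    by (rule vec_measurableI) simp
  then show "sqint lborel (\<lambda>\<xi>. cis (x \<bullet> \<xi>) *s K \<xi>)" using assms by (simp add: sqint_def n)
  show "l2norm lborel (\<lambda>\<xi>. cis (x \<bullet> \<xi>) *s K \<xi>) = l2norm lborel K" by (simp add: l2norm_def n)
qed

text \<open>A scalar phase commutes with a matrix: on the Fourier side this is the translation
  invariance of multipliers.\<close>

lemma multiplier_rel_cis:
  assumes "multiplier_rel s m K K'"
  shows "multiplier_rel s m (\<lambda>\<xi>. cis (x \<bullet> \<xi>) *s K \<xi>) (\<lambda>\<xi>. cis (x \<bullet> \<xi>) *s K' \<xi>)"
proof -
  have "AE \<xi> in lborel. weight_vec s \<xi> (K' \<xi>) = m \<xi> *v weight_vec s \<xi> (K \<xi>)" using assms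
    by (simp add: multiplier_rel_def)
  then have "AE \<xi> in lborel. weight_vec s \<xi> (cis (x \<bullet> \<xi>) *s K' \<xi>)
    = m \<xi> *v weight_vec s \<xi> (cis (x \<bullet> \<xi>) *s K \<xi>)"
    by eventually_elim (simp add: weight_vec_cmult vector_scalar_commute)
  then show ?thesis using assms by (auto simp: multiplier_rel_def intro: sqint_cis_mult)
qed

lemma scaleR_conv_smult: "c *\<^sub>R (y :: complex^'n) = complex_of_real c *s y"
  by (simp add: vec_eq_iff scaleR_conv_of_real[where 'a=complex])

lemma multiplier_rel_scaleR:
  assumes "multiplier_rel s m K K'"
  shows "multiplier_rel s m (\<lambda>\<xi>. c *\<^sub>R K \<xi>) (\<lambda>\<xi>. c *\<^sub>R K' \<xi>)"
proof -
  have "AE \<xi> in lborel. weight_vec s \<xi> (K' \<xi>) = m \<xi> *v weight_vec s \<xi> (K \<xi>)" using assms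
    by (simp add: multiplier_rel_def)
  then have "AE \<xi> in lborel. weight_vec s \<xi> (c *\<^sub>R K' \<xi>) = m \<xi> *v weight_vec s \<xi> (c *\<^sub>R K \<xi>)"
    by eventually_elim (simp add: weight_vec_cmult vector_scalar_commute scaleR_conv_smult)
  then show ?thesis using assms by (auto simp: multiplier_rel_def intro: sqint_scaleR(1))
qed

section \<open>Dilations\<close>

text \<open>The prefactor makes the dilation unitary on L2. By \<open>dilate_hdot_of\<close> it is
  the spatial part of \<open>rescale\<close> on the Fourier side.\<close>

definition dilate_L2 :: "real \<Rightarrow> ('a::euclidean_space \<Rightarrow> 'b::real_vector) \<Rightarrow> 'a \<Rightarrow> 'b"
  where "dilate_L2 \<rho> K \<xi> = (\<rho> powr (- (real DIM('a) / 2))) *\<^sub>R K (\<xi> /\<^sub>R \<rho>)"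

lemma sqint_dilate_L2:
  fixes K :: "'a::euclidean_space \<Rightarrow> 'b::euclidean_space"
  assumes K: "sqint lborel K" and \<rho>: "\<rho> > 0"
  shows "sqint lborel (dilate_L2 \<rho> K)" "l2norm lborel (dilate_L2 \<rho> K) = l2norm lborel K"
proof -
  have [measurable]: "K \<in> borel_measurable borel" using K by (simp add: sqint_def)
  have c: "(\<rho> powr (- (real DIM('a) / 2)))\<^sup>2 * \<rho> ^ DIM('a) = 1"
    using \<rho> by (simp add: sqrt_powr powr_realpow[symmetric] flip: powr_add)
  have eq: "(norm (dilate_L2 \<rho> K \<xi>))\<^sup>2 = (\<rho> powr (- (real DIM('a) / 2)))\<^sup>2
    * (norm (K (0 + (inverse \<rho>) *\<^sub>R \<xi>)))\<^sup>2" for \<xi>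
    by (simp add: dilate_L2_def power_mult_distrib)
  have i: "integrable lborel (\<lambda>\<xi>. (norm (K (0 + (inverse \<rho>) *\<^sub>R \<xi>)))\<^sup>2)"
    using integrable_lborel_affine[OF sqint_integrable[OF K], of "inverse \<rho>" 0] \<rho> by simp
  show "sqint lborel (dilate_L2 \<rho> K)"
    unfolding sqint_def eq using i by (auto simp: dilate_L2_def[abs_def])
  have "(\<integral>\<xi>. (norm (K \<xi>))\<^sup>2 \<partial>lborel)
    = (inverse \<rho> ^ DIM('a)) *\<^sub>R (\<integral>\<xi>. (norm (K (0 + (inverse \<rho>) *\<^sub>R \<xi>)))\<^sup>2 \<partial>lborel)"
    using integral_lborel_affine[of "\<lambda>\<xi>. (norm (K \<xi>))\<^sup>2" "inverse \<rho>" 0] \<rho> by simp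
  then have "(\<integral>\<xi>. (norm (K (0 + (inverse \<rho>) *\<^sub>R \<xi>)))\<^sup>2 \<partial>lborel)
    = \<rho> ^ DIM('a) * (\<integral>\<xi>. (norm (K \<xi>))\<^sup>2 \<partial>lborel)"
    using \<rho> by (simp add: power_inverse field_simps)
  then have "(\<integral>\<xi>. (norm (dilate_L2 \<rho> K \<xi>))\<^sup>2 \<partial>lborel)
    = ((\<rho> powr (- (real DIM('a) / 2)))\<^sup>2 * \<rho> ^ DIM('a)) * (\<integral>\<xi>. (norm (K \<xi>))\<^sup>2 \<partial>lborel)"
    unfolding eq by simp
  then show "l2norm lborel (dilate_L2 \<rho> K) = l2norm lborel K" unfolding l2norm_def c by simp
qed

lemma schwartz_dilate_iff:
  fixes \<phi> :: "'a::euclidean_space \<Rightarrow> complex"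
  assumes "\<rho> > 0"
  shows "(\<lambda>x. \<phi> (x /\<^sub>R \<rho>)) \<in> schwartz \<longleftrightarrow> \<phi> \<in> schwartz"
proof
  show "(\<lambda>x. \<phi> (x /\<^sub>R \<rho>)) \<in> schwartz" if "\<phi> \<in> schwartz"
    using schwartz_affine[OF that, of "inverse \<rho>" 0] assms by simp
  show "\<phi> \<in> schwartz" if "(\<lambda>x. \<phi> (x /\<^sub>R \<rho>)) \<in> schwartz"
    using schwartz_affine[OF that, of \<rho> 0] assms by simp
qed

lemma test_space_dilate:
  fixes \<phi> :: "'a::euclidean_space \<Rightarrow> complex"
  assumes \<rho>: "\<rho> > 0" and \<phi>: "\<phi> \<in> test_space s"
  shows "(\<lambda>x. \<phi> (x /\<^sub>R \<rho>)) \<in> test_space s"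
proof -
  have sch: "\<phi> \<in> schwartz" "(\<lambda>x. \<phi> (x /\<^sub>R \<rho>)) \<in> schwartz"
    using \<phi> schwartz_dilate_iff[OF \<rho>, of \<phi>] by (auto simp: test_space_def)
  note [measurable] = inv_fourier_measurable[OF sch(1)] inv_fourier_measurable[OF sch(2)]
  let ?F = "\<lambda>\<xi>. weight (- s) \<xi> * inv_fourier \<phi> \<xi>"
  have F: "sqint lborel ?F" by (rule test_space_sqint[OF \<phi>])
  have "sqint lborel (dilate_L2 (inverse \<rho>) ?F)" using \<rho> by (intro sqint_dilate_L2 F) simp
  \<comment> \<open>The constant cancels the L2 normalisation and the homogeneity of the weight and
    contributes the Jacobian of \<open>inv_fourier_dilate\<close>; the two functions then have equal
    modulus.\<close>
  from sqint_scaleR(1)[OF this, of "\<rho> powr s * \<rho> ^ DIM('a) / (inverse \<rho>) powr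
    (- (real DIM('a) / 2))"]
  have "sqint lborel (\<lambda>\<xi>. weight (- s) \<xi> * inv_fourier (\<lambda>x. \<phi> (x /\<^sub>R \<rho>)) \<xi>)"
  proof (rule sqint_bound(1))
    fix \<xi> :: 'a
    have w: "norm (\<rho> *\<^sub>R \<xi>) powr (- s) = \<rho> powr (- s) * norm \<xi> powr (- s)"
      using \<rho> by (simp add: powr_mult)
    have s1: "\<rho> powr s * \<rho> powr (- s) = 1" using \<rho> by (simp flip: powr_add)
    let ?c = "inverse \<rho> powr (- (real DIM('a) / 2))"
    have "?c > 0" using \<rho> by simp
    then have "norm ((\<rho> powr s * \<rho> ^ DIM('a) / ?c) *\<^sub>R dilate_L2 (inverse \<rho>) ?F \<xi>)
      = \<rho> powr s * \<rho> ^ DIM('a) * norm (?F (\<rho> *\<^sub>R \<xi>))"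
      using \<rho> by (simp add: dilate_L2_def)
    also have "\<dots> = (\<rho> powr s * \<rho> powr (- s))
      * (norm \<xi> powr (- s) * (\<rho> ^ DIM('a) * cmod (inv_fourier \<phi> (\<rho> *\<^sub>R \<xi>))))"
      by (simp add: norm_mult w[simplified] mult_ac)
    also have "\<dots> = norm (weight (- s) \<xi> * inv_fourier (\<lambda>x. \<phi> (x /\<^sub>R \<rho>)) \<xi>)"
      unfolding s1 inv_fourier_dilate[OF sch(1) \<rho>] using \<rho> by (simp add: norm_mult norm_power)
    finally show "norm (weight (- s) \<xi> * inv_fourier (\<lambda>x. \<phi> (x /\<^sub>R \<rho>)) \<xi>) \<le>
      norm ((\<rho> powr s * \<rho> ^ DIM('a) / ?c) *\<^sub>R dilate_L2 (inverse \<rho>) ?F \<xi>)"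
      by simp
  qed measurable
  then show ?thesis
    using sch(2) weighted_L2_iff[OF inv_fourier_measurable[OF sch(2)], of "- s"]
      by (simp add: test_space_def)
qed

text \<open>The power d/2 - s in the scaling is exactly what the weight |\<xi>|^(-s) requires, so on
  the Fourier side one and the same L2 dilation serves all components, whatever their
  regularity.\<close>

lemma dilate_hdot_of:
  fixes k :: "'a::euclidean_space \<Rightarrow> complex"
  assumes k: "sqint lborel k" and \<rho>: "\<rho> > 0"
  shows "complex_of_real (\<rho> powr (real DIM('a) / 2 - s)) * dilate \<rho> (hdot_of s k) \<phi>
    = hdot_of s (dilate_L2 \<rho> k) \<phi>"
proof (cases "\<phi> \<in> test_space s")
  case False
  \<comment> \<open>Dilating back would make \<phi> a test function, so both functionals take their
    default value 0.\<close>
  have "(\<lambda>x. \<phi> (x /\<^sub>R \<rho>)) \<notin> test_space s"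
    using test_space_dilate[of "inverse \<rho>" "\<lambda>x. \<phi> (x /\<^sub>R \<rho>)" s] False \<rho> by auto
  then show ?thesis using False by (simp add: dilate_def hdot_of_not_test)
next
  case True
  let ?\<psi> = "\<lambda>x. \<phi> (x /\<^sub>R \<rho>)"
  have \<psi>: "?\<psi> \<in> test_space s" by (rule test_space_dilate[OF \<rho> True])
  have sch: "\<phi> \<in> schwartz" using True by (simp add: test_space_def)
  have [measurable]: "k \<in> borel_measurable borel" using k by (simp add: sqint_def)
  note [measurable] = inv_fourier_measurable[OF sch]
  let ?d = "real DIM('a)"
  have "hdot_of s k ?\<psi>
    = (\<integral>\<xi>. k \<xi> * (weight (- s) \<xi> * (complex_of_real (\<rho> ^ DIM('a)) * inv_fourier \<phi> (\<rho> *\<^sub>R \<xi>)))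
    \<partial>lborel)"
    unfolding hdot_of_apply(1)[OF k \<psi>] inv_fourier_dilate[OF sch \<rho>] ..
  also have "\<dots> = (\<bar>inverse \<rho>\<bar> ^ DIM('a)) *\<^sub>R (\<integral>\<xi>. k (0 + inverse \<rho> *\<^sub>R \<xi>)
    * (weight (- s) (0 + inverse \<rho> *\<^sub>R \<xi>) * (complex_of_real (\<rho> ^ DIM('a)) * inv_fourier \<phi>
    (\<rho> *\<^sub>R (0 + inverse \<rho> *\<^sub>R \<xi>)))) \<partial>lborel)"
    by (rule integral_lborel_affine) (use \<rho> in auto)
  also have "\<dots> = (\<integral>\<xi>. complex_of_real (inverse \<rho> ^ DIM('a)) * (k (0 + inverse \<rho> *\<^sub>R \<xi>)
    * (weight (- s) (0 + inverse \<rho> *\<^sub>R \<xi>) * (complex_of_real (\<rho> ^ DIM('a)) * inv_fourier \<phi>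
    (\<rho> *\<^sub>R (0 + inverse \<rho> *\<^sub>R \<xi>))))) \<partial>lborel)"
    using \<rho>
      by (simp only: integral_mult_right_zero scaleR_conv_of_real abs_of_pos
      positive_imp_inverse_positive)
  also have "\<dots> = (\<integral>\<xi>. complex_of_real (\<rho> powr (?d / 2 + s))
    * (dilate_L2 \<rho> k \<xi> * (weight (- s) \<xi> * inv_fourier \<phi> \<xi>)) \<partial>lborel)"
  proof (rule Bochner_Integration.integral_cong[OF refl])
    fix \<xi> :: 'a
    have w: "weight (- s) (inverse \<rho> *\<^sub>R \<xi>) = complex_of_real (\<rho> powr s) * weight (- s) \<xi>"
    proof -
      have "(inverse \<rho>) powr (- s) = \<rho> powr s" using \<rho> by (simp add: powr_minus inverse_powr)
      then show ?thesis using \<rho> by (simp add: weight_def powr_mult)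
    qed
    have p: "\<rho> powr (?d / 2 + s) * \<rho> powr (- (?d / 2)) = \<rho> powr s" by (simp flip: powr_add)
    have "complex_of_real (inverse \<rho> ^ DIM('a)) * (k (0 + inverse \<rho> *\<^sub>R \<xi>)
      * (weight (- s) (0 + inverse \<rho> *\<^sub>R \<xi>) * (complex_of_real (\<rho> ^ DIM('a)) * inv_fourier \<phi>
      (\<rho> *\<^sub>R (0 + inverse \<rho> *\<^sub>R \<xi>)))))
      = complex_of_real (inverse \<rho> ^ DIM('a) * \<rho> ^ DIM('a)) * complex_of_real (\<rho> powr s) *
        (k (\<xi> /\<^sub>R \<rho>) * (weight (- s) \<xi> * inv_fourier \<phi> \<xi>))"
      using \<rho> by (simp add: w mult_ac)
    also have "inverse \<rho> ^ DIM('a) * \<rho> ^ DIM('a) = 1" using \<rho> by (simp flip: power_mult_distrib)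
    also have "complex_of_real 1 * complex_of_real (\<rho> powr s)
      * (k (\<xi> /\<^sub>R \<rho>) * (weight (- s) \<xi> * inv_fourier \<phi> \<xi>))
      = complex_of_real (\<rho> powr (?d / 2 + s)) * (dilate_L2 \<rho> k \<xi> * (weight (- s) \<xi> * inv_fourier \<phi>
        \<xi>))"
      unfolding p[symmetric] by (simp add: dilate_L2_def scaleR_conv_of_real mult_ac)
    finally show "complex_of_real (inverse \<rho> ^ DIM('a))
      * (k (0 + inverse \<rho> *\<^sub>R \<xi>) * (weight (- s) (0 + inverse \<rho> *\<^sub>R \<xi>) *
      (complex_of_real (\<rho> ^ DIM('a)) * inv_fourier \<phi> (\<rho> *\<^sub>R (0 + inverse \<rho> *\<^sub>R \<xi>)))))
      = complex_of_real (\<rho> powr (?d / 2 + s)) * (dilate_L2 \<rho> k \<xi> * (weight (- s) \<xi> * inv_fourier \<phi>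
        \<xi>))" .
  qed
  also have "\<dots> = complex_of_real (\<rho> powr (?d / 2 + s)) * hdot_of s (dilate_L2 \<rho> k) \<phi>"
    unfolding hdot_of_apply(1)[OF sqint_dilate_L2(1)[OF k \<rho>] True] by simp
  finally have "hdot_of s k ?\<psi> = complex_of_real (\<rho> powr (?d / 2 + s)) * hdot_of s (dilate_L2 \<rho> k)
    \<phi>" .
  moreover have "\<rho> powr (?d / 2 - s) * \<rho> powr (?d / 2 + s) = \<rho> ^ DIM('a)"
    using \<rho> by (simp add: powr_realpow flip: powr_add)
  ultimately show ?thesis
    using \<rho> by (simp add: dilate_def mult.assoc[symmetric] flip: of_real_mult of_real_power)
qed

lemma hdot_of_cis:
  assumes k: "sqint lborel k" "sqint lborel (\<lambda>\<xi>. cis (y \<bullet> \<xi>) * k \<xi>)"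
    and t: "\<phi> \<in> test_space s" "(\<lambda>x. \<phi> (x - y)) \<in> test_space s"
  shows "hdot_of s (\<lambda>\<xi>. cis (y \<bullet> \<xi>) * k \<xi>) \<phi> = hdot_of s k (\<lambda>x. \<phi> (x - y))"
proof -
  have sch: "\<phi> \<in> schwartz" using t by (simp add: test_space_def)
  show ?thesis
    unfolding hdot_of_apply(1)[OF k(2) t(1)] hdot_of_apply(1)[OF k(1) t(2)]
      inv_fourier_shift[OF sch]
    by (simp add: mult_ac)
qed

section \<open>The flow on the Fourier side\<close>

lemma domain_diff:
  assumes "f \<in> multiplier_domain s m" "g \<in> multiplier_domain s m"
  shows "f - g \<in> multiplier_domain s m" "multiplier s m (f - g)
    = multiplier s m f - multiplier s m g"
proof -
  obtain K L where K: "sqint lborel K" "f = datum s K" and L: "sqint lborel L" "g = datum s L"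
    using assms datum_surj by (metis (no_types, lifting) multiplier_domain_def mem_Collect_eq)
  obtain K' L' where K': "multiplier_rel s m K K'" "multiplier s m f = datum s K'"
    and L': "multiplier_rel s m L L'" "multiplier s m g = datum s L'"
    using multiplier_rel_of_domain K L assms by metis
  have eq: "f - g = datum s (\<lambda>\<xi>. K \<xi> - L \<xi>)" using datum_diff[OF K(1) L(1)] K(2) L(2) by simp
  note r = domain_of_multiplier_rel[OF multiplier_rel_diff[OF K'(1) L'(1)]]
  show "f - g \<in> multiplier_domain s m" unfolding eq by (rule r)
  have "sqint lborel K'" "sqint lborel L'" using K' L' by (auto simp: multiplier_rel_def)
  then show "multiplier s m (f - g) = multiplier s m f - multiplier s m g"
    unfolding eq r(2) K'(2) L'(2) by (rule datum_diff)
qed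

text \<open>Pairing with a fixed test function is bounded for the norm. The integrands of
  \<open>time_integral\<close> are therefore continuous, as \<open>interval_integral_shift\<close>
  requires.\<close>

lemma hdot_continuous_pairing:
  assumes u: "hdot_continuous s u"
  shows "continuous_on UNIV (\<lambda>\<tau>. (u \<tau> $ i) \<phi>)"
proof -
  have "\<forall>\<tau>. \<exists>K. sqint lborel K \<and> u \<tau> = datum s K" using u datum_surj
    by (auto simp: hdot_continuous_def)
  then obtain K where K: "\<And>\<tau>. sqint lborel (K \<tau>)" "\<And>\<tau>. u \<tau> = datum s (K \<tau>)" by metis
  show ?thesis
  proof (cases "\<phi> \<in> test_space (s $ i)")
    case False
    then show ?thesis by (simp add: K(2) datum_nth hdot_of_not_test)
  next
    case True
    define c where "c = l2norm lborel (\<lambda>\<xi>. weight (- (s $ i)) \<xi> * inv_fourier \<phi> \<xi>)"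
    have b: "norm ((u \<tau> $ i) \<phi> - (u t $ i) \<phi>) \<le> hdot_prod_norm s (u \<tau> - u t) * c" for \<tau> t
    proof -
      note d = sqint_diff(1)[OF K(1)[of \<tau>] K(1)[of t]]
      have "(u \<tau> $ i) \<phi> - (u t $ i) \<phi> = hdot_of (s $ i) (\<lambda>\<xi>. K \<tau> \<xi> $ i - K t \<xi> $ i) \<phi>"
        unfolding K(2) datum_nth hdot_of_linear[OF sqint_nth(1)[OF K(1)] sqint_nth(1)[OF K(1)]] ..
      also have "norm \<dots> \<le> l2norm lborel (\<lambda>\<xi>. K \<tau> \<xi> $ i - K t \<xi> $ i) * c"
        unfolding c_def using sqint_nth(1)[OF d, of i] by (intro hdot_of_apply(3) True) simp
      also have "\<dots> \<le> l2norm lborel (\<lambda>\<xi>. K \<tau> \<xi> - K t \<xi>) * c"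
        using sqint_nth(2)[OF d, of i] by (intro mult_right_mono) (auto simp: c_def)
      also have "l2norm lborel (\<lambda>\<xi>. K \<tau> \<xi> - K t \<xi>) = hdot_prod_norm s (u \<tau> - u t)"
        using datum_norm[OF d] datum_diff[OF K(1) K(1)] by (simp add: K(2))
      finally show ?thesis .
    qed
    have "((\<lambda>\<tau>. (u \<tau> $ i) \<phi>) \<longlongrightarrow> (u t $ i) \<phi>) (at t)" for t
    proof (rule Lim_null[THEN iffD2], rule Lim_null_comparison)
      show "\<forall>\<^sub>F \<tau> in at t. norm ((u \<tau> $ i) \<phi> - (u t $ i) \<phi>) \<le> hdot_prod_norm s (u \<tau> - u t) * c"
        using b by simp
      show "((\<lambda>\<tau>. hdot_prod_norm s (u \<tau> - u t) * c) \<longlongrightarrow> 0) (at t)"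
        using u by (intro tendsto_mult_left_zero) (simp add: hdot_continuous_def)
    qed
    then show ?thesis by (auto intro!: continuous_at_imp_continuous_on simp: continuous_at)
  qed
qed

lemma interval_integral_shift:
  fixes f :: "real \<Rightarrow> complex"
  assumes f: "continuous_on UNIV f"
  shows "(LBINT \<tau>=0..ereal t. f (t0 + \<tau>)) = (LBINT \<tau>=0..ereal (t0 + t). f \<tau>)
    - (LBINT \<tau>=0..ereal t0. f \<tau>)"
proof -
  have c: "continuous_on A f" for A using f continuous_on_subset by blast
  have sub: "(LBINT \<tau>=ereal a..ereal b. f (t0 + \<tau>)) = (LBINT \<tau>=ereal (t0 + a)..ereal (t0 + b). f \<tau>)"
    if "a \<le> b" for a b
  proof -
    have d: "((\<lambda>x. t0 + x) has_real_derivative 1) (at x within {a..b})" for x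
      by (auto intro!: derivative_eq_intros)
    show ?thesis
      using interval_integral_substitution_finite[OF that d c continuous_on_const] by simp
  qed
  have "(LBINT \<tau>=ereal 0..ereal t. f (t0 + \<tau>)) = (LBINT \<tau>=ereal t0..ereal (t0 + t). f \<tau>)"
  proof (cases "0 \<le> t")
    case True
    then show ?thesis using sub[of 0 t] by simp
  next
    case False
    then have "(LBINT \<tau>=ereal t..ereal 0. f (t0 + \<tau>)) = (LBINT \<tau>=ereal (t0 + t)..ereal t0. f \<tau>)"
      using sub[of t 0] by simp
    then show ?thesis
      using interval_integral_endpoints_reverse[of "ereal 0" "ereal t" "\<lambda>\<tau>. f (t0 + \<tau>)"]
        interval_integral_endpoints_reverse[of "ereal t0" "ereal (t0 + t)" f] by (simp only:)
  qed
  moreover have "(LBINT \<tau>=ereal 0..ereal t0. f \<tau>) + (LBINT \<tau>=ereal t0..ereal (t0 + t). f \<tau>)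
    = (LBINT \<tau>=ereal 0..ereal (t0 + t). f \<tau>)"
  proof (rule interval_integral_sum)
    let ?a = "min 0 (min t0 (t0 + t))" and ?b = "max 0 (max t0 (t0 + t))"
    have "interval_lebesgue_integrable lborel (ereal ?a) (ereal ?b) f"
      by (rule interval_integrable_continuous_on[OF _ c]) auto
    then show "interval_lebesgue_integrable lborel (min (ereal 0) (min (ereal t0) (ereal (t0 + t))))
      (max (ereal 0) (max (ereal t0) (ereal (t0 + t)))) f"
      by (simp only: ereal_min ereal_max)
  qed
  ultimately show ?thesis by (simp add: zero_ereal_def algebra_simps)
qed

text \<open>The equation is autonomous: the time integral of the shifted solution is a difference of
  two time integrals of u, and subtracting the corresponding two instances of the mild equation
  gives the claim, since the multiplier is linear on its domain.\<close>

lemma solves_equation_shift: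
  assumes "solves_equation s h u"
  shows "solves_equation s h (\<lambda>t. u (t0 + t))"
proof -
  have u: "hdot_continuous s u" and dom: "\<And>t. time_integral u t \<in> multiplier_domain s h"
    and eq: "\<And>t i \<phi>. \<i> * ((u t $ i) \<phi> - (u 0 $ i) \<phi>) + (multiplier s h (time_integral u t) $ i) \<phi>
      = 0"
    using assms by (auto simp: solves_equation_def)
  have T: "time_integral (\<lambda>t. u (t0 + t)) t = time_integral u (t0 + t) - time_integral u t0" for t
    unfolding vec_eq_iff fun_eq_iff time_integral_def
    by (simp add: interval_integral_shift[OF hdot_continuous_pairing[OF u]])
  have "hdot_continuous s (\<lambda>t. u (t0 + t))"
    unfolding hdot_continuous_def
  proof (intro conjI allI)
    fix t
    show "u (t0 + t) \<in> hdot_prod s" using u by (simp add: hdot_continuous_def)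
    have "((\<lambda>\<tau>. hdot_prod_norm s (u \<tau> - u (t0 + t))) \<longlongrightarrow> 0) (at (t0 + t))"
      using u by (simp add: hdot_continuous_def)
    from LIM_offset[OF this, of t0]
    show "((\<lambda>\<tau>. hdot_prod_norm s (u (t0 + \<tau>) - u (t0 + t))) \<longlongrightarrow> 0) (at t)" by (simp add: add.commute)
  qed
  moreover have "\<i> * ((u (t0 + t) $ i) \<phi> - (u (t0 + 0) $ i) \<phi>)
    + (multiplier s h (time_integral (\<lambda>t. u (t0 + t)) t) $ i) \<phi> = 0" for t i \<phi>
    using eq[of "t0 + t" i \<phi>] eq[of t0 i \<phi>]
    unfolding T domain_diff(2)[OF dom dom] by (simp add: algebra_simps)
  ultimately show ?thesis
    unfolding solves_equation_def using domain_diff(1)[OF dom dom] by (auto simp: T)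
qed

locale dispersive =
  fixes s :: "real^'n" and h :: "'a::euclidean_space \<Rightarrow> complex^'n^'n"
  assumes well_posed: "globally_well_posed s h"
    and flow: "\<And>f. f \<in> hdot_prod s \<Longrightarrow>
        (\<forall>t. f \<in> multiplier_domain s (propagator_symbol h t)) \<and>
        solves_cauchy s h f (\<lambda>t. propagator s h t f)"
    and unitary: "\<And>t f. f \<in> hdot_prod s \<Longrightarrow>
        hdot_prod_norm s (propagator s h t f) = hdot_prod_norm s f"
    and scaling: "\<And>u \<rho>. solves_equation s h u \<Longrightarrow> 0 < \<rho> \<Longrightarrow>
        solves_equation s h (rescale s \<rho> u)"
begin

lemma solution_unique:
  assumes "solves_equation s h u" "u 0 = f" "f \<in> hdot_prod s"
  shows "u t = propagator s h t f"
proof -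
  have "\<exists>!u. solves_cauchy s h f u" using well_posed assms(3) by (simp add: globally_well_posed_def)
  then have "u = (\<lambda>t. propagator s h t f)"
    using flow[OF assms(3)] assms(1,2) by (auto simp: solves_cauchy_def)
  then show ?thesis by simp
qed

text \<open>The flow on the Fourier side. The choice fixes some representative, so its algebraic
  laws hold almost everywhere or after applying \<open>datum s\<close>.\<close>

definition evol :: "real \<Rightarrow> ('a \<Rightarrow> complex^'n) \<Rightarrow> 'a \<Rightarrow> complex^'n"
  where "evol t K = (SOME K'. sqint lborel K' \<and> propagator s h t (datum s K) = datum s K')"

lemma evol:
  assumes "sqint lborel K"
  shows "sqint lborel (evol t K)" "propagator s h t (datum s K) = datum s (evol t K)"
proof -
  have "\<exists>K'. multiplier_rel s (propagator_symbol h t) K K'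
    \<and> multiplier s (propagator_symbol h t) (datum s K) = datum s K'"
    using flow[OF datum_in[OF assms]] by (intro multiplier_rel_of_domain assms) blast
  then have "\<exists>K'. sqint lborel K' \<and> propagator s h t (datum s K) = datum s K'"
    by (auto simp: multiplier_rel_def propagator_def)
  from someI_ex[OF this] show "sqint lborel (evol t K)" "propagator s h t (datum s K)
    = datum s (evol t K)"
    by (simp_all add: evol_def)
qed

lemma multiplier_rel_evol:
  assumes "sqint lborel K"
  shows "multiplier_rel s (propagator_symbol h t) K (evol t K)"
proof -
  obtain K' where K': "multiplier_rel s (propagator_symbol h t) K K'"
    "multiplier s (propagator_symbol h t) (datum s K) = datum s K'"
    using multiplier_rel_of_domain[OF assms] flow[OF datum_in[OF assms]] by blast
  have s': "sqint lborel K'" using K'(1) by (simp add: multiplier_rel_def)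
  have "datum s (evol t K) = datum s K'" using evol(2)[OF assms, of t] K'(2)
    by (simp add: propagator_def)
  from datum_inj[OF evol(1)[OF assms] s' this] have "AE \<xi> in lborel. evol t K \<xi> = K' \<xi>" .
  moreover have "AE \<xi> in lborel. weight_vec s \<xi> (K' \<xi>)
    = propagator_symbol h t \<xi> *v weight_vec s \<xi> (K \<xi>)"
    using K'(1) by (simp add: multiplier_rel_def)
  ultimately have "AE \<xi> in lborel. weight_vec s \<xi> (evol t K \<xi>)
    = propagator_symbol h t \<xi> *v weight_vec s \<xi> (K \<xi>)"
    by eventually_elim simp
  then show ?thesis using evol(1)[OF assms] assms by (simp add: multiplier_rel_def)
qed

lemma l2norm_evol:
  assumes "sqint lborel K"
  shows "l2norm lborel (evol t K) = l2norm lborel K"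
  using unitary[OF datum_in[OF assms], of t]
    unfolding evol(2)[OF assms] datum_norm[OF evol(1)[OF assms]] datum_norm[OF assms] .

lemma evol_diff:
  assumes "sqint lborel K" "sqint lborel L"
  shows "AE \<xi> in lborel. evol t (\<lambda>\<xi>. K \<xi> - L \<xi>) \<xi> = evol t K \<xi> - evol t L \<xi>"
  by (rule multiplier_rel_unique[OF multiplier_rel_evol[OF sqint_diff(1)[OF assms]]
    multiplier_rel_diff[OF multiplier_rel_evol[OF assms(1)] multiplier_rel_evol[OF assms(2)]]])

lemma evol_scaleR:
  assumes "sqint lborel K"
  shows "AE \<xi> in lborel. evol t (\<lambda>\<xi>. c *\<^sub>R K \<xi>) \<xi> = c *\<^sub>R evol t K \<xi>"
  by (rule multiplier_rel_unique[OF multiplier_rel_evol[OF sqint_scaleR(1)[OF assms]]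
    multiplier_rel_scaleR[OF multiplier_rel_evol[OF assms]]])

lemma evol_cis:
  assumes "sqint lborel K"
  shows "AE \<xi> in lborel. evol t (\<lambda>\<xi>. cis (x \<bullet> \<xi>) *s K \<xi>) \<xi> = cis (x \<bullet> \<xi>) *s evol t K \<xi>"
  by (rule multiplier_rel_unique[OF multiplier_rel_evol[OF sqint_cis_mult(1)[OF assms]]
    multiplier_rel_cis[OF multiplier_rel_evol[OF assms]]])

lemma solves_evol:
  assumes "sqint lborel K"
  shows "solves_equation s h (\<lambda>t. datum s (evol t K))" "datum s (evol 0 K) = datum s K"
  using flow[OF datum_in[OF assms]] by (auto simp: solves_cauchy_def evol(2)[OF assms])

text \<open>The group law, from uniqueness: the solution restarted at time t0 is the solution whose
  datum is its value there.\<close>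

lemma evol_add:
  assumes K: "sqint lborel K"
  shows "datum s (evol t (evol t0 K)) = datum s (evol (t0 + t) K)"
proof -
  have "datum s (evol (t0 + t) K) = propagator s h t (datum s (evol t0 K))"
    using solution_unique[OF solves_equation_shift[OF solves_evol(1)[OF K], of t0], of
      "datum s (evol t0 K)" t] datum_in[OF evol(1)[OF K]]
    by simp
  then show ?thesis by (simp add: evol(2)[OF evol(1)[OF K]])
qed

text \<open>The rescaled solution solves the equation by scaling invariance, and its datum is the
  dilated one, so uniqueness applies. Time is dilated by the same factor as space.\<close>

lemma evol_dilate_L2:
  assumes K: "sqint lborel K" and \<rho>: "\<rho> > 0"
  shows "datum s (evol t (dilate_L2 \<rho> K)) = datum s (dilate_L2 \<rho> (evol (\<rho> * t) K))"
proof -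
  have R: "rescale s \<rho> (\<lambda>t. datum s (evol t K)) t = datum s (dilate_L2 \<rho> (evol (\<rho> * t) K))" for t
  proof -
    have "rescale s \<rho> (\<lambda>t. datum s (evol t K)) t $ i = datum s (dilate_L2 \<rho> (evol (\<rho> * t) K)) $ i"
      for i
    proof
      fix \<phi>
      have "dilate_L2 \<rho> (\<lambda>\<xi>. evol (\<rho> * t) K \<xi> $ i) = (\<lambda>\<xi>. dilate_L2 \<rho> (evol (\<rho> * t) K) \<xi> $ i)"
        by (simp add: dilate_L2_def fun_eq_iff)
      then show "(rescale s \<rho> (\<lambda>t. datum s (evol t K)) t $ i) \<phi>
        = (datum s (dilate_L2 \<rho> (evol (\<rho> * t) K)) $ i) \<phi>"
        using dilate_hdot_of[OF sqint_nth(1)[OF evol(1)[OF K]] \<rho>, of "s $ i" "\<rho> * t" i \<phi>]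
        by (simp add: rescale_def datum_nth)
    qed
    then show ?thesis by (simp add: vec_eq_iff)
  qed
  \<comment> \<open>\<open>evol 0 K\<close> is a chosen representative and agrees with K only almost
    everywhere, so the dilated identity has to be transported through an affine map.\<close>
  have ae: "AE \<xi> in lborel. evol 0 K \<xi> = K \<xi>"
    by (rule datum_inj[OF evol(1)[OF K] K solves_evol(2)[OF K]])
  have "AE \<xi> in lborel. evol 0 K (0 + inverse \<rho> *\<^sub>R \<xi>) = K (0 + inverse \<rho> *\<^sub>R \<xi>)"
    by (rule AE_lborel_affine[OF ae]) (use \<rho> in auto)
  then have "AE \<xi> in lborel. dilate_L2 \<rho> (evol 0 K) \<xi> = dilate_L2 \<rho> K \<xi>"
    by eventually_elim (simp add: dilate_L2_def)
  then have "datum s (dilate_L2 \<rho> (evol 0 K)) = datum s (dilate_L2 \<rho> K)"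
    by (intro datum_cong_AE sqint_dilate_L2 evol K \<rho>)
  then have "rescale s \<rho> (\<lambda>t. datum s (evol t K)) t = propagator s h t (datum s (dilate_L2 \<rho> K))"
    by (intro solution_unique scaling solves_evol K \<rho> datum_in sqint_dilate_L2) (simp add: R)
  then show ?thesis by (simp add: R evol(2)[OF sqint_dilate_L2(1)[OF K \<rho>]])
qed

lemma evol_continuous:
  assumes K: "sqint lborel K"
  shows "((\<lambda>\<tau>. l2norm lborel (\<lambda>\<xi>. evol \<tau> K \<xi> - evol t K \<xi>)) \<longlongrightarrow> 0) (at t)"
proof -
  have "hdot_prod_norm s (datum s (evol \<tau> K) - datum s (evol t K))
    = l2norm lborel (\<lambda>\<xi>. evol \<tau> K \<xi> - evol t K \<xi>)" for \<tau>
    using datum_norm[OF sqint_diff(1)[OF evol(1)[OF K, of \<tau>] evol(1)[OF K, of t]], of s]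
      datum_diff[OF evol(1)[OF K] evol(1)[OF K], of s \<tau> t] by simp
  moreover have "((\<lambda>\<tau>. hdot_prod_norm s (datum s (evol \<tau> K) - datum s (evol t K))) \<longlongrightarrow> 0) (at t)"
    using solves_evol(1)[OF K] by (simp add: solves_equation_def hdot_continuous_def)
  ultimately show ?thesis by simp
qed

end

section \<open>Space-time norms of solutions\<close>

lemma Lp_norm_cong_AE:
  assumes "f \<in> borel_measurable M" "g \<in> borel_measurable M" "AE x in M. f x = g x"
  shows "Lp_norm p M f = Lp_norm p M g"
proof (cases "p = \<infinity>")
  case True
  have "esssup M f = esssup M g"
    using assms by (intro antisym esssup_AE_mono) (auto elim: eventually_mono)
  then show ?thesis using True by (simp add: Lp_norm_def)
next
  case False
  have "(\<integral>\<^sup>+x. ennreal_powr (f x) (enn2real p) \<partial>M) = (\<integral>\<^sup>+x. ennreal_powr (g x) (enn2real p) \<partial>M)"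
    by (rule nn_integral_cong_AE) (use assms(3) in \<open>auto elim: eventually_mono\<close>)
  then show ?thesis using False by (simp add: Lp_norm_def)
qed

lemma section_measurable [measurable (raw)]:
  fixes U :: "real \<times> 'a::euclidean_space \<Rightarrow> complex"
  assumes [measurable]: "U \<in> borel_measurable borel"
  shows "(\<lambda>x. U (t, x)) \<in> borel_measurable borel"
  by measurable

lemma mixed_norm_cong_AE:
  fixes U U' :: "real \<times> 'a::euclidean_space \<Rightarrow> complex"
  assumes [measurable]: "U \<in> borel_measurable borel" "U' \<in> borel_measurable borel"
    and ae: "AE t in lborel. AE x in lborel. U (t, x) = U' (t, x)"
  shows "mixed_norm p q U = mixed_norm p q U'"
  unfolding mixed_norm_def
proof (rule Lp_norm_cong_AE)
  show "(\<lambda>t. Lp_norm q lborel (\<lambda>x. ennreal (cmod (U (t, x))))) \<in> borel_measurable lborel"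
    "(\<lambda>t. Lp_norm q lborel (\<lambda>x. ennreal (cmod (U' (t, x))))) \<in> borel_measurable lborel"
    using Lp_norm_section_measurable[of U q] Lp_norm_section_measurable[of U' q] by simp_all
  show "AE t in lborel. Lp_norm q lborel (\<lambda>x. ennreal (cmod (U (t, x))))
    = Lp_norm q lborel (\<lambda>x. ennreal (cmod (U' (t, x))))"
    using ae
  proof eventually_elim
    fix t assume "AE x in lborel. U (t, x) = U' (t, x)"
    then have "AE x in lborel. ennreal (cmod (U (t, x))) = ennreal (cmod (U' (t, x)))"
      by eventually_elim simp
    then show "Lp_norm q lborel (\<lambda>x. ennreal (cmod (U (t, x))))
      = Lp_norm q lborel (\<lambda>x. ennreal (cmod (U' (t, x))))"
      by (intro Lp_norm_cong_AE) auto
  qed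
qed

definition inv_exp :: "ennreal \<Rightarrow> real"
  where "inv_exp q = (if q = \<infinity> then 0 else 1 / enn2real q)"

lemma Lp_norm_affine:
  fixes f :: "'a::euclidean_space \<Rightarrow> ennreal"
  assumes [measurable]: "f \<in> borel_measurable borel" and N: "N > 0" and q: "q > 0"
  shows "Lp_norm q lborel (\<lambda>x. f (x0 + inverse N *\<^sub>R x))
    = ennreal (N powr (real DIM('a) * inv_exp q)) * Lp_norm q lborel f"
proof (cases "q = \<infinity>")
  case True
  have *: "(AE x in lborel. f (x0 + inverse N *\<^sub>R x) \<le> c) \<longleftrightarrow> (AE x in lborel. f x \<le> c)" for c
  proof
    show "AE x in lborel. f (x0 + inverse N *\<^sub>R x) \<le> c" if "AE x in lborel. f x \<le> c"
      by (rule AE_lborel_affine[OF that]) (use N in simp)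
    show "AE x in lborel. f x \<le> c" if "AE x in lborel. f (x0 + inverse N *\<^sub>R x) \<le> c"
      using AE_lborel_affine[OF that, of N "- N *\<^sub>R x0"] N by (simp add: scaleR_diff_right)
  qed
  \<comment> \<open>Two extended reals with the same upper bounds coincide.\<close>
  have "esssup lborel (\<lambda>x. f (x0 + inverse N *\<^sub>R x)) \<le> c \<longleftrightarrow> esssup lborel f \<le> c" for c
    using * by (simp add: esssup_le_iff)
  then have "esssup lborel (\<lambda>x. f (x0 + inverse N *\<^sub>R x)) = esssup lborel f"
    by (meson antisym order_refl)
  then show ?thesis using True N by (simp add: Lp_norm_def inv_exp_def)
next
  case False
  define Q where "Q = enn2real q"
  have Q: "Q > 0" using False q by (simp add: Q_def enn2real_positive_iff less_top)
  let ?I = "\<integral>\<^sup>+x. ennreal_powr (f x) Q \<partial>lborel"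
    and ?I' = "\<integral>\<^sup>+x. ennreal_powr (f (x0 + inverse N *\<^sub>R x)) Q \<partial>lborel"
  have "?I = ennreal (\<bar>inverse N\<bar> ^ DIM('a)) * ?I'"
    by (rule nn_integral_lborel_affine) (use N in auto)
  then have "ennreal (N ^ DIM('a)) * ?I = ennreal (N ^ DIM('a) * inverse N ^ DIM('a)) * ?I'"
    using N by (simp add: ennreal_mult mult.assoc)
  also have "N ^ DIM('a) * inverse N ^ DIM('a) = 1" using N by (simp flip: power_mult_distrib)
  finally have "?I' = ennreal (N powr DIM('a)) * ?I" using N by (simp add: powr_realpow)
  then have "ennreal_powr ?I' (1 / Q) = ennreal (N powr (real DIM('a) * (1 / Q)))
    * ennreal_powr ?I (1 / Q)"
    using N by (simp add: ennreal_powr_mult powr_powr)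
  then show ?thesis using False by (simp add: Lp_norm_def inv_exp_def Q_def)
qed

lemma Lp_norm_cmult:
  assumes [measurable]: "f \<in> borel_measurable M" and c: "c > 0" and q: "q > 0"
  shows "Lp_norm q M (\<lambda>x. ennreal c * f x) = ennreal c * Lp_norm q M f"
proof (cases "q = \<infinity>")
  case True
  have c1: "ennreal (inverse c) * (ennreal c * y) = y" "ennreal c * (ennreal (inverse c) * y) = y"
    for y
    using c by (simp_all add: mult.assoc[symmetric] flip: ennreal_mult)
  have le: "ennreal c * y \<le> z \<longleftrightarrow> y \<le> ennreal (inverse c) * z" for y z
    by (metis c1 mult_left_mono zero_le)
  have "esssup M (\<lambda>x. ennreal c * f x) \<le> z \<longleftrightarrow> ennreal c * esssup M f \<le> z" for z
    by (simp add: esssup_le_iff le)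
  then have "esssup M (\<lambda>x. ennreal c * f x) = ennreal c * esssup M f" by (meson antisym order_refl)
  then show ?thesis using True by (simp add: Lp_norm_def)
next
  case False
  then have Q: "enn2real q > 0" using q by (simp add: enn2real_positive_iff less_top)
  show ?thesis
    using False c Q by (simp add: Lp_norm_def ennreal_powr_mult nn_integral_cmult powr_powr)
qed

lemma hdot_of_scaleR:
  assumes k: "sqint lborel k"
  shows "hdot_of s (\<lambda>\<xi>. c *\<^sub>R k \<xi>) \<phi> = c *\<^sub>R hdot_of s k \<phi>"
proof (cases "\<phi> \<in> test_space s")
  case True
  show ?thesis
    by (simp add: hdot_of_apply(1)[OF sqint_scaleR(1)[OF k] True] hdot_of_apply(1)[OF k True])
qed (simp add: hdot_of_not_test)

locale dispersive_component = dispersive s h + sobolev_index "s $ j" dummy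
  for s :: "real^'n" and h :: "'a::euclidean_space \<Rightarrow> complex^'n^'n" and j :: 'n
    and dummy :: "'a itself"
begin

abbreviation "\<sigma> \<equiv> s $ j"

definition evol_j :: "real \<Rightarrow> ('a \<Rightarrow> complex^'n) \<Rightarrow> 'a \<Rightarrow> complex"
  where "evol_j t K = (\<lambda>\<xi>. evol t K \<xi> $ j)"

definition wave :: "('a \<Rightarrow> complex^'n) \<Rightarrow> real \<Rightarrow> 'a distribution"
  where "wave K = (\<lambda>t. propagator s h t (datum s K) $ j)"

definition rep :: "(real \<times> 'a \<Rightarrow> complex) \<Rightarrow> ('a \<Rightarrow> complex^'n) \<Rightarrow> bool"
  where "rep U K \<longleftrightarrow> U \<in> borel_measurable borel
    \<and> (AE t in lborel. has_density (\<lambda>x. U (t, x)) (hdot_of \<sigma> (evol_j t K)))"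

lemma evol_j_sqint:
  assumes "sqint lborel K"
  shows "sqint lborel (evol_j t K)" "l2norm lborel (evol_j t K) \<le> l2norm lborel K"
  unfolding evol_j_def using sqint_nth[OF evol(1)[OF assms], of t j] l2norm_evol[OF assms, of t]
    by auto

lemma represents_wave:
  assumes "sqint lborel K"
  shows "represents U (wave K) \<longleftrightarrow> rep U K"
  by (simp add: represents_def rep_def has_density_def wave_def evol(2)[OF assms] datum_nth
    evol_j_def)

lemma rep_unique:
  assumes "rep U K" "rep U' K"
  shows "AE t in lborel. AE x in lborel. U (t, x) = U' (t, x)"
proof -
  have "AE t in lborel. has_density (\<lambda>x. U (t, x)) (hdot_of \<sigma> (evol_j t K))"
    "AE t in lborel. has_density (\<lambda>x. U' (t, x)) (hdot_of \<sigma> (evol_j t K))"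
    using assms by (auto simp: rep_def)
  then show ?thesis by eventually_elim (rule has_density_unique)
qed

lemma spacetime_norm_rep:
  assumes K: "sqint lborel K" and U: "rep U K"
  shows "spacetime_norm p q (wave K) = mixed_norm p q U"
proof -
  have eq: "mixed_norm p q U' = mixed_norm p q U" if "rep U' K" for U'
    using that U by (intro mixed_norm_cong_AE rep_unique[OF that U]) (auto simp: rep_def)
  show ?thesis
    unfolding spacetime_norm_def represents_wave[OF K] by (rule INF_eq_const) (use U eq in blast)+
qed

lemma rep_diff:
  assumes K: "sqint lborel K" "rep U K" and L: "sqint lborel L" "rep U' L"
  shows "rep (\<lambda>z. U z - U' z) (\<lambda>\<xi>. K \<xi> - L \<xi>)"
proof -
  have "hdot_of \<sigma> (evol_j t (\<lambda>\<xi>. K \<xi> - L \<xi>))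
    = (\<lambda>\<phi>. hdot_of \<sigma> (evol_j t K) \<phi> - hdot_of \<sigma> (evol_j t L) \<phi>)" for t
  proof -
    have "AE \<xi> in lborel. evol_j t (\<lambda>\<xi>. K \<xi> - L \<xi>) \<xi> = evol_j t K \<xi> - evol_j t L \<xi>"
      unfolding evol_j_def using evol_diff[OF K(1) L(1), of t] by eventually_elim simp
    then have "hdot_of \<sigma> (evol_j t (\<lambda>\<xi>. K \<xi> - L \<xi>)) = hdot_of \<sigma> (\<lambda>\<xi>. evol_j t K \<xi> - evol_j t L \<xi>)"
      by (intro hdot_of_cong_AE sqint_diff(1) evol_j_sqint K L)
    then show ?thesis
      by (simp add: hdot_of_linear[OF evol_j_sqint(1)[OF K(1)] evol_j_sqint(1)[OF L(1)]])
  qed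
  then show ?thesis
    using K(2) L(2) unfolding rep_def has_density_def
    by (auto simp: left_diff_distrib elim!: eventually_elim2)
qed

lemma rep_scaleR:
  assumes K: "sqint lborel K" "rep U K"
  shows "rep (\<lambda>z. c *\<^sub>R U z) (\<lambda>\<xi>. c *\<^sub>R K \<xi>)"
proof -
  have "hdot_of \<sigma> (evol_j t (\<lambda>\<xi>. c *\<^sub>R K \<xi>)) \<phi> = c *\<^sub>R hdot_of \<sigma> (evol_j t K) \<phi>" for t \<phi>
  proof -
    have "AE \<xi> in lborel. evol_j t (\<lambda>\<xi>. c *\<^sub>R K \<xi>) \<xi> = c *\<^sub>R evol_j t K \<xi>"
      unfolding evol_j_def using evol_scaleR[OF K(1), of t c] by eventually_elim simp
    then have "hdot_of \<sigma> (evol_j t (\<lambda>\<xi>. c *\<^sub>R K \<xi>)) = hdot_of \<sigma> (\<lambda>\<xi>. c *\<^sub>R evol_j t K \<xi>)"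
      by (intro hdot_of_cong_AE sqint_scaleR(1) evol_j_sqint K)
    then show ?thesis by (simp add: hdot_of_scaleR[OF evol_j_sqint(1)[OF K(1)]])
  qed
  then show ?thesis
    using K(2) unfolding rep_def has_density_def
    by (auto elim!: eventually_mono)
qed

section \<open>Renormalisation by translations and dilation\<close>

text \<open>Moves the space-time point (t0, x0) to the origin and the frequency N to 1:
  \<open>evol t0\<close> is the translation in time, the phase is the translation in space, and
  dilation by 1 / N places the value at N \<xi> at \<xi>.\<close>

definition renorm :: "real \<Rightarrow> real \<Rightarrow> 'a \<Rightarrow> ('a \<Rightarrow> complex^'n) \<Rightarrow> 'a \<Rightarrow> complex^'n"
  where "renorm N t0 x0 K = dilate_L2 (inverse N) (\<lambda>\<xi>. cis (x0 \<bullet> \<xi>) *s evol t0 K \<xi>)"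

lemma sqint_renorm:
  assumes "sqint lborel K" "N > 0"
  shows "sqint lborel (renorm N t0 x0 K)" "l2norm lborel (renorm N t0 x0 K) = l2norm lborel K"
  unfolding renorm_def using assms
  by (simp_all add: sqint_dilate_L2 sqint_cis_mult evol l2norm_evol)

lemma dilate_L2_AE:
  fixes K L :: "'a \<Rightarrow> complex^'n"
  assumes "AE \<xi> in lborel. K \<xi> = L \<xi>" "\<rho> > 0"
  shows "AE \<xi> in lborel. dilate_L2 \<rho> K \<xi> = dilate_L2 \<rho> L \<xi>"
proof -
  have "AE \<xi> in lborel. K (0 + inverse \<rho> *\<^sub>R \<xi>) = L (0 + inverse \<rho> *\<^sub>R \<xi>)"
    by (rule AE_lborel_affine[OF assms(1)]) (use assms(2) in simp)
  then show ?thesis by eventually_elim (simp add: dilate_L2_def)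
qed

text \<open>The flow commutes with phases, satisfies the group law and is intertwined with
  dilations, which slow time down by the factor N.\<close>

lemma evol_renorm:
  assumes K: "sqint lborel K" and N: "N > 0"
  shows "AE \<xi> in lborel. evol t (renorm N t0 x0 K) \<xi>
    = dilate_L2 (inverse N) (\<lambda>\<xi>. cis (x0 \<bullet> \<xi>) *s evol (t0 + inverse N * t) K \<xi>) \<xi>"
proof -
  note c = sqint_cis_mult(1)[OF evol(1)[OF K]]
  have iN: "inverse N > 0" using N by simp
  have 1: "AE \<xi> in lborel. evol t (renorm N t0 x0 K) \<xi>
    = dilate_L2 (inverse N) (evol (inverse N * t) (\<lambda>\<xi>. cis (x0 \<bullet> \<xi>) *s evol t0 K \<xi>)) \<xi>"
    using evol_dilate_L2[OF c iN] sqint_dilate_L2(1)[OF evol(1)[OF c] iN]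
      evol(1)[OF sqint_renorm(1)[OF K N]]
    unfolding renorm_def by (intro datum_inj[of _ _ s]) auto
  have 2: "AE \<xi> in lborel. evol (inverse N * t) (\<lambda>\<xi>. cis (x0 \<bullet> \<xi>) *s evol t0 K \<xi>) \<xi>
    = cis (x0 \<bullet> \<xi>) *s evol (t0 + inverse N * t) K \<xi>"
  proof -
    have "AE \<xi> in lborel. evol (inverse N * t) (evol t0 K) \<xi> = evol (t0 + inverse N * t) K \<xi>"
      by (rule datum_inj[OF evol(1)[OF evol(1)[OF K]] evol(1)[OF K] evol_add[OF K]])
    then show ?thesis
      using evol_cis[OF evol(1)[OF K], of "inverse N * t" x0 t0] by eventually_elim simp
  qed
  show ?thesis using 1 dilate_L2_AE[OF 2 iN] by eventually_elim simp
qed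

lemma hdot_of_evol_j_renorm:
  assumes K: "sqint lborel K" and N: "N > 0" and \<phi>: "\<phi> \<in> schwartz"
  shows "hdot_of \<sigma> (evol_j t (renorm N t0 x0 K)) \<phi> =
    complex_of_real (N powr (- bernstein_exp) * N ^ DIM('a)) * hdot_of \<sigma>
      (evol_j (t0 + inverse N * t) K) (\<lambda>x. \<phi> (N *\<^sub>R (x - x0)))"
proof -
  let ?k = "evol_j (t0 + inverse N * t) K"
  note k = evol_j_sqint(1)[OF K, of "t0 + inverse N * t"]
  let ?c = "\<lambda>\<xi>. cis (x0 \<bullet> \<xi>) * ?k \<xi>"
  have iN: "inverse N > 0" using N by simp
  have c: "sqint lborel ?c"
    using sqint_nth(1)[OF sqint_cis_mult(1)[OF evol(1)[OF K]], of x0 "t0 + inverse N * t" j]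
      by (simp add: evol_j_def)
  have "AE \<xi> in lborel. evol_j t (renorm N t0 x0 K) \<xi> = dilate_L2 (inverse N) ?c \<xi>"
    using evol_renorm[OF K N, of t t0 x0] by eventually_elim (simp add: evol_j_def dilate_L2_def)
  then have "hdot_of \<sigma> (evol_j t (renorm N t0 x0 K)) = hdot_of \<sigma> (dilate_L2 (inverse N) ?c)"
    by (intro hdot_of_cong_AE evol_j_sqint sqint_renorm K N sqint_dilate_L2 c iN)
  then have "hdot_of \<sigma> (evol_j t (renorm N t0 x0 K)) \<phi> = hdot_of \<sigma> (dilate_L2 (inverse N) ?c) \<phi>"
    by simp
  also have "hdot_of \<sigma> (dilate_L2 (inverse N) ?c) \<phi> = complex_of_real (inverse N powr bernstein_exp)
    * dilate (inverse N) (hdot_of \<sigma> ?c) \<phi>"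
    using dilate_hdot_of[OF c iN, of \<sigma> \<phi>] by (simp add: bernstein_exp_def)
  also have "dilate (inverse N) (hdot_of \<sigma> ?c) \<phi> = complex_of_real (N ^ DIM('a))
    * hdot_of \<sigma> ?c (\<lambda>x. \<phi> (N *\<^sub>R x))"
    using N by (simp add: dilate_def power_inverse divide_inverse mult.commute)
  also have "hdot_of \<sigma> ?c (\<lambda>x. \<phi> (N *\<^sub>R x)) = hdot_of \<sigma> ?k (\<lambda>x. \<phi> (N *\<^sub>R (x - x0)))"
  proof (rule hdot_of_cis[OF k c])
    have s1: "(\<lambda>x. \<phi> (N *\<^sub>R x)) \<in> schwartz" using schwartz_affine[OF \<phi>, of N 0] N by simp
    then show "(\<lambda>x. \<phi> (N *\<^sub>R x)) \<in> test_space \<sigma>" by (simp add: schwartz_test_space)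
    have "(\<lambda>x. \<phi> (N *\<^sub>R (x - x0))) \<in> schwartz" using schwartz_affine[OF s1, of 1 "- x0"] by simp
    then show "(\<lambda>x. \<phi> (N *\<^sub>R (x - x0))) \<in> test_space \<sigma>" by (simp add: schwartz_test_space)
  qed
  finally show ?thesis using N by (simp add: powr_minus inverse_powr mult.assoc)
qed

text \<open>The space-time function that belongs to \<open>renorm\<close>; the power of N is the
  factor (1/N)^(d/2 - s_j) of the j-th component in \<open>rescale\<close>.\<close>

definition renorm_wave :: "real \<Rightarrow> real \<Rightarrow> 'a \<Rightarrow> (real \<times> 'a \<Rightarrow> complex) \<Rightarrow> real \<times> 'a \<Rightarrow> complex"
  where "renorm_wave N t0 x0 U z = complex_of_real (N powr (- bernstein_exp))
    * U (t0 + inverse N * fst z, x0 + inverse N *\<^sub>R snd z)"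

lemma renorm_wave_measurable:
  assumes [measurable]: "U \<in> borel_measurable borel"
  shows "renorm_wave N t0 x0 U \<in> borel_measurable borel"
proof -
  have "(\<lambda>z::real \<times> 'a. (t0 + inverse N * fst z, x0 + inverse N *\<^sub>R snd z)) \<in> borel_measurable borel"
    by (intro borel_measurable_continuous_onI continuous_intros)
  from measurable_compose[OF this assms] show ?thesis unfolding renorm_wave_def[abs_def] by simp
qed

lemma rep_renorm_wave:
  assumes K: "sqint lborel K" and N: "N > 0" and U: "rep U K"
  shows "rep (renorm_wave N t0 x0 U) (renorm N t0 x0 K)"
  unfolding rep_def
proof
  show "renorm_wave N t0 x0 U \<in> borel_measurable borel" using U
    by (intro renorm_wave_measurable) (simp add: rep_def)
  have "AE t in lborel. has_density (\<lambda>x. U (t, x)) (hdot_of \<sigma> (evol_j t K))" using U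
    by (simp add: rep_def)
  from AE_lborel_affine[OF this, of "inverse N" t0] N
  have "AE t in lborel. has_density (\<lambda>x. U (t0 + inverse N * t, x))
    (hdot_of \<sigma> (evol_j (t0 + inverse N * t) K))" by simp
  then show "AE t in lborel. has_density (\<lambda>x. renorm_wave N t0 x0 U (t, x))
    (hdot_of \<sigma> (evol_j t (renorm N t0 x0 K)))"
  proof eventually_elim
    fix t assume d: "has_density (\<lambda>x. U (t0 + inverse N * t, x))
      (hdot_of \<sigma> (evol_j (t0 + inverse N * t) K))"
    show "has_density (\<lambda>x. renorm_wave N t0 x0 U (t, x)) (hdot_of \<sigma> (evol_j t (renorm N t0 x0 K)))"
      unfolding has_density_def
    proof (intro ballI)
      fix \<phi> :: "'a \<Rightarrow> complex" assume \<phi>: "\<phi> \<in> schwartz"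
      let ?u = "\<lambda>x. U (t0 + inverse N * t, x)" and ?\<psi> = "\<lambda>x. \<phi> (N *\<^sub>R (x - x0))"
      have "(\<lambda>x. \<phi> (- N *\<^sub>R x0 + N *\<^sub>R x)) \<in> schwartz" using schwartz_affine[OF \<phi>, of N "- N *\<^sub>R x0"] N
        by simp
      then have \<psi>: "?\<psi> \<in> schwartz" by (simp add: scaleR_diff_right)
      have i: "integrable lborel (\<lambda>x. ?u x * ?\<psi> x)"
        and e: "hdot_of \<sigma> (evol_j (t0 + inverse N * t) K) ?\<psi> = (\<integral>x. ?u x * ?\<psi> x \<partial>lborel)"
        using d \<psi> by (auto simp: has_density_def)
      have eq: "?u (x0 + inverse N *\<^sub>R x) * ?\<psi> (x0 + inverse N *\<^sub>R x) = ?u (x0 + inverse N *\<^sub>R x)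
        * \<phi> x" for x
        using N by simp
      have i2: "integrable lborel (\<lambda>x. ?u (x0 + inverse N *\<^sub>R x) * \<phi> x)"
        using integrable_lborel_affine[OF i, of "inverse N" x0] N unfolding eq by simp
      have "(\<integral>x. ?u x * ?\<psi> x \<partial>lborel) = (\<bar>inverse N\<bar> ^ DIM('a)) *\<^sub>R (\<integral>x. ?u (x0 + inverse N *\<^sub>R x)
        * \<phi> x \<partial>lborel)"
        using integral_lborel_affine[OF borel_measurable_integrable[OF i, simplified], of
          "inverse N" x0] N unfolding eq by simp
      then have e2: "complex_of_real (N ^ DIM('a)) * (\<integral>x. ?u x * ?\<psi> x \<partial>lborel)
        = (\<integral>x. ?u (x0 + inverse N *\<^sub>R x) * \<phi> x \<partial>lborel)"
        using N by (simp add: scaleR_conv_of_real power_inverse)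
      have "hdot_of \<sigma> (evol_j t (renorm N t0 x0 K)) \<phi> = complex_of_real (N powr (- bernstein_exp))
        * (complex_of_real (N ^ DIM('a)) * (\<integral>x. ?u x * ?\<psi> x \<partial>lborel))"
        unfolding hdot_of_evol_j_renorm[OF K N \<phi>] e by (simp add: mult.assoc)
      also have "\<dots> = (\<integral>x. renorm_wave N t0 x0 U (t, x) * \<phi> x \<partial>lborel)"
        unfolding e2 by (simp add: renorm_wave_def mult.assoc)
      finally have "hdot_of \<sigma> (evol_j t (renorm N t0 x0 K)) \<phi>
        = (\<integral>x. renorm_wave N t0 x0 U (t, x) * \<phi> x \<partial>lborel)" .
      moreover have "integrable lborel (\<lambda>x. renorm_wave N t0 x0 U (t, x) * \<phi> x)"
        using integrable_mult_right[OF i2, of "complex_of_real (N powr (- bernstein_exp))"]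
          by (simp add: renorm_wave_def mult.assoc)
      ultimately show "integrable lborel (\<lambda>x. renorm_wave N t0 x0 U (t, x) * \<phi> x)
        \<and> hdot_of \<sigma> (evol_j t (renorm N t0 x0 K)) \<phi> = (\<integral>x. renorm_wave N t0 x0 U (t, x) * \<phi> x
        \<partial>lborel)"
        by blast
    qed
  qed
qed

text \<open>For the critical diagonal pair the exponent of N vanishes and the norm is invariant. For
  (p, q) a nonvanishing exponent contradicts a finite nonzero Strichartz norm.\<close>

lemma mixed_norm_renorm_wave:
  fixes U :: "real \<times> 'a \<Rightarrow> complex"
  assumes U [measurable]: "U \<in> borel_measurable borel" and N: "N > 0" and pq: "p > 0" "q > 0"
  shows "mixed_norm p q (renorm_wave N t0 x0 U)
    = ennreal (N powr (inv_exp p + real DIM('a) * inv_exp q - bernstein_exp)) * mixed_norm p q U"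
proof -
  let ?G = "\<lambda>t. Lp_norm q lborel (\<lambda>x. ennreal (cmod (U (t, x))))"
  note Gm = Lp_norm_section_measurable[OF U, of q]
  have "Lp_norm q lborel (\<lambda>x. ennreal (cmod (renorm_wave N t0 x0 U (t, x))))
    = ennreal (N powr (real DIM('a) * inv_exp q - bernstein_exp)) * ?G (t0 + inverse N *\<^sub>R t)" for t
  proof -
    have "Lp_norm q lborel (\<lambda>x. ennreal (cmod (renorm_wave N t0 x0 U (t, x))))
      = Lp_norm q lborel (\<lambda>x. ennreal (N powr (- bernstein_exp)) * ennreal
      (cmod (U (t0 + inverse N * t, x0 + inverse N *\<^sub>R x))))"
      by (simp add: renorm_wave_def norm_mult ennreal_mult)
    also have "\<dots> = ennreal (N powr (- bernstein_exp))
      * Lp_norm q lborel (\<lambda>x. ennreal (cmod (U (t0 + inverse N * t, x0 + inverse N *\<^sub>R x))))"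
      using N pq by (intro Lp_norm_cmult) (auto simp: section_measurable)
    also have "Lp_norm q lborel (\<lambda>x. ennreal (cmod (U (t0 + inverse N * t, x0 + inverse N *\<^sub>R x))))
      = ennreal (N powr (real DIM('a) * inv_exp q)) * ?G (t0 + inverse N * t)"
      using Lp_norm_affine[of "\<lambda>x. ennreal (cmod (U (t0 + inverse N * t, x)))" N q x0] N pq by simp
    finally show ?thesis
      by (simp add: mult.assoc[symmetric] flip: ennreal_mult powr_add)
  qed
  then have "mixed_norm p q (renorm_wave N t0 x0 U)
    = Lp_norm p lborel (\<lambda>t. ennreal (N powr (real DIM('a) * inv_exp q - bernstein_exp)) * ?G
    (t0 + inverse N *\<^sub>R t))"
    by (simp only: mixed_norm_def)
  also have "\<dots> = ennreal (N powr (real DIM('a) * inv_exp q - bernstein_exp))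
    * Lp_norm p lborel (\<lambda>t. ?G (t0 + inverse N *\<^sub>R t))"
    using N pq Gm by (intro Lp_norm_cmult) (auto intro!: measurable_compose[OF _ Gm])
  also have "Lp_norm p lborel (\<lambda>t. ?G (t0 + inverse N *\<^sub>R t))
    = ennreal (N powr (real DIM(real) * inv_exp p)) * Lp_norm p lborel ?G"
    by (rule Lp_norm_affine[OF Gm N pq(1)])
  finally show ?thesis
    unfolding mixed_norm_def mult.assoc[symmetric] ennreal_mult[symmetric, OF powr_ge_zero
      powr_ge_zero] powr_add[symmetric]
    by (simp add: algebra_simps)
qed

text \<open>Transfers a low-pass value at frequency N and point (t0, x0) to frequency one at the
  origin. It reduces Bernstein's inequality to N = 1 and later places all concentration points at
  the same spot.\<close>

lemma LP_renorm:
  assumes K: "sqint lborel K" and N: "N > 0"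
  shows "LP N (evol_j t0 K) x0 = complex_of_real (N powr bernstein_exp)
    * LP 1 (\<lambda>\<xi>. renorm N t0 x0 K \<xi> $ j) 0"
proof -
  have [measurable]: "evol_j t0 K \<in> borel_measurable borel" using evol_j_sqint(1)[OF K]
    by (simp add: sqint_def)
  have m [measurable]: "ball (0::'a) r \<in> sets borel" for r by simp
  let ?f = "\<lambda>\<xi>. cis (x0 \<bullet> \<xi>) * lowp N (evol_j t0 K) \<xi>"
  have fm: "?f \<in> borel_measurable borel" by measurable
  have eq: "?f (0 + N *\<^sub>R \<xi>) = complex_of_real (N powr (- \<sigma>) * N powr (- (real DIM('a) / 2)))
    * lowp 1 (\<lambda>\<xi>. renorm N t0 x0 K \<xi> $ j) \<xi>" for \<xi>
  proof -
    have i: "indicator (ball 0 N) (N *\<^sub>R \<xi>) = (indicator (ball 0 1) \<xi> :: complex)"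
      using N by (auto simp: indicator_def)
    have w: "weight (- \<sigma>) (N *\<^sub>R \<xi>) = complex_of_real (N powr (- \<sigma>)) * weight (- \<sigma>) \<xi>"
      using N by (simp add: weight_def powr_mult)
    have p: "N powr (- (real DIM('a) / 2)) * inverse N powr (- (real DIM('a) / 2)) = 1"
      using N by (simp add: inverse_powr powr_minus)
    have sy: "renorm N t0 x0 K \<xi> $ j = complex_of_real (inverse N powr (- (real DIM('a) / 2)))
      * (cis (x0 \<bullet> (N *\<^sub>R \<xi>)) * evol_j t0 K (N *\<^sub>R \<xi>))"
      unfolding renorm_def dilate_L2_def evol_j_def
        by (simp add: scaleR_conv_of_real[where 'a=complex])
    have "complex_of_real (N powr (- \<sigma>) * N powr (- (real DIM('a) / 2)))
      * lowp 1 (\<lambda>\<xi>. renorm N t0 x0 K \<xi> $ j) \<xi>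
      = complex_of_real (N powr (- (real DIM('a) / 2)) * inverse N powr (- (real DIM('a) / 2))) * ?f
        (0 + N *\<^sub>R \<xi>)"
      unfolding lowp_def sy by (simp add: i w mult_ac)
    then show ?thesis unfolding p by simp
  qed
  have "FT (lowp N (evol_j t0 K)) x0 = (\<bar>N\<bar> ^ DIM('a)) *\<^sub>R (\<integral>\<xi>. ?f (0 + N *\<^sub>R \<xi>) \<partial>lborel)"
    unfolding FT_def by (rule integral_lborel_affine[OF fm]) (use N in simp)
  also have "\<dots> = complex_of_real (N ^ DIM('a) * (N powr (- \<sigma>) * N powr (- (real DIM('a) / 2))))
    * FT (lowp 1 (\<lambda>\<xi>. renorm N t0 x0 K \<xi> $ j)) 0"
    unfolding eq using N by (simp add: FT_def scaleR_conv_of_real)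
  also have "N ^ DIM('a) * (N powr (- \<sigma>) * N powr (- (real DIM('a) / 2))) = N powr bernstein_exp"
    using N by (simp add: bernstein_exp_def powr_realpow[symmetric] flip: powr_add)
  finally show ?thesis by (simp add: LP_def)
qed

definition bernstein_const :: real
  where "bernstein_const = fourier_const TYPE('a) * l2norm lborel (\<lambda>\<xi>::'a. indicator (ball 0 1) \<xi>
    * weight (- \<sigma>) \<xi>)"

lemma bernstein_const_nonneg: "bernstein_const \<ge> 0"
  using fourier_const_pos[where 'a='a] by (simp add: bernstein_const_def)

lemma LP_evol_j_bound:
  assumes K: "sqint lborel K" and N: "N > 0"
  shows "cmod (LP N (evol_j t K) x) \<le> bernstein_const * l2norm lborel K * N powr bernstein_exp"
proof -
  note s = sqint_renorm[OF K N, of t x]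
  have "cmod (LP 1 (\<lambda>\<xi>. renorm N t x K \<xi> $ j) 0) \<le> bernstein_const
    * l2norm lborel (\<lambda>\<xi>. renorm N t x K \<xi> $ j)"
    using LP_bound[OF sqint_nth(1)[OF s(1)], of 1 j 0] by (simp add: bernstein_const_def)
  also have "\<dots> \<le> bernstein_const * l2norm lborel K"
    using sqint_nth(2)[OF s(1), of j] s(2) bernstein_const_nonneg by (intro mult_left_mono) auto
  finally show ?thesis
    using N unfolding LP_renorm[OF K N] by (simp add: norm_mult mult.commute mult_left_mono)
qed

definition J :: "real \<Rightarrow> (real \<times> 'a \<Rightarrow> complex) \<Rightarrow> ennreal"
  where "J r U = (\<integral>\<^sup>+t. (\<integral>\<^sup>+x. ennreal (cmod (U (t, x)) powr r) \<partial>lborel) \<partial>lborel)"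

text \<open>At almost every time the Lr integral is interpolated between Lq and the refined Sobolev
  bound. The latter does not depend on t, as the flow preserves the norm and B is uniform in time,
  so integrating in t leaves the p-th power of the mixed norm.\<close>

lemma J_bound:
  fixes p q :: ennreal
  assumes K: "sqint lborel K" and U: "rep U K" and R: "l2norm lborel K \<le> R" "R > 0"
    and B: "B > 0" "\<And>t N x. N > 0 \<Longrightarrow> cmod (LP N (evol_j t K) x) \<le> B * N powr bernstein_exp"
    and pq: "0 < p" "p < q"
    and r: "r = enn2real p + (1 - enn2real p * inv_exp q) * sobolev_exp"
  shows "J r U \<le> ennreal_powr (mixed_norm p q U) (enn2real p) *
    ennreal ((sobolev_const * B powr (sobolev_exp - 2) * R\<^sup>2) powr (1 - enn2real p * inv_exp q))"
proof -
  let ?P = "enn2real p" and ?\<theta> = "1 - enn2real p * inv_exp q"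
    and ?G0 = "sobolev_const * B powr (sobolev_exp - 2) * R\<^sup>2"
  have [measurable]: "U \<in> borel_measurable borel" using U by (simp add: rep_def)
  have pf: "p \<noteq> \<infinity>" using less_le_trans[OF pq(2) top_greatest] by auto
  have P: "?P > 0" using pf pq by (simp add: enn2real_positive_iff less_top)
  have \<theta>: "?\<theta> = (if q = \<infinity> then 1 else 1 - ?P / enn2real q)" by (simp add: inv_exp_def)
  have G0: "?G0 > 0" using sobolev_const_pos B(1) R(2) by simp
  let ?N = "\<lambda>t. Lp_norm q lborel (\<lambda>x. ennreal (cmod (U (t, x))))"
  have "AE t in lborel. has_density (\<lambda>x. U (t, x)) (hdot_of \<sigma> (evol_j t K))" using U
    by (simp add: rep_def)
  then have "AE t in lborel. (\<integral>\<^sup>+x. ennreal (cmod (U (t, x)) powr r) \<partial>lborel)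
    \<le> ennreal_powr (?N t) ?P * ennreal (?G0 powr ?\<theta>)"
  proof eventually_elim
    fix t assume d: "has_density (\<lambda>x. U (t, x)) (hdot_of \<sigma> (evol_j t K))"
    have vm: "(\<lambda>x. U (t, x)) \<in> borel_measurable borel" by measurable
    have "(\<integral>\<^sup>+x. ennreal (cmod (U (t, x)) powr sobolev_exp) \<partial>lborel)
      \<le> ennreal (sobolev_const * B powr (sobolev_exp - 2) * (l2norm lborel (evol_j t K))\<^sup>2)"
      by (rule refined_sobolev[OF evol_j_sqint(1)[OF K] d vm B])
    also have "\<dots> \<le> ennreal ?G0"
      using evol_j_sqint(2)[OF K, of t] R sobolev_const_pos
        by (intro ennreal_leI mult_left_mono power_mono) auto
    finally have le: "(\<integral>\<^sup>+x. ennreal (cmod (U (t, x)) powr sobolev_exp) \<partial>lborel) \<le> ennreal ?G0" .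
    have vm': "(\<lambda>x. U (t, x)) \<in> borel_measurable lborel" by measurable
    show "(\<integral>\<^sup>+x. ennreal (cmod (U (t, x)) powr r) \<partial>lborel) \<le> ennreal_powr (?N t) ?P
      * ennreal (?G0 powr ?\<theta>)"
      unfolding r by (rule Lp_interpolation[OF vm' le G0 pq \<theta>])
  qed
  then have "J r U \<le> (\<integral>\<^sup>+t. ennreal_powr (?N t) ?P * ennreal (?G0 powr ?\<theta>) \<partial>lborel)"
    unfolding J_def by (rule nn_integral_mono_AE)
  also have "\<dots> = (\<integral>\<^sup>+t. ennreal_powr (?N t) ?P \<partial>lborel) * ennreal (?G0 powr ?\<theta>)"
    using Lp_norm_section_measurable[of U q] by (intro nn_integral_multc) simp
  also have "(\<integral>\<^sup>+t. ennreal_powr (?N t) ?P \<partial>lborel) = ennreal_powr (mixed_norm p q U) ?P"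
    using pf P by (simp add: mixed_norm_def Lp_norm_def[of p] ennreal_powr_inverse)
  finally show ?thesis .
qed

end

section \<open>Compactness\<close>

text \<open>Extends the convergence from countably many test functions to all of them. If it failed
  for \<phi>, a further weak limit g' along the bad subsequence, tested against \<phi> as well,
  would have the same pairings as g with g and with the sequence; this forces g' = g in norm and
  contradicts the failure.\<close>

theorem l2_weak_compact:
  fixes f :: "nat \<Rightarrow> 'a \<Rightarrow> 'b::euclidean_space"
  assumes f: "\<And>n. sqint M (f n)" and B: "\<And>n. l2norm M (f n) \<le> B"
  shows "\<exists>r g. strict_mono (r::nat \<Rightarrow> nat) \<and> sqint M g \<and>
    (\<forall>\<phi>. sqint M \<phi> \<longrightarrow> (\<lambda>n. \<integral>x. f (r n) x \<bullet> \<phi> x \<partial>M) \<longlonglongrightarrow> (\<integral>x. g x \<bullet> \<phi> x \<partial>M))"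
proof -
  from l2_weak_limit[of M f B f, OF f B f] obtain r g where r: "strict_mono (r::nat \<Rightarrow> nat)"
    and g: "sqint M g"
    and fk: "\<And>k. (\<lambda>n. \<integral>x. f (r n) x \<bullet> f k x \<partial>M) \<longlonglongrightarrow> (\<integral>x. g x \<bullet> f k x \<partial>M)"
    and gg: "(\<lambda>n. \<integral>x. f (r n) x \<bullet> g x \<partial>M) \<longlonglongrightarrow> (\<integral>x. g x \<bullet> g x \<partial>M)" by blast
  have "(\<lambda>n. \<integral>x. f (r n) x \<bullet> \<phi> x \<partial>M) \<longlonglongrightarrow> (\<integral>x. g x \<bullet> \<phi> x \<partial>M)" if \<phi>: "sqint M \<phi>" for \<phi>
  proof (rule ccontr)
    let ?a = "\<lambda>n. \<integral>x. f (r n) x \<bullet> \<phi> x \<partial>M" and ?L = "\<integral>x. g x \<bullet> \<phi> x \<partial>M"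
    assume "\<not> ?a \<longlonglongrightarrow> ?L"
    then obtain e where e: "e > 0" "\<forall>N. \<exists>n\<ge>N. e \<le> \<bar>?a n - ?L\<bar>"
      by (auto simp: LIMSEQ_def dist_real_def not_less)
    then have "\<exists>u. strict_mono (u::nat \<Rightarrow> nat) \<and> (\<forall>n. e \<le> \<bar>?a (u n) - ?L\<bar>)"
      using infinite_enumerate[of "{n. e \<le> \<bar>?a n - ?L\<bar>}"]
        by (auto simp: infinite_nat_iff_unbounded_le)
    then obtain u where u: "strict_mono (u::nat \<Rightarrow> nat)" "\<And>n. e \<le> \<bar>?a (u n) - ?L\<bar>" by blast
    define F where "F n = f (r (u n))" for n
    \<comment> \<open>Slots 0 and 1 hold \<phi> and g; the sequence itself is shifted by
      two.\<close>
    define \<psi> where "\<psi> k = (if k = 0 then \<phi> else if k = 1 then g else F (k - 2))" for k :: nat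
    have F: "sqint M (F n)" "l2norm M (F n) \<le> B" for n using f B by (auto simp: F_def)
    have \<psi>: "sqint M (\<psi> k)" for k using \<phi> g F by (simp add: \<psi>_def)
    from l2_weak_limit[of M F B \<psi>, OF F \<psi>] obtain v g' where v: "strict_mono (v::nat \<Rightarrow> nat)"
      and g': "sqint M g'"
      and k': "\<And>k. (\<lambda>n. \<integral>x. F (v n) x \<bullet> \<psi> k x \<partial>M) \<longlonglongrightarrow> (\<integral>x. g' x \<bullet> \<psi> k x \<partial>M)"
      and gg': "(\<lambda>n. \<integral>x. F (v n) x \<bullet> g' x \<partial>M) \<longlonglongrightarrow> (\<integral>x. g' x \<bullet> g' x \<partial>M)" by blast
    have uv: "strict_mono (\<lambda>n. u (v n))" using strict_mono_o[OF u(1) v] by (simp add: o_def)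
    have Fg: "(\<lambda>n. \<integral>x. F (v n) x \<bullet> g x \<partial>M) \<longlonglongrightarrow> (\<integral>x. g x \<bullet> g x \<partial>M)"
      using LIMSEQ_subseq_LIMSEQ[OF gg uv] by (simp add: F_def o_def)
    have g'g: "(\<integral>x. g' x \<bullet> g x \<partial>M) = (\<integral>x. g x \<bullet> g x \<partial>M)"
      using LIMSEQ_unique[OF k'[of 1] , of "\<integral>x. g x \<bullet> g x \<partial>M"] Fg by (simp add: \<psi>_def)
    have "(\<integral>x. g' x \<bullet> F k x \<partial>M) = (\<integral>x. g x \<bullet> F k x \<partial>M)" for k
    proof (rule LIMSEQ_unique)
      show "(\<lambda>n. \<integral>x. F (v n) x \<bullet> F k x \<partial>M) \<longlonglongrightarrow> (\<integral>x. g' x \<bullet> F k x \<partial>M)"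
        using k'[of "k + 2"] by (simp add: \<psi>_def)
      show "(\<lambda>n. \<integral>x. F (v n) x \<bullet> F k x \<partial>M) \<longlonglongrightarrow> (\<integral>x. g x \<bullet> F k x \<partial>M)"
        using LIMSEQ_subseq_LIMSEQ[OF fk[of "r (u k)"] uv] by (simp add: F_def o_def)
    qed
    \<comment> \<open>Pairings of the sequence with g' and with g agree for every k. Letting k tend
      to infinity identifies the squared norms of g' and g.\<close>
    then have "(\<integral>x. F (v k) x \<bullet> g' x \<partial>M) = (\<integral>x. F (v k) x \<bullet> g x \<partial>M)" for k
      by (simp add: inner_commute)
    then have g'g': "(\<integral>x. g' x \<bullet> g' x \<partial>M) = (\<integral>x. g x \<bullet> g x \<partial>M)"
      using LIMSEQ_unique[OF gg'] Fg by simp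
    have nn: "(l2norm M u)\<^sup>2 = (\<integral>x. u x \<bullet> u x \<partial>M)" for u
      by (simp add: l2norm_power2 power2_norm_eq_inner)
    have "(l2norm M (\<lambda>x. g' x - g x))\<^sup>2 = 0"
      using sqint_diff(3)[OF g' g] g'g g'g' by (simp add: nn)
    then have z: "l2norm M (\<lambda>x. g' x - g x) = 0" by simp
    have "\<bar>(\<integral>x. g' x \<bullet> \<phi> x \<partial>M) - ?L\<bar> \<le> 0"
      using sqint_inner(2)[OF sqint_diff(1)[OF g' g] \<phi>] sqint_inner(1)[OF g' \<phi>]
        sqint_inner(1)[OF g \<phi>] z
      by (simp add: inner_diff_left)
    then have "(\<lambda>n. \<integral>x. F (v n) x \<bullet> \<phi> x \<partial>M) \<longlonglongrightarrow> ?L" using k'[of 0] by (simp add: \<psi>_def)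
    from LIMSEQ_D[OF this e(1)] obtain n where "\<bar>(\<integral>x. F (v n) x \<bullet> \<phi> x \<partial>M) - ?L\<bar> < e" by auto
    then show False using u(2)[of "v n"] by (simp add: F_def)
  qed
  then show ?thesis using r g by blast
qed

text \<open>With \<delta> such that (1 + \<delta>)^r = 1 + \<epsilon>: if x \<le> \<delta> y, the
  sum is at most (1 + \<delta>) y; otherwise y \<le> x / \<delta> and x alone controls the
  sum.\<close>

lemma powr_add_le:
  assumes "r \<ge> 1" "\<epsilon> > 0"
  shows "\<exists>C\<ge>0. \<forall>x\<ge>0. \<forall>y\<ge>0. (x + y) powr r \<le> (1 + \<epsilon>) * y powr r + C * (x::real) powr r"
proof -
  define \<delta> where "\<delta> = (1 + \<epsilon>) powr (1 / r) - 1"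
  have d1: "(1 + \<delta>) powr r = 1 + \<epsilon>" using assms by (simp add: \<delta>_def powr_powr)
  have "1 powr (1 / r) < (1 + \<epsilon>) powr (1 / r)" using assms by (intro powr_less_mono2) auto
  then have d: "\<delta> > 0" by (simp add: \<delta>_def)
  show ?thesis
  proof (intro exI[of _ "(1 + 1 / \<delta>) powr r"] conjI allI impI)
    fix x y :: real assume xy: "x \<ge> 0" "y \<ge> 0"
    show "(x + y) powr r \<le> (1 + \<epsilon>) * y powr r + (1 + 1 / \<delta>) powr r * x powr r"
    proof (cases "x \<le> \<delta> * y")
      case True
      then have "(x + y) powr r \<le> ((1 + \<delta>) * y) powr r" using xy assms
        by (intro powr_mono2) (auto simp: algebra_simps)
      also have "\<dots> = (1 + \<epsilon>) * y powr r" using xy d by (simp add: powr_mult d1)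
      finally show ?thesis by (simp add: add_increasing2)
    next
      case False
      then have "y \<le> x / \<delta>" using d by (simp add: field_simps)
      then have "(x + y) powr r \<le> ((1 + 1 / \<delta>) * x) powr r" using xy assms
        by (intro powr_mono2) (auto simp: algebra_simps)
      also have "\<dots> = (1 + 1 / \<delta>) powr r * x powr r" using xy d by (simp add: powr_mult)
      finally show ?thesis using assms by (simp add: add_increasing)
    qed
  qed simp
qed

text \<open>The half of the Brezis--Lieb lemma that is needed here.\<close>

lemma brezis_lieb_le:
  fixes f :: "nat \<Rightarrow> 'a \<Rightarrow> complex"
  assumes [measurable]: "\<And>n. f n \<in> borel_measurable M" "g \<in> borel_measurable M"
    and lim: "AE x in M. (\<lambda>n. f n x) \<longlonglongrightarrow> g x"
    and g: "(\<integral>\<^sup>+x. ennreal (cmod (g x) powr r) \<partial>M) < \<infinity>" and r: "r \<ge> 1"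
    and \<epsilon>: "\<epsilon> > 0"
  shows "\<exists>w. w \<longlonglongrightarrow> (0::ennreal) \<and> (\<forall>n. (\<integral>\<^sup>+x. ennreal (cmod (f n x) powr r) \<partial>M) \<le>
    (\<integral>\<^sup>+x. ennreal (cmod (g x) powr r) \<partial>M) + ennreal (1 + \<epsilon>) *
      (\<integral>\<^sup>+x. ennreal (cmod (f n x - g x) powr r) \<partial>M) + w n)"
proof -
  obtain C where C: "C \<ge> 0" "\<And>x y. x \<ge> 0 \<Longrightarrow> y \<ge> 0 \<Longrightarrow> (x + y) powr r \<le> (1 + \<epsilon>) * y powr r + C
    * x powr r"
    using powr_add_le[OF r \<epsilon>] by metis
  \<comment> \<open>The positive part of the defect. By \<open>powr_add_le\<close> it is at most C
    |g|^r, a majorant independent of n, so dominated convergence applies although the functions f n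
    themselves have no common majorant.\<close>
  define W where "W n x = max 0 (cmod (f n x) powr r - cmod (g x) powr r - (1 + \<epsilon>)
    * cmod (f n x - g x) powr r)" for n x
  have Wm [measurable]: "W n \<in> borel_measurable M" for n unfolding W_def by measurable
  have "(\<lambda>n. \<integral>\<^sup>+x. ennreal (W n x) \<partial>M) \<longlonglongrightarrow> (\<integral>\<^sup>+x. 0 \<partial>M)"
  proof (rule nn_integral_dominated_convergence[where w="\<lambda>x. ennreal (C * cmod (g x) powr r)"])
    show "AE x in M. ennreal (W n x) \<le> ennreal (C * cmod (g x) powr r)" for n
    proof (intro AE_I2 ennreal_leI)
      fix x
      have "cmod (f n x) powr r \<le> (cmod (g x) + cmod (f n x - g x)) powr r"
        using norm_triangle_ineq[of "g x" "f n x - g x"] r by (intro powr_mono2) auto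
      also have "\<dots> \<le> (1 + \<epsilon>) * cmod (f n x - g x) powr r + C * cmod (g x) powr r"
        by (rule C(2)) auto
      finally have "cmod (f n x) powr r \<le> (1 + \<epsilon>) * cmod (f n x - g x) powr r + C
        * cmod (g x) powr r" .
      moreover have "0 \<le> C * cmod (g x) powr r" "0 \<le> cmod (g x) powr r" using C(1) by auto
      ultimately show "W n x \<le> C * cmod (g x) powr r" unfolding W_def
        by (intro max.boundedI) linarith+
    qed
    have "(\<integral>\<^sup>+x. ennreal (C * cmod (g x) powr r) \<partial>M)
      = ennreal C * (\<integral>\<^sup>+x. ennreal (cmod (g x) powr r) \<partial>M)"
      using C(1) by (simp add: ennreal_mult nn_integral_cmult)
    then show "(\<integral>\<^sup>+x. ennreal (C * cmod (g x) powr r) \<partial>M) < \<infinity>"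
      using g by (simp add: ennreal_mult_less_top)
    show "AE x in M. (\<lambda>n. ennreal (W n x)) \<longlonglongrightarrow> 0"
      using lim
    proof eventually_elim
      fix x assume l: "(\<lambda>n. f n x) \<longlonglongrightarrow> g x"
      have "(\<lambda>n. W n x) \<longlonglongrightarrow> max 0 (cmod (g x) powr r - cmod (g x) powr r - (1 + \<epsilon>)
        * cmod (g x - g x) powr r)"
        unfolding W_def using r by (intro tendsto_intros l tendsto_powr') auto
      then have "(\<lambda>n. W n x) \<longlonglongrightarrow> 0" by simp
      from tendsto_ennrealI[OF this] show "(\<lambda>n. ennreal (W n x)) \<longlonglongrightarrow> 0" by simp
    qed
  qed auto
  then have w: "(\<lambda>n. \<integral>\<^sup>+x. ennreal (W n x) \<partial>M) \<longlonglongrightarrow> 0" by simp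
  have "(\<integral>\<^sup>+x. ennreal (cmod (f n x) powr r) \<partial>M) \<le>
    (\<integral>\<^sup>+x. ennreal (cmod (g x) powr r) \<partial>M) + ennreal (1 + \<epsilon>) *
      (\<integral>\<^sup>+x. ennreal (cmod (f n x - g x) powr r) \<partial>M) + (\<integral>\<^sup>+x. ennreal (W n x) \<partial>M)" for n
  proof -
    have "(\<integral>\<^sup>+x. ennreal (cmod (f n x) powr r) \<partial>M)
      \<le> (\<integral>\<^sup>+x. ennreal (cmod (g x) powr r) + ennreal (1 + \<epsilon>) * ennreal (cmod (f n x - g x) powr r) +
      ennreal (W n x) \<partial>M)"
    proof (rule nn_integral_mono)
      fix x
      have "cmod (f n x) powr r \<le> cmod (g x) powr r + (1 + \<epsilon>) * cmod (f n x - g x) powr r + W n x"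
        by (simp add: W_def)
      then show "ennreal (cmod (f n x) powr r) \<le> ennreal (cmod (g x) powr r) + ennreal (1 + \<epsilon>)
        * ennreal (cmod (f n x - g x) powr r) + ennreal (W n x)"
        using \<epsilon> by (simp add: ennreal_leI W_def flip: ennreal_mult ennreal_plus)
    qed
    also have "\<dots> = (\<integral>\<^sup>+x. ennreal (cmod (g x) powr r) \<partial>M) + ennreal (1 + \<epsilon>)
      * (\<integral>\<^sup>+x. ennreal (cmod (f n x - g x) powr r) \<partial>M) + (\<integral>\<^sup>+x. ennreal (W n x) \<partial>M)"
      by (simp add: nn_integral_add nn_integral_cmult)
    finally show ?thesis .
  qed
  with w show ?thesis by blast
qed

section \<open>From weak convergence of data to almost everywhere convergence of solutions\<close>

lemma gauss_Pair: "gauss \<tau> (t, x) = gauss \<tau> t * gauss \<tau> x"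
  by (simp add: gauss_def norm_Pair exp_add[symmetric] field_simps)

context dispersive_component
begin

text \<open>Polarisation: the flow preserves the norms of K, of L and of their difference.\<close>

lemma inner_evol:
  assumes K: "sqint lborel K" and L: "sqint lborel L"
  shows "(\<integral>\<xi>. evol t K \<xi> \<bullet> evol t L \<xi> \<partial>lborel) = (\<integral>\<xi>. K \<xi> \<bullet> L \<xi> \<partial>lborel)"
proof -
  note d = sqint_diff(1)[OF K L]
  have "(\<lambda>\<xi>. evol t K \<xi> - evol t L \<xi>) \<in> borel_measurable lborel"
    using evol(1)[OF K, of t] evol(1)[OF L, of t]
      by (auto simp: sqint_def intro: borel_measurable_diff)
  from sqint_cong_AE(2)[OF evol(1)[OF d] this evol_diff[OF K L]]
  have "l2norm lborel (\<lambda>\<xi>. evol t K \<xi> - evol t L \<xi>) = l2norm lborel (\<lambda>\<xi>. K \<xi> - L \<xi>)"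
    by (simp add: l2norm_evol[OF d])
  then show ?thesis
    using sqint_diff(3)[OF evol(1)[OF K, of t] evol(1)[OF L, of t]] sqint_diff(3)[OF K L]
      l2norm_evol[OF K, of t] l2norm_evol[OF L, of t]
    by simp
qed

lemma evol_inverse:
  assumes L: "sqint lborel L"
  shows "AE \<xi> in lborel. evol t (evol (- t) L) \<xi> = L \<xi>"
proof (rule datum_inj[OF evol(1)[OF evol(1)[OF L]] L])
  show "datum s (evol t (evol (- t) L)) = datum s L"
    using evol_add[OF L, of t "- t"] solves_evol(2)[OF L] by simp
qed

text \<open>A low-pass value is an L2 pairing with a fixed function in the j-th slot. The inner
  product is real and sees only a real part; the scalar c recovers the complex value by taking 1 and
  - \<i>.\<close>

lemma LP_as_inner:
  assumes N: "N \<ge> 0"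
  shows "\<exists>e. sqint lborel e \<and> (\<forall>K. sqint lborel K \<longrightarrow> (\<integral>\<xi>. K \<xi> \<bullet> e \<xi> \<partial>lborel)
    = Re (c * LP N (\<lambda>\<xi>. K \<xi> $ j) x))"
proof -
  let ?g = "\<lambda>\<xi>. cnj (c * complex_of_real (fourier_const TYPE('a)) * cis (x \<bullet> \<xi>))
    * (indicator (ball 0 N) \<xi> * weight (- \<sigma>) \<xi>)"
  let ?e = "\<lambda>\<xi>. axis j (?g \<xi>) :: complex^'n"
  have [measurable]: "ball (0::'a) N \<in> sets borel" by simp
  have "sqint lborel ?g"
    by (rule sqint_bound(1)[OF sqint_scaleR(1)[OF sqint_low_weight[OF N], of "cmod (c
      * complex_of_real (fourier_const TYPE('a)))"]])
       (auto simp: norm_mult)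
  then have "sqint lborel (\<lambda>\<xi>. ?e \<xi> $ i)" for i
    by (cases "i = j") (auto simp: axis_def sqint_def)
  then have e: "sqint lborel ?e" by (rule sqint_vec(1))
  have "(\<integral>\<xi>. K \<xi> \<bullet> ?e \<xi> \<partial>lborel) = Re (c * LP N (\<lambda>\<xi>. K \<xi> $ j) x)" if K: "sqint lborel K" for K
  proof -
    note l = lowp_integrable[OF sqint_nth(1)[OF K, of j] N]
    have "K \<xi> \<bullet> ?e \<xi> = Re (c * complex_of_real (fourier_const TYPE('a))
      * (cis (x \<bullet> \<xi>) * lowp N (\<lambda>\<xi>. K \<xi> $ j) \<xi>))" for \<xi>
    proof -
      have "K \<xi> \<bullet> ?e \<xi> = Re (K \<xi> $ j * cnj (?g \<xi>))"
      proof -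
        have "z \<bullet> w = Re (z * cnj w)" for z w :: complex by (simp add: inner_complex_def)
        then show ?thesis by (simp only: inner_axis)
      qed
      also have "K \<xi> $ j * cnj (?g \<xi>) = c * complex_of_real (fourier_const TYPE('a))
        * (cis (x \<bullet> \<xi>) * lowp N (\<lambda>\<xi>. K \<xi> $ j) \<xi>)"
        by (simp add: lowp_def weight_def indicator_def mult_ac)
      finally show ?thesis .
    qed
    then have "(\<integral>\<xi>. K \<xi> \<bullet> ?e \<xi> \<partial>lborel)
      = (\<integral>\<xi>. Re (c * complex_of_real (fourier_const TYPE('a)) * (cis (x \<bullet> \<xi>) * lowp N (\<lambda>\<xi>. K \<xi> $ j)
      \<xi>)) \<partial>lborel)"
      by simp
    also have "\<dots> = Re (\<integral>\<xi>. c * complex_of_real (fourier_const TYPE('a))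
      * (cis (x \<bullet> \<xi>) * lowp N (\<lambda>\<xi>. K \<xi> $ j) \<xi>) \<partial>lborel)"
      by (intro integral_Re integrable_mult_right integrable_cis_mult l)
    finally show ?thesis by (simp add: LP_def FT_def mult.assoc)
  qed
  with e show ?thesis by blast
qed

text \<open>Norm preservation and the group law make \<open>evol (- t)\<close> the adjoint of
  \<open>evol t\<close>, so the low-pass value at time t is again the pairing of the datum with one
  fixed L2 function.\<close>

lemma LP_weak:
  assumes N: "N \<ge> 0" and K: "\<And>n. sqint lborel (K n)" and G: "sqint lborel G"
    and weak: "\<And>\<phi>. sqint lborel \<phi> \<Longrightarrow> (\<lambda>n. \<integral>\<xi>. K n \<xi> \<bullet> \<phi> \<xi> \<partial>lborel) \<longlonglongrightarrow> (\<integral>\<xi>. G \<xi> \<bullet> \<phi> \<xi> \<partial>lborel)"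
  shows "(\<lambda>n. LP N (evol_j t (K n)) x) \<longlonglongrightarrow> LP N (evol_j t G) x" "(\<lambda>n. LP N (\<lambda>\<xi>. K n \<xi> $ j) x) \<longlonglongrightarrow> LP N
    (\<lambda>\<xi>. G \<xi> $ j) x"
proof -
  have *: "(\<lambda>n. Re (c * LP N (evol_j t (K n)) x)) \<longlonglongrightarrow> Re (c * LP N (evol_j t G) x) \<and>
      (\<lambda>n. Re (c * LP N (\<lambda>\<xi>. K n \<xi> $ j) x)) \<longlonglongrightarrow> Re (c * LP N (\<lambda>\<xi>. G \<xi> $ j) x)" for c
  proof -
    obtain e where e: "sqint lborel e" "\<And>K. sqint lborel K \<Longrightarrow> (\<integral>\<xi>. K \<xi> \<bullet> e \<xi> \<partial>lborel)
      = Re (c * LP N (\<lambda>\<xi>. K \<xi> $ j) x)"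
      using LP_as_inner[OF N] by metis
    have adj: "Re (c * LP N (evol_j t L) x) = (\<integral>\<xi>. L \<xi> \<bullet> evol (- t) e \<xi> \<partial>lborel)"
      if L: "sqint lborel L" for L
    proof -
      have [measurable]: "evol t L \<in> borel_measurable borel" "evol t (evol (- t) e)
        \<in> borel_measurable borel" "e \<in> borel_measurable borel"
        using evol(1)[OF L] evol(1)[OF evol(1)[OF e(1)]] e(1) by (auto simp: sqint_def)
      have "Re (c * LP N (evol_j t L) x) = (\<integral>\<xi>. evol t L \<xi> \<bullet> e \<xi> \<partial>lborel)"
        using e(2)[OF evol(1)[OF L]] by (simp add: evol_j_def)
      also have "\<dots> = (\<integral>\<xi>. evol t L \<xi> \<bullet> evol t (evol (- t) e) \<xi> \<partial>lborel)"
        by (rule integral_cong_AE) (use evol_inverse[OF e(1), of t] in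
          \<open>auto elim!: eventually_mono\<close>)
      also have "\<dots> = (\<integral>\<xi>. L \<xi> \<bullet> evol (- t) e \<xi> \<partial>lborel)" by (rule inner_evol[OF L evol(1)[OF e(1)]])
      finally show ?thesis .
    qed
    have "(\<lambda>n. Re (c * LP N (evol_j t (K n)) x)) \<longlonglongrightarrow> Re (c * LP N (evol_j t G) x)"
      unfolding adj[OF K] adj[OF G] by (rule weak[OF evol(1)[OF e(1)]])
    moreover have "(\<lambda>n. Re (c * LP N (\<lambda>\<xi>. K n \<xi> $ j) x)) \<longlonglongrightarrow> Re (c * LP N (\<lambda>\<xi>. G \<xi> $ j) x)"
      using weak[OF e(1)] unfolding e(2)[OF K] e(2)[OF G] .
    ultimately show ?thesis ..
  qed
  show "(\<lambda>n. LP N (evol_j t (K n)) x) \<longlonglongrightarrow> LP N (evol_j t G) x" "(\<lambda>n. LP N (\<lambda>\<xi>. K n \<xi> $ j) x) \<longlonglongrightarrow> LP N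
    (\<lambda>\<xi>. G \<xi> $ j) x"
    using *[of 1] *[of "- \<i>"] by (auto simp: tendsto_complex_iff)
qed

text \<open>By \<open>LP_bound\<close> continuity in time is uniform in space, which joins the
  separate continuities. The purpose is joint measurability of low-pass parts in space-time.\<close>

lemma continuous_LP_evol_j:
  assumes K: "sqint lborel K" and N: "N \<ge> 0"
  shows "continuous_on UNIV (\<lambda>z. LP N (evol_j (fst z) K) (snd z))"
proof -
  have "isCont (\<lambda>z. LP N (evol_j (fst z) K) (snd z)) (t, x)" for t x
    unfolding continuous_at
  proof (rule Lim_null[THEN iffD2], rule Lim_null_comparison)
    let ?c = "fourier_const TYPE('a) * l2norm lborel (\<lambda>\<xi>::'a. indicator (ball 0 N) \<xi>
      * weight (- \<sigma>) \<xi>)"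
    let ?F = "\<lambda>\<tau>. l2norm lborel (\<lambda>\<xi>. evol \<tau> K \<xi> - evol t K \<xi>)"
    have c0: "?c \<ge> 0" using fourier_const_pos[where 'a='a] by simp
    have "cmod (LP N (evol_j \<tau> K) y - LP N (evol_j t K) x)
      \<le> ?c * ?F \<tau> + cmod (LP N (evol_j t K) y - LP N (evol_j t K) x)" for \<tau> y
    proof -
      note d = sqint_diff(1)[OF evol(1)[OF K, of \<tau>] evol(1)[OF K, of t]]
      have "cmod (LP N (evol_j \<tau> K) y - LP N (evol_j t K) y)
        \<le> ?c * l2norm lborel (\<lambda>\<xi>. evol_j \<tau> K \<xi> - evol_j t K \<xi>)"
        using LP_bound[OF sqint_diff(1)[OF evol_j_sqint(1)[OF K, of \<tau>] evol_j_sqint(1)[OF K, of t]]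
          N, of y]
        by (simp add: LP_diff[OF evol_j_sqint(1)[OF K] evol_j_sqint(1)[OF K] N])
      also have "\<dots> \<le> ?c * ?F \<tau>"
        using sqint_nth(2)[OF d, of j] by (intro mult_left_mono c0) (simp add: evol_j_def)
      finally show ?thesis
        using norm_triangle_ineq[of "LP N (evol_j \<tau> K) y - LP N (evol_j t K) y" "LP N (evol_j t K) y
          - LP N (evol_j t K) x"] by simp
    qed
    then show "\<forall>\<^sub>F z in at (t, x). norm (LP N (evol_j (fst z) K) (snd z)
      - LP N (evol_j (fst (t, x)) K) (snd (t, x)))
        \<le> ?c * ?F (fst z) + cmod (LP N (evol_j t K) (snd z) - LP N (evol_j t K) x)"
      by (intro always_eventually) simp
    have "isCont ?F t"
      using evol_continuous[OF K, of t] by (simp add: continuous_at l2norm_def)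
    then have "isCont (\<lambda>z. ?F (fst z)) (t, x)"
      using isCont_o2[of "(t, x)" fst ?F] by simp
    then have F: "((\<lambda>z. ?F (fst z)) \<longlongrightarrow> 0) (at (t, x))" by (simp add: continuous_at l2norm_def)
    have "isCont (LP N (evol_j t K)) x"
      using continuous_LP[OF evol_j_sqint(1)[OF K] N, of t]
        by (simp add: continuous_on_eq_continuous_at)
    then have "isCont (\<lambda>z. LP N (evol_j t K) (snd z)) (t, x)"
      using isCont_o2[of "(t, x)" snd "LP N (evol_j t K)"] by simp
    then have "((\<lambda>z. LP N (evol_j t K) (snd z)) \<longlongrightarrow> LP N (evol_j t K) x) (at (t, x))"
      by (simp add: continuous_at)
    then have "((\<lambda>z. ?c * ?F (fst z) + cmod (LP N (evol_j t K) (snd z) - LP N (evol_j t K) x)) \<longlongrightarrow> ?c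
      * 0 + cmod (LP N (evol_j t K) x - LP N (evol_j t K) x)) (at (t, x))"
      by (intro tendsto_intros F)
    then show "((\<lambda>z. ?c * ?F (fst z) + cmod (LP N (evol_j t K) (snd z) - LP N (evol_j t K) x)) \<longlongrightarrow> 0)
      (at (t, x))" by simp
  qed
  then show ?thesis by (auto intro!: continuous_at_imp_continuous_on)
qed

text \<open>At each time U is split at frequency N. For the high-pass part the spatial Gaussian is
  estimated by 1 and the temporal one, of mass sqrt(2 pi), makes the time integral finite; the
  factors 2 come from squaring a sum of two terms.\<close>

lemma gauss_weighted_bound:
  assumes K: "sqint lborel K" and U: "rep U K" and N: "N > 0"
  shows "(\<integral>\<^sup>+z. ennreal (gauss 1 z * (cmod (U z))\<^sup>2) \<partial>lborel) \<le>
    2 * (\<integral>\<^sup>+z. ennreal (gauss 1 z * (cmod (LP N (evol_j (fst z) K) (snd z)))\<^sup>2) \<partial>lborel)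
      + ennreal (2 * sqrt (2 * pi) * (N powr (- \<sigma>) * l2norm lborel K)\<^sup>2)"
proof -
  have Um [measurable]: "U \<in> borel_measurable borel" using U by (simp add: rep_def)
  have Lm [measurable]: "(\<lambda>z. LP N (evol_j (fst z) K) (snd z)) \<in> borel_measurable borel"
    using N by (intro borel_measurable_continuous_onI continuous_LP_evol_j K) simp
  have it: "(\<integral>\<^sup>+z. f z \<partial>lborel) = (\<integral>\<^sup>+t. (\<integral>\<^sup>+x. f (t, x) \<partial>lborel) \<partial>lborel)"
    if "f \<in> borel_measurable borel" for f :: "real \<times> 'a \<Rightarrow> ennreal"
    using lborel.nn_integral_fst[of f "lborel :: real measure"] that by (simp add: lborel_prod)
  let ?e = "\<lambda>t. ennreal (gauss 1 (t::real)) * ennreal (2 * (N powr (- \<sigma>) * l2norm lborel K)\<^sup>2)"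
  let ?A = "\<lambda>t. \<integral>\<^sup>+x. ennreal (gauss 1 (t, x) * (cmod (LP N (evol_j t K) x))\<^sup>2) \<partial>lborel"
  have Am: "?A \<in> borel_measurable lborel"
  proof -
    have "(\<lambda>z. ennreal (gauss 1 z * (cmod (LP N (evol_j (fst z) K) (snd z)))\<^sup>2))
      \<in> borel_measurable (lborel \<Otimes>\<^sub>M lborel)"
      unfolding lborel_prod by measurable
    from lborel.borel_measurable_nn_integral_fst[OF this] show ?thesis by simp
  qed
  have "AE t in lborel. has_density (\<lambda>x. U (t, x)) (hdot_of \<sigma> (evol_j t K))" using U
    by (simp add: rep_def)
  then have "AE t in lborel. (\<integral>\<^sup>+x. ennreal (gauss 1 (t, x) * (cmod (U (t, x)))\<^sup>2) \<partial>lborel)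
    \<le> 2 * ?A t + ?e t"
  proof eventually_elim
    fix t assume d: "has_density (\<lambda>x. U (t, x)) (hdot_of \<sigma> (evol_j t K))"
    let ?L = "\<lambda>x. LP N (evol_j t K) x"
    have Lm' [measurable]: "?L \<in> borel_measurable borel" using N
      by (intro LP_measurable evol_j_sqint K) simp
    have vm: "(\<lambda>x. U (t, x)) \<in> borel_measurable borel" by measurable
    note W = has_density_highp[OF evol_j_sqint(1)[OF K, of t] d vm N]
    have "l2norm lborel (\<lambda>x. U (t, x) - ?L x) \<le> N powr (- \<sigma>) * l2norm lborel (evol_j t K)"
      using W(2) highp_sqint(2)[OF evol_j_sqint(1)[OF K, of t] N] by linarith
    also have "\<dots> \<le> N powr (- \<sigma>) * l2norm lborel K" by (intro mult_left_mono evol_j_sqint K) simp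
    finally have Wb: "(l2norm lborel (\<lambda>x. U (t, x) - ?L x))\<^sup>2 \<le> (N powr (- \<sigma>) * l2norm lborel K)\<^sup>2"
      by (intro power_mono) auto
    have "(\<integral>\<^sup>+x. ennreal (gauss 1 (t, x) * (cmod (U (t, x)))\<^sup>2) \<partial>lborel)
      \<le> (\<integral>\<^sup>+x. 2 * ennreal (gauss 1 (t, x) * (cmod (?L x))\<^sup>2) + ennreal (gauss 1 t * 2) * ennreal
        ((cmod (U (t, x) - ?L x))\<^sup>2) \<partial>lborel)"
    proof (rule nn_integral_mono)
      fix x
      have "(cmod (U (t, x)))\<^sup>2 \<le> (cmod (?L x) + cmod (U (t, x) - ?L x))\<^sup>2"
        using norm_triangle_ineq[of "?L x" "U (t, x) - ?L x"] by (intro power_mono) auto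
      also have "\<dots> \<le> 2 * (cmod (?L x))\<^sup>2 + 2 * (cmod (U (t, x) - ?L x))\<^sup>2"
        using sum_squares_bound[of "cmod (?L x)" "cmod (U (t, x) - ?L x)"] by (simp add: power2_sum)
      finally have "gauss 1 (t, x) * (cmod (U (t, x)))\<^sup>2
        \<le> gauss 1 (t, x) * (2 * (cmod (?L x))\<^sup>2 + 2 * (cmod (U (t, x) - ?L x))\<^sup>2)"
        by (rule mult_left_mono) simp
      also have "\<dots> = 2 * (gauss 1 (t, x) * (cmod (?L x))\<^sup>2) + gauss 1 (t, x)
        * (2 * (cmod (U (t, x) - ?L x))\<^sup>2)" by (simp add: algebra_simps)
      also have "\<dots> \<le> 2 * (gauss 1 (t, x) * (cmod (?L x))\<^sup>2) + gauss 1 t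
        * (2 * (cmod (U (t, x) - ?L x))\<^sup>2)"
        by (intro add_left_mono mult_right_mono) (auto simp: gauss_Pair mult_left_le)
      finally have "ennreal (gauss 1 (t, x) * (cmod (U (t, x)))\<^sup>2)
        \<le> ennreal (2 * (gauss 1 (t, x) * (cmod (?L x))\<^sup>2) + gauss 1 t * 2 *
        (cmod (U (t, x) - ?L x))\<^sup>2)"
        by (intro ennreal_leI) (simp only: mult.assoc)
      also have "\<dots> = 2 * ennreal (gauss 1 (t, x) * (cmod (?L x))\<^sup>2) + ennreal (gauss 1 t * 2)
        * ennreal ((cmod (U (t, x) - ?L x))\<^sup>2)"
        by (subst ennreal_plus) (auto simp: ennreal_mult)
      finally show "ennreal (gauss 1 (t, x) * (cmod (U (t, x)))\<^sup>2)
        \<le> 2 * ennreal (gauss 1 (t, x) * (cmod (?L x))\<^sup>2) + ennreal (gauss 1 t * 2) * ennreal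
        ((cmod (U (t, x) - ?L x))\<^sup>2)" .
    qed
    also have "\<dots> = 2 * ?A t + ennreal (gauss 1 t * 2)
      * ennreal ((l2norm lborel (\<lambda>x. U (t, x) - ?L x))\<^sup>2)"
      unfolding nn_integral_l2norm[OF W(1), symmetric]
      by (simp add: nn_integral_add nn_integral_cmult)
    also have "\<dots> \<le> 2 * ?A t + ennreal (gauss 1 t * 2) * ennreal ((N powr (- \<sigma>) * l2norm lborel K)\<^sup>2)"
      by (intro add_left_mono mult_left_mono ennreal_leI Wb) simp
    also have "\<dots> = 2 * ?A t + ?e t" by (simp add: ennreal_mult mult.assoc)
    finally show "(\<integral>\<^sup>+x. ennreal (gauss 1 (t, x) * (cmod (U (t, x)))\<^sup>2) \<partial>lborel) \<le> 2 * ?A t + ?e t" .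
  qed
  then have "(\<integral>\<^sup>+t. (\<integral>\<^sup>+x. ennreal (gauss 1 (t, x) * (cmod (U (t, x)))\<^sup>2) \<partial>lborel) \<partial>lborel)
    \<le> (\<integral>\<^sup>+t. 2 * ?A t + ?e t \<partial>lborel)"
    by (rule nn_integral_mono_AE)
  also have "\<dots> = 2 * (\<integral>\<^sup>+t. ?A t \<partial>lborel) + (\<integral>\<^sup>+t. ennreal (gauss 1 (t::real)) \<partial>lborel)
    * ennreal (2 * (N powr (- \<sigma>) * l2norm lborel K)\<^sup>2)"
    using Am by (simp add: nn_integral_add nn_integral_cmult nn_integral_multc)
  also have "(\<integral>\<^sup>+t. ennreal (gauss 1 (t::real)) \<partial>lborel)
    * ennreal (2 * (N powr (- \<sigma>) * l2norm lborel K)\<^sup>2) = ennreal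
    (2 * sqrt (2 * pi) * (N powr (- \<sigma>) * l2norm lborel K)\<^sup>2)"
    by (subst nn_integral_gauss) (auto simp: mult_ac simp flip: ennreal_mult)
  also have "(\<integral>\<^sup>+t. (\<integral>\<^sup>+x. ennreal (gauss 1 (t, x) * (cmod (U (t, x)))\<^sup>2) \<partial>lborel) \<partial>lborel)
    = (\<integral>\<^sup>+z. ennreal (gauss 1 z * (cmod (U z))\<^sup>2) \<partial>lborel)"
    by (rule it[symmetric]) measurable
  also have "(\<integral>\<^sup>+t. ?A t \<partial>lborel)
    = (\<integral>\<^sup>+z. ennreal (gauss 1 z * (cmod (LP N (evol_j (fst z) K) (snd z)))\<^sup>2) \<partial>lborel)"
    by (subst it) (auto intro!: measurable_compose[OF _ measurable_ennreal] borel_measurable_times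
      Lm)
  finally show ?thesis .
qed

text \<open>N is taken large first, which controls the high-pass term uniformly in n; for that N the
  low-pass terms tend to 0 pointwise and are dominated by Bernstein's inequality. The
  Gaussian-weighted squares thus vanish in L1, and the weight is positive everywhere.\<close>

lemma weak_imp_AE_subseq:
  assumes K: "\<And>n. sqint lborel (K n)" "\<And>n. l2norm lborel (K n) \<le> R" and U: "\<And>n. rep (U n) (K n)"
    and weak: "\<And>\<phi>. sqint lborel \<phi> \<Longrightarrow> (\<lambda>n. \<integral>\<xi>. K n \<xi> \<bullet> \<phi> \<xi> \<partial>lborel) \<longlonglongrightarrow> 0"
  shows "\<exists>r. strict_mono (r::nat \<Rightarrow> nat) \<and> (AE z in lborel. (\<lambda>n. U (r n) z) \<longlonglongrightarrow> 0)"
proof -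
  have Um [measurable]: "U n \<in> borel_measurable borel" for n using U by (simp add: rep_def)
  define u where "u n z = gauss 1 z * (cmod (U n z))\<^sup>2" for n z
  have um [measurable]: "u n \<in> borel_measurable borel" for n unfolding u_def by measurable
  have R: "R \<ge> 0" using order_trans[OF l2norm_nonneg K(2)] .
  define a where "a N n = (\<integral>\<^sup>+z. ennreal (gauss 1 z * (cmod (LP N (evol_j (fst z) (K n)) (snd z)))\<^sup>2)
    \<partial>lborel)" for N n
  have b: "(\<integral>\<^sup>+z. ennreal (u n z) \<partial>lborel)
    \<le> 2 * a N n + ennreal (2 * sqrt (2 * pi) * (N powr (- \<sigma>) * R)\<^sup>2)" if N: "N > 0" for N n
  proof -
    have "(N powr (- \<sigma>) * l2norm lborel (K n))\<^sup>2 \<le> (N powr (- \<sigma>) * R)\<^sup>2"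
      by (intro power_mono mult_left_mono K) auto
    then have "ennreal (2 * sqrt (2 * pi) * (N powr (- \<sigma>) * l2norm lborel (K n))\<^sup>2)
      \<le> ennreal (2 * sqrt (2 * pi) * (N powr (- \<sigma>) * R)\<^sup>2)"
      by (intro ennreal_leI mult_left_mono) auto
    then show ?thesis
      using gauss_weighted_bound[OF K(1) U N, of n] unfolding u_def a_def
        by (meson add_left_mono order_trans)
  qed
  have sz: "sqint lborel (\<lambda>_::'a. 0 :: complex^'n)" by (simp add: sqint_def)
  \<comment> \<open>The weak limit is the zero datum, but its evolution is again only a chosen
    representative; norm preservation shows that its low-pass values are 0.\<close>
  have LP0: "LP N (evol_j t (\<lambda>_. 0)) x = 0" if "N \<ge> 0" for N t x
  proof -
    have "l2norm lborel (evol_j t (\<lambda>_. 0)) \<le> 0" using evol_j_sqint(2)[OF sz, of t]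
      by (simp add: l2norm_def)
    then show ?thesis
      using LP_bound[OF evol_j_sqint(1)[OF sz, of t] that, of x]
      l2norm_nonneg[of lborel "evol_j t (\<lambda>_. 0)"] by simp
  qed
  have a0: "a N \<longlonglongrightarrow> 0" if N: "N > 0" for N
  proof -
    have "a N \<longlonglongrightarrow> (\<integral>\<^sup>+z. 0 \<partial>(lborel :: (real \<times> 'a) measure))"
      unfolding a_def
    proof (rule nn_integral_dominated_convergence[where w="\<lambda>z. ennreal (gauss 1 z * (bernstein_const
      * R * N powr bernstein_exp)\<^sup>2)"])
      fix n
      have "(\<lambda>z. LP N (evol_j (fst z) (K n)) (snd z)) \<in> borel_measurable borel"
        using N by (intro borel_measurable_continuous_onI continuous_LP_evol_j K) simp
      then show "(\<lambda>z. ennreal (gauss 1 z * (cmod (LP N (evol_j (fst z) (K n)) (snd z)))\<^sup>2))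
        \<in> borel_measurable lborel" by measurable
      show "AE z in lborel. ennreal (gauss 1 z * (cmod (LP N (evol_j (fst z) (K n)) (snd z)))\<^sup>2)
        \<le> ennreal (gauss 1 z * (bernstein_const * R * N powr bernstein_exp)\<^sup>2)"
      proof (intro AE_I2 ennreal_leI mult_left_mono power_mono)
        fix z :: "real \<times> 'a"
        have "bernstein_const * l2norm lborel (K n) * N powr bernstein_exp \<le> bernstein_const * R
          * N powr bernstein_exp"
          using bernstein_const_nonneg K(2) by (intro mult_right_mono mult_left_mono) auto
        then show "cmod (LP N (evol_j (fst z) (K n)) (snd z)) \<le> bernstein_const * R
          * N powr bernstein_exp"
          using LP_evol_j_bound[OF K(1) N, of "fst z" n "snd z"] by linarith
      qed auto
    next
      have "(\<integral>\<^sup>+z. ennreal (gauss 1 z * (bernstein_const * R * N powr bernstein_exp)\<^sup>2)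
        \<partial>(lborel :: (real \<times> 'a) measure)) = (\<integral>\<^sup>+z. ennreal (gauss 1 (z::real \<times> 'a)) \<partial>lborel) *
        ennreal ((bernstein_const * R * N powr bernstein_exp)\<^sup>2)"
        by (subst nn_integral_multc[symmetric]) (auto simp: ennreal_mult)
      also have "\<dots> < \<infinity>" by (subst nn_integral_gauss) (auto simp: ennreal_mult_less_top)
      finally show "(\<integral>\<^sup>+z. ennreal (gauss 1 z * (bernstein_const * R * N powr bernstein_exp)\<^sup>2)
        \<partial>(lborel :: (real \<times> 'a) measure)) < \<infinity>" .
      show "AE z in lborel. (\<lambda>n. ennreal (gauss 1 z
        * (cmod (LP N (evol_j (fst z) (K n)) (snd z)))\<^sup>2)) \<longlonglongrightarrow> 0"
      proof (rule AE_I2)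
        fix z :: "real \<times> 'a"
        have "(\<lambda>n. LP N (evol_j (fst z) (K n)) (snd z)) \<longlonglongrightarrow> LP N (evol_j (fst z) (\<lambda>_. 0)) (snd z)"
          using N by (intro LP_weak(1) K sz) (auto simp: weak)
        then have "(\<lambda>n. LP N (evol_j (fst z) (K n)) (snd z)) \<longlonglongrightarrow> 0" using N by (simp add: LP0)
        then have "(\<lambda>n. ennreal (gauss 1 z * (cmod (LP N (evol_j (fst z) (K n)) (snd z)))\<^sup>2)) \<longlonglongrightarrow>
          ennreal (gauss 1 z * (cmod 0)\<^sup>2)"
          by (intro tendsto_intros)
        then show "(\<lambda>n. ennreal (gauss 1 z * (cmod (LP N (evol_j (fst z) (K n)) (snd z)))\<^sup>2)) \<longlonglongrightarrow> 0"
          by simp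
      qed
    qed auto
    then show ?thesis by simp
  qed
  \<comment> \<open>Any fixed cut-off gives integrability; N = 1 is used.\<close>
  have fin: "(\<integral>\<^sup>+z. ennreal (u n z) \<partial>lborel) < \<infinity>" for n
  proof -
    have "a 1 n \<le> (\<integral>\<^sup>+z. ennreal (gauss 1 (z::real \<times> 'a)) * ennreal ((bernstein_const * R)\<^sup>2)
      \<partial>lborel)"
      unfolding a_def
    proof (rule nn_integral_mono)
      fix z :: "real \<times> 'a"
      have "bernstein_const * l2norm lborel (K n) \<le> bernstein_const * R"
        using bernstein_const_nonneg K(2) by (intro mult_left_mono) auto
      then have "cmod (LP 1 (evol_j (fst z) (K n)) (snd z)) \<le> bernstein_const * R"
        using LP_evol_j_bound[OF K(1), of 1 "fst z" n "snd z"] by simp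
      then show "ennreal (gauss 1 z * (cmod (LP 1 (evol_j (fst z) (K n)) (snd z)))\<^sup>2)
        \<le> ennreal (gauss 1 z) * ennreal ((bernstein_const * R)\<^sup>2)"
        by (simp add: ennreal_leI mult_left_mono power_mono flip: ennreal_mult)
    qed
    also have "\<dots> < \<infinity>" by (simp add: nn_integral_multc nn_integral_gauss ennreal_mult_less_top)
    finally have "2 * a 1 n + ennreal (2 * sqrt (2 * pi) * (1 powr (- \<sigma>) * R)\<^sup>2) < \<infinity>"
      by (simp add: ennreal_mult_less_top)
    from le_less_trans[OF b[OF zero_less_one, of n] this] show ?thesis .
  qed
  have u0: "0 \<le> u n z" for n z by (simp add: u_def)
  have int: "integrable lborel (u n)" for n
    using fin[of n] u0 by (simp add: integrable_iff_bounded)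
  have nneq: "(\<integral>\<^sup>+z. ennreal (u n z) \<partial>lborel) = ennreal (\<integral>z. norm (u n z) \<partial>lborel)" for n
    using int u0 by (simp add: nn_integral_eq_integral)
  have "(\<lambda>n. \<integral>z. norm (u n z) \<partial>lborel) \<longlonglongrightarrow> 0"
  proof (rule LIMSEQ_I)
    fix e :: real assume e: "e > 0"
    have "((\<lambda>N. 2 * sqrt (2 * pi) * (N powr (- \<sigma>) * R)\<^sup>2) \<longlongrightarrow> 2 * sqrt (2 * pi) * (0 * R)\<^sup>2) at_top"
      by (intro tendsto_intros tendsto_neg_powr filterlim_ident) (use \<sigma> in auto)
    then have "\<forall>\<^sub>F N in at_top. 2 * sqrt (2 * pi) * (N powr (- \<sigma>) * R)\<^sup>2 < e / 2"
      by (rule order_tendstoD(2)) (use e in simp)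
    then have "\<exists>N>0. 2 * sqrt (2 * pi) * (N powr (- \<sigma>) * R)\<^sup>2 < e / 2"
      using eventually_happens[OF eventually_conj[OF eventually_gt_at_top[of "0::real"]]] by auto
    then obtain N where N: "N > 0" "2 * sqrt (2 * pi) * (N powr (- \<sigma>) * R)\<^sup>2 < e / 2" by blast
    have "\<forall>\<^sub>F n in sequentially. a N n < ennreal (e / 4)"
      by (rule order_tendstoD(2)[OF a0[OF N(1)]]) (use e in simp)
    then obtain n0 where n0: "\<And>n. n \<ge> n0 \<Longrightarrow> a N n < ennreal (e / 4)"
      by (auto simp: eventually_sequentially)
    have "norm ((\<integral>z. norm (u n z) \<partial>lborel) - 0) < e" if "n \<ge> n0" for n
    proof -
      have "ennreal (\<integral>z. norm (u n z) \<partial>lborel) \<le> 2 * ennreal (e / 4)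
        + ennreal (2 * sqrt (2 * pi) * (N powr (- \<sigma>) * R)\<^sup>2)"
        unfolding nneq[symmetric] using n0[OF that]
        by (intro order_trans[OF b[OF N(1)]] add_right_mono mult_left_mono) auto
      also have "\<dots> = ennreal (e / 2 + 2 * sqrt (2 * pi) * (N powr (- \<sigma>) * R)\<^sup>2)"
      proof -
        have "2 * ennreal (e / 4) = ennreal (2 * (e / 4))" using e by (subst ennreal_mult) auto
        then show ?thesis using e by (subst ennreal_plus) auto
      qed
      finally have "(\<integral>z. norm (u n z) \<partial>lborel) \<le> e / 2 + 2 * sqrt (2 * pi) * (N powr (- \<sigma>) * R)\<^sup>2"
        using e by (subst (asm) ennreal_le_iff) auto
      then show ?thesis using N(2) by simp
    qed
    then show "\<exists>n0. \<forall>n\<ge>n0. norm ((\<integral>z. norm (u n z) \<partial>lborel) - 0) < e" by blast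
  qed
  from tendsto_L1_AE_subseq[OF int this] obtain r where r: "strict_mono (r::nat \<Rightarrow> nat)"
    and ae: "AE z in lborel. (\<lambda>n. u (r n) z) \<longlonglongrightarrow> 0" by blast
  from ae have "AE z in lborel. (\<lambda>n. U (r n) z) \<longlonglongrightarrow> 0"
  proof eventually_elim
    fix z assume "(\<lambda>n. u (r n) z) \<longlonglongrightarrow> 0"
    then have "(\<lambda>n. inverse (gauss 1 z) * u (r n) z) \<longlonglongrightarrow> inverse (gauss 1 z) * 0"
      by (rule tendsto_mult_left)
    then have "(\<lambda>n. (cmod (U (r n) z))\<^sup>2) \<longlonglongrightarrow> 0"
      using gauss_pos(1)[of 1 z] by (simp add: u_def mult.assoc[symmetric] less_imp_neq[symmetric])
    then have "(\<lambda>n. sqrt ((cmod (U (r n) z))\<^sup>2)) \<longlonglongrightarrow> sqrt 0" by (rule tendsto_real_sqrt)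
    then show "(\<lambda>n. U (r n) z) \<longlonglongrightarrow> 0" by (simp add: tendsto_norm_zero_iff)
  qed
  with r show ?thesis by blast
qed

end

section \<open>Existence of maximizers\<close>

lemma Lp_norm_eq_0D:
  assumes [measurable]: "f \<in> borel_measurable M" and p: "p > 0" and z: "Lp_norm p M f = 0"
  shows "AE x in M. f x = 0"
proof (cases "p = \<infinity>")
  case True
  then have "esssup M f \<le> 0" using z by (simp add: Lp_norm_def)
  then show ?thesis using esssup_le_iff[of f M 0] by simp
next
  case False
  then have "(\<integral>\<^sup>+x. ennreal_powr (f x) (enn2real p) \<partial>M) = 0"
    using z by (simp add: Lp_norm_def ennreal_powr_eq_0_iff)
  then have "AE x in M. ennreal_powr (f x) (enn2real p) = 0"
    by (subst (asm) nn_integral_0_iff_AE) auto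
  then show ?thesis by eventually_elim (simp add: ennreal_powr_eq_0_iff)
qed

text \<open>Splitting the unit mass strictly loses for an exponent above 1. This excludes a weak
  limit of norm strictly between 0 and 1.\<close>

lemma powr_sum_less_1:
  fixes a r :: real
  assumes "0 < a" "a < 1" "r > 1"
  shows "a powr r + (1 - a) powr r < 1"
proof -
  have "a powr r < a powr 1" using assms by (intro powr_less_mono') auto
  moreover have "(1 - a) powr r < (1 - a) powr 1" using assms by (intro powr_less_mono') auto
  ultimately show ?thesis using assms by simp
qed

locale strichartz_flow = dispersive_component s h j dummy
  for s :: "real^'n" and h :: "'a::euclidean_space \<Rightarrow> complex^'n^'n" and j :: 'n
    and dummy :: "'a itself" +
  fixes p q :: ennreal and C :: real
  assumes exponents: "2 \<le> p" "p < q"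
    and strichartz: "\<And>f u. f \<in> hdot_prod s \<Longrightarrow> solves_cauchy s h f u \<Longrightarrow>
        spacetime_norm p q (\<lambda>t. u t $ j) \<le> ennreal (C * hdot_prod_norm s f)"
begin

lemma p_pos: "p > 0" and q_pos: "q > 0" and p_fin: "p \<noteq> \<infinity>"
proof -
  have "(0::ennreal) < 2" by simp
  then show "p > 0" using exponents(1) by (rule less_le_trans)
  then show "q > 0" using exponents(2) by (rule less_trans)
  show "p \<noteq> \<infinity>" using less_le_trans[OF exponents(2) top_greatest] by auto
qed

definition P :: real where "P = enn2real p"

lemma P_pos: "P > 0"
  using p_pos p_fin by (simp add: P_def enn2real_positive_iff less_top)

text \<open>The strict inequality \<open>p < q\<close> enters here: a positive share of the
  interpolation is left for the refined Sobolev bound.\<close>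

lemma theta_pos: "1 - P * inv_exp q > 0"
proof (cases "q = \<infinity>")
  case False
  have "P < enn2real q"
    unfolding P_def using exponents(2) p_fin False
    by (metis enn2real_mono ennreal_enn2real infinity_ennreal_def less_le less_top)
  then show ?thesis using False P_pos by (simp add: inv_exp_def)
qed (simp add: inv_exp_def)

text \<open>The exponent r of the theorem with the factor 2 cancelled.\<close>

definition crit_exp :: real where "crit_exp = (1 + real DIM('a)) / bernstein_exp"

lemma crit_exp_gt_2: "crit_exp > 2"
proof -
  have "sobolev_exp < crit_exp" using bernstein_exp_pos
    by (simp add: crit_exp_def sobolev_exp_def divide_strict_right_mono)
  then show ?thesis using sobolev_exp_gt_2 by simp
qed

text \<open>An infimum over the empty set is infinite, so the finite Strichartz bound itself
  provides a representing function.\<close>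

lemma rep_exists:
  assumes K: "sqint lborel K"
  shows "\<exists>U. rep U K \<and> mixed_norm p q U \<le> ennreal (C * l2norm lborel K)"
proof -
  have le: "spacetime_norm p q (wave K) \<le> ennreal (C * l2norm lborel K)"
    using strichartz[OF datum_in[OF K]] flow[OF datum_in[OF K]] datum_norm[OF K, of s]
      by (simp add: wave_def)
  have "{U. represents U (wave K)} \<noteq> {}"
  proof
    assume "{U. represents U (wave K)} = {}"
    then have "spacetime_norm p q (wave K) = top" by (simp add: spacetime_norm_def)
    then show False using le by (simp add: top_unique)
  qed
  then obtain U where U: "rep U K" using represents_wave[OF K] by blast
  then show ?thesis using le spacetime_norm_rep[OF K U, of p q] by auto
qed

definition wave_fn :: "('a \<Rightarrow> complex^'n) \<Rightarrow> real \<times> 'a \<Rightarrow> complex"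
  where "wave_fn K = (SOME U. rep U K \<and> mixed_norm p q U \<le> ennreal (C * l2norm lborel K))"

lemma wave_fn:
  assumes "sqint lborel K"
  shows "rep (wave_fn K) K" "mixed_norm p q (wave_fn K) \<le> ennreal (C * l2norm lborel K)"
  using someI_ex[OF rep_exists[OF assms]] by (auto simp: wave_fn_def)

lemma rep_borel: "rep U K \<Longrightarrow> U \<in> borel_measurable borel"
  by (simp add: rep_def)

lemma J_mixed: "J crit_exp U = ennreal_powr (mixed_norm (ennreal crit_exp) (ennreal crit_exp) U)
    crit_exp"
  using crit_exp_gt_2 by (simp add: mixed_norm_diag J_def ennreal_powr_inverse)

lemma mixed_J: "mixed_norm (ennreal crit_exp) (ennreal crit_exp) U
    = ennreal_powr (J crit_exp U) (1 / crit_exp)"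
  using crit_exp_gt_2 by (simp add: mixed_norm_diag J_def)

lemma J_prod:
  assumes [measurable]: "U \<in> borel_measurable borel"
  shows "J crit_exp U = (\<integral>\<^sup>+z. ennreal (cmod (U z) powr crit_exp) \<partial>lborel)"
  unfolding J_def
    using lborel.nn_integral_fst[of "\<lambda>z. ennreal (cmod (U z) powr crit_exp)"
    "lborel :: real measure"]
  by (simp add: lborel_prod)

text \<open>The r-th power of the norm to be maximised. By \<open>wave_pow_rep\<close> it does not
  depend on the chosen function; the power is the quantity that the Brezis--Lieb estimate
  splits.\<close>

definition wave_pow :: "('a \<Rightarrow> complex^'n) \<Rightarrow> ennreal" where "wave_pow K = J crit_exp (wave_fn K)"

lemma mixed_norm_wave_fn:
  assumes "sqint lborel K" "rep U K"
  shows "mixed_norm p' q' U = mixed_norm p' q' (wave_fn K)"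
  using spacetime_norm_rep[OF assms] spacetime_norm_rep[OF assms(1) wave_fn(1)[OF assms(1)]]
    by metis

lemma wave_pow_rep:
  assumes "sqint lborel K" "rep U K"
  shows "J crit_exp U = wave_pow K"
  unfolding wave_pow_def J_mixed mixed_norm_wave_fn[OF assms] ..

lemma spacetime_norm_wave_pow:
  assumes "sqint lborel K"
  shows "spacetime_norm (ennreal crit_exp) (ennreal crit_exp) (wave K)
    = ennreal_powr (wave_pow K) (1 / crit_exp)"
  unfolding spacetime_norm_rep[OF assms wave_fn(1)[OF assms]] mixed_J wave_pow_def ..

lemma wave_pow_renorm:
  assumes K: "sqint lborel K" and N: "N > 0"
  shows "wave_pow (renorm N t0 x0 K) = wave_pow K"
proof -
  have e: "inv_exp (ennreal crit_exp) + real DIM('a) * inv_exp (ennreal crit_exp) - bernstein_exp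
    = 0"
  proof -
    have "inv_exp (ennreal crit_exp) = 1 / crit_exp" using crit_exp_gt_2 by (simp add: inv_exp_def)
    moreover have "1 / crit_exp + real DIM('a) * (1 / crit_exp) = (1 + real DIM('a)) / crit_exp"
      by (simp add: add_divide_distrib)
    moreover have "(1 + real DIM('a)) / crit_exp = bernstein_exp" using bernstein_exp_pos
      by (simp add: crit_exp_def)
    ultimately show ?thesis by simp
  qed
  have r0: "ennreal crit_exp > 0" using crit_exp_gt_2 by simp
  have "wave_pow (renorm N t0 x0 K) = J crit_exp (renorm_wave N t0 x0 (wave_fn K))"
    by (rule wave_pow_rep[symmetric, OF sqint_renorm(1)[OF K N] rep_renorm_wave[OF K N
      wave_fn(1)[OF K]]])
  also have "\<dots> = wave_pow K"
    unfolding J_mixed wave_pow_def mixed_norm_renorm_wave[OF rep_borel[OF wave_fn(1)[OF K]] N r0 r0]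
      e using N by simp
  finally show ?thesis .
qed

lemma wave_pow_scaleR:
  assumes K: "sqint lborel K" and c: "c > 0"
  shows "wave_pow (\<lambda>\<xi>. c *\<^sub>R K \<xi>) = ennreal (c powr crit_exp) * wave_pow K"
proof -
  note [measurable] = rep_borel[OF wave_fn(1)[OF K]]
  have r: "rep (\<lambda>z. c *\<^sub>R wave_fn K z) (\<lambda>\<xi>. c *\<^sub>R K \<xi>)" by (rule rep_scaleR[OF K wave_fn(1)[OF K]])
  have "wave_pow (\<lambda>\<xi>. c *\<^sub>R K \<xi>) = J crit_exp (\<lambda>z. c *\<^sub>R wave_fn K z)"
    by (rule wave_pow_rep[symmetric, OF sqint_scaleR(1)[OF K] r])
  also have "\<dots> = (\<integral>\<^sup>+z. ennreal (c powr crit_exp) * ennreal (cmod (wave_fn K z) powr crit_exp)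
    \<partial>lborel)"
    using c by (subst J_prod[OF rep_borel[OF r]]) (simp add: powr_mult ennreal_mult)
  also have "\<dots> = ennreal (c powr crit_exp) * wave_pow K"
    unfolding wave_pow_def J_prod[OF rep_borel[OF wave_fn(1)[OF K]]]
      by (rule nn_integral_cmult) measurable
  finally show ?thesis .
qed

lemma J_eq_0_if_mixed:
  assumes U [measurable]: "U \<in> borel_measurable borel" and z: "mixed_norm p q U = 0"
  shows "J crit_exp U = 0"
proof -
  have m: "(\<lambda>t. Lp_norm q lborel (\<lambda>x. ennreal (cmod (U (t, x))))) \<in> borel_measurable lborel"
    using Lp_norm_section_measurable[OF U] by simp
  have "AE t in lborel. Lp_norm q lborel (\<lambda>x. ennreal (cmod (U (t, x)))) = 0"
    by (rule Lp_norm_eq_0D[OF m p_pos]) (use z in \<open>simp add: mixed_norm_def\<close>)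
  then have "AE t in lborel. (\<integral>\<^sup>+x. ennreal (cmod (U (t, x)) powr crit_exp) \<partial>lborel) = 0"
  proof eventually_elim
    fix t assume "Lp_norm q lborel (\<lambda>x. ennreal (cmod (U (t, x)))) = 0"
    then have "AE x in lborel. ennreal (cmod (U (t, x))) = 0"
      by (intro Lp_norm_eq_0D[OF _ q_pos]) auto
    then have "AE x in lborel. ennreal (cmod (U (t, x)) powr crit_exp) = 0" by eventually_elim simp
    then show "(\<integral>\<^sup>+x. ennreal (cmod (U (t, x)) powr crit_exp) \<partial>lborel) = 0"
      by (subst nn_integral_0_iff_AE) auto
  qed
  then have "J crit_exp U = (\<integral>\<^sup>+t. 0 \<partial>(lborel :: real measure))" unfolding J_def
    by (rule nn_integral_cong_AE)
  then show ?thesis by simp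
qed

lemma wave_pow_zero:
  assumes K: "sqint lborel K" and z: "l2norm lborel K = 0"
  shows "wave_pow K = 0"
  unfolding wave_pow_def
  by (rule J_eq_0_if_mixed[OF rep_borel[OF wave_fn(1)[OF K]]]) (use wave_fn(2)[OF K] z in simp)

text \<open>Unless the exponents satisfy the scaling relation, rescaling makes the left-hand side of the
  Strichartz estimate arbitrarily large, so both sides vanish.\<close>

lemma scaling_dichotomy:
  assumes e: "inv_exp p + real DIM('a) * inv_exp q \<noteq> bernstein_exp" and K: "sqint lborel K"
  shows "wave_pow K = 0"
proof -
  let ?e = "inv_exp p + real DIM('a) * inv_exp q - bernstein_exp"
  let ?X = "mixed_norm p q (wave_fn K)"
  have le: "ennreal (N powr ?e) * ?X \<le> ennreal (C * l2norm lborel K)" if N: "N > 0" for N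
  proof -
    note s = sqint_renorm[OF K N, of 0 0]
    have "ennreal (N powr ?e) * ?X = mixed_norm p q (renorm_wave N 0 0 (wave_fn K))"
      by (rule mixed_norm_renorm_wave[symmetric, OF rep_borel[OF wave_fn(1)[OF K]] N p_pos q_pos])
    also have "\<dots> = mixed_norm p q (wave_fn (renorm N 0 0 K))"
      by (rule mixed_norm_wave_fn[OF s(1) rep_renorm_wave[OF K N wave_fn(1)[OF K]]])
    also have "\<dots> \<le> ennreal (C * l2norm lborel K)" using wave_fn(2)[OF s(1)] s(2) by simp
    finally show ?thesis .
  qed
  have "?X = 0"
  proof (rule ccontr)
    assume X0: "?X \<noteq> 0"
    have "?X < top" using wave_fn(2)[OF K] by (rule le_less_trans) simp
    then obtain y where y: "?X = ennreal y" "y > 0"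
      using X0 by (cases ?X) (auto simp: less_le)
    \<comment> \<open>Any positive number above the right-hand side of the estimate; N is then
      solved from N powr ?e = b / y.\<close>
    define b where "b = \<bar>C\<bar> * l2norm lborel K + 1"
    have b: "b > 0" by (simp add: b_def add_nonneg_pos)
    define N where "N = (b / y) powr (1 / ?e)"
    have N: "N > 0" using b y by (simp add: N_def)
    have "N powr ?e = b / y" using e b y by (simp add: N_def powr_powr)
    then have "ennreal b \<le> ennreal (C * l2norm lborel K)"
      using le[OF N] y b by (simp flip: ennreal_mult)
    moreover have "C * l2norm lborel K < b"
      unfolding b_def using mult_right_mono[OF abs_ge_self[of C] l2norm_nonneg[of lborel K]]
        by linarith
    ultimately show False using b by (simp add: ennreal_le_iff2)
  qed
  then show ?thesis unfolding wave_pow_def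
    by (rule J_eq_0_if_mixed[OF rep_borel[OF wave_fn(1)[OF K]]])
qed

text \<open>Under the scaling relation the interpolation exponent of \<open>J_bound\<close> is the
  critical one; multiplying by \<open>bernstein_exp\<close> turns this into a linear
  identity.\<close>

lemma crit_exp_relation:
  assumes e: "inv_exp p + real DIM('a) * inv_exp q = bernstein_exp"
  shows "crit_exp = P + (1 - P * inv_exp q) * sobolev_exp"
proof -
  have "inv_exp p = 1 / P" using p_fin by (simp add: inv_exp_def P_def)
  then have "P * bernstein_exp = 1 + real DIM('a) * P * inv_exp q" using P_pos
    by (simp add: e[symmetric] algebra_simps)
  then have "(P + (1 - P * inv_exp q) * sobolev_exp) * bernstein_exp = 1 + real DIM('a)"
  proof -
    have "sobolev_exp * bernstein_exp = real DIM('a)" using bernstein_exp_pos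
      by (simp add: sobolev_exp_def)
    then have "(P + (1 - P * inv_exp q) * sobolev_exp) * bernstein_exp
      = P * bernstein_exp + (1 - P * inv_exp q) * real DIM('a)"
      by (simp add: distrib_right mult.assoc)
    then show ?thesis using \<open>P * bernstein_exp = _\<close> by (simp add: algebra_simps)
  qed
  then show ?thesis using bernstein_exp_pos unfolding crit_exp_def by (subst divide_eq_eq) simp
qed

lemma wave_pow_bound:
  assumes e: "inv_exp p + real DIM('a) * inv_exp q = bernstein_exp"
    and K: "sqint lborel K" "l2norm lborel K = 1"
    and B: "B > 0" "\<And>t N x. N > 0 \<Longrightarrow> cmod (LP N (evol_j t K) x) \<le> B * N powr bernstein_exp"
  shows "wave_pow K \<le> ennreal (\<bar>C\<bar> powr P * (sobolev_const * B powr (sobolev_exp - 2)) powr (1 - P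
    * inv_exp q))"
proof -
  have "wave_pow K \<le> ennreal_powr (mixed_norm p q (wave_fn K)) (enn2real p) *
    ennreal ((sobolev_const * B powr (sobolev_exp - 2) * 1\<^sup>2) powr (1 - enn2real p * inv_exp q))"
    unfolding wave_pow_def
    by (rule J_bound[OF K(1) wave_fn(1)[OF K(1)] _ _ B p_pos exponents(2)])
       (use K crit_exp_relation[OF e] in \<open>auto simp: P_def\<close>)
  also have "ennreal_powr (mixed_norm p q (wave_fn K)) (enn2real p) \<le> ennreal (\<bar>C\<bar> powr P)"
  proof -
    have "mixed_norm p q (wave_fn K) \<le> ennreal \<bar>C\<bar>"
      using wave_fn(2)[OF K(1)] K(2) by (rule_tac order_trans) (auto intro: ennreal_leI)
    then have "ennreal_powr (mixed_norm p q (wave_fn K)) P \<le> ennreal_powr (ennreal \<bar>C\<bar>) P"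
      using P_pos by (intro ennreal_powr_mono) auto
    then show ?thesis by (simp add: ennreal_powr_ennreal P_def)
  qed
  finally show ?thesis by (simp add: P_def mult_right_mono flip: ennreal_mult)
qed

definition sup_wave_pow :: ennreal
    where "sup_wave_pow = (SUP K\<in>{K. sqint lborel K \<and> l2norm lborel K = 1}. wave_pow K)"

lemma wave_pow_le_sup_wave_pow: "sqint lborel K \<Longrightarrow> l2norm lborel K = 1 \<Longrightarrow> wave_pow K \<le> sup_wave_pow"
  unfolding sup_wave_pow_def by (rule SUP_upper) simp

lemma sup_wave_pow_finite: "sup_wave_pow < \<infinity>"
proof (cases "inv_exp p + real DIM('a) * inv_exp q = bernstein_exp")
  case True
  \<comment> \<open>Bernstein's inequality is a bound for the low-pass parts uniform over unit data;
    adding 1 makes the constant positive.\<close>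
  have "sup_wave_pow
    \<le> ennreal (\<bar>C\<bar> powr P * (sobolev_const * (bernstein_const + 1) powr (sobolev_exp - 2)) powr
    (1 - P * inv_exp q))"
    unfolding sup_wave_pow_def
  proof (rule SUP_least)
    fix K :: "'a \<Rightarrow> complex^'n"
    assume "K \<in> {K. sqint lborel K \<and> l2norm lborel K = 1}"
    then have K: "sqint lborel K" "l2norm lborel K = 1" by auto
    have "cmod (LP N (evol_j t K) x) \<le> (bernstein_const + 1) * N powr bernstein_exp" if N: "N > 0"
      for t N x
    proof -
      have "cmod (LP N (evol_j t K) x) \<le> bernstein_const * N powr bernstein_exp"
        using LP_evol_j_bound[OF K(1) N] K(2) by simp
      also have "\<dots> \<le> (bernstein_const + 1) * N powr bernstein_exp" by (intro mult_right_mono) auto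
      finally show ?thesis .
    qed
    then show "wave_pow K
      \<le> ennreal (\<bar>C\<bar> powr P * (sobolev_const * (bernstein_const + 1) powr (sobolev_exp - 2)) powr
      (1 - P * inv_exp q))"
      using bernstein_const_nonneg by (intro wave_pow_bound True K) auto
  qed
  then show ?thesis by (simp add: le_less_trans)
next
  case False
  then have "sup_wave_pow \<le> 0" unfolding sup_wave_pow_def
    by (intro SUP_least) (use scaling_dichotomy in auto)
  then show ?thesis by simp
qed

lemma wave_pow_le:
  assumes K: "sqint lborel K"
  shows "wave_pow K \<le> sup_wave_pow * ennreal (l2norm lborel K powr crit_exp)"
proof (cases "l2norm lborel K = 0")
  case True
  then show ?thesis using wave_pow_zero[OF K] by simp
next
  case False
  let ?l = "l2norm lborel K"
  have l: "?l > 0" using False l2norm_nonneg[of lborel K] by linarith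
  let ?K = "\<lambda>\<xi>. (1 / ?l) *\<^sub>R K \<xi>"
  have K': "sqint lborel ?K" "l2norm lborel ?K = 1" using sqint_scaleR[OF K, of "1 / ?l"] l by auto
  have "wave_pow K = wave_pow (\<lambda>\<xi>. ?l *\<^sub>R ?K \<xi>)" using l by simp
  also have "\<dots> = ennreal (?l powr crit_exp) * wave_pow ?K" by (rule wave_pow_scaleR[OF K'(1) l])
  also have "\<dots> \<le> ennreal (?l powr crit_exp) * sup_wave_pow"
    by (intro mult_left_mono wave_pow_le_sup_wave_pow K') simp
  finally show ?thesis by (simp add: mult.commute)
qed

text \<open>Provides the maximiser when the supremum is 0.\<close>

lemma unit_exists: "\<exists>K :: 'a \<Rightarrow> complex^'n. sqint lborel K \<and> l2norm lborel K = 1"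
proof -
  let ?g = "\<lambda>\<xi>::'a. axis j (complex_of_real (gauss 1 \<xi>)) :: complex^'n"
  have i: "integrable lborel (\<lambda>\<xi>::'a. (cmod (complex_of_real (gauss 1 \<xi>)))\<^sup>2)"
    by (rule Bochner_Integration.integrable_bound[OF integrable_gauss(1)[of 1]])
      (auto simp: power2_eq_square mult_left_le)
  then have "sqint lborel (\<lambda>\<xi>. ?g \<xi> $ i)" for i by (cases "i = j") (auto simp: axis_def sqint_def)
  then have g: "sqint lborel ?g" by (rule sqint_vec(1))
  have "l2norm lborel ?g \<noteq> 0"
  proof
    assume "l2norm lborel ?g = 0"
    then have "(\<integral>\<^sup>+\<xi>. ennreal ((norm (?g \<xi>))\<^sup>2) \<partial>lborel) = 0" by (simp add: nn_integral_l2norm[OF g])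
    then have "AE \<xi> in lborel. ennreal ((norm (?g \<xi>))\<^sup>2) = 0"
      using g by (subst (asm) nn_integral_0_iff_AE) (auto simp: sqint_def)
    moreover have "ennreal ((norm (?g \<xi>))\<^sup>2) \<noteq> 0" for \<xi>
      using less_imp_neq[OF gauss_pos(1)[of 1 \<xi>]] by (simp add: axis_eq_0_iff)
    ultimately have "AE \<xi> in (lborel :: 'a measure). False" by (auto elim: eventually_mono)
    then show False by (simp add: eventually_False ae_filter_eq_bot_iff)
  qed
  then have "l2norm lborel ?g > 0" using l2norm_nonneg[of lborel ?g] by linarith
  then have "l2norm lborel (\<lambda>\<xi>. (1 / l2norm lborel ?g) *\<^sub>R ?g \<xi>) = 1"
    using sqint_scaleR(2)[OF g, of "1 / l2norm lborel ?g"] by simp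
  then show ?thesis using sqint_scaleR(1)[OF g] by blast
qed

text \<open>The contrapositive of \<open>wave_pow_bound\<close>: if all normalised low-pass values
  were at most c, then \<open>wave_pow K\<close> would be at most A c^\<kappa> with \<kappa> > 0,
  hence below m for small c.\<close>

lemma nonvanishing:
  assumes m: "m > 0" and e: "inv_exp p + real DIM('a) * inv_exp q = bernstein_exp"
  shows "\<exists>c>0. \<forall>K. sqint lborel K \<longrightarrow> l2norm lborel K = 1 \<longrightarrow> ennreal m \<le> wave_pow K \<longrightarrow>
    (\<exists>t N x. N > 0 \<and> c * N powr bernstein_exp < cmod (LP N (evol_j t K) x))"
proof -
  let ?\<theta> = "1 - P * inv_exp q"
  define A where "A = \<bar>C\<bar> powr P * sobolev_const powr ?\<theta>"
  define \<kappa> where "\<kappa> = (sobolev_exp - 2) * ?\<theta>"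
  have \<kappa>: "\<kappa> > 0" unfolding \<kappa>_def using sobolev_exp_gt_2 theta_pos by (intro mult_pos_pos) auto
  have A: "A \<ge> 0" by (simp add: A_def)
  \<comment> \<open>Chosen so that A c^\<kappa> = m A / (A + 1), which is strictly below m also when
    A = 0.\<close>
  define c where "c = (m / (A + 1)) powr (1 / \<kappa>)"
  have c: "c > 0" using m A by (simp add: c_def)
  have ck: "c powr \<kappa> = m / (A + 1)" using m A \<kappa> by (simp add: c_def powr_powr)
  have "\<bar>C\<bar> powr P * (sobolev_const * c powr (sobolev_exp - 2)) powr ?\<theta> = A * c powr \<kappa>"
    using sobolev_const_pos c by (simp add: A_def \<kappa>_def powr_mult powr_powr)
  also have "\<dots> < m" unfolding ck using m A by (simp add: field_simps)
  finally have lt: "\<bar>C\<bar> powr P * (sobolev_const * c powr (sobolev_exp - 2)) powr ?\<theta> < m" .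
  show ?thesis
  proof (rule exI[of _ c], intro conjI allI impI c)
    fix K assume K: "sqint lborel K" "l2norm lborel K = 1" and J: "ennreal m \<le> wave_pow K"
    show "\<exists>t N x. N > 0 \<and> c * N powr bernstein_exp < cmod (LP N (evol_j t K) x)"
    proof (rule ccontr)
      assume "\<not> ?thesis"
      then have "cmod (LP N (evol_j t K) x) \<le> c * N powr bernstein_exp" if "N > 0" for t N x
        using that by (rule_tac ccontr) (auto simp: not_le)
      from wave_pow_bound[OF e K c this] J
      have "ennreal m \<le> ennreal (\<bar>C\<bar> powr P * (sobolev_const * c powr (sobolev_exp - 2)) powr ?\<theta>)"
        by (rule_tac order_trans)
      then show False using lt m by (simp add: ennreal_le_iff2)
    qed
  qed
qed

lemma square_powr_half:
  fixes y :: real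
  assumes "y \<ge> 0"
  shows "(y\<^sup>2) powr (\<alpha> / 2) = y powr \<alpha>"
proof (cases "y = 0")
  case False
  then have "y\<^sup>2 = y powr 2" using assms by (simp add: powr_numeral)
  then show ?thesis by (simp add: powr_powr)
qed simp

theorem maximizer_exists: "\<exists>G. sqint lborel G \<and> l2norm lborel G = 1 \<and> wave_pow G = sup_wave_pow"
proof (cases "sup_wave_pow = 0")
  case True
  obtain K :: "'a \<Rightarrow> complex^'n" where K: "sqint lborel K" "l2norm lborel K = 1" using unit_exists
    by blast
  then show ?thesis using wave_pow_le_sup_wave_pow[OF K] True by auto
next
  case False
  have e: "inv_exp p + real DIM('a) * inv_exp q = bernstein_exp"
  proof (rule ccontr)
    assume "inv_exp p + real DIM('a) * inv_exp q \<noteq> bernstein_exp"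
    then have "sup_wave_pow \<le> 0" unfolding sup_wave_pow_def
      by (intro SUP_least) (use scaling_dichotomy in auto)
    then show False using False by simp
  qed
  obtain m where m: "sup_wave_pow = ennreal m" "m > 0"
    using sup_wave_pow_finite False by (cases sup_wave_pow) (auto simp: less_le)
  \<comment> \<open>The shift by 2 keeps the factor at least 1/2, so \<open>nonvanishing\<close>
    with m / 2 applies to every member of the sequence.\<close>
  have "\<exists>K. sqint lborel K \<and> l2norm lborel K = 1 \<and> ennreal (m * (1 - 1 / real (n + 2)))
    < wave_pow K" for n
  proof -
    have "m * (1 - 1 / real (n + 2)) < m" using m(2) by (simp add: field_simps)
    then have "ennreal (m * (1 - 1 / real (n + 2))) < sup_wave_pow" unfolding m(1) using m(2)
      by (intro ennreal_lessI) auto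
    then show ?thesis unfolding sup_wave_pow_def less_SUP_iff by blast
  qed
  then obtain K0 where K0: "\<And>n. sqint lborel (K0 n)" "\<And>n. l2norm lborel (K0 n) = 1"
    "\<And>n. ennreal (m * (1 - 1 / real (n + 2))) < wave_pow (K0 n)" by metis
  have half: "ennreal (m / 2) \<le> wave_pow (K0 n)" for n
  proof -
    have "m / 2 \<le> m * (1 - 1 / real (n + 2))" using m(2) by (simp add: field_simps)
    then have "ennreal (m / 2) \<le> ennreal (m * (1 - 1 / real (n + 2)))" by (rule ennreal_leI)
    then show ?thesis using K0(3)[of n] by simp
  qed
  obtain c where c: "c > 0" "\<And>K. sqint lborel K \<Longrightarrow> l2norm lborel K = 1 \<Longrightarrow> ennreal (m / 2)
    \<le> wave_pow K \<Longrightarrow>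
      \<exists>t N x. N > 0 \<and> c * N powr bernstein_exp < cmod (LP N (evol_j t K) x)"
    using nonvanishing[of "m / 2", OF _ e] m(2) by auto
  have "\<exists>t N x. N > 0 \<and> c * N powr bernstein_exp < cmod (LP N (evol_j t (K0 n)) x)" for n
    by (rule c(2)[OF K0(1,2) half])
  then obtain tt NN xx where NN: "\<And>n. NN n > 0" "\<And>n. c * NN n powr bernstein_exp
    < cmod (LP (NN n) (evol_j (tt n) (K0 n)) (xx n))"
    by metis
  \<comment> \<open>Each member is renormalised at its own concentration point. Norm and
    \<open>wave_pow\<close> are unchanged, so the sequence still maximises, but its low-pass value
    at frequency one and the origin now exceeds c.\<close>
  define K where "K n = renorm (NN n) (tt n) (xx n) (K0 n)" for n
  have K: "sqint lborel (K n)" "l2norm lborel (K n) = 1" "wave_pow (K n) = wave_pow (K0 n)" for n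
    unfolding K_def using sqint_renorm[OF K0(1) NN(1)] K0(2) wave_pow_renorm[OF K0(1) NN(1)] by auto
  have Kc: "c < cmod (LP 1 (\<lambda>\<xi>. K n \<xi> $ j) 0)" for n
  proof -
    have "c * NN n powr bernstein_exp < NN n powr bernstein_exp * cmod (LP 1 (\<lambda>\<xi>. K n \<xi> $ j) 0)"
      using NN(2)[of n] unfolding LP_renorm[OF K0(1) NN(1)] K_def by (simp add: norm_mult)
    then show ?thesis using NN(1)[of n] by (simp add: mult.commute)
  qed
  obtain r1 G where r1: "strict_mono (r1::nat \<Rightarrow> nat)" and G: "sqint lborel G"
    and weak: "\<And>\<phi>. sqint lborel \<phi> \<Longrightarrow> (\<lambda>n. \<integral>\<xi>. K (r1 n) \<xi> \<bullet> \<phi> \<xi> \<partial>lborel) \<longlonglongrightarrow> (\<integral>\<xi>. G \<xi> \<bullet> \<phi> \<xi> \<partial>lborel)"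
    using l2_weak_compact[of lborel K 1] K(1,2) by auto
  have "(\<lambda>n. LP 1 (\<lambda>\<xi>. K (r1 n) \<xi> $ j) 0) \<longlonglongrightarrow> LP 1 (\<lambda>\<xi>. G \<xi> $ j) 0"
    by (rule LP_weak(2)[OF _ K(1) G weak]) auto
  then have "c \<le> cmod (LP 1 (\<lambda>\<xi>. G \<xi> $ j) 0)"
    by (intro LIMSEQ_le_const[OF tendsto_norm]) (use Kc in \<open>auto intro: less_imp_le\<close>)
  also have "\<dots> \<le> bernstein_const * l2norm lborel (\<lambda>\<xi>. G \<xi> $ j)"
    using LP_bound[OF sqint_nth(1)[OF G], of 1 j 0] by (simp add: bernstein_const_def)
  also have "\<dots> \<le> bernstein_const * l2norm lborel G"
    by (intro mult_left_mono sqint_nth(2) G bernstein_const_nonneg)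
  finally have "l2norm lborel G \<noteq> 0" using c(1) by auto
  define a where "a = (l2norm lborel G)\<^sup>2"
  have a0: "a > 0" using \<open>l2norm lborel G \<noteq> 0\<close> by (simp add: a_def)
  define E where "E n \<xi> = K (r1 n) \<xi> - G \<xi>" for n \<xi>
  have E: "sqint lborel (E n)" for n unfolding E_def by (intro sqint_diff(1) K G)
  have ER: "l2norm lborel (E n) \<le> 1 + l2norm lborel G" for n
    unfolding E_def using sqint_diff(2)[OF K(1) G, of "r1 n"] K(2)[of "r1 n"] by simp
  have repE: "rep (\<lambda>z. wave_fn (K (r1 n)) z - wave_fn G z) (E n)" for n
    unfolding E_def by (intro rep_diff K G wave_fn)
  have weakE: "(\<lambda>n. \<integral>\<xi>. E n \<xi> \<bullet> \<phi> \<xi> \<partial>lborel) \<longlonglongrightarrow> 0" if \<phi>: "sqint lborel \<phi>" for \<phi>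
  proof -
    have "(\<integral>\<xi>. E n \<xi> \<bullet> \<phi> \<xi> \<partial>lborel) = (\<integral>\<xi>. K (r1 n) \<xi> \<bullet> \<phi> \<xi> \<partial>lborel) - (\<integral>\<xi>. G \<xi> \<bullet> \<phi> \<xi> \<partial>lborel)"
      for n
      unfolding E_def using sqint_inner(1)[OF K(1) \<phi>] sqint_inner(1)[OF G \<phi>]
        by (simp add: inner_diff_left)
    then show ?thesis using tendsto_diff[OF weak[OF \<phi>] tendsto_const[of "\<integral>\<xi>. G \<xi> \<bullet> \<phi> \<xi> \<partial>lborel"]]
      by simp
  qed
  obtain r2 where r2: "strict_mono (r2::nat \<Rightarrow> nat)"
    and ae: "AE z in lborel. (\<lambda>n. wave_fn (K (r1 (r2 n))) z - wave_fn G z) \<longlonglongrightarrow> 0"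
    using weak_imp_AE_subseq[OF E ER repE weakE] by auto
  define \<kappa> where "\<kappa> n = r1 (r2 n)" for n
  have \<kappa>: "strict_mono \<kappa>" unfolding \<kappa>_def using strict_mono_o[OF r1 r2] by (simp add: o_def)
  \<comment> \<open>Expanding the square, weak convergence tested with G itself sends the cross term
    to a, which leaves 1 - 2 a + a.\<close>
  have En: "(\<lambda>n. (l2norm lborel (E (r2 n)))\<^sup>2) \<longlonglongrightarrow> 1 - a"
  proof -
    have gg: "(\<integral>\<xi>. G \<xi> \<bullet> G \<xi> \<partial>lborel) = a" by (simp add: a_def l2norm_power2 power2_norm_eq_inner)
    have "(\<lambda>n. \<integral>\<xi>. K (\<kappa> n) \<xi> \<bullet> G \<xi> \<partial>lborel) \<longlonglongrightarrow> a"
      using LIMSEQ_subseq_LIMSEQ[OF weak[OF G] r2] by (simp add: gg \<kappa>_def o_def)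
    then have "(\<lambda>n. 1 - 2 * (\<integral>\<xi>. K (\<kappa> n) \<xi> \<bullet> G \<xi> \<partial>lborel) + a) \<longlonglongrightarrow> 1 - 2 * a + a"
      by (intro tendsto_intros)
    moreover have "(l2norm lborel (E (r2 n)))\<^sup>2 = 1 - 2 * (\<integral>\<xi>. K (\<kappa> n) \<xi> \<bullet> G \<xi> \<partial>lborel) + a" for n
      unfolding E_def \<kappa>_def using sqint_diff(3)[OF K(1) G, of "r1 (r2 n)"] K(2)[of "r1 (r2 n)"]
        by (simp add: a_def)
    ultimately show ?thesis by simp
  qed
  have a1: "a \<le> 1" using LIMSEQ_le_const[OF En, of 0] by simp
  have powE: "(\<lambda>n. l2norm lborel (E (r2 n)) powr crit_exp) \<longlonglongrightarrow> (1 - a) powr (crit_exp / 2)"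
  proof -
    have "(\<lambda>n. ((l2norm lborel (E (r2 n)))\<^sup>2) powr (crit_exp / 2)) \<longlonglongrightarrow> (1 - a) powr (crit_exp / 2)"
      using crit_exp_gt_2 by (intro tendsto_powr' En tendsto_const) auto
    then show ?thesis by (simp add: square_powr_half l2norm_nonneg)
  qed
  note bT = rep_borel[OF wave_fn(1)]
  have lim: "AE z in lborel. (\<lambda>n. wave_fn (K (\<kappa> n)) z) \<longlonglongrightarrow> wave_fn G z"
    using ae by eventually_elim (simp add: \<kappa>_def Lim_null[symmetric])
  have JG: "wave_pow G \<le> ennreal (m * a powr (crit_exp / 2))"
  proof -
    have "l2norm lborel G powr crit_exp = a powr (crit_exp / 2)"
      unfolding a_def by (rule square_powr_half[OF l2norm_nonneg, symmetric])
    then show ?thesis using wave_pow_le[OF G] m by (simp flip: ennreal_mult)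
  qed
  \<comment> \<open>The left side is the limit of the values of the maximising sequence.
    Brezis--Lieb splits them, and homogeneity bounds the remainder by m times the r-th power of its
    norm.\<close>
  have key: "ennreal m \<le> wave_pow G + ennreal ((1 + \<epsilon>) * (m * (1 - a) powr (crit_exp / 2)))"
    if \<epsilon>: "\<epsilon> > 0" for \<epsilon>
  proof -
    have gf: "(\<integral>\<^sup>+z. ennreal (cmod (wave_fn G z) powr crit_exp) \<partial>lborel) < \<infinity>"
      unfolding J_prod[OF bT[OF G], symmetric] wave_pow_def[symmetric] using JG
        by (simp add: le_less_trans)
    have r1': "crit_exp \<ge> 1" using crit_exp_gt_2 by simp
    have mb: "wave_fn (K (\<kappa> n)) \<in> borel_measurable lborel" "wave_fn G \<in> borel_measurable lborel"
      for n
      using bT[OF K(1)] bT[OF G] by auto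
    obtain w where w: "w \<longlonglongrightarrow> (0::ennreal)"
      and bl: "\<And>n. (\<integral>\<^sup>+z. ennreal (cmod (wave_fn (K (\<kappa> n)) z) powr crit_exp) \<partial>lborel) \<le>
      (\<integral>\<^sup>+z. ennreal (cmod (wave_fn G z) powr crit_exp) \<partial>lborel) + ennreal (1 + \<epsilon>) *
        (\<integral>\<^sup>+z. ennreal (cmod (wave_fn (K (\<kappa> n)) z - wave_fn G z) powr crit_exp) \<partial>lborel) + w n"
      using brezis_lieb_le[OF mb lim gf r1' \<epsilon>]
        by (elim exE conjE) (rule that, assumption, erule spec)
    have JE: "(\<integral>\<^sup>+z. ennreal (cmod (wave_fn (K (\<kappa> n)) z - wave_fn G z) powr crit_exp) \<partial>lborel)
      \<le> ennreal (m * l2norm lborel (E (r2 n)) powr crit_exp)" for n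
    proof -
      have "(\<integral>\<^sup>+z. ennreal (cmod (wave_fn (K (\<kappa> n)) z - wave_fn G z) powr crit_exp) \<partial>lborel)
        = wave_pow (E (r2 n))"
        using J_prod[OF rep_borel[OF repE], of "r2 n"] wave_pow_rep[OF E repE, of "r2 n"]
          by (simp add: \<kappa>_def)
      then show ?thesis using wave_pow_le[OF E, of "r2 n"] m by (simp flip: ennreal_mult)
    qed
    have step: "ennreal (m * (1 - 1 / real (\<kappa> n + 2)))
      \<le> wave_pow G + ennreal ((1 + \<epsilon>) * (m * l2norm lborel (E (r2 n)) powr crit_exp)) + w n" for n
    proof -
      have "ennreal (m * (1 - 1 / real (\<kappa> n + 2))) \<le> wave_pow (K (\<kappa> n))"
        using K0(3)[of "\<kappa> n"] K(3)[of "\<kappa> n"] by simp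
      also have "\<dots> \<le> wave_pow G + ennreal (1 + \<epsilon>)
        * (\<integral>\<^sup>+z. ennreal (cmod (wave_fn (K (\<kappa> n)) z - wave_fn G z) powr crit_exp) \<partial>lborel) + w n"
        unfolding wave_pow_def J_prod[OF bT[OF K(1)]] J_prod[OF bT[OF G]] by (rule bl)
      also have "\<dots> \<le> wave_pow G + ennreal (1 + \<epsilon>)
        * ennreal (m * l2norm lborel (E (r2 n)) powr crit_exp) + w n"
        by (intro add_right_mono add_left_mono mult_left_mono JE) simp
      also have "ennreal (1 + \<epsilon>) * ennreal (m * l2norm lborel (E (r2 n)) powr crit_exp)
        = ennreal ((1 + \<epsilon>) * (m * l2norm lborel (E (r2 n)) powr crit_exp))"
        using \<epsilon> m(2) by (intro ennreal_mult[symmetric]) auto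
      finally show ?thesis .
    qed
    have "(\<lambda>n. ennreal (m * (1 - 1 / real (\<kappa> n + 2)))) \<longlonglongrightarrow> ennreal (m * (1 - 0))"
    proof -
      have "(\<lambda>n. 1 / real (n + 2)) \<longlonglongrightarrow> 0"
        using LIMSEQ_ignore_initial_segment[OF lim_const_over_n[of 1], of 2] by simp
      from LIMSEQ_subseq_LIMSEQ[OF this \<kappa>] have "(\<lambda>n. 1 / real (\<kappa> n + 2)) \<longlonglongrightarrow> 0" by (simp add: o_def)
      then show ?thesis by (intro tendsto_ennrealI tendsto_intros)
    qed
    moreover have "(\<lambda>n. wave_pow G + ennreal ((1 + \<epsilon>)
      * (m * l2norm lborel (E (r2 n)) powr crit_exp)) + w n) \<longlonglongrightarrow>
        wave_pow G + ennreal ((1 + \<epsilon>) * (m * (1 - a) powr (crit_exp / 2))) + 0"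
      by (intro tendsto_add tendsto_const w tendsto_ennrealI tendsto_mult powE)
    ultimately have "ennreal (m * (1 - 0))
      \<le> wave_pow G + ennreal ((1 + \<epsilon>) * (m * (1 - a) powr (crit_exp / 2))) + 0"
      by (rule LIMSEQ_le) (intro exI allI impI step)
    then show ?thesis by simp
  qed
  \<comment> \<open>Divide by m, which is positive and finite, and let the slack of
    \<open>key\<close> tend to 0.\<close>
  have "1 \<le> a powr (crit_exp / 2) + (1 - a) powr (crit_exp / 2)"
  proof (rule field_le_epsilon)
    fix \<delta> :: real assume \<delta>: "\<delta> > 0"
    have "ennreal m \<le> ennreal (m * a powr (crit_exp / 2))
      + ennreal ((1 + \<delta>) * (m * (1 - a) powr (crit_exp / 2)))"
      by (rule order_trans[OF key[OF \<delta>] add_right_mono[OF JG]])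
    also have "\<dots> = ennreal (m * a powr (crit_exp / 2) + (1 + \<delta>)
      * (m * (1 - a) powr (crit_exp / 2)))"
      using m(2) \<delta> by (intro ennreal_plus[symmetric]) auto
    finally have "m \<le> m * a powr (crit_exp / 2) + (1 + \<delta>) * (m * (1 - a) powr (crit_exp / 2))"
      using m(2) \<delta> by (subst (asm) ennreal_le_iff) auto
    also have "\<dots> = m * (a powr (crit_exp / 2) + (1 + \<delta>) * (1 - a) powr (crit_exp / 2))"
      by (simp add: algebra_simps)
    finally have "1 \<le> a powr (crit_exp / 2) + (1 + \<delta>) * (1 - a) powr (crit_exp / 2)" using m(2)
      by simp
    moreover have "(1 - a) powr (crit_exp / 2) \<le> 1"
      using a0 a1 crit_exp_gt_2 powr_mono2[of "crit_exp / 2" "1 - a" 1] by simp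
    ultimately show "1 \<le> a powr (crit_exp / 2) + (1 - a) powr (crit_exp / 2) + \<delta>"
      using mult_left_mono[of "(1 - a) powr (crit_exp / 2)" 1 \<delta>, OF _ less_imp_le[OF \<delta>]]
        unfolding distrib_right by linarith
  qed
  then have "a = 1" using powr_sum_less_1[of a "crit_exp / 2"] a0 a1 crit_exp_gt_2 by force
  then have l1: "l2norm lborel G = 1" unfolding a_def
    by (simp add: power2_eq_1_iff) (use l2norm_nonneg[of lborel G] in auto)
  \<comment> \<open>For a = 1 the remainder in \<open>key\<close> carries the factor 0 powr (r / 2)
    = 0, so any slack will do.\<close>
  have "ennreal m \<le> wave_pow G" using key[of 1] \<open>a = 1\<close> by simp
  then have "wave_pow G = sup_wave_pow" using wave_pow_le_sup_wave_pow[OF G l1] m(1) by simp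
  then show ?thesis using G l1 by blast
qed

end

section \<open>Transfer of the maximiser to distributions\<close>

theorem theorem1p2:
  fixes s :: "real^'n"
    and h :: "real^'d \<Rightarrow> complex^'n^'n"
    and j :: 'n
    and p q :: ennreal
    and C r :: real
    and M :: ennreal
  assumes well_posed: "globally_well_posed s h"
    and flow: "\<And>f. f \<in> hdot_prod s \<Longrightarrow>
        (\<forall>t. f \<in> multiplier_domain s (propagator_symbol h t)) \<and>
        solves_cauchy s h f (\<lambda>t. propagator s h t f)"
    and unitary: "\<And>t f. f \<in> hdot_prod s \<Longrightarrow>
        hdot_prod_norm s (propagator s h t f) = hdot_prod_norm s f"
    and exponents: "2 \<le> p" "p < q" "q \<le> \<infinity>"
    and strichartz: "\<And>f u. f \<in> hdot_prod s \<Longrightarrow> solves_cauchy s h f u \<Longrightarrow>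
        spacetime_norm p q (\<lambda>t. u t $ j) \<le> ennreal (C * hdot_prod_norm s f)"
    and scaling: "\<And>u \<rho>. solves_equation s h u \<Longrightarrow> 0 < \<rho> \<Longrightarrow>
        solves_equation s h (rescale s \<rho> u)"
    and s_j: "0 < s $ j" "s $ j < real CARD('d) / 2"
    and r_eq: "r = 2 * (1 + real CARD('d)) / (real CARD('d) - 2 * s $ j)"
    and M_eq: "M = (SUP f\<in>{f \<in> hdot_prod s. hdot_prod_norm s f = 1}.
        spacetime_norm (ennreal r) (ennreal r) (\<lambda>t. propagator s h t f $ j))"
  shows "M < \<infinity> \<and>
    (\<forall>f\<in>hdot_prod s. spacetime_norm (ennreal r) (ennreal r) (\<lambda>t. propagator s h t f $ j)
        \<le> M * ennreal (hdot_prod_norm s f)) \<and>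
    (\<exists>f\<^sub>0\<in>hdot_prod s. hdot_prod_norm s f\<^sub>0 = 1 \<and>
        spacetime_norm (ennreal r) (ennreal r) (\<lambda>t. propagator s h t f\<^sub>0 $ j) = M)"
proof -
  interpret strichartz_flow s h j "TYPE(real^'d)" p q C
  proof (unfold_locales)
    show "2 * s $ j < real DIM(real^'d)" using s_j(2) by simp
  qed (fact well_posed flow unitary scaling s_j(1) exponents(1,2) strichartz)+
  have r: "r = crit_exp"
    using bernstein_exp_pos by (simp add: r_eq crit_exp_def bernstein_exp_def field_simps)
  have st: "spacetime_norm (ennreal r) (ennreal r) (\<lambda>t. propagator s h t (datum s K) $ j)
    = ennreal_powr (wave_pow K) (1 / crit_exp)"
    if "sqint lborel K" for K
    using spacetime_norm_wave_pow[OF that] by (simp add: wave_def r)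
  obtain G where G: "sqint lborel G" "l2norm lborel G = 1" "wave_pow G = sup_wave_pow"
    using maximizer_exists by blast
  \<comment> \<open>\<open>datum s\<close> maps L2 isometrically onto the product space, so both
    suprema run over the same unit data; taking r-th roots is monotone and the maximiser attains the
    value.\<close>
  have M: "M = ennreal_powr sup_wave_pow (1 / crit_exp)"
  proof (rule antisym)
    show "M \<le> ennreal_powr sup_wave_pow (1 / crit_exp)"
      unfolding M_eq
    proof (rule SUP_least)
      fix f :: "(real^'d) distribution^'n"
      assume "f \<in> {f \<in> hdot_prod s. hdot_prod_norm s f = 1}"
      then obtain K where K: "sqint lborel K" "f = datum s K" "hdot_prod_norm s f = 1"
        using datum_surj by blast
      then have "l2norm lborel K = 1" using datum_norm[OF K(1), of s] by simp
      then show "spacetime_norm (ennreal r) (ennreal r) (\<lambda>t. propagator s h t f $ j)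
        \<le> ennreal_powr sup_wave_pow (1 / crit_exp)"
        unfolding K(2) st[OF K(1)] using crit_exp_gt_2
          by (intro ennreal_powr_mono wave_pow_le_sup_wave_pow K) auto
    qed
    show "ennreal_powr sup_wave_pow (1 / crit_exp) \<le> M"
      unfolding M_eq
      by (rule SUP_upper2[of "datum s G"]) (use G datum_in[OF G(1), of s] datum_norm[OF G(1), of s]
        st[OF G(1)] in auto)
  qed
  show ?thesis
  proof (intro conjI ballI)
    show "M < \<infinity>" unfolding M using sup_wave_pow_finite
      by (cases sup_wave_pow) (auto simp: ennreal_powr_ennreal)
  next
    fix f :: "(real^'d) distribution^'n"
    assume "f \<in> hdot_prod s"
    then obtain K where K: "sqint lborel K" "f = datum s K" using datum_surj by blast
    have "ennreal_powr (wave_pow K) (1 / crit_exp)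
      \<le> ennreal_powr (sup_wave_pow * ennreal (l2norm lborel K powr crit_exp)) (1 / crit_exp)"
      using crit_exp_gt_2 by (intro ennreal_powr_mono wave_pow_le K) auto
    also have "\<dots> = M * ennreal (l2norm lborel K)"
    proof (cases "l2norm lborel K = 0")
      case False
      then have "l2norm lborel K > 0" using l2norm_nonneg[of lborel K] by linarith
      then show ?thesis
        unfolding M
          using crit_exp_gt_2 ennreal_powr_mult[of "l2norm lborel K powr crit_exp" sup_wave_pow
          "1 / crit_exp"]
        by (simp add: powr_powr mult.commute)
    qed simp
    finally show "spacetime_norm (ennreal r) (ennreal r) (\<lambda>t. propagator s h t f $ j)
      \<le> M * ennreal (hdot_prod_norm s f)"
      unfolding K(2) st[OF K(1)] datum_norm[OF K(1)] .
  next
    show "\<exists>f\<^sub>0\<in>hdot_prod s. hdot_prod_norm s f\<^sub>0 = 1 \<and>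
        spacetime_norm (ennreal r) (ennreal r) (\<lambda>t. propagator s h t f\<^sub>0 $ j) = M"
      by (rule bexI[of _ "datum s G"]) (use G datum_in[OF G(1), of s] datum_norm[OF G(1), of s]
        st[OF G(1)] M in auto)
  qed
qed

end
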